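(* Let $n,k,d\ge 1$ be integers, $z\ge 1$, and $\varepsilon\in(0,1)$. There exists a randomized algorithm that, given a dataset $P\subset\mathbb{R}^d$ of size $n$ satisfying the Assumption below, outputs an $\varepsilon$-coreset of $P$ for robust $(k,z)$-clustering (with $m$ outliers) of size $\tilde{O}(k^2\varepsilon^{-2z}\min\{\varepsilon^{-2},d\})$ in $O(nkd)$ time. Assumption: for the given dataset $P$ and a given $\varepsilon$-approximate center set $C^\star=\{c_1^\star,\dots,c_k^\star\}\subset\mathbb{R}^d$ of $P$ for robust $(k,z)$-clustering, let $P_I^\star:=\arg\min_{P_I\subseteq P,\,|P_I|=n-m}\sum_{p\in P_I}\mathrm{dist}(p,C^\star)$ and let $P_1^\star,\dots,P_k^\star$ be the partition of $P_I^\star$ where $P_i^\star$ consists of the points of $P_I^\star$ whose closest center in $C^\star$ is $c_i^\star$. Then (1) $\min_{i\in[k]}|P_i^\star|\ge 4m$, and (2) $\max_{p\in P_I^\star}\mathrm{dist}(p,C^\star)^z\le 4k\sum_{p\in P_I^\star}\mathrm{dist}(p,C^\star)^z/|P_I^\star|$.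
   Context: For $p\in\mathbb{R}^d$ and a finite $C\subset\mathbb{R}^d$, $\mathrm{dist}(p,C):=\min_{c\in C}\|p-c\|_2$. For a dataset $P\subset\mathbb{R}^d$, integer $m\ge0$ and $z\ge1$, the robust $(k,z)$-clustering cost of a center set $C$ with $|C|=k$ is $\mathrm{cost}_z^{(m)}(P,C):=\min_{L\subseteq P,|L|=m}\sum_{p\in P\setminus L}\mathrm{dist}(p,C)^z$; the problem is to minimize it over $C$. An $\varepsilon$-approximate center set is a $k$-point set $C^\star$ whose cost is within a $(1+\varepsilon)$ factor of the optimum. For a weighted set $S$ with weights $w$ and $w(S)=\sum_p w(p)$, let $\mathcal{W}$ be the set of $w':S\to\mathbb{R}^+$ with $w'(p)\le w(p)$ and $\sum_pw'(p)=w(S)-m$, and $\mathrm{cost}_z^{(m)}(S,C):=\min_{w'\in\mathcal{W}}\sum_{p\in S}w'(p)\mathrm{dist}(p,C)^z$. A weighted subset $S\subseteq P$ is an $\varepsilon$-coreset of $P$ for robust $(k,z)$-clustering if $w(S)=|P|$ and $\mathrm{cost}_z^{(m)}(S,C)\in(1\pm\varepsilon)\mathrm{cost}_z^{(m)}(P,C)$ for every $C\subset\mathbb{R}^d$ with $|C|=k$. $\tilde{O}$ hides polylogarithmic factors. *)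

theory Defs
  imports "HOL-Probability.Probability"
begin

section \<open>Robust clustering\<close>

text \<open>
  The dimension varies inside the statement (all hidden constants have to be uniform in it), so
  points of the \<open>d\<close>-dimensional Euclidean space are real lists of length \<open>d\<close>.
\<close>

type_synonym point = "real list"

definition Rd :: "nat \<Rightarrow> point set" where
  "Rd d = {p. length p = d}"

definition pdist :: "point \<Rightarrow> point \<Rightarrow> real" where
  "pdist p q = L2_set (\<lambda>i. p ! i - q ! i) {..<length p}"

definition cdist :: "point \<Rightarrow> point set \<Rightarrow> real" where
  "cdist p C = (MIN c\<in>C. pdist p c)"

definition robust_cost :: "real \<Rightarrow> nat \<Rightarrow> point set \<Rightarrow> point set \<Rightarrow> real" where
  "robust_cost z m P C =
     Min ((\<lambda>L. \<Sum>p\<in>P - L. cdist p C powr z) ` {L. L \<subseteq> P \<and> card L = m})"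

definition center_sets :: "nat \<Rightarrow> nat \<Rightarrow> point set set" where
  "center_sets d k = {C. C \<subseteq> Rd d \<and> finite C \<and> card C = k}"

definition robust_opt :: "nat \<Rightarrow> nat \<Rightarrow> real \<Rightarrow> nat \<Rightarrow> point set \<Rightarrow> real" where
  "robust_opt d k z m P = (INF C\<in>center_sets d k. robust_cost z m P C)"

definition approx_center_set ::
    "nat \<Rightarrow> nat \<Rightarrow> real \<Rightarrow> nat \<Rightarrow> real \<Rightarrow> point set \<Rightarrow> point set \<Rightarrow> bool" where
  "approx_center_set d k z m \<epsilon> P C \<longleftrightarrow>
     C \<in> center_sets d k \<and> robust_cost z m P C \<le> (1 + \<epsilon>) * robust_opt d k z m P"

definition residual_weights ::
    "nat \<Rightarrow> point set \<Rightarrow> (point \<Rightarrow> real) \<Rightarrow> (point \<Rightarrow> real) set" where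
  "residual_weights m S w =
     {w'. (\<forall>p\<in>S. 0 \<le> w' p \<and> w' p \<le> w p) \<and> (\<Sum>p\<in>S. w' p) = (\<Sum>p\<in>S. w p) - real m}"

text \<open>
  The infimum below is a minimum whenever \<open>S\<close> is finite with nonnegative weights of total at
  least \<open>m\<close> (continuous function on a nonempty compact set).
\<close>

definition weighted_robust_cost ::
    "real \<Rightarrow> nat \<Rightarrow> point set \<Rightarrow> (point \<Rightarrow> real) \<Rightarrow> point set \<Rightarrow> real" where
  "weighted_robust_cost z m S w C =
     (INF w'\<in>residual_weights m S w. \<Sum>p\<in>S. w' p * cdist p C powr z)"

definition robust_coreset ::
    "nat \<Rightarrow> nat \<Rightarrow> real \<Rightarrow> nat \<Rightarrow> real \<Rightarrow> point set \<Rightarrow> point set \<Rightarrow> (point \<Rightarrow> real) \<Rightarrow> bool"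
  where
  "robust_coreset d k z m \<epsilon> P S w \<longleftrightarrow>
     S \<subseteq> P \<and> (\<forall>p\<in>S. 0 \<le> w p) \<and> (\<Sum>p\<in>S. w p) = real (card P) \<and>
     (\<forall>C\<in>center_sets d k.
        weighted_robust_cost z m S w C
          \<in> {(1 - \<epsilon>) * robust_cost z m P C .. (1 + \<epsilon>) * robust_cost z m P C})"

text \<open>
  Neither the minimising inlier set nor the nearest center of a point need be unique.  The
  assumption asks that the two inequalities hold for some choice \<open>I\<close> of the inlier set and some
  choice \<open>\<sigma>\<close> of nearest centers.
\<close>

definition inlier_assumption :: "nat \<Rightarrow> real \<Rightarrow> nat \<Rightarrow> point set \<Rightarrow> point set \<Rightarrow> bool" where
  "inlier_assumption k z m P C \<longleftrightarrow>
     (\<exists>I \<sigma>. is_arg_min (\<lambda>Q. \<Sum>p\<in>Q. cdist p C) (\<lambda>Q. Q \<subseteq> P \<and> card Q + m = card P) I \<and>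
        (\<forall>p\<in>I. \<sigma> p \<in> C \<and> pdist p (\<sigma> p) = cdist p C) \<and>
        4 * m \<le> (MIN c\<in>C. card {p\<in>I. \<sigma> p = c}) \<and>
        (MAX p\<in>I. cdist p C powr z)
          \<le> 4 * real k * (\<Sum>p\<in>I. cdist p C powr z) / real (card I))"


section \<open>Randomized real-RAM programs\<close>

text \<open>
  A program is a piece of syntax over natural-number registers and arrays (used for counting and
  addressing) and real registers and arrays, with exact unit-cost arithmetic.  Powers and
  logarithms are primitive because distances are raised to the real power \<open>z\<close>.  There is no
  rounding operation and there are no real literals, so no information can be hidden in constants
  of the program or extracted from digits in constant time.
\<close>

datatype nexp =
    NLit nat
  | NReg nat
  | NAt nat nexp
  | NAdd nexp nexp
  | NSub nexp nexp
  | NMul nexp nexp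

datatype rexp =
    RNat nexp
  | RReg nat
  | RAt nat nexp
  | RAdd rexp rexp
  | RSub rexp rexp
  | RMul rexp rexp
  | RDiv rexp rexp
  | RPow rexp rexp
  | RLn rexp

datatype bexp =
    NLess nexp nexp
  | RLess rexp rexp
  | BNot bexp
  | BAnd bexp bexp

datatype com =
    Skip
  | NSet nat nexp
  | RSet nat rexp
  | NPut nat nexp nexp
  | RPut nat nexp rexp
  | Sample nat
  | Seq com com
  | Cond bexp com com
  | While bexp com

text \<open>\<open>used\<close> counts the random numbers drawn so far.\<close>

record store =
  nreg :: "nat \<Rightarrow> nat"
  rreg :: "nat \<Rightarrow> real"
  narr :: "nat \<Rightarrow> nat \<Rightarrow> nat"
  rarr :: "nat \<Rightarrow> nat \<Rightarrow> real"
  used :: nat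

fun nval :: "nexp \<Rightarrow> store \<Rightarrow> nat" where
  "nval (NLit c) s = c"
| "nval (NReg x) s = nreg s x"
| "nval (NAt a e) s = narr s a (nval e s)"
| "nval (NAdd e f) s = nval e s + nval f s"
| "nval (NSub e f) s = nval e s - nval f s"
| "nval (NMul e f) s = nval e s * nval f s"

fun rval :: "rexp \<Rightarrow> store \<Rightarrow> real" where
  "rval (RNat e) s = real (nval e s)"
| "rval (RReg x) s = rreg s x"
| "rval (RAt a e) s = rarr s a (nval e s)"
| "rval (RAdd e f) s = rval e s + rval f s"
| "rval (RSub e f) s = rval e s - rval f s"
| "rval (RMul e f) s = rval e s * rval f s"
| "rval (RDiv e f) s = rval e s / rval f s"
| "rval (RPow e f) s = rval e s powr rval f s"
| "rval (RLn e) s = ln (rval e s)"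

fun bval :: "bexp \<Rightarrow> store \<Rightarrow> bool" where
  "bval (NLess e f) s \<longleftrightarrow> nval e s < nval f s"
| "bval (RLess e f) s \<longleftrightarrow> rval e s < rval f s"
| "bval (BNot b) s \<longleftrightarrow> \<not> bval b s"
| "bval (BAnd b c) s \<longleftrightarrow> bval b s \<and> bval c s"

text \<open>
  \<open>exec \<omega> c s \<tau> t\<close>: started in \<open>s\<close> with the random numbers \<open>\<omega> 0, \<omega> 1, \<dots>\<close>, the program \<open>c\<close> halts
  in \<open>t\<close> after \<open>\<tau>\<close> steps.  Each atomic command and each test is one step; the expressions of a
  program have bounded size, so this is the number of arithmetic operations up to a constant
  factor depending on the program only.
\<close>

inductive exec :: "(nat \<Rightarrow> real) \<Rightarrow> com \<Rightarrow> store \<Rightarrow> nat \<Rightarrow> store \<Rightarrow> bool"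
  for \<omega> :: "nat \<Rightarrow> real" where
  Skip: "exec \<omega> Skip s 1 s"
| NSet: "exec \<omega> (NSet x e) s 1 (s\<lparr>nreg := (nreg s)(x := nval e s)\<rparr>)"
| RSet: "exec \<omega> (RSet x e) s 1 (s\<lparr>rreg := (rreg s)(x := rval e s)\<rparr>)"
| NPut: "exec \<omega> (NPut a i e) s 1
           (s\<lparr>narr := (narr s)(a := (narr s a)(nval i s := nval e s))\<rparr>)"
| RPut: "exec \<omega> (RPut a i e) s 1
           (s\<lparr>rarr := (rarr s)(a := (rarr s a)(nval i s := rval e s))\<rparr>)"
| Sample: "exec \<omega> (Sample x) s 1
             (s\<lparr>rreg := (rreg s)(x := \<omega> (used s)), used := Suc (used s)\<rparr>)"
| Seq: "exec \<omega> c s i t \<Longrightarrow> exec \<omega> c' t j u \<Longrightarrow> exec \<omega> (Seq c c') s (i + j) u"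
| CondTrue: "bval b s \<Longrightarrow> exec \<omega> c s i t \<Longrightarrow> exec \<omega> (Cond b c c') s (Suc i) t"
| CondFalse: "\<not> bval b s \<Longrightarrow> exec \<omega> c' s i t \<Longrightarrow> exec \<omega> (Cond b c c') s (Suc i) t"
| WhileFalse: "\<not> bval b s \<Longrightarrow> exec \<omega> (While b c) s 1 s"
| WhileTrue: "bval b s \<Longrightarrow> exec \<omega> c s i t \<Longrightarrow> exec \<omega> (While b c) t j u \<Longrightarrow>
                exec \<omega> (While b c) s (Suc (i + j)) u"

inductive_cases SkipE: "exec \<omega> Skip s i t"
inductive_cases NSetE: "exec \<omega> (NSet x e) s i t"
inductive_cases RSetE: "exec \<omega> (RSet x e) s i t"
inductive_cases NPutE: "exec \<omega> (NPut a e f) s i t"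
inductive_cases RPutE: "exec \<omega> (RPut a e f) s i t"
inductive_cases SampleE: "exec \<omega> (Sample x) s i t"
inductive_cases SeqE: "exec \<omega> (Seq c c') s i t"
inductive_cases CondE: "exec \<omega> (Cond b c c') s i t"
inductive_cases WhileE: "exec \<omega> (While b c) s i t"

lemma exec_deterministic:
  "exec \<omega> c s i t \<Longrightarrow> exec \<omega> c s j u \<Longrightarrow> i = j \<and> t = u"
proof (induction arbitrary: j u rule: exec.induct)
  case (Seq c s i t c' j' u')
  from Seq.prems obtain i2 j2 t2 where *: "exec \<omega> c s i2 t2" "exec \<omega> c' t2 j2 u" "j = i2 + j2"
    by (rule SeqE)
  then show ?case using Seq.IH(1)[OF *(1)] Seq.IH(2)[of j2 u] by simp
next
  case (CondTrue b s c i t c')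
  from CondTrue.prems obtain i2 where "exec \<omega> c s i2 u" "j = Suc i2"
    by (rule CondE) (use CondTrue.hyps(1) in auto)
  then show ?case using CondTrue.IH by simp
next
  case (CondFalse b s c' i t c)
  from CondFalse.prems obtain i2 where "exec \<omega> c' s i2 u" "j = Suc i2"
    by (rule CondE) (use CondFalse.hyps(1) in auto)
  then show ?case using CondFalse.IH by simp
next
  case (WhileFalse b s c)
  from WhileFalse.prems show ?case by (rule WhileE) (use WhileFalse.hyps in auto)
next
  case (WhileTrue b s c i t j' u')
  from WhileTrue.prems obtain i2 j2 t2
    where *: "exec \<omega> c s i2 t2" "exec \<omega> (While b c) t2 j2 u" "j = Suc (i2 + j2)"
    by (rule WhileE) (use WhileTrue.hyps(1) in auto)
  then show ?case using WhileTrue.IH(1)[OF *(1)] WhileTrue.IH(2)[of j2 u] by simp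
qed (erule SkipE NSetE RSetE NPutE RPutE SampleE, simp)+

text \<open>The random numbers are independent and uniform on the unit interval.\<close>

definition coins :: "(nat \<Rightarrow> real) measure" where
  "coins = Pi\<^sub>M UNIV (\<lambda>_. uniform_measure lborel {0..1})"

lemma prob_space_coins: "prob_space coins"
  unfolding coins_def
  by (intro prob_space_PiM prob_space_uniform_measure) auto

text \<open>
  Input: the natural-number registers 0 to 3 contain \<open>n\<close>, \<open>k\<close>, \<open>d\<close>, \<open>m\<close>, the real registers
  0 and 1 contain \<open>z\<close> and \<open>\<epsilon>\<close>, and the real arrays 0 and 1 contain the data points and the
  centers row by row.  All other memory is zero.
\<close>

definition matrix_arr :: "nat \<Rightarrow> point list \<Rightarrow> nat \<Rightarrow> real" where
  "matrix_arr d xs i = (if i < length xs * d then xs ! (i div d) ! (i mod d) else 0)"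

definition input_store ::
    "nat \<Rightarrow> nat \<Rightarrow> real \<Rightarrow> nat \<Rightarrow> real \<Rightarrow> point list \<Rightarrow> point list \<Rightarrow> store" where
  "input_store d k z m \<epsilon> ps cs =
     \<lparr>nreg = (\<lambda>_. 0)(0 := length ps, 1 := k, 2 := d, 3 := m),
      rreg = (\<lambda>_. 0)(0 := z, 1 := \<epsilon>),
      narr = (\<lambda>_ _. 0),
      rarr = (\<lambda>_ _. 0)(0 := matrix_arr d ps, 1 := matrix_arr d cs),
      used = 0\<rparr>"

text \<open>
  Output: natural-number register 0 contains a length \<open>l\<close>, natural-number array 0 contains \<open>l\<close>
  indices of data points, and real array 0 the corresponding weights.  The weights of repeated
  indices add up.
\<close>

definition out_valid :: "point list \<Rightarrow> store \<Rightarrow> bool" where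
  "out_valid ps t \<longleftrightarrow> (\<forall>j<nreg t 0. narr t 0 j < length ps)"

definition out_set :: "point list \<Rightarrow> store \<Rightarrow> point set" where
  "out_set ps t = (\<lambda>j. ps ! narr t 0 j) ` {..<nreg t 0}"

definition out_weight :: "point list \<Rightarrow> store \<Rightarrow> point \<Rightarrow> real" where
  "out_weight ps t p = (\<Sum>j | j < nreg t 0 \<and> ps ! narr t 0 j = p. rarr t 0 j)"

definition coreset_size_term :: "nat \<Rightarrow> nat \<Rightarrow> real \<Rightarrow> real \<Rightarrow> real" where
  "coreset_size_term d k z \<epsilon> =
     real k ^ 2 * \<epsilon> powr (- 2 * z) * min (\<epsilon> powr (- 2)) (real d)"

end

theory Submission
  imports Defs "HOL-Real_Asymp.Real_Asymp"
begin

text \<open>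
  The points are split into far points, whose cost exceeds a threshold \<open>\<tau>\<close> that discards at most
  \<open>m\<close> points, and \<open>O(k log k)\<close> near strata, given by the closest center and the dyadic scale of the
  cost.  A point drawn at random is with probability \<open>\<Omega>(1/k)\<close> one of average inlier cost, and
  constantly many rounds of \<open>k\<close> such candidates yield a threshold within \<open>O(k)\<close> of the average cost.
  Each stratum is cut into consecutive blocks of equal size, and each block is represented by one
  random point with the weight of the block; the total weight of every stratum is thus exact.

  The traces on a finite set \<open>Z\<close> of the neighbourhoods \<open>{p. cdist p C \<le> t}\<close> are sandwiched, up to a
  factor \<open>1 + \<epsilon> / (4 * z)\<close> in the radius, by a small family of sets: \<open>|Z|\<close> to the power
  \<open>O(k/\<epsilon>\<^sup>2)\<close> by a perceptron argument in every dimension, and to the power \<open>O(kd)\<close> up to logarithms by a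
  grid.  Symmetrization and a union bound over this family show that in each stratum the weight of
  all neighbourhoods is preserved up to a small fraction of the stratum.

  Finally, the robust cost is the maximum over thresholds \<open>T\<close> of the truncated cost
  \<open>\<Sum>p. min (cdist p C powr z) T\<close> minus \<open>m * T\<close>, for the weighted set as well.  By the layer cake formula
  a truncated cost is an integral of weights of neighbourhoods, and the additive errors of all
  strata add up to \<open>O(\<epsilon>)\<close> times the robust cost because each cluster keeps most of its points
  whatever \<open>m\<close> points are removed.
\<close>

section \<open>Covers of neighbourhoods of center sets\<close>

text \<open>The exact stratum weights shape the argument. The far stratum has weight at most
  \<open>m\<close> in the coreset as well, so for both cost functions the optimal threshold
  \<open>T\<close> can be taken at most a level \<open>Tmax C\<close> that no near point exceeds.
  Far points, whose distance to \<open>C\<close> is not controlled, thus enter the error only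
  through \<open>m * Tmax C\<close>, which the cluster sizes bound by the robust cost. Sorting the
  costs would exceed the time \<open>O(nkd)\<close>, and the machine cannot round; therefore
  thresholds are tested by linear scans and improved by repeated halving, and coins are evaluated by
  comparisons. As the program and its time constant are fixed before \<open>z\<close>, the factor
  exponential in \<open>z\<close> is computed by the program as \<open>512 powr z\<close>. Each
  stratum receives about \<open>1 / \<epsilon>^2\<close> times the cover exponent many samples,
  which gives \<open>k^2 * \<epsilon>^(-2) * min (\<epsilon>^(-2)) d\<close> up to logarithms and a
  factor depending on \<open>z\<close>; for \<open>z \<ge> 1\<close> this is within the claimed
  size.\<close>

lemma card_chain_le:
  assumes Z: "finite Z" and sub: "\<And>A. A \<in> \<C> \<Longrightarrow> A \<subseteq> Z"
    and chain: "\<And>A B. A \<in> \<C> \<Longrightarrow> B \<in> \<C> \<Longrightarrow> A \<subseteq> B \<or> B \<subseteq> A"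
  shows "finite \<C> \<and> card \<C> \<le> card Z + 1"
proof -
  have "inj_on card \<C>"
  proof (rule inj_onI)
    fix A B assume AB: "A \<in> \<C>" "B \<in> \<C>" "card A = card B"
    have "finite A" "finite B" using AB sub Z finite_subset by blast+
    then show "A = B" using chain[OF AB(1,2)] AB(3) card_subset_eq by metis
  qed
  moreover have "card ` \<C> \<subseteq> {..card Z}" using card_mono[OF Z sub] by auto
  ultimately show ?thesis
    by (metis card_atMost card_image card_mono finite_atMost finite_imageD finite_subset Suc_eq_plus1)
qed

definition sublevels :: "'a set \<Rightarrow> ('a \<Rightarrow> real) \<Rightarrow> 'a set set" where
  "sublevels Z h = range (\<lambda>\<theta>. {p\<in>Z. h p \<le> \<theta>})"

lemma card_sublevels: "finite Z \<Longrightarrow> finite (sublevels Z h) \<and> card (sublevels Z h) \<le> card Z + 1"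
proof (rule card_chain_le)
  fix A B assume "A \<in> sublevels Z h" "B \<in> sublevels Z h"
  then obtain a b where "A = {p\<in>Z. h p \<le> a}" "B = {p\<in>Z. h p \<le> b}" by (auto simp: sublevels_def)
  then show "A \<subseteq> B \<or> B \<subseteq> A" by (cases "a \<le> b") auto
qed (auto simp: sublevels_def)

section \<open>Balls via a perceptron, in every dimension\<close>

definition ip :: "nat \<Rightarrow> (nat \<Rightarrow> real) \<Rightarrow> (nat \<Rightarrow> real) \<Rightarrow> real" where
  "ip d u v = (\<Sum>i<d. u i * v i)"

lemma ip_diff_right: "ip d u (\<lambda>i. v i - w i) = ip d u v - ip d u w"
  and ip_diff_left: "ip d (\<lambda>i. v i - w i) u = ip d v u - ip d w u"
  and ip_scale_right: "ip d u (\<lambda>i. a * v i) = a * ip d u v"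
  and ip_scale_left: "ip d (\<lambda>i. a * v i) u = a * ip d v u"
  by (simp_all add: ip_def sum.distrib sum_subtractf sum_distrib_left algebra_simps)

lemma ip_commute: "ip d u v = ip d v u"
  by (simp add: ip_def mult.commute)

lemma ip_self_nonneg: "0 \<le> ip d u u"
  by (simp add: ip_def sum_nonneg)

lemma ip_self_le_0: "ip d u u \<le> 0 \<Longrightarrow> ip d v u = 0"
proof -
  assume "ip d u u \<le> 0"
  then have "(\<Sum>i<d. u i * u i) = 0" using ip_self_nonneg[of d u] by (simp add: ip_def)
  then have "\<forall>i<d. u i = 0" by (subst (asm) sum_nonneg_eq_0_iff) auto
  then show ?thesis by (simp add: ip_def)
qed

text \<open>The second components will be signs or 0; an entry with 0 contributes nothing and pads a
  list to a prescribed length, so that lists of one fixed length can be counted.\<close>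

fun signed_sum :: "real \<Rightarrow> ((nat \<Rightarrow> real) \<times> real) list \<Rightarrow> nat \<Rightarrow> real" where
  "signed_sum \<gamma> [] i = 0"
| "signed_sum \<gamma> ((q, s) # l) i = \<gamma> * s * q i + signed_sum \<gamma> l i"

text \<open>
  A perceptron argument: whenever \<open>r\<close> is badly approximated in the direction of some \<open>q\<close>,
  subtracting a small multiple of \<open>q\<close> decreases the squared norm of \<open>r\<close> by a fixed amount.  The
  coefficients do not depend on the scale \<open>t\<close>.
\<close>

lemma perceptron:
  assumes t: "0 \<le> t" and \<epsilon>: "0 < \<epsilon>" and q0: "q0 \<in> Q"
    and Q: "\<And>q. q \<in> Q \<Longrightarrow> ip d q q \<le> (2 * t)\<^sup>2"
    and r: "ip d r r \<le> real n * (\<epsilon>\<^sup>2 * t\<^sup>2 / 4)"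
  shows "\<exists>l. length l = n \<and> set l \<subseteq> Q \<times> {1, -1, 0} \<and>
           (\<forall>q\<in>Q. \<bar>ip d q (\<lambda>i. r i - signed_sum (\<epsilon> / 4) l i)\<bar> \<le> \<epsilon> * t\<^sup>2)"
  using r
proof (induction n arbitrary: r)
  case 0
  then have "ip d q r = 0" for q by (intro ip_self_le_0) simp
  then show ?case using \<epsilon> t by (intro exI[of _ "[]"]) (simp add: ip_diff_right)
next
  case (Suc n)
  show ?case
  proof (cases "\<forall>q\<in>Q. \<bar>ip d q r\<bar> \<le> \<epsilon> * t\<^sup>2")
    case True
    have "signed_sum \<gamma> (replicate m (q0, 0)) i = 0" for m i \<gamma>
      by (induction m) auto
    then show ?thesis using True q0
      by (intro exI[of _ "replicate (Suc n) (q0, 0)"]) auto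
  next
    case False
    then obtain q where q: "q \<in> Q" "\<bar>ip d q r\<bar> > \<epsilon> * t\<^sup>2" by auto
    define s :: real where "s = (if ip d q r > 0 then 1 else -1)"
    have s: "s * s = 1" "s \<in> {1, -1, 0}" "s * ip d q r > \<epsilon> * t\<^sup>2"
      using q by (auto simp: s_def abs_if split: if_splits)
    \<comment> \<open>The linear term gains at least \<open>\<epsilon>^2 * t^2 / 2\<close>; the
      quadratic term costs at most \<open>\<epsilon>^2 * t^2 / 4\<close>, as \<open>q\<close> has
      norm at most \<open>2 * t\<close>. The net decrease is one unit of the budget in the
      hypothesis on \<open>r\<close>.\<close>
    define r' where "r' = (\<lambda>i. r i - \<epsilon> / 4 * s * q i)"
    have "ip d r' r' = ip d r r - (\<epsilon> / 2) * (s * ip d q r) + (\<epsilon> / 4)\<^sup>2 * (s * s) * ip d q q"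
      unfolding r'_def ip_diff_right ip_diff_left ip_scale_right ip_scale_left
      by (simp add: ip_commute[of d r q] algebra_simps power2_eq_square)
    also have "\<dots> \<le> real (Suc n) * (\<epsilon>\<^sup>2 * t\<^sup>2 / 4) - (\<epsilon> / 2) * (\<epsilon> * t\<^sup>2) + (\<epsilon> / 4)\<^sup>2 * (s * s) * (2 * t)\<^sup>2"
      using Suc.prems s(1,3) \<epsilon> Q[OF q(1)]
      by (intro add_mono diff_mono mult_left_mono) auto
    also have "\<dots> = real n * (\<epsilon>\<^sup>2 * t\<^sup>2 / 4)"
      by (simp add: s(1) field_simps power2_eq_square)
    finally obtain l where l: "length l = n" "set l \<subseteq> Q \<times> {1, -1, 0}"
      "\<And>q. q \<in> Q \<Longrightarrow> \<bar>ip d q (\<lambda>i. r' i - signed_sum (\<epsilon> / 4) l i)\<bar> \<le> \<epsilon> * t\<^sup>2"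
      using Suc.IH by blast
    have "(\<lambda>i. r' i - signed_sum (\<epsilon> / 4) l i) = (\<lambda>i. r i - signed_sum (\<epsilon> / 4) ((q, s) # l) i)"
      by (simp add: r'_def algebra_simps)
    with l s(2) q(1) show ?thesis
      by (intro exI[of _ "(q, s) # l"]) auto
  qed
qed

definition pvec :: "point \<Rightarrow> point \<Rightarrow> nat \<Rightarrow> real" where
  "pvec p0 p = (\<lambda>i. p ! i - p0 ! i)"

lemma pdist_L2: "p \<in> Rd d \<Longrightarrow> pdist p c = L2_set (pvec c p) {..<d}"
  by (simp add: pdist_def Rd_def pvec_def)

lemma pdist_square: "p \<in> Rd d \<Longrightarrow> (pdist p c)\<^sup>2 = ip d (pvec c p) (pvec c p)"
  by (simp add: pdist_L2 L2_set_def ip_def power2_eq_square sum_nonneg)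

lemma pdist_nonneg: "0 \<le> pdist p q"
  by (simp add: pdist_def)

lemma pdist_commute: "p \<in> Rd d \<Longrightarrow> q \<in> Rd d \<Longrightarrow> pdist p q = pdist q p"
  by (simp add: pdist_L2 L2_set_def pvec_def power2_commute)

lemma pdist_triangle:
  assumes "p \<in> Rd d" "q \<in> Rd d"
  shows "pdist p r \<le> pdist p q + pdist q r"
proof -
  have "pvec r p = (\<lambda>i. pvec q p i + pvec r q i)" by (auto simp: pvec_def)
  then show ?thesis using assms L2_set_triangle_ineq[of "pvec q p" "pvec r q" "{..<d}"]
    by (simp add: pdist_L2)
qed

text \<open>
  If a short signed sum \<open>u\<close> of differences to a point \<open>p0\<close> of the ball approximates the center in
  all directions that matter, the ball is nearly cut out by its radius around \<open>p0\<close> and a half-space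
  type condition in terms of \<open>u\<close>; there are few choices of \<open>u\<close> and few sublevel sets for each.
\<close>

lemma ball_cover_perceptron:
  assumes Z: "finite Z" "Z \<subseteq> Rd d" and \<epsilon>: "0 < \<epsilon>" and l: "16 / \<epsilon>\<^sup>2 \<le> real len"
  shows "\<exists>F. finite F \<and> card F \<le> (3 * card Z + 3) ^ (len + 3) \<and>
           (\<forall>c\<in>Rd d. \<forall>t\<ge>0. \<exists>B\<in>F. {p\<in>Z. pdist p c \<le> t} \<subseteq> B \<and> B \<subseteq> {p\<in>Z. pdist p c \<le> (1 + \<epsilon>) * t})"
proof -
  \<comment> \<open>The lists hold points of \<open>Z\<close> with signs rather than difference
    vectors, so the family is indexed by finite data from \<open>Z\<close> that mention neither the
    center nor the radius.\<close>
  define U where "U = (\<lambda>p0 l. signed_sum (\<epsilon> / 2 / 4) (map (\<lambda>(p, s). (pvec p0 p, s)) l))"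
  define h where "h = (\<lambda>p0 l p. ip d (pvec p0 p) (pvec p0 p) - 2 * ip d (pvec p0 p) (U p0 l))"
  define W where "W = {l. set l \<subseteq> Z \<times> {1, -1, 0::real} \<and> length l = len}"
  define G where "G = (\<lambda>(p0, l). (\<lambda>(X, Y). X \<inter> Y) ` (sublevels Z (\<lambda>p. pdist p p0) \<times> sublevels Z (h p0 l)))"
  \<comment> \<open>The empty set serves the balls that contain no point of \<open>Z\<close>, for
    which there is no base point \<open>p0\<close>.\<close>
  define F where "F = insert {} (\<Union>x\<in>Z \<times> W. G x)"
  let ?N = "card Z"
  have W: "finite W" "card W = (3 * ?N) ^ len"
  proof -
    have f: "finite (Z \<times> {1, -1, 0::real})" using Z by simp
    have "card (Z \<times> {1, -1, 0::real}) = 3 * ?N" by (simp add: card_cartesian_product)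
    then show "finite W" "card W = (3 * ?N) ^ len"
      unfolding W_def using card_lists_length_eq[OF f, of len] finite_lists_length_eq[OF f, of len] by auto
  qed
  have G: "finite (G x)" "card (G x) \<le> (?N + 1) * (?N + 1)" for x
  proof -
    obtain p0 l where x: "x = (p0, l)" by fastforce
    note c = card_sublevels[OF Z(1), of "\<lambda>p. pdist p p0"] card_sublevels[OF Z(1), of "h p0 l"]
    show "finite (G x)" using c by (simp add: G_def x)
    have "card (G x) \<le> card (sublevels Z (\<lambda>p. pdist p p0) \<times> sublevels Z (h p0 l))"
      unfolding G_def x using c by (simp only: prod.case) (intro card_image_le, simp)
    also have "\<dots> \<le> (?N + 1) * (?N + 1)"
      using c by (simp only: card_cartesian_product) (intro mult_le_mono, auto)
    finally show "card (G x) \<le> (?N + 1) * (?N + 1)" .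
  qed
  have finF: "finite F" using Z W G by (simp add: F_def)
  have "card F \<le> 1 + card (\<Union>x\<in>Z \<times> W. G x)"
    unfolding F_def using Z W G by (simp add: card_insert_if)
  also have "\<dots> \<le> 1 + (\<Sum>x\<in>Z \<times> W. card (G x))"
    using Z W by (intro add_left_mono card_UN_le) simp
  also have "\<dots> \<le> 1 + card (Z \<times> W) * ((?N + 1) * (?N + 1))"
    using sum_bounded_above[of "Z \<times> W" "\<lambda>x. card (G x)" "(?N + 1) * (?N + 1)"] G by simp
  also have "\<dots> = 1 + ?N * (3 * ?N) ^ len * ((?N + 1) * (?N + 1))"
    by (simp add: card_cartesian_product W)
  also have "\<dots> \<le> (3 * ?N + 3) ^ len * ((?N + 1) * (?N + 1)) + ?N * (3 * ?N + 3) ^ len * ((?N + 1) * (?N + 1))"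
  proof (intro add_mono mult_le_mono power_mono)
    show "1 \<le> (3 * ?N + 3) ^ len * ((?N + 1) * (?N + 1))"
      by (simp add: Suc_le_eq del: mult_Suc mult_Suc_right)
  qed auto
  also have "\<dots> = (3 * ?N + 3) ^ len * (?N + 1) ^ 3"
    by (simp add: algebra_simps power3_eq_cube)
  also have "\<dots> \<le> (3 * ?N + 3) ^ len * (3 * ?N + 3) ^ 3"
    by (intro mult_le_mono power_mono) auto
  finally have cardF: "card F \<le> (3 * ?N + 3) ^ (len + 3)"
    by (simp add: power_add)
  have "\<exists>B\<in>F. {p\<in>Z. pdist p c \<le> t} \<subseteq> B \<and> B \<subseteq> {p\<in>Z. pdist p c \<le> (1 + \<epsilon>) * t}"
    if c: "c \<in> Rd d" and t: "0 \<le> t" for c t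
  proof (cases "{p\<in>Z. pdist p c \<le> t} = {}")
    case True
    then show ?thesis by (auto simp: F_def)
  next
    case False
    then obtain p0 where p0: "p0 \<in> Z" "pdist p0 c \<le> t" by auto
    define u where "u = pvec p0 c"
    \<comment> \<open>Any two points of the ball are within \<open>2 * t\<close>, so restricting to
      this set loses no point of the ball and bounds the directions given to the perceptron.\<close>
    define Z' where "Z' = {p\<in>Z. pdist p p0 \<le> 2 * t}"
    have "pdist c p0 \<le> t" using pdist_commute[of c d p0] c Z p0 by auto
    then have uu: "ip d u u \<le> t\<^sup>2"
      using pdist_square[OF c, of p0] power_mono[OF _ pdist_nonneg] by (metis u_def)
    have "p0 \<in> Z'"
      using p0 Z t pdist_L2[of p0 d p0] by (auto simp: Z'_def L2_set_0' pvec_def)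
    then have p0': "pvec p0 p0 \<in> pvec p0 ` Z'" by simp
    \<comment> \<open>The perceptron is run with accuracy \<open>\<epsilon> / 2\<close>, and
      \<open>len\<close> units of \<open>(\<epsilon> / 2)^2 * t^2 / 4\<close> have to pay for a
      squared norm of at most \<open>t^2\<close>.\<close>
    have "16 \<le> real len * \<epsilon>\<^sup>2" using l \<epsilon> by (simp add: divide_simps)
    then have "t\<^sup>2 * 16 \<le> t\<^sup>2 * (real len * \<epsilon>\<^sup>2)" by (intro mult_left_mono) auto
    then have "ip d u u \<le> real len * ((\<epsilon> / 2)\<^sup>2 * t\<^sup>2 / 4)"
      using uu by (simp add: field_simps power_divide)
    moreover have "ip d q q \<le> (2 * t)\<^sup>2" if q: "q \<in> pvec p0 ` Z'" for q
    proof -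
      obtain p where p: "p \<in> Z" "pdist p p0 \<le> 2 * t" "q = pvec p0 p" using q by (auto simp: Z'_def)
      have "ip d q q = (pdist p p0)\<^sup>2" using p Z by (subst pdist_square) auto
      also have "\<dots> \<le> (2 * t)\<^sup>2" using p by (intro power_mono) (auto simp: pdist_nonneg)
      finally show ?thesis .
    qed
    ultimately obtain L where L: "length L = len" "set L \<subseteq> pvec p0 ` Z' \<times> {1, -1, 0}"
      "\<And>q. q \<in> pvec p0 ` Z' \<Longrightarrow> \<bar>ip d q (\<lambda>i. u i - signed_sum (\<epsilon> / 2 / 4) L i)\<bar> \<le> \<epsilon> / 2 * t\<^sup>2"
      using perceptron[OF t _ p0', of "\<epsilon> / 2" d u len] \<epsilon> by auto
    have "\<exists>l. set l \<subseteq> Z' \<times> {1, -1, 0::real} \<and> L = map (\<lambda>(p, s). (pvec p0 p, s)) l"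
    proof -
      have "\<forall>x\<in>set L. \<exists>y. y \<in> Z' \<times> {1, -1, 0::real} \<and> x = (\<lambda>(p, s). (pvec p0 p, s)) y"
        using L(2) by fastforce
      then obtain f where f: "\<And>x. x \<in> set L \<Longrightarrow> f x \<in> Z' \<times> {1, -1, 0::real} \<and> x = (\<lambda>(p, s). (pvec p0 p, s)) (f x)"
        by metis
      have "L = map (\<lambda>(p, s). (pvec p0 p, s)) (map f L)"
        using f by (subst map_map, intro map_idI[symmetric]) auto
      moreover have "set (map f L) \<subseteq> Z' \<times> {1, -1, 0}"
        unfolding set_map using f by blast
      ultimately show ?thesis by blast
    qed
    then obtain l where l: "set l \<subseteq> Z' \<times> {1, -1, 0::real}" "L = map (\<lambda>(p, s). (pvec p0 p, s)) l" by blast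
    have lW: "l \<in> W" using l L(1) by (auto simp: W_def Z'_def)
    \<comment> \<open>Replacing \<open>u\<close> by its approximation changes the squared distance
      by at most \<open>\<epsilon> * t^2\<close>. This slack is granted once in
      \<open>\<theta>\<close>, for the first inclusion, and incurred again in the second, ending at
      \<open>(1 + 2 * \<epsilon>) * t^2\<close>.\<close>
    define \<theta> where "\<theta> = (1 + \<epsilon>) * t\<^sup>2 - ip d u u"
    define B where "B = Z' \<inter> {p\<in>Z. h p0 l p \<le> \<theta>}"
    have BF: "B \<in> F"
      unfolding F_def B_def Z'_def G_def using lW p0(1)
      by (auto simp: sublevels_def intro!: bexI[of _ "(p0, l)"] image_eqI[of _ _ "({p \<in> Z. pdist p p0 \<le> 2 * t}, {p \<in> Z. h p0 l p \<le> \<theta>})"])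
    have dist: "(pdist p c)\<^sup>2 = h p0 l p - 2 * ip d (pvec p0 p) (\<lambda>i. u i - U p0 l i) + ip d u u"
      if p: "p \<in> Z" for p
    proof -
      have "pvec c p = (\<lambda>i. pvec p0 p i - u i)" by (auto simp: pvec_def u_def)
      then have "(pdist p c)\<^sup>2 = ip d (pvec p0 p) (pvec p0 p) - 2 * ip d (pvec p0 p) u + ip d u u"
        using p Z pdist_square[of p d c] ip_commute[of d u "pvec p0 p"]
        by (auto simp: ip_diff_right ip_diff_left)
      then show ?thesis by (simp add: h_def ip_diff_right)
    qed
    have app: "\<bar>ip d (pvec p0 p) (\<lambda>i. u i - U p0 l i)\<bar> \<le> \<epsilon> / 2 * t\<^sup>2" if p: "p \<in> Z'" for p
      using L(3)[of "pvec p0 p"] p l(2) by (auto simp: U_def)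
    have 1: "{p\<in>Z. pdist p c \<le> t} \<subseteq> B"
    proof
      fix p assume p: "p \<in> {p\<in>Z. pdist p c \<le> t}"
      have "pdist p p0 \<le> pdist p c + pdist c p0" using p Z c by (intro pdist_triangle) auto
      also have "\<dots> \<le> 2 * t" using p p0 pdist_commute[of c d p0] c Z by auto
      finally have p': "p \<in> Z'" using p by (auto simp: Z'_def)
      have "(pdist p c)\<^sup>2 \<le> t\<^sup>2" using p by (auto intro!: power_mono simp: pdist_nonneg)
      then have "h p0 l p \<le> \<theta>" using dist[of p] app[OF p'] p
        by (auto simp: \<theta>_def algebra_simps abs_le_iff)
      then show "p \<in> B" using p p' by (auto simp: B_def)
    qed
    have 2: "B \<subseteq> {p\<in>Z. pdist p c \<le> (1 + \<epsilon>) * t}"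
    proof
      fix p assume p: "p \<in> B"
      then have p': "p \<in> Z'" "p \<in> Z" "h p0 l p \<le> \<theta>" by (auto simp: B_def)
      have "(pdist p c)\<^sup>2 \<le> (1 + 2 * \<epsilon>) * t\<^sup>2"
        using dist[OF p'(2)] app[OF p'(1)] p'(3) by (auto simp: \<theta>_def algebra_simps abs_le_iff)
      also have "\<dots> \<le> ((1 + \<epsilon>) * t)\<^sup>2"
      proof -
        have "((1 + \<epsilon>) * t)\<^sup>2 = (1 + 2 * \<epsilon>) * t\<^sup>2 + (\<epsilon> * t)\<^sup>2"
          by (simp add: power2_eq_square algebra_simps)
        then show ?thesis by simp
      qed
      finally have "pdist p c \<le> (1 + \<epsilon>) * t"
        by (rule power2_le_imp_le) (use \<epsilon> t in auto)
      then show "p \<in> {p\<in>Z. pdist p c \<le> (1 + \<epsilon>) * t}" using p' by auto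
    qed
    show ?thesis using BF 1 2 by blast
  qed
  with finF cardF show ?thesis by blast
qed

text \<open>Measured in units of \<open>t\<close> from a point \<open>p0\<close> of the ball, the
  center is rounded to a grid of mesh \<open>\<epsilon> / (2 * sqrt d)\<close>. For a fixed base
  point and grid vector the rounded balls increase with \<open>t\<close>, so their traces on
  \<open>Z\<close> form a chain and \<open>t\<close> need not be discretized.\<close>

lemma ball_cover_grid:
  assumes Z: "finite Z" "Z \<subseteq> Rd d" and \<epsilon>: "0 < \<epsilon>" and d: "1 \<le> d" and g: "2 * sqrt (real d) / \<epsilon> + 1 \<le> real g"
  shows "\<exists>F. finite F \<and> card F \<le> (card Z + 1) ^ 2 * (2 * g + 1) ^ d \<and>
           (\<forall>c\<in>Rd d. \<forall>t\<ge>0. \<exists>B\<in>F. {p\<in>Z. pdist p c \<le> t} \<subseteq> B \<and> B \<subseteq> {p\<in>Z. pdist p c \<le> (1 + \<epsilon>) * t})"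
proof -
  define h where "h = \<epsilon> / (2 * sqrt (real d))"
  have h: "0 < h" using \<epsilon> d by (simp add: h_def)
  \<comment> \<open>The norm bound is what yields monotonicity in \<open>t\<close>: when
    \<open>t\<close> grows by \<open>s\<close>, the rounded center moves by at most
    \<open>(1 + \<epsilon> / 2) * s\<close>, which is the growth of the radius.\<close>
  define V where "V = {v \<in> PiE {..<d} (\<lambda>_. {- int g..int g}). L2_set (\<lambda>i. h * real_of_int (v i)) {..<d} \<le> 1 + \<epsilon> / 2}"
  define b where "b = (\<lambda>p0 v t. {p\<in>Z. L2_set (\<lambda>i. pvec p0 p i - t * (h * real_of_int (v i))) {..<d} \<le> (1 + \<epsilon> / 2) * t})"
  define G where "G = (\<lambda>(p0, v). b p0 v ` {0..})"
  define F where "F = insert {} (\<Union>x\<in>Z \<times> V. G x)"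
  let ?N = "card Z"
  have V: "finite V" "card V \<le> (2 * g + 1) ^ d"
  proof -
    have f: "finite (PiE {..<d} (\<lambda>_. {- int g..int g}))" by (intro finite_PiE) auto
    then show "finite V" by (simp add: V_def)
    have "card V \<le> card (PiE {..<d} (\<lambda>_. {- int g..int g}))"
      unfolding V_def using f by (intro card_mono) auto
    also have "\<dots> = (2 * g + 1) ^ d" by (simp add: card_PiE nat_add_distrib nat_mult_distrib)
    finally show "card V \<le> (2 * g + 1) ^ d" .
  qed
  have mono: "b p0 v t \<subseteq> b p0 v t'" if v: "v \<in> V" and t: "t \<le> t'" for p0 v t t'
  proof
    fix p assume p: "p \<in> b p0 v t"
    have "(\<lambda>i. pvec p0 p i - t' * (h * real_of_int (v i))) =
        (\<lambda>i. (pvec p0 p i - t * (h * real_of_int (v i))) + (t - t') * (h * real_of_int (v i)))"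
      by (auto simp: algebra_simps)
    then have "L2_set (\<lambda>i. pvec p0 p i - t' * (h * real_of_int (v i))) {..<d}
        \<le> L2_set (\<lambda>i. pvec p0 p i - t * (h * real_of_int (v i))) {..<d} + L2_set (\<lambda>i. (t - t') * (h * real_of_int (v i))) {..<d}"
      using L2_set_triangle_ineq[of "\<lambda>i. pvec p0 p i - t * (h * real_of_int (v i))" "\<lambda>i. (t - t') * (h * real_of_int (v i))" "{..<d}"] by simp
    also have "L2_set (\<lambda>i. (t - t') * (h * real_of_int (v i))) {..<d} = (t' - t) * L2_set (\<lambda>i. h * real_of_int (v i)) {..<d}"
    proof -
      have "L2_set (\<lambda>i. (t - t') * (h * real_of_int (v i))) {..<d} = L2_set (\<lambda>i. (t' - t) * (h * real_of_int (v i))) {..<d}"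
        unfolding L2_set_def by (intro arg_cong[where f=sqrt] sum.cong refl) (simp add: power_mult_distrib power2_commute[of t t'])
      then show ?thesis using t by (simp add: L2_set_right_distrib)
    qed
    also have "L2_set (\<lambda>i. pvec p0 p i - t * (h * real_of_int (v i))) {..<d} + (t' - t) * L2_set (\<lambda>i. h * real_of_int (v i)) {..<d}
        \<le> (1 + \<epsilon> / 2) * t + (t' - t) * (1 + \<epsilon> / 2)"
      using p v t by (intro add_mono mult_left_mono) (auto simp: b_def V_def)
    also have "(1 + \<epsilon> / 2) * t + (t' - t) * (1 + \<epsilon> / 2) = (1 + \<epsilon> / 2) * t'"
      by (simp add: field_simps)
    finally show "p \<in> b p0 v t'" using p by (simp add: b_def)
  qed
  have G: "finite (G x) \<and> card (G x) \<le> ?N + 1" if "x \<in> Z \<times> V" for x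
  proof -
    obtain p0 v where x: "x = (p0, v)" "v \<in> V" using \<open>x \<in> Z \<times> V\<close> by fastforce
    show ?thesis unfolding G_def x(1) prod.case
    proof (rule card_chain_le[OF Z(1)])
      fix A B assume "A \<in> b p0 v ` {0..}" "B \<in> b p0 v ` {0..}"
      then obtain s t where "A = b p0 v s" "B = b p0 v t" by auto
      then show "A \<subseteq> B \<or> B \<subseteq> A" using mono[OF x(2)] by (metis linear)
    qed (auto simp: b_def)
  qed
  have finF: "finite F" using Z V G by (simp add: F_def)
  have "card (\<Union>x\<in>Z \<times> V. G x) \<le> (\<Sum>x\<in>Z \<times> V. card (G x))"
    using Z V by (intro card_UN_le) simp
  also have "\<dots> \<le> card (Z \<times> V) * (?N + 1)"
    using sum_bounded_above[of "Z \<times> V" "\<lambda>x. card (G x)" "?N + 1"] G by simp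
  also have "\<dots> \<le> (?N * (2 * g + 1) ^ d) * (?N + 1)"
    using V by (simp only: card_cartesian_product) (intro mult_le_mono, auto)
  finally have "card F \<le> 1 + (?N * (2 * g + 1) ^ d) * (?N + 1)"
    unfolding F_def using card_insert_le_m1 Z V G by (simp add: card_insert_if)
  also have "\<dots> \<le> (2 * g + 1) ^ d * (?N + 1) + (?N * (2 * g + 1) ^ d) * (?N + 1)"
    by (intro add_right_mono) (simp add: Suc_le_eq del: mult_Suc mult_Suc_right)
  also have "\<dots> = (?N + 1) ^ 2 * (2 * g + 1) ^ d"
    by (simp add: algebra_simps power2_eq_square)
  finally have cardF: "card F \<le> (?N + 1) ^ 2 * (2 * g + 1) ^ d" .
  have "\<exists>B\<in>F. {p\<in>Z. pdist p c \<le> t} \<subseteq> B \<and> B \<subseteq> {p\<in>Z. pdist p c \<le> (1 + \<epsilon>) * t}"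
    if c: "c \<in> Rd d" and t: "0 \<le> t" for c t
  proof (cases "{p\<in>Z. pdist p c \<le> t} = {}")
    case True
    then show ?thesis by (auto simp: F_def)
  next
    case False
    then obtain p0 where p0: "p0 \<in> Z" "pdist p0 c \<le> t" by auto
    define u where "u = pvec p0 c"
    have uL: "L2_set u {..<d} \<le> t"
      using pdist_L2[OF c, of p0] pdist_commute[of c d p0] c Z p0 by (auto simp: u_def)
    have ui: "\<bar>u i\<bar> \<le> t" if "i < d" for i
      using uL member_le_L2_set[of "{..<d}" i "\<lambda>i. \<bar>u i\<bar>"] that
      by (auto simp: L2_set_def)
    \<comment> \<open>For \<open>t = 0\<close> the quotient is 0 by convention, so \<open>v\<close>
      vanishes and the claims below persist. Otherwise it is at most \<open>1 / h\<close> in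
      absolute value; rounding down accounts for the additional 1 in the bound on
      \<open>g\<close>.\<close>
    define v where "v = (\<lambda>i\<in>{..<d}. \<lfloor>u i / (t * h)\<rfloor>)"
    have vi: "\<bar>u i - t * (h * real_of_int (v i))\<bar> \<le> t * h" if i: "i < d" for i
    proof (cases "t = 0")
      case True then show ?thesis using ui[OF i] by simp
    next
      case False
      then have th: "0 < t * h" using t h by simp
      have "real_of_int (v i) \<le> u i / (t * h)" "u i / (t * h) \<le> real_of_int (v i) + 1"
        using i by (auto simp: v_def intro: less_imp_le)
      then have "real_of_int (v i) * (t * h) \<le> u i" "u i \<le> (real_of_int (v i) + 1) * (t * h)"
        using th by (simp_all add: field_simps)
      then show ?thesis by (auto simp: algebra_simps abs_le_iff)
    qed
    have dh: "L2_set (\<lambda>i. t * h) {..<d} = t * (\<epsilon> / 2)"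
      using t \<epsilon> d by (simp add: L2_set_constant h_def abs_mult)
    have app: "L2_set (\<lambda>i. u i - t * (h * real_of_int (v i))) {..<d} \<le> t * (\<epsilon> / 2)"
    proof -
      have "L2_set (\<lambda>i. \<bar>u i - t * (h * real_of_int (v i))\<bar>) {..<d} \<le> L2_set (\<lambda>i. t * h) {..<d}"
        using vi by (intro L2_set_mono) auto
      then show ?thesis unfolding dh by (simp add: L2_set_def)
    qed
    have vV: "v \<in> V"
    proof -
      have "v i \<in> {- int g..int g}" if i: "i < d" for i
      proof -
        have "\<bar>u i / (t * h)\<bar> \<le> 1 / h"
          using ui[OF i] t h by (cases "t = 0") (auto simp: divide_simps abs_mult mult.commute)
        then have c: "\<bar>u i / (t * h)\<bar> \<le> 1 / h" .
        have "- (1 / h) \<le> u i / (t * h)" "u i / (t * h) \<le> 1 / h"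
          using abs_le_D1[OF c] abs_le_D2[OF c] by linarith+
        moreover have "1 / h + 1 \<le> real g" using g by (simp add: h_def)
        ultimately have "- real g \<le> real_of_int \<lfloor>u i / (t * h)\<rfloor>" "real_of_int \<lfloor>u i / (t * h)\<rfloor> \<le> real g" by linarith+
        then have "- int g \<le> \<lfloor>u i / (t * h)\<rfloor>" "\<lfloor>u i / (t * h)\<rfloor> \<le> int g" by linarith+
        then show ?thesis using i by (simp add: v_def)
      qed
      moreover have "L2_set (\<lambda>i. h * real_of_int (v i)) {..<d} \<le> 1 + \<epsilon> / 2"
      proof (cases "t = 0")
        case True then show ?thesis using \<epsilon> by (simp add: v_def L2_set_def)
      next
        case False
        have "t * L2_set (\<lambda>i. h * real_of_int (v i)) {..<d} = L2_set (\<lambda>i. t * (h * real_of_int (v i))) {..<d}"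
          using t by (simp add: L2_set_right_distrib)
        also have "\<dots> = L2_set (\<lambda>i. u i + - (u i - t * (h * real_of_int (v i)))) {..<d}" by simp
        also have "\<dots> \<le> L2_set u {..<d} + L2_set (\<lambda>i. - (u i - t * (h * real_of_int (v i)))) {..<d}"
          by (rule L2_set_triangle_ineq)
        also have "L2_set (\<lambda>i. - (u i - t * (h * real_of_int (v i)))) {..<d} = L2_set (\<lambda>i. u i - t * (h * real_of_int (v i))) {..<d}"
          by (simp add: L2_set_def power2_commute)
        also have "L2_set u {..<d} + \<dots> \<le> t * (1 + \<epsilon> / 2)" using uL app by (simp add: distrib_left)
        finally show ?thesis using False t by (simp add: mult_le_cancel_left)
      qed
      ultimately show ?thesis by (auto simp: V_def v_def)
    qed
    have BF: "b p0 v t \<in> F" unfolding F_def G_def using vV p0(1) t by auto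
    have 1: "{p\<in>Z. pdist p c \<le> t} \<subseteq> b p0 v t"
    proof
      fix p assume p: "p \<in> {p\<in>Z. pdist p c \<le> t}"
      have "(\<lambda>i. pvec p0 p i - t * (h * real_of_int (v i))) = (\<lambda>i. pvec c p i + (u i - t * (h * real_of_int (v i))))"
        by (auto simp: pvec_def u_def)
      then have "L2_set (\<lambda>i. pvec p0 p i - t * (h * real_of_int (v i))) {..<d} \<le> L2_set (pvec c p) {..<d} + L2_set (\<lambda>i. u i - t * (h * real_of_int (v i))) {..<d}"
        using L2_set_triangle_ineq[of "pvec c p" "\<lambda>i. u i - t * (h * real_of_int (v i))" "{..<d}"] by simp
      also have "\<dots> \<le> t + t * (\<epsilon> / 2)" using p Z app pdist_L2[of p d c] by (intro add_mono) auto
      finally show "p \<in> b p0 v t" using p by (simp add: b_def algebra_simps)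
    qed
    have 2: "b p0 v t \<subseteq> {p\<in>Z. pdist p c \<le> (1 + \<epsilon>) * t}"
    proof
      fix p assume p: "p \<in> b p0 v t"
      have "pvec c p = (\<lambda>i. (pvec p0 p i - t * (h * real_of_int (v i))) + - (u i - t * (h * real_of_int (v i))))"
        by (auto simp: pvec_def u_def)
      then have "L2_set (pvec c p) {..<d} \<le> L2_set (\<lambda>i. pvec p0 p i - t * (h * real_of_int (v i))) {..<d} + L2_set (\<lambda>i. - (u i - t * (h * real_of_int (v i)))) {..<d}"
        using L2_set_triangle_ineq[of "\<lambda>i. pvec p0 p i - t * (h * real_of_int (v i))" "\<lambda>i. - (u i - t * (h * real_of_int (v i)))" "{..<d}"] by simp
      also have "L2_set (\<lambda>i. - (u i - t * (h * real_of_int (v i)))) {..<d} = L2_set (\<lambda>i. u i - t * (h * real_of_int (v i))) {..<d}"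
        by (simp add: L2_set_def power2_commute)
      also have "L2_set (\<lambda>i. pvec p0 p i - t * (h * real_of_int (v i))) {..<d} + \<dots> \<le> (1 + \<epsilon> / 2) * t + t * (\<epsilon> / 2)"
        using p app by (intro add_mono) (auto simp: b_def)
      also have "\<dots> = (1 + \<epsilon>) * t" by (simp add: algebra_simps)
      finally show "p \<in> {p\<in>Z. pdist p c \<le> (1 + \<epsilon>) * t}"
        using p Z pdist_L2[of p d c] by (auto simp: b_def)
    qed
    show ?thesis using BF 1 2 by blast
  qed
  with finF cardF show ?thesis by blast
qed

section \<open>From balls to neighbourhoods of center sets\<close>

lemma cdist_le_iff: "finite C \<Longrightarrow> C \<noteq> {} \<Longrightarrow> cdist p C \<le> t \<longleftrightarrow> (\<exists>c\<in>C. pdist p c \<le> t)"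
  unfolding cdist_def by (subst Min_le_iff) auto

text \<open>A neighbourhood of \<open>C\<close> is the union of \<open>k\<close> balls of the same
  radius, so unions of \<open>k\<close> members of \<open>F\<close> suffice; lists of length
  \<open>k\<close> count them.\<close>

lemma center_cover:
  assumes F: "finite F" "\<forall>c\<in>Rd d. \<forall>t\<ge>0. \<exists>B\<in>F. {p\<in>Z. pdist p c \<le> t} \<subseteq> B \<and> B \<subseteq> {p\<in>Z. pdist p c \<le> (1 + \<epsilon>) * t}"
    and k: "1 \<le> k"
  shows "\<exists>F'. finite F' \<and> card F' \<le> card F ^ k \<and>
           (\<forall>C\<in>center_sets d k. \<forall>t\<ge>0. \<exists>B\<in>F'. {p\<in>Z. cdist p C \<le> t} \<subseteq> B \<and> B \<subseteq> {p\<in>Z. cdist p C \<le> (1 + \<epsilon>) * t})"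
proof -
  define F' where "F' = (\<lambda>l. \<Union>(set l)) ` {l. set l \<subseteq> F \<and> length l = k}"
  have "finite F'" unfolding F'_def using F finite_lists_length_eq by blast
  moreover have "card F' \<le> card F ^ k"
    unfolding F'_def using card_image_le[OF finite_lists_length_eq[OF F(1), of k], of "\<lambda>l. \<Union>(set l)"]
    by (simp add: card_lists_length_eq[OF F(1)])
  moreover have "\<exists>B\<in>F'. {p\<in>Z. cdist p C \<le> t} \<subseteq> B \<and> B \<subseteq> {p\<in>Z. cdist p C \<le> (1 + \<epsilon>) * t}"
    if C: "C \<in> center_sets d k" and t: "0 \<le> t" for C t
  proof -
    have C': "finite C" "C \<noteq> {}" "C \<subseteq> Rd d" "card C = k" using C k by (auto simp: center_sets_def)
    obtain cl where cl: "set cl = C" "length cl = k"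
      using C' finite_distinct_list[of C] distinct_card by metis
    have "\<forall>c\<in>C. \<exists>B. B \<in> F \<and> {p\<in>Z. pdist p c \<le> t} \<subseteq> B \<and> B \<subseteq> {p\<in>Z. pdist p c \<le> (1 + \<epsilon>) * t}"
      using F(2) C'(3) t by blast
    then obtain b where b: "\<And>c. c \<in> C \<Longrightarrow> b c \<in> F"
        "\<And>c. c \<in> C \<Longrightarrow> {p\<in>Z. pdist p c \<le> t} \<subseteq> b c" "\<And>c. c \<in> C \<Longrightarrow> b c \<subseteq> {p\<in>Z. pdist p c \<le> (1 + \<epsilon>) * t}"
      by (auto dest!: bchoice)
    have "\<Union>(set (map b cl)) \<in> F'"
      unfolding F'_def using b(1) cl by (intro image_eqI[of _ _ "map b cl"]) auto
    moreover have "{p\<in>Z. cdist p C \<le> t} \<subseteq> \<Union>(set (map b cl))"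
      unfolding cdist_le_iff[OF C'(1,2)] set_map cl(1) using b(2) by blast
    moreover have "\<Union>(set (map b cl)) \<subseteq> {p\<in>Z. cdist p C \<le> (1 + \<epsilon>) * t}"
      unfolding cdist_le_iff[OF C'(1,2)] set_map cl(1) using b(3) by blast
    ultimately show ?thesis by blast
  qed
  ultimately show ?thesis by blast
qed

section \<open>Symmetrization for block samples\<close>

text \<open>Termwise comparison of the power series, by
  \<open>2 ^ n * fact n \<le> fact (2 * n)\<close>. It bounds the moment generating function of a
  random sign.\<close>

lemma cosh_le_exp_half_square: "cosh (x::real) \<le> exp (x\<^sup>2 / 2)"
proof -
  have "(\<lambda>n. (\<lambda>n. if even n then x ^ n /\<^sub>R fact n else 0) (2 * n)) sums cosh x"
    by (subst sums_mono_reindex) (auto simp: strict_mono_def cosh_converges elim!: evenE)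
  then have c: "(\<lambda>n. x ^ (2 * n) /\<^sub>R fact (2 * n)) sums cosh x"
    by simp
  have e: "(\<lambda>n. (x\<^sup>2 / 2) ^ n /\<^sub>R fact n) sums exp (x\<^sup>2 / 2)"
    by (rule exp_converges)
  have f: "2 ^ n * fact n \<le> (fact (2 * n) :: real)" for n
  proof (induction n)
    case (Suc n)
    have "2 ^ Suc n * fact (Suc n) = (2 * (real n + 1)) * (2 ^ n * fact n)"
      by (simp add: algebra_simps)
    also have "\<dots> \<le> (2 * (real n + 1)) * fact (2 * n)"
      using Suc by (intro mult_left_mono) auto
    also have "\<dots> \<le> ((2 * real n + 2) * (2 * real n + 1)) * fact (2 * n)"
      by (intro mult_right_mono) (auto simp: algebra_simps)
    also have "\<dots> = fact (2 * Suc n)"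
      by (simp add: algebra_simps)
    finally show ?case .
  qed simp
  have "x ^ (2 * n) /\<^sub>R fact (2 * n) \<le> (x\<^sup>2 / 2) ^ n /\<^sub>R fact n" for n
  proof -
    have "x ^ (2 * n) * inverse (fact (2 * n)) \<le> x ^ (2 * n) * inverse (2 ^ n * fact n)"
      using f[of n] by (intro mult_left_mono le_imp_inverse_le) (auto simp: power_mult)
    then show ?thesis
      by (simp add: power_mult[symmetric] power_divide divide_simps mult.commute)
  qed
  then show ?thesis
    using sums_le[OF _ c e] by blast
qed

text \<open>\<open>J\<close> names the blocks, \<open>\<beta> j\<close> is the size of block
  \<open>j\<close> and \<open>pt j i\<close> its \<open>i\<close>-th point; \<open>x\<close> selects
  one position per block, and the selected point carries the weight of the whole block.\<close>

definition block_weight ::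
    "'j set \<Rightarrow> ('j \<Rightarrow> nat) \<Rightarrow> ('j \<Rightarrow> nat \<Rightarrow> 'p) \<Rightarrow> ('j \<Rightarrow> nat) \<Rightarrow> 'p set \<Rightarrow> real" where
  "block_weight J \<beta> pt x A = (\<Sum>j\<in>J. real (\<beta> j) * of_bool (pt j (x j) \<in> A))"

definition block_count ::
    "'j set \<Rightarrow> ('j \<Rightarrow> nat) \<Rightarrow> ('j \<Rightarrow> nat \<Rightarrow> 'p) \<Rightarrow> 'p set \<Rightarrow> real" where
  "block_count J \<beta> pt A = (\<Sum>j\<in>J. \<Sum>i<\<beta> j. of_bool (pt j i \<in> A))"

abbreviation choices :: "'j set \<Rightarrow> ('j \<Rightarrow> nat) \<Rightarrow> ('j \<Rightarrow> nat) set" where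
  "choices J \<beta> \<equiv> PiE J (\<lambda>j. {..<\<beta> j})"

lemma block_weight_mono: "A \<inter> (\<lambda>j. pt j (x j)) ` J \<subseteq> B \<Longrightarrow> block_weight J \<beta> pt x A \<le> block_weight J \<beta> pt x B"
  unfolding block_weight_def by (intro sum_mono mult_left_mono) auto

text \<open>Unbiasedness: the average weight over all choices is the true count. It lets a second
  sample stand in for the count in the symmetrization.\<close>

lemma sum_block_weight:
  assumes J: "finite J"
  shows "(\<Sum>x\<in>choices J \<beta>. block_weight J \<beta> pt x A) = real (card (choices J \<beta>)) * block_count J \<beta> pt A"
proof -
  have "(\<Sum>x\<in>choices J \<beta>. real (\<beta> j) * of_bool (pt j (x j) \<in> A))
      = real (card (choices J \<beta>)) * (\<Sum>i<\<beta> j. of_bool (pt j i \<in> A))" if j: "j \<in> J" for j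
  proof -
    \<comment> \<open>Padding the indicator by factors 1 for the other blocks makes the sum over
      choices a product of sums over blocks.\<close>
    let ?f = "\<lambda>l i. if l = j then of_bool (pt j i \<in> A) else (1::real)"
    have "(\<Sum>x\<in>choices J \<beta>. of_bool (pt j (x j) \<in> A)) = (\<Sum>x\<in>choices J \<beta>. \<Prod>l\<in>J. ?f l (x l))"
      using J j by (intro sum.cong refl) (simp add: prod.delta)
    also have "\<dots> = (\<Prod>l\<in>J. \<Sum>i<\<beta> l. ?f l i)"
      using J by (intro prod_sum_PiE[symmetric]) auto
    also have "\<dots> = (\<Sum>i<\<beta> j. of_bool (pt j i \<in> A)) * (\<Prod>l\<in>J - {j}. real (\<beta> l))"
      using J j by (subst prod.remove[of _ j]) (auto intro!: prod.cong)
    finally show ?thesis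
      using J j by (simp add: card_PiE prod.remove[of _ j] sum_distrib_left[symmetric] algebra_simps
          del: sum_of_bool_eq)
  qed
  then show ?thesis
    unfolding block_weight_def block_count_def sum_distrib_left
    by (subst sum.swap) (simp add: sum_distrib_left)
qed

text \<open>
  Swapping the \<open>j\<close>-th entries of \<open>x\<close> and \<open>y\<close> changes neither the set of points they select nor the
  uniform distribution on pairs; averaging over all swaps turns the difference of the two samples
  into a Rademacher sum.
\<close>

lemma swap_mgf:
  fixes F :: "'p set \<Rightarrow> 'p set set"
  assumes J: "finite J" and b: "\<And>j. j \<in> J \<Longrightarrow> \<beta> j \<le> b"
    and F: "\<And>x y. x \<in> choices J \<beta> \<Longrightarrow> y \<in> choices J \<beta> \<Longrightarrow>
              real (card (F ((\<lambda>j. pt j (x j)) ` J \<union> (\<lambda>j. pt j (y j)) ` J))) \<le> \<Phi>"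
  shows "(\<Sum>x\<in>choices J \<beta>. \<Sum>y\<in>choices J \<beta>. \<Sum>B\<in>F ((\<lambda>j. pt j (x j)) ` J \<union> (\<lambda>j. pt j (y j)) ` J).
            exp (\<theta> * (block_weight J \<beta> pt y B - block_weight J \<beta> pt x B)))
         \<le> (real (card (choices J \<beta>)))\<^sup>2 * \<Phi> * exp (\<theta>\<^sup>2 * real b * (\<Sum>j\<in>J. real (\<beta> j)) / 2)"
    (is "?L \<le> ?R")
proof -
  let ?\<Omega> = "choices J \<beta>"
  let ?S = "PiE J (\<lambda>_. UNIV :: bool set)"
  define Z where "Z = (\<lambda>x y. (\<lambda>j. pt j (x j)) ` J \<union> (\<lambda>j. pt j (y j)) ` J)"
  define a where "a = (\<lambda>x y B j. \<theta> * real (\<beta> j) * (of_bool (pt j (y j) \<in> B) - of_bool (pt j (x j) \<in> B)))"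
  define G where "G = (\<lambda>(x, y). \<Sum>B\<in>F (Z x y). exp (\<Sum>j\<in>J. a x y B j))"
  define sw where "sw = (\<lambda>s (x::'a\<Rightarrow>nat, y::'a\<Rightarrow>nat).
      (\<lambda>j\<in>J. if s j then y j else x j, \<lambda>j\<in>J. if s j then x j else y j))"
  have fin: "finite ?\<Omega>" using J by (simp add: finite_PiE)
  have G: "?L = (\<Sum>p\<in>?\<Omega> \<times> ?\<Omega>. G p)"
    unfolding sum.cartesian_product[symmetric] G_def Z_def a_def block_weight_def
    by (intro sum.cong refl) (simp add: sum_distrib_left sum_subtractf[symmetric] algebra_simps)
  \<comment> \<open>For fixed \<open>s\<close> the swap is an involution on pairs of
    choices.\<close>
  have inv: "(\<Sum>p\<in>?\<Omega> \<times> ?\<Omega>. G (sw s p)) = (\<Sum>p\<in>?\<Omega> \<times> ?\<Omega>. G p)" for s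
  proof (rule sum.reindex_bij_witness[of _ "sw s" "sw s"])
    fix p assume p: "p \<in> ?\<Omega> \<times> ?\<Omega>"
    then obtain x y where xy: "p = (x, y)" "x \<in> ?\<Omega>" "y \<in> ?\<Omega>" by blast
    show "sw s p \<in> ?\<Omega> \<times> ?\<Omega>" using xy by (fastforce simp: sw_def)
    show "sw s (sw s p) = p"
      using xy PiE_restrict[OF xy(2)] PiE_restrict[OF xy(3)]
      by (auto simp: sw_def restrict_def fun_eq_iff split: if_splits)
  next
    fix p assume p: "p \<in> ?\<Omega> \<times> ?\<Omega>"
    then obtain x y where xy: "p = (x, y)" "x \<in> ?\<Omega>" "y \<in> ?\<Omega>" by blast
    show "sw s p \<in> ?\<Omega> \<times> ?\<Omega>" using xy by (fastforce simp: sw_def)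
    show "sw s (sw s p) = p"
      using xy PiE_restrict[OF xy(2)] PiE_restrict[OF xy(3)]
      by (auto simp: sw_def restrict_def fun_eq_iff split: if_splits)
  qed auto
  have Gsw: "G (sw s (x, y)) = (\<Sum>B\<in>F (Z x y). \<Prod>j\<in>J. exp (if s j then - a x y B j else a x y B j))" for s x y
  proof -
    let ?x = "\<lambda>j\<in>J. if s j then y j else x j" and ?y = "\<lambda>j\<in>J. if s j then x j else y j"
    \<comment> \<open>The pooled points survive the swap, so the family may depend on both samples
      and still stays fixed while the signs vary.\<close>
    have "Z ?x ?y = Z x y"
      unfolding Z_def by (auto simp: image_iff split: if_splits) metis+
    moreover have "(\<Sum>j\<in>J. a ?x ?y B j) = (\<Sum>j\<in>J. if s j then - a x y B j else a x y B j)" for B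
      unfolding a_def by (intro sum.cong refl) auto
    ultimately show ?thesis
      unfolding G_def sw_def exp_sum[OF J, symmetric] by simp
  qed
  have avg: "(\<Sum>s\<in>?S. G (sw s (x, y))) \<le> 2 ^ card J * (\<Phi> * exp (\<theta>\<^sup>2 * real b * (\<Sum>j\<in>J. real (\<beta> j)) / 2))"
    if xy: "x \<in> ?\<Omega>" "y \<in> ?\<Omega>" for x y
  proof -
    have "(\<Sum>s\<in>?S. \<Prod>j\<in>J. exp (if s j then - a x y B j else a x y B j))
        \<le> 2 ^ card J * exp (\<theta>\<^sup>2 * real b * (\<Sum>j\<in>J. real (\<beta> j)) / 2)" for B
    proof -
      have "(\<Sum>s\<in>?S. \<Prod>j\<in>J. exp (if s j then - a x y B j else a x y B j))
          = (\<Prod>j\<in>J. \<Sum>s\<in>UNIV. exp (if s then - a x y B j else a x y B j))"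
        using J by (intro prod_sum_PiE[symmetric]) auto
      also have "\<dots> = (\<Prod>j\<in>J. 2 * cosh (a x y B j))"
        by (intro prod.cong refl) (simp add: UNIV_bool cosh_def)
      also have "\<dots> \<le> (\<Prod>j\<in>J. 2 * exp (\<theta>\<^sup>2 * real b * real (\<beta> j) / 2))"
      proof (intro prod_mono conjI mult_left_mono)
        fix j assume j: "j \<in> J"
        \<comment> \<open>A difference of two indicators is at most 1 in absolute value. Only one of
          the two factors \<open>\<beta> j\<close> is then estimated by \<open>b\<close>; the other
          sums up to the size of the stratum.\<close>
        have "(a x y B j)\<^sup>2 \<le> (\<theta> * real (\<beta> j))\<^sup>2"
          unfolding a_def by (auto simp: power_mult_distrib)
        also have "\<dots> \<le> \<theta>\<^sup>2 * real b * real (\<beta> j)"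
          using mult_left_mono[OF mult_right_mono[of "real (\<beta> j)" "real b" "real (\<beta> j)"], of "\<theta>\<^sup>2"] b[OF j]
          by (simp add: power2_eq_square mult_ac)
        finally have "exp ((a x y B j)\<^sup>2 / 2) \<le> exp (\<theta>\<^sup>2 * real b * real (\<beta> j) / 2)"
          by simp
        then show "cosh (a x y B j) \<le> exp (\<theta>\<^sup>2 * real b * real (\<beta> j) / 2)"
          using cosh_le_exp_half_square[of "a x y B j"] by linarith
      qed (auto simp: cosh_def add_nonneg_nonneg)
      also have "\<dots> = 2 ^ card J * exp (\<theta>\<^sup>2 * real b * (\<Sum>j\<in>J. real (\<beta> j)) / 2)"
        using J by (simp add: prod.distrib exp_sum sum_distrib_left sum_divide_distrib)
      finally show ?thesis .
    qed
    then have "(\<Sum>B\<in>F (Z x y). \<Sum>s\<in>?S. \<Prod>j\<in>J. exp (if s j then - a x y B j else a x y B j))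
        \<le> real (card (F (Z x y))) * (2 ^ card J * exp (\<theta>\<^sup>2 * real b * (\<Sum>j\<in>J. real (\<beta> j)) / 2))"
      by (intro sum_bounded_above)
    also have "\<dots> \<le> \<Phi> * (2 ^ card J * exp (\<theta>\<^sup>2 * real b * (\<Sum>j\<in>J. real (\<beta> j)) / 2))"
      using F[OF xy] by (intro mult_right_mono) (auto simp: Z_def)
    finally show ?thesis
      unfolding Gsw by (subst sum.swap) (simp add: mult_ac)
  qed
  have "2 ^ card J * ?L = (\<Sum>s\<in>?S. \<Sum>p\<in>?\<Omega> \<times> ?\<Omega>. G (sw s p))"
    unfolding inv G using J by (simp add: card_PiE)
  also have "\<dots> = (\<Sum>(x,y)\<in>?\<Omega> \<times> ?\<Omega>. \<Sum>s\<in>?S. G (sw s (x, y)))"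
    by (subst sum.swap) (simp add: case_prod_unfold)
  also have "\<dots> \<le> (\<Sum>p\<in>?\<Omega> \<times> ?\<Omega>. 2 ^ card J * (\<Phi> * exp (\<theta>\<^sup>2 * real b * (\<Sum>j\<in>J. real (\<beta> j)) / 2)))"
    using avg by (intro sum_mono) auto
  also have "\<dots> = 2 ^ card J * ?R"
    by (simp add: power2_eq_square card_cartesian_product)
  finally show ?thesis
    by simp
qed

text \<open>Jensen's inequality for \<open>exp\<close>, by the tangent at the mean.\<close>

lemma exp_mean_le:
  fixes f :: "'a \<Rightarrow> real"
  assumes "finite A" "A \<noteq> {}"
  shows "real (card A) * exp ((\<Sum>x\<in>A. f x) / real (card A)) \<le> (\<Sum>x\<in>A. exp (f x))"
proof -
  define \<mu> where "\<mu> = (\<Sum>x\<in>A. f x) / real (card A)"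
  have c: "real (card A) > 0" using assms by (simp add: card_gt_0_iff)
  have "(\<Sum>x\<in>A. exp \<mu> * (1 + (f x - \<mu>))) \<le> (\<Sum>x\<in>A. exp (f x))"
  proof (intro sum_mono)
    fix x
    have "exp \<mu> * (1 + (f x - \<mu>)) \<le> exp \<mu> * exp (f x - \<mu>)"
      using exp_ge_add_one_self[of "f x - \<mu>"] by (intro mult_left_mono) auto
    then show "exp \<mu> * (1 + (f x - \<mu>)) \<le> exp (f x)"
      by (simp add: exp_add[symmetric])
  qed
  moreover have "(\<Sum>x\<in>A. exp \<mu> * (1 + (f x - \<mu>))) = real (card A) * exp \<mu>"
    using c by (simp add: sum_distrib_left[symmetric] sum.distrib sum_subtractf \<mu>_def)
  ultimately show ?thesis unfolding \<mu>_def by simp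
qed

text \<open>The pairs in \<open>\<A>\<close> are infinitely many, so a direct union bound is
  impossible. The count is replaced by the mean over a second sample \<open>y\<close>, Jensen moves
  the mean out of \<open>exp\<close>, and on the finitely many pooled points the pair is separated
  by a member of \<open>F\<close>, over which the union bound is affordable.\<close>

lemma symmetrization:
  fixes F :: "'p set \<Rightarrow> 'p set set"
  assumes J: "finite J" and \<beta>: "\<And>j. j \<in> J \<Longrightarrow> 1 \<le> \<beta> j" and b: "\<And>j. j \<in> J \<Longrightarrow> \<beta> j \<le> b" "0 < b"
    and fin: "\<And>Z. finite (F Z)"
    and F: "\<And>Z. finite Z \<Longrightarrow> card Z \<le> 2 * card J \<Longrightarrow> real (card (F Z)) \<le> \<Phi>"
    and cover: "\<And>A A' Z. (A, A') \<in> \<A> \<Longrightarrow> finite Z \<Longrightarrow> \<exists>B\<in>F Z. A \<inter> Z \<subseteq> B \<and> B \<inter> Z \<subseteq> A'"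
    and \<eta>: "0 \<le> \<eta>"
    and N: "N = (\<Sum>j\<in>J. real (\<beta> j))"
    and D: "D = (\<lambda>x A A'. block_count J \<beta> pt A - block_weight J \<beta> pt x A') \<or>
            D = (\<lambda>x A A'. block_weight J \<beta> pt x A - block_count J \<beta> pt A')"
  shows "real (card {x\<in>choices J \<beta>. \<exists>(A, A')\<in>\<A>. D x A A' > \<eta> * N})
           \<le> real (card (choices J \<beta>)) * (\<Phi> * exp (- (\<eta>\<^sup>2 * N / (2 * real b))))"
proof -
  let ?\<Omega> = "choices J \<beta>"
  define Bad where "Bad = {x\<in>?\<Omega>. \<exists>(A, A')\<in>\<A>. D x A A' > \<eta> * N}"
  \<comment> \<open>This value minimises the exponent
    \<open>\<theta>^2 * b * N / 2 - \<theta> * \<eta> * N\<close>.\<close>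
  define \<theta> where "\<theta> = \<eta> / real b"
  have \<theta>: "0 \<le> \<theta>" using \<eta> by (simp add: \<theta>_def)
  define Z where "Z = (\<lambda>x y. (\<lambda>j. pt j (x j)) ` J \<union> (\<lambda>j. pt j (y j)) ` J)"
  have ZJ: "finite (Z x y)" "card (Z x y) \<le> 2 * card J" for x y
  proof -
    show "finite (Z x y)" using J by (simp add: Z_def)
    have "card (Z x y) \<le> card ((\<lambda>j. pt j (x j)) ` J) + card ((\<lambda>j. pt j (y j)) ` J)"
      unfolding Z_def by (rule card_Un_le)
    then show "card (Z x y) \<le> 2 * card J"
      using card_image_le[OF J, of "\<lambda>j. pt j (x j)"] card_image_le[OF J, of "\<lambda>j. pt j (y j)"] by linarith
  qed
  have fin\<Omega>: "finite ?\<Omega>" using J by (simp add: finite_PiE)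
  have pos: "real (card ?\<Omega>) > 0"
    using J \<beta> by (auto simp: card_PiE intro!: prod_pos) (fastforce simp: Suc_le_eq)
  then have ne: "?\<Omega> \<noteq> {}" by (metis card.empty less_irrefl of_nat_0)
  let ?w = "block_weight J \<beta> pt"
  have \<Phi>: "0 \<le> \<Phi>" using F[of "{}"] by (auto intro: order_trans[OF of_nat_0_le_iff])
  consider (l) "D = (\<lambda>x A A'. block_count J \<beta> pt A - ?w x A')" | (r) "D = (\<lambda>x A A'. ?w x A - block_count J \<beta> pt A')"
    using D by blast
  \<comment> \<open>The two kinds of deviation differ in which of the samples is in excess, that is,
    in the sign \<open>s\<close> of the exponent.\<close>
  then have key: "\<exists>s\<in>{1,-1}. \<forall>x\<in>Bad. real (card ?\<Omega>) * exp (\<theta> * (\<eta> * N)) \<le>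
               (\<Sum>y\<in>?\<Omega>. \<Sum>B\<in>F (Z x y). exp (s * \<theta> * (?w y B - ?w x B)))"
  proof cases
    case l
    show ?thesis
    proof (intro bexI[of _ 1] ballI)
      fix x assume "x \<in> Bad"
      then obtain A A' where x: "x \<in> ?\<Omega>" and A: "(A, A') \<in> \<A>" "\<eta> * N < block_count J \<beta> pt A - ?w x A'"
        unfolding Bad_def l by auto
      have "block_count J \<beta> pt A - ?w x A' = (\<Sum>y\<in>?\<Omega>. ?w y A - ?w x A') / real (card ?\<Omega>)"
        using pos sum_block_weight[OF J, of \<beta> pt A] by (simp add: sum_subtractf diff_divide_distrib)
      then have "\<theta> * (\<eta> * N) \<le> \<theta> * ((\<Sum>y\<in>?\<Omega>. ?w y A - ?w x A') / real (card ?\<Omega>))"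
        using A \<theta> by (intro mult_left_mono) auto
      also have "\<dots> = (\<Sum>y\<in>?\<Omega>. \<theta> * (?w y A - ?w x A')) / real (card ?\<Omega>)"
        by (simp add: sum_distrib_left)
      finally have "real (card ?\<Omega>) * exp (\<theta> * (\<eta> * N)) \<le> (\<Sum>y\<in>?\<Omega>. exp (\<theta> * (?w y A - ?w x A')))"
        using exp_mean_le[OF fin\<Omega> ne, of "\<lambda>y. \<theta> * (?w y A - ?w x A')"]
        by (meson exp_le_cancel_iff mult_left_mono of_nat_0_le_iff order_trans)
      also have "\<dots> \<le> (\<Sum>y\<in>?\<Omega>. \<Sum>B\<in>F (Z x y). exp (\<theta> * (?w y B - ?w x B)))"
      proof (intro sum_mono)
        fix y
        obtain B where B: "B \<in> F (Z x y)" "A \<inter> Z x y \<subseteq> B" "B \<inter> Z x y \<subseteq> A'"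
          using cover[OF A(1) ZJ(1)] by blast
        \<comment> \<open>All selected points lie in \<open>Z x y\<close>, so the sandwich acts on
          weights: \<open>A\<close> is enlarged to \<open>B\<close> for one sample and
          \<open>A'\<close> shrunk to \<open>B\<close> for the other.\<close>
        have "?w y A \<le> ?w y B" using B by (intro block_weight_mono) (auto simp: Z_def)
        moreover have "?w x B \<le> ?w x A'" using B by (intro block_weight_mono) (auto simp: Z_def)
        ultimately have "exp (\<theta> * (?w y A - ?w x A')) \<le> exp (\<theta> * (?w y B - ?w x B))"
          using \<theta> by (auto intro!: mult_left_mono)
        also have "\<dots> \<le> (\<Sum>B\<in>F (Z x y). exp (\<theta> * (?w y B - ?w x B)))"
          using B fin by (intro member_le_sum) auto
        finally show "exp (\<theta> * (?w y A - ?w x A')) \<le> (\<Sum>B\<in>F (Z x y). exp (\<theta> * (?w y B - ?w x B)))" .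
      qed
      finally show "real (card ?\<Omega>) * exp (\<theta> * (\<eta> * N)) \<le>
               (\<Sum>y\<in>?\<Omega>. \<Sum>B\<in>F (Z x y). exp (1 * \<theta> * (?w y B - ?w x B)))" by simp
    qed simp
  next
    case r
    show ?thesis
    proof (intro bexI[of _ "-1"] ballI)
      fix x assume "x \<in> Bad"
      then obtain A A' where x: "x \<in> ?\<Omega>" and A: "(A, A') \<in> \<A>" "\<eta> * N < ?w x A - block_count J \<beta> pt A'"
        unfolding Bad_def r by auto
      have "?w x A - block_count J \<beta> pt A' = (\<Sum>y\<in>?\<Omega>. ?w x A - ?w y A') / real (card ?\<Omega>)"
        using pos sum_block_weight[OF J, of \<beta> pt A'] by (simp add: sum_subtractf diff_divide_distrib)
      then have "\<theta> * (\<eta> * N) \<le> \<theta> * ((\<Sum>y\<in>?\<Omega>. ?w x A - ?w y A') / real (card ?\<Omega>))"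
        using A \<theta> by (intro mult_left_mono) auto
      also have "\<dots> = (\<Sum>y\<in>?\<Omega>. \<theta> * (?w x A - ?w y A')) / real (card ?\<Omega>)"
        by (simp add: sum_distrib_left)
      finally have "real (card ?\<Omega>) * exp (\<theta> * (\<eta> * N)) \<le> (\<Sum>y\<in>?\<Omega>. exp (\<theta> * (?w x A - ?w y A')))"
        using exp_mean_le[OF fin\<Omega> ne, of "\<lambda>y. \<theta> * (?w x A - ?w y A')"]
        by (meson exp_le_cancel_iff mult_left_mono of_nat_0_le_iff order_trans)
      also have "\<dots> \<le> (\<Sum>y\<in>?\<Omega>. \<Sum>B\<in>F (Z x y). exp ((-1) * \<theta> * (?w y B - ?w x B)))"
      proof (intro sum_mono)
        fix y
        obtain B where B: "B \<in> F (Z x y)" "A \<inter> Z x y \<subseteq> B" "B \<inter> Z x y \<subseteq> A'"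
          using cover[OF A(1) ZJ(1)] by blast
        have "?w x A \<le> ?w x B" using B by (intro block_weight_mono) (auto simp: Z_def)
        moreover have "?w y B \<le> ?w y A'" using B by (intro block_weight_mono) (auto simp: Z_def)
        ultimately have "\<theta> * (?w x A - ?w y A') \<le> \<theta> * (?w x B - ?w y B)"
          using \<theta> by (auto intro!: mult_left_mono)
        then have "exp (\<theta> * (?w x A - ?w y A')) \<le> exp ((-1) * \<theta> * (?w y B - ?w x B))"
          by (simp add: algebra_simps)
        also have "\<dots> \<le> (\<Sum>B\<in>F (Z x y). exp ((-1) * \<theta> * (?w y B - ?w x B)))"
          using B fin by (intro member_le_sum) auto
        finally show "exp (\<theta> * (?w x A - ?w y A')) \<le> (\<Sum>B\<in>F (Z x y). exp ((-1) * \<theta> * (?w y B - ?w x B)))" .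
      qed
      finally show "real (card ?\<Omega>) * exp (\<theta> * (\<eta> * N)) \<le>
               (\<Sum>y\<in>?\<Omega>. \<Sum>B\<in>F (Z x y). exp ((-1) * \<theta> * (?w y B - ?w x B)))" .
    qed simp
  qed
  then obtain s where s1: "s \<in> {1, -1::real}" and "\<forall>x\<in>Bad. real (card ?\<Omega>) * exp (\<theta> * (\<eta> * N)) \<le>
               (\<Sum>y\<in>?\<Omega>. \<Sum>B\<in>F (Z x y). exp (s * \<theta> * (?w y B - ?w x B)))" by (rule bexE)
  note sB = bspec[OF this(2)]
  have s: "s\<^sup>2 = 1" using s1 by auto
  have "real (card Bad) * (real (card ?\<Omega>) * exp (\<theta> * (\<eta> * N)))
      = (\<Sum>x\<in>Bad. real (card ?\<Omega>) * exp (\<theta> * (\<eta> * N)))" by simp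
  also have "\<dots> \<le> (\<Sum>x\<in>Bad. \<Sum>y\<in>?\<Omega>. \<Sum>B\<in>F (Z x y). exp (s * \<theta> * (?w y B - ?w x B)))"
    using sB by (intro sum_mono)
  also have "\<dots> \<le> (\<Sum>x\<in>?\<Omega>. \<Sum>y\<in>?\<Omega>. \<Sum>B\<in>F (Z x y). exp (s * \<theta> * (?w y B - ?w x B)))"
    by (intro sum_mono2 fin\<Omega>) (auto simp: Bad_def intro!: sum_nonneg)
  also have "\<dots> \<le> (real (card ?\<Omega>))\<^sup>2 * \<Phi> * exp ((s * \<theta>)\<^sup>2 * real b * (\<Sum>j\<in>J. real (\<beta> j)) / 2)"
    unfolding Z_def using F ZJ by (intro swap_mgf J b) (auto simp: Z_def)
  finally have 1: "real (card Bad) * (real (card ?\<Omega>) * exp (\<theta> * (\<eta> * N))) \<le> 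
      (real (card ?\<Omega>))\<^sup>2 * \<Phi> * exp (\<theta>\<^sup>2 * real b * N / 2)"
    by (simp add: power_mult_distrib s N)
  have 2: "\<theta>\<^sup>2 * real b * N / 2 - \<theta> * (\<eta> * N) = - (\<eta>\<^sup>2 * N / (2 * real b))"
    using b(2) by (simp add: \<theta>_def field_simps power2_eq_square)
  have "real (card Bad) = real (card Bad) * (real (card ?\<Omega>) * exp (\<theta> * (\<eta> * N))) / (real (card ?\<Omega>) * exp (\<theta> * (\<eta> * N)))"
    using pos by simp
  also have "\<dots> \<le> ((real (card ?\<Omega>))\<^sup>2 * \<Phi> * exp (\<theta>\<^sup>2 * real b * N / 2)) / (real (card ?\<Omega>) * exp (\<theta> * (\<eta> * N)))"
    using 1 by (intro divide_right_mono) auto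
  also have "\<dots> = real (card ?\<Omega>) * (\<Phi> * exp (\<theta>\<^sup>2 * real b * N / 2 - \<theta> * (\<eta> * N)))"
    using pos by (simp add: exp_diff power2_eq_square)
  finally show ?thesis
    unfolding 2 Bad_def .
qed

section \<open>Layer cake comparison of truncated sums\<close>

lemma has_integral_of_bool_less:
  assumes "0 \<le> x" "x \<le> (M::real)"
  shows "((\<lambda>t. of_bool (t < x) :: real) has_integral x) {0..M}"
proof -
  have "((\<lambda>t. if t \<in> {0..x} then 1 else 0 :: real) has_integral x) {0..M}"
    using assms has_integral_const_real[of "1::real" 0 x] by (subst has_integral_restrict) auto
  then show ?thesis
    by (rule has_integral_spike_finite[of "{x}", rotated 2]) auto
qed

text \<open>Integrate the inequality between level sets over \<open>t\<close> from 0 to a common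
  upper bound of all values; an error present at levels below \<open>r\<close> contributes
  \<open>c * r\<close>.\<close>

lemma layer_cake_le:
  fixes x :: "'a \<Rightarrow> real" and y :: "'b \<Rightarrow> real"
  assumes fin: "finite A" "finite B" and nn: "\<And>a. a \<in> A \<Longrightarrow> 0 \<le> x a" "\<And>b. b \<in> B \<Longrightarrow> 0 \<le> y b" "0 \<le> r"
    and le: "\<And>t. 0 \<le> t \<Longrightarrow> (\<Sum>a\<in>A. u a * of_bool (t < x a)) \<le> (\<Sum>b\<in>B. v b * of_bool (t < y b)) + c * of_bool (t < r)"
  shows "(\<Sum>a\<in>A. u a * x a) \<le> (\<Sum>b\<in>B. v b * y b) + c * r"
proof -
  define M where "M = Max (insert r (x ` A \<union> y ` B))"
  have M: "r \<le> M" "\<And>a. a \<in> A \<Longrightarrow> x a \<le> M" "\<And>b. b \<in> B \<Longrightarrow> y b \<le> M"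
    unfolding M_def using fin by (auto intro!: Max_ge)
  have 1: "((\<lambda>t. \<Sum>a\<in>A. u a * of_bool (t < x a)) has_integral (\<Sum>a\<in>A. u a * x a)) {0..M}"
    using fin nn M by (intro has_integral_sum has_integral_mult_right has_integral_of_bool_less) auto
  have 2: "((\<lambda>t. (\<Sum>b\<in>B. v b * of_bool (t < y b)) + c * of_bool (t < r)) has_integral (\<Sum>b\<in>B. v b * y b) + c * r) {0..M}"
    using fin nn M by (intro has_integral_add has_integral_sum has_integral_mult_right has_integral_of_bool_less) auto
  show ?thesis
    by (rule has_integral_le[OF 1 2]) (use le in auto)
qed

text \<open>The error \<open>c\<close> is charged only for levels below \<open>R\<close>. Above
  \<open>R\<close> the left side has no layers, either because no value of \<open>f\<close> gets
  there or because truncation at \<open>\<theta>\<close> has cut them off.\<close>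

lemma truncated_sum_le:
  fixes f :: "'a \<Rightarrow> real"
  assumes Q: "finite Q" and f: "\<And>p. p \<in> Q \<Longrightarrow> 0 \<le> f p" and h: "\<And>p. p \<in> Q \<Longrightarrow> 0 \<le> h p"
    and l: "1 \<le> l" and \<theta>: "0 \<le> \<theta>" and R: "0 \<le> R" "(\<forall>p\<in>Q. f p \<le> R) \<or> \<theta> \<le> R" and c: "0 \<le> c"
    and le: "\<And>t. 0 \<le> t \<Longrightarrow> (\<Sum>p\<in>Q. g p * of_bool (l * t < f p)) \<le> (\<Sum>p\<in>Q. h p * of_bool (t < f p)) + c"
  shows "(\<Sum>p\<in>Q. g p * min (f p / l) \<theta>) \<le> (\<Sum>p\<in>Q. h p * min (f p) \<theta>) + c * R"
proof -
  have "(\<Sum>p\<in>Q. g p * min (f p / l) \<theta>) \<le> (\<Sum>p\<in>Q. h p * min (f p) \<theta>) + c * min R \<theta>"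
  proof (rule layer_cake_le)
    fix t :: real assume t: "0 \<le> t"
    show "(\<Sum>p\<in>Q. g p * of_bool (t < min (f p / l) \<theta>))
        \<le> (\<Sum>p\<in>Q. h p * of_bool (t < min (f p) \<theta>)) + c * of_bool (t < min R \<theta>)"
    proof (cases "t < \<theta>")
      case True
      have eq: "t < f p / l \<longleftrightarrow> l * t < f p" for p using l by (simp add: field_simps)
      show ?thesis
      proof (cases "t < R")
        case tR: True
        then show ?thesis using le[OF t] True by (simp add: eq)
      next
        case False
        \<comment> \<open>Here \<open>R \<le> t < \<theta>\<close>, which rules out the alternative
          \<open>\<theta> \<le> R\<close>.\<close>
        then have fR: "\<forall>p\<in>Q. f p \<le> t" using R True by force
        have "f p \<le> l * t" if "p \<in> Q" for p
          using fR that l t mult_right_mono[of 1 l t] by force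
        then have "(\<Sum>p\<in>Q. g p * of_bool (t < min (f p / l) \<theta>)) = 0"
          by (intro sum.neutral) (auto simp: eq not_less)
        moreover have "0 \<le> (\<Sum>p\<in>Q. h p * of_bool (t < min (f p) \<theta>))"
          using h by (intro sum_nonneg) auto
        ultimately show ?thesis using c by auto
      qed
    next
      case False
      then show ?thesis using h c by (auto intro!: sum_nonneg)
    qed
  qed (use Q f \<theta> R l in auto)
  also have "c * min R \<theta> \<le> c * R" using c by (intro mult_left_mono) auto
  finally show ?thesis by simp
qed

section \<open>Duality for the robust cost\<close>

lemma top_subset_exists:
  fixes f :: "'a \<Rightarrow> real"
  assumes "finite P" "m \<le> card P"
  shows "\<exists>L\<subseteq>P. card L = m \<and> (\<forall>p\<in>L. \<forall>q\<in>P - L. f q \<le> f p)"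
  using assms(2)
proof (induction m)
  case (Suc m)
  then obtain L where L: "L \<subseteq> P" "card L = m" "\<forall>p\<in>L. \<forall>q\<in>P - L. f q \<le> f p" by auto
  have finL: "finite L" using L assms finite_subset by blast
  have "P - L \<noteq> {}" using L Suc.prems finL assms by (metis Diff_eq_empty_iff card_mono not_less_eq_eq)
  then have "Max (f ` (P - L)) \<in> f ` (P - L)" using assms by (intro Max_in) auto
  then obtain x where x: "x \<in> P - L" "f x = Max (f ` (P - L))" by auto
  have "f q \<le> f x" if "q \<in> P - L" for q
    unfolding x(2) using assms that by (intro Max_ge) auto
  note x = x(1) this
  then show ?case using L finL by (intro exI[of _ "insert x L"]) (auto simp: card_insert_if)
qed auto

text \<open>Weak duality: the \<open>m\<close> removed points contribute at most
  \<open>\<theta>\<close> each to the truncated sum.\<close>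

lemma robust_cost_ge:
  assumes P: "finite P" "m \<le> card P" and \<theta>: "0 \<le> \<theta>"
  shows "(\<Sum>p\<in>P. min (cdist p C powr z) \<theta>) - real m * \<theta> \<le> robust_cost z m P C"
proof -
  let ?f = "\<lambda>p. cdist p C powr z"
  have ne: "{L. L \<subseteq> P \<and> card L = m} \<noteq> {}"
    using obtain_subset_with_card_n[OF P(2)] by auto
  have "(\<Sum>p\<in>P. min (?f p) \<theta>) - real m * \<theta> \<le> (\<Sum>p\<in>P - L. ?f p)" if L: "L \<subseteq> P" "card L = m" for L
  proof -
    have "(\<Sum>p\<in>P. min (?f p) \<theta>) = (\<Sum>p\<in>P - L. min (?f p) \<theta>) + (\<Sum>p\<in>L. min (?f p) \<theta>)"
      by (rule sum.subset_diff[OF L(1) P(1)])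
    moreover have "(\<Sum>p\<in>P - L. min (?f p) \<theta>) \<le> (\<Sum>p\<in>P - L. ?f p)" by (rule sum_mono) simp
    moreover have "(\<Sum>p\<in>L. min (?f p) \<theta>) \<le> real m * \<theta>"
      unfolding L(2)[symmetric] by (rule sum_bounded_above) simp
    ultimately show ?thesis by linarith
  qed
  note ge = this
  show ?thesis
    unfolding robust_cost_def
  proof (rule Min.boundedI)
    show "finite ((\<lambda>L. \<Sum>p\<in>P - L. ?f p) ` {L. L \<subseteq> P \<and> card L = m})" using P by simp
    show "(\<lambda>L. \<Sum>p\<in>P - L. ?f p) ` {L. L \<subseteq> P \<and> card L = m} \<noteq> {}" using ne by blast
    fix a assume "a \<in> (\<lambda>L. \<Sum>p\<in>P - L. ?f p) ` {L. L \<subseteq> P \<and> card L = m}"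
    then obtain L where L: "L \<subseteq> P" "card L = m" "a = (\<Sum>p\<in>P - L. ?f p)" by blast
    show "(\<Sum>p\<in>P. min (?f p) \<theta>) - real m * \<theta> \<le> a"
      unfolding L(3) by (rule ge[OF L(1,2)])
  qed
qed

text \<open>Complementary slackness: with \<open>\<theta>\<close> the largest cost that is kept,
  truncation leaves the kept points alone and turns each removed cost into \<open>\<theta>\<close>.
  If \<open>\<theta>\<close> exceeded \<open>B\<close>, there would be \<open>m + 1\<close> points
  of cost above \<open>B\<close>.\<close>

lemma robust_cost_eq:
  assumes P: "finite P" "m \<le> card P" and B: "0 \<le> B" "card {p\<in>P. B < cdist p C powr z} \<le> m"
  shows "\<exists>\<theta>. 0 \<le> \<theta> \<and> \<theta> \<le> B \<and> robust_cost z m P C = (\<Sum>p\<in>P. min (cdist p C powr z) \<theta>) - real m * \<theta>"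
proof -
  let ?f = "\<lambda>p. cdist p C powr z"
  obtain L where L: "L \<subseteq> P" "card L = m" "\<forall>p\<in>L. \<forall>q\<in>P - L. ?f q \<le> ?f p"
    using top_subset_exists[OF P, of ?f] by (elim exE conjE) auto
  \<comment> \<open>The value 0 covers \<open>m = card P\<close>, where nothing is kept.\<close>
  define \<theta> where "\<theta> = (if P - L = {} then 0 else Max (?f ` (P - L)))"
  have \<theta>1: "?f q \<le> \<theta>" if "q \<in> P - L" for q
    using that P by (auto simp: \<theta>_def intro!: Max_ge)
  have \<theta>x: "\<theta> = 0 \<or> (\<exists>q\<in>P - L. \<theta> = ?f q)"
  proof (cases "P - L = {}")
    case False
    then have "Max (?f ` (P - L)) \<in> ?f ` (P - L)" using P by (intro Max_in) auto
    then show ?thesis using False by (auto simp: \<theta>_def)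
  qed (simp add: \<theta>_def)
  have \<theta>2: "\<theta> \<le> ?f p" if "p \<in> L" for p
    using \<theta>x L(3) that by auto
  have \<theta>0: "0 \<le> \<theta>" using \<theta>x by auto
  have "\<theta> \<le> B"
  proof (rule ccontr)
    assume "\<not> \<theta> \<le> B"
    then obtain q where q: "q \<in> P - L" "\<theta> = ?f q" using \<theta>x B by auto
    then have "insert q L \<subseteq> {p\<in>P. B < ?f p}" using \<open>\<not> \<theta> \<le> B\<close> \<theta>2 L by force
    then have "card (insert q L) \<le> m" using B(2) P card_mono[of "{p\<in>P. B < ?f p}" "insert q L"] by auto
    then show False using q L P finite_subset[OF L(1)] by simp
  qed
  have "(\<Sum>p\<in>P. min (?f p) \<theta>) = (\<Sum>p\<in>P - L. min (?f p) \<theta>) + (\<Sum>p\<in>L. min (?f p) \<theta>)"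
    by (rule sum.subset_diff[OF L(1) P(1)])
  also have "\<dots> = (\<Sum>p\<in>P - L. ?f p) + (\<Sum>p\<in>L. \<theta>)"
    using \<theta>1 \<theta>2 by (intro arg_cong2[where f="(+)"] sum.cong) (auto simp: min_def intro: antisym)
  finally have eq: "(\<Sum>p\<in>P. min (?f p) \<theta>) - real m * \<theta> = (\<Sum>p\<in>P - L. ?f p)" using L by simp
  have "robust_cost z m P C \<le> (\<Sum>p\<in>P - L. ?f p)"
    unfolding robust_cost_def using P L by (intro Min_le) auto
  with robust_cost_ge[OF P \<theta>0, of C z] eq \<theta>0 \<open>\<theta> \<le> B\<close> show ?thesis by force
qed

text \<open>Scaling all weights by the same factor is admissible. A lower bound for all admissible
  weights passes to the infimum only if there is one.\<close>

lemma residual_weights_nonempty: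
  assumes "finite S" "\<And>p. p \<in> S \<Longrightarrow> 0 \<le> w p" "real m \<le> (\<Sum>p\<in>S. w p)"
  shows "residual_weights m S w \<noteq> {}"
proof -
  define W where "W = (\<Sum>p\<in>S. w p)"
  have ?thesis if "W \<noteq> 0"
  proof -
    have "0 < W" using assms that by (simp add: W_def sum_nonneg less_le)
    define r where "r = (W - real m) / W"
    have r: "0 \<le> r" "r \<le> 1" "W * r = W - real m"
      using assms \<open>0 < W\<close> by (auto simp: W_def r_def)
    have "(\<lambda>p. w p * r) \<in> residual_weights m S w"
      using r assms(2) mult_left_mono[OF r(2)] 
      by (auto simp: residual_weights_def sum_distrib_right[symmetric] W_def[symmetric])
    then show ?thesis by blast
  qed
  moreover have "w \<in> residual_weights m S w" if "W = 0"
    using that assms unfolding residual_weights_def W_def by auto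
  ultimately show ?thesis by blast
qed

text \<open>Weak duality again: the removed weights \<open>w - w'\<close> total \<open>m\<close>,
  and each unit accounts for at most \<open>\<theta>\<close>.\<close>

lemma weighted_robust_cost_ge:
  assumes S: "finite S" and w: "\<And>p. p \<in> S \<Longrightarrow> 0 \<le> w p" "real m \<le> (\<Sum>p\<in>S. w p)" and \<theta>: "0 \<le> \<theta>"
  shows "(\<Sum>p\<in>S. w p * min (cdist p C powr z) \<theta>) - real m * \<theta> \<le> weighted_robust_cost z m S w C"
  unfolding weighted_robust_cost_def
proof (rule cINF_greatest[OF residual_weights_nonempty[OF assms(1-3)]])
  fix w' assume w': "w' \<in> residual_weights m S w"
  let ?f = "\<lambda>p. cdist p C powr z"
  have "(\<Sum>p\<in>S. w p * min (?f p) \<theta>) - (\<Sum>p\<in>S. w' p * min (?f p) \<theta>) = (\<Sum>p\<in>S. (w p - w' p) * min (?f p) \<theta>)"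
    by (simp add: sum_subtractf algebra_simps)
  also have "\<dots> \<le> (\<Sum>p\<in>S. (w p - w' p) * \<theta>)"
    using w' by (intro sum_mono mult_left_mono) (auto simp: residual_weights_def)
  also have "\<dots> = real m * \<theta>"
    using w' by (simp add: sum_distrib_right[symmetric] sum_subtractf residual_weights_def)
  finally have "(\<Sum>p\<in>S. w p * min (?f p) \<theta>) - real m * \<theta> \<le> (\<Sum>p\<in>S. w' p * min (?f p) \<theta>)" by linarith
  also have "\<dots> \<le> (\<Sum>p\<in>S. w' p * ?f p)"
    using w' by (intro sum_mono mult_left_mono) (auto simp: residual_weights_def)
  finally show "(\<Sum>p\<in>S. w p * min (?f p) \<theta>) - real m * \<theta> \<le> (\<Sum>p\<in>S. w' p * ?f p)" .
qed

text \<open>The multiplier is a weighted quantile of the costs. Everything above it is removed,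
  together with the fraction of the weight at the level itself that brings the removed weight to
  \<open>m\<close>.\<close>

lemma weighted_robust_cost_le:
  assumes S: "finite S" and w: "\<And>p. p \<in> S \<Longrightarrow> 0 \<le> w p" "real m \<le> (\<Sum>p\<in>S. w p)"
    and B: "0 \<le> B" "(\<Sum>p\<in>{p\<in>S. B < cdist p C powr z}. w p) \<le> real m"
  shows "\<exists>\<theta>. 0 \<le> \<theta> \<and> \<theta> \<le> B \<and>
    weighted_robust_cost z m S w C \<le> (\<Sum>p\<in>S. w p * min (cdist p C powr z) \<theta>) - real m * \<theta>"
proof -
  let ?f = "\<lambda>p. cdist p C powr z"
  define V where "V = {v \<in> insert 0 (?f ` S). (\<Sum>p\<in>{p\<in>S. v < ?f p}. w p) \<le> real m}"
  define v0 where "v0 = Max {v \<in> insert 0 (?f ` S). v \<le> B}"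
  have finV: "finite V" using S by (simp add: V_def)
  have v0: "v0 \<in> {v \<in> insert 0 (?f ` S). v \<le> B}"
    unfolding v0_def using S B by (intro Max_in) auto
  have v0max: "?f p \<le> v0" if "p \<in> S" "?f p \<le> B" for p
    unfolding v0_def using S that by (intro Max_ge) auto
  have "{p\<in>S. v0 < ?f p} = {p\<in>S. B < ?f p}"
    using v0 v0max by force
  then have v0V: "v0 \<in> V" using v0 B by (auto simp: V_def)
  define \<theta> where "\<theta> = Min V"
  have \<theta>V: "\<theta> \<in> V" unfolding \<theta>_def using finV v0V by (intro Min_in) auto
  have \<theta>le: "\<theta> \<le> v" if "v \<in> V" for v unfolding \<theta>_def using finV that by (intro Min_le)
  have \<theta>0: "0 \<le> \<theta>" using \<theta>V by (auto simp: V_def)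
  have \<theta>B: "\<theta> \<le> B" using \<theta>le[OF v0V] v0 by auto
  define Lt Eq Gt where "Lt = (\<Sum>p\<in>{p\<in>S. ?f p < \<theta>}. w p)" and "Eq = (\<Sum>p\<in>{p\<in>S. ?f p = \<theta>}. w p)"
    and "Gt = (\<Sum>p\<in>{p\<in>S. \<theta> < ?f p}. w p)"
  have split: "(\<Sum>p\<in>S. h p) = (\<Sum>p\<in>{p\<in>S. ?f p < \<theta>}. h p) + (\<Sum>p\<in>{p\<in>S. ?f p = \<theta>}. h p) + (\<Sum>p\<in>{p\<in>S. \<theta> < ?f p}. h p)"
    for h :: "point \<Rightarrow> real"
  proof -
    have "S = ({p\<in>S. ?f p < \<theta>} \<union> {p\<in>S. ?f p = \<theta>}) \<union> {p\<in>S. \<theta> < ?f p}" by auto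
    then have "(\<Sum>p\<in>S. h p) = (\<Sum>p\<in>({p\<in>S. ?f p < \<theta>} \<union> {p\<in>S. ?f p = \<theta>}) \<union> {p\<in>S. \<theta> < ?f p}. h p)" by simp
    also have "\<dots> = (\<Sum>p\<in>{p\<in>S. ?f p < \<theta>}. h p) + (\<Sum>p\<in>{p\<in>S. ?f p = \<theta>}. h p) + (\<Sum>p\<in>{p\<in>S. \<theta> < ?f p}. h p)"
      using S by (subst sum.union_disjoint, auto)+
    finally show ?thesis .
  qed
  have Gt: "Gt \<le> real m" using \<theta>V by (simp add: V_def Gt_def)
  have Eq0: "0 \<le> Eq" unfolding Eq_def using w by (intro sum_nonneg) auto
  have Ge: "real m \<le> Eq + Gt"
  proof (cases "\<theta> = 0")
    case True
    then have "Lt = 0" unfolding Lt_def by (intro sum.neutral) (auto simp: not_less[symmetric])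
    then show ?thesis using w(2) split[of w] by (simp add: Lt_def Eq_def Gt_def)
  next
    case False
    define v where "v = Max {v \<in> insert 0 (?f ` S). v < \<theta>}"
    have v: "v \<in> {v \<in> insert 0 (?f ` S). v < \<theta>}"
      unfolding v_def using S \<theta>0 False by (intro Max_in) auto
    have vmax: "?f p \<le> v" if "p \<in> S" "?f p < \<theta>" for p
      unfolding v_def using S that by (intro Max_ge) auto
    have "v \<notin> V" using \<theta>le[of v] v by auto
    then have "real m < (\<Sum>p\<in>{p\<in>S. v < ?f p}. w p)" using v by (auto simp: V_def)
    also have "{p\<in>S. v < ?f p} = {p\<in>S. ?f p = \<theta>} \<union> {p\<in>S. \<theta> < ?f p}"
      using v vmax by force
    also have "(\<Sum>p\<in>\<dots>. w p) = Eq + Gt"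
      unfolding Eq_def Gt_def using S by (intro sum.union_disjoint) auto
    finally show ?thesis by simp
  qed
  \<comment> \<open>The fraction of the weight at the level that is kept. If \<open>Eq = 0\<close>,
    the quotient is 0 by convention and \<open>Gt = m\<close>, so the identity below still
    holds.\<close>
  define \<alpha> where "\<alpha> = (Eq + Gt - real m) / Eq"
  have \<alpha>: "0 \<le> \<alpha>" "\<alpha> \<le> 1" "\<alpha> * Eq = Eq + Gt - real m"
    using Gt Ge Eq0 by (auto simp: \<alpha>_def divide_simps)
  define w' where "w' = (\<lambda>p. if ?f p < \<theta> then w p else if ?f p = \<theta> then \<alpha> * w p else 0)"
  have s1: "(\<Sum>p\<in>S. w' p * h p) = (\<Sum>p\<in>{p\<in>S. ?f p < \<theta>}. w p * h p) + \<alpha> * (\<Sum>p\<in>{p\<in>S. ?f p = \<theta>}. w p * h p)" for h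
    by (subst split) (simp add: w'_def sum_distrib_left mult.assoc)
  have "w' \<in> residual_weights m S w"
    unfolding residual_weights_def
  proof (intro CollectI conjI ballI)
    fix p assume "p \<in> S"
    then show "0 \<le> w' p" "w' p \<le> w p"
      using w(1) \<alpha> mult_right_mono[of \<alpha> 1 "w p"] by (auto simp: w'_def)
  next
    show "(\<Sum>p\<in>S. w' p) = (\<Sum>p\<in>S. w p) - real m"
      using s1[of "\<lambda>_. 1"] \<alpha>(3) split[of w] by (simp add: Lt_def Eq_def Gt_def)
  qed
  then have "weighted_robust_cost z m S w C \<le> (\<Sum>p\<in>S. w' p * ?f p)"
    unfolding weighted_robust_cost_def
    by (intro cINF_lower bdd_belowI2[of _ 0]) (auto simp: residual_weights_def intro!: sum_nonneg mult_nonneg_nonneg)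
  also have "\<dots> = (\<Sum>p\<in>{p\<in>S. ?f p < \<theta>}. w p * ?f p) + \<alpha> * (\<Sum>p\<in>{p\<in>S. ?f p = \<theta>}. w p * \<theta>)"
    unfolding s1 by simp
  also have "\<dots> = (\<Sum>p\<in>{p\<in>S. ?f p < \<theta>}. w p * ?f p) + (Eq + Gt - real m) * \<theta>"
  proof -
    have "(\<Sum>p\<in>{p\<in>S. ?f p = \<theta>}. w p * \<theta>) = Eq * \<theta>" by (simp add: Eq_def sum_distrib_right)
    then show ?thesis by (simp add: \<alpha>(3)[symmetric])
  qed
  also have "\<dots> = (\<Sum>p\<in>S. w p * min (?f p) \<theta>) - real m * \<theta>"
    by (subst split) (simp add: Eq_def Gt_def sum_distrib_left algebra_simps min_def)
  finally show ?thesis using \<theta>0 \<theta>B by blast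
qed

section \<open>Deviations in the strata and the robust cost\<close>

text \<open>The larger summand bounds half of the sum. The resulting \<open>2 powr z\<close> is
  affordable, since the sampling rate absorbs constants exponential in \<open>z\<close>.\<close>

lemma powr_add_le:
  fixes a b z :: real
  assumes "0 \<le> a" "0 \<le> b" "0 \<le> z"
  shows "(a + b) powr z \<le> 2 powr z * (a powr z + b powr z)"
proof -
  have "(a + b) powr z \<le> (2 * max a b) powr z"
    using assms by (intro powr_mono2) auto
  also have "\<dots> = 2 powr z * max a b powr z"
    using assms by (simp add: powr_mult)
  also have "max a b powr z \<le> a powr z + b powr z"
    by (simp add: max_def)
  finally show ?thesis by (simp add: mult_left_mono)
qed

lemma cdist_attained: "finite C \<Longrightarrow> C \<noteq> {} \<Longrightarrow> \<exists>c\<in>C. pdist p c = cdist p C"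
proof -
  assume "finite C" "C \<noteq> {}"
  then have "Min (pdist p ` C) \<in> pdist p ` C" by (intro Min_in) auto
  then obtain c where "c \<in> C" "Min (pdist p ` C) = pdist p c" by blast
  then show ?thesis by (auto simp: cdist_def)
qed

lemma cdist_le: "finite C \<Longrightarrow> c \<in> C \<Longrightarrow> cdist p C \<le> pdist p c"
  unfolding cdist_def by (rule Min_le) auto

lemma cdist_nonneg: "finite C \<Longrightarrow> C \<noteq> {} \<Longrightarrow> 0 \<le> cdist p C"
  using cdist_attained[of C p] pdist_nonneg by metis

lemma cdist_triangle:
  assumes "p \<in> Rd d" "q \<in> Rd d" "finite C" "C \<noteq> {}"
  shows "cdist p C \<le> pdist p q + cdist q C"
proof -
  obtain c where c: "c \<in> C" "pdist q c = cdist q C" using cdist_attained[OF assms(3,4)] by blast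
  have "cdist p C \<le> pdist p c" by (rule cdist_le[OF assms(3) c(1)])
  also have "\<dots> \<le> pdist p q + pdist q c" by (rule pdist_triangle[OF assms(1,2)])
  finally show ?thesis using c by simp
qed

text \<open>\<open>I\<close> and \<open>\<sigma>\<close> are witnesses of the assumption on the
  input. \<open>I\<close> minimises the sum of plain distances while the costs carry the power
  \<open>z\<close>; \<open>I_order\<close> reconciles the two.\<close>

locale inlier_instance =
  fixes d k m :: nat and z \<epsilon> :: real and P Cs I :: "point set" and \<sigma> :: "point \<Rightarrow> point"
  assumes k: "1 \<le> k" and z: "1 \<le> z" and eps: "0 < \<epsilon>" "\<epsilon> < 1"
    and P: "finite P" "P \<subseteq> Rd d" "P \<noteq> {}"
    and approx: "approx_center_set d k z m \<epsilon> P Cs"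
    and I: "is_arg_min (\<lambda>Q. \<Sum>p\<in>Q. cdist p Cs) (\<lambda>Q. Q \<subseteq> P \<and> card Q + m = card P) I"
    and \<sigma>: "\<forall>p\<in>I. \<sigma> p \<in> Cs \<and> pdist p (\<sigma> p) = cdist p Cs"
    and big: "4 * m \<le> (MIN c\<in>Cs. card {p\<in>I. \<sigma> p = c})"
    and spread: "(MAX p\<in>I. cdist p Cs powr z)
          \<le> 4 * real k * (\<Sum>p\<in>I. cdist p Cs powr z) / real (card I)"
begin

abbreviation cost0 :: "point \<Rightarrow> real" where
  "cost0 p \<equiv> cdist p Cs powr z"

definition opt :: real where
  "opt = (\<Sum>p\<in>I. cost0 p)"

lemma Cs: "Cs \<in> center_sets d k" "finite Cs" "card Cs = k" "Cs \<noteq> {}" "Cs \<subseteq> Rd d"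
  using approx k by (auto simp: approx_center_set_def center_sets_def)

lemma centers: "C \<in> center_sets d k \<Longrightarrow> finite C \<and> C \<noteq> {} \<and> C \<subseteq> Rd d"
  using k by (auto simp: center_sets_def)

lemma I_sub: "I \<subseteq> P" "card I + m = card P" "finite I"
  using I P finite_subset by (auto simp: is_arg_min_def)

lemma cluster_size: "c \<in> Cs \<Longrightarrow> 4 * m \<le> card {p\<in>I. \<sigma> p = c}"
  using big Cs by (subst (asm) Min_ge_iff) auto

lemma sum_clusters: "(\<Sum>c\<in>Cs. \<Sum>p\<in>{p\<in>I. \<sigma> p = c}. h p) = (\<Sum>p\<in>I. h p)"
  for h :: "point \<Rightarrow> 'b::comm_monoid_add"
  using \<sigma> Cs I_sub by (intro sum.group) auto

lemma card_I: "4 * m * k \<le> card I"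
proof -
  have "4 * m * k = (\<Sum>c\<in>Cs. 4 * m)" using Cs by simp
  also have "\<dots> \<le> (\<Sum>c\<in>Cs. card {p\<in>I. \<sigma> p = c})" using cluster_size by (intro sum_mono)
  also have "\<dots> = card I" using sum_clusters[of "\<lambda>_. 1::nat"] by simp
  finally show ?thesis .
qed

lemma card_I_pos: "0 < card I"
proof (rule ccontr)
  assume "\<not> 0 < card I"
  then have "card I = 0" by simp
  then have "m = 0" using card_I k by simp
  then have "card P = 0" using I_sub \<open>card I = 0\<close> by simp
  then show False using P by simp
qed

lemma card_P_le: "4 * real (card P) \<le> 5 * real (card I)"
proof -
  have "4 * m * 1 \<le> 4 * m * k" using k by (intro mult_le_mono2)
  then have "4 * m \<le> card I" using card_I by linarith
  then show ?thesis using I_sub by linarith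
qed

text \<open>Exchange argument: replacing \<open>p\<close> by \<open>q\<close> must not decrease the
  sum of distances that \<open>I\<close> minimises.\<close>

lemma I_order:
  assumes p: "p \<in> I" and q: "q \<in> P - I"
  shows "cost0 p \<le> cost0 q"
proof -
  let ?Q = "insert q (I - {p})"
  have fin: "finite (I - {p})" using I_sub by simp
  have "card ?Q = card I" using p q I_sub card_I_pos by (simp add: card_insert_if)
  then have "?Q \<subseteq> P \<and> card ?Q + m = card P" using p q I_sub by auto
  then have "\<not> (\<Sum>p\<in>?Q. cdist p Cs) < (\<Sum>p\<in>I. cdist p Cs)"
    using I unfolding is_arg_min_def by blast
  moreover have "(\<Sum>p\<in>?Q. cdist p Cs) = cdist q Cs + (\<Sum>p\<in>I - {p}. cdist p Cs)"
    using q fin by simp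
  moreover have "(\<Sum>p\<in>I. cdist p Cs) = cdist p Cs + (\<Sum>p\<in>I - {p}. cdist p Cs)"
    using p I_sub by (intro sum.remove) auto
  ultimately have "cdist p Cs \<le> cdist q Cs" by linarith
  then show ?thesis using z cdist_nonneg[OF Cs(2,4)] by (intro powr_mono2) auto
qed

lemma opt_nonneg: "0 \<le> opt"
  by (simp add: opt_def sum_nonneg)

text \<open>Weak duality at the largest inlier cost: the \<open>m\<close> points outside
  \<open>I\<close> cost at least that much, so after truncation they cancel the term
  \<open>m * \<theta>\<close>.\<close>

lemma opt_le_robust_cost0: "opt \<le> robust_cost z m P Cs"
proof -
  define \<theta> where "\<theta> = Max (cost0 ` I)"
  have Ine: "I \<noteq> {}" using card_I_pos by auto
  have \<theta>1: "cost0 p \<le> \<theta>" if "p \<in> I" for p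
    unfolding \<theta>_def using that I_sub by (intro Max_ge) auto
  have "Max (cost0 ` I) \<in> cost0 ` I" using I_sub Ine by (intro Max_in) auto
  then obtain p0 where p0: "p0 \<in> I" "\<theta> = cost0 p0"
    unfolding \<theta>_def by blast
  have "(\<Sum>p\<in>P. min (cost0 p) \<theta>) = (\<Sum>p\<in>P - I. min (cost0 p) \<theta>) + (\<Sum>p\<in>I. min (cost0 p) \<theta>)"
    by (rule sum.subset_diff[OF I_sub(1) P(1)])
  also have "(\<Sum>p\<in>P - I. min (cost0 p) \<theta>) = (\<Sum>p\<in>P - I. \<theta>)"
    using I_order p0 by (intro sum.cong) auto
  also have "(\<Sum>p\<in>I. min (cost0 p) \<theta>) = opt"
    unfolding opt_def using \<theta>1 by (intro sum.cong) auto
  also have "(\<Sum>p\<in>P - I. \<theta>) = real m * \<theta>"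
    using I_sub by (simp add: card_Diff_subset)
  finally show ?thesis
    using robust_cost_ge[OF P(1), of m \<theta> Cs z] I_sub p0 by simp
qed

lemma robust_cost_nonneg: "0 \<le> robust_cost z m P C"
proof -
  have "(\<Sum>p\<in>P. min (cdist p C powr z) 0) = 0" by (intro sum.neutral) auto
  then show ?thesis using robust_cost_ge[OF P(1), of m 0 C z] I_sub by simp
qed

lemma opt_le:
  assumes C: "C \<in> center_sets d k"
  shows "opt \<le> 2 * robust_cost z m P C"
proof -
  have "robust_opt d k z m P \<le> robust_cost z m P C"
    unfolding robust_opt_def using robust_cost_nonneg by (intro cINF_lower C bdd_belowI2[of _ 0])
  moreover have "robust_cost z m P Cs \<le> (1 + \<epsilon>) * robust_opt d k z m P"
    using approx by (simp add: approx_center_set_def)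
  ultimately have "robust_cost z m P Cs \<le> (1 + \<epsilon>) * robust_cost z m P C"
    using eps by (meson mult_left_mono order_trans add_nonneg_nonneg zero_le_one less_imp_le)
  also have "\<dots> \<le> 2 * robust_cost z m P C"
    using eps robust_cost_nonneg[of C] by (intro mult_right_mono) auto
  finally show ?thesis using opt_le_robust_cost0 by linarith
qed

lemma cost0_le: "p \<in> I \<Longrightarrow> cost0 p \<le> 4 * real k * opt / real (card I)"
proof -
  assume "p \<in> I"
  then have "cost0 p \<le> Max (cost0 ` I)" using I_sub by (intro Max_ge) auto
  then show ?thesis using spread by (simp add: opt_def)
qed

text \<open>A cluster of at least \<open>4 * m\<close> points keeps three quarters of them whatever
  \<open>m\<close> points are removed, and for a kept point the triangle inequality charges the cost
  of its center to its own costs for \<open>Cs\<close> and \<open>C\<close>. The factor 4 is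
  \<open>4 / 3\<close> times 3, as \<open>opt\<close> is at most twice the robust cost.\<close>

lemma cluster_cost:
  assumes C: "C \<in> center_sets d k"
  shows "(\<Sum>p\<in>I. cdist (\<sigma> p) C powr z) \<le> 4 * 2 powr z * robust_cost z m P C"
proof -
  note C' = centers[OF C]
  have "robust_cost z m P C \<in> (\<lambda>L. \<Sum>p\<in>P - L. cdist p C powr z) ` {L. L \<subseteq> P \<and> card L = m}"
    unfolding robust_cost_def using P I_sub obtain_subset_with_card_n[of m P] by (intro Min_in) auto
  then obtain L where L: "L \<subseteq> P" "card L = m" "robust_cost z m P C = (\<Sum>p\<in>P - L. cdist p C powr z)"
    by blast
  have finL: "finite L" using L P finite_subset by blast
  let ?D = "\<lambda>c. cdist c C powr z"
  have "(\<Sum>p\<in>{p\<in>I. \<sigma> p = c}. ?D (\<sigma> p)) \<le> 4 / 3 * (\<Sum>p\<in>{p\<in>I - L. \<sigma> p = c}. ?D (\<sigma> p))" if c: "c \<in> Cs" for c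
  proof -
    have "card {p\<in>I. \<sigma> p = c} - card L \<le> card ({p\<in>I. \<sigma> p = c} - L)"
      by (rule diff_card_le_card_Diff[OF finL])
    moreover have "{p\<in>I. \<sigma> p = c} - L = {p\<in>I - L. \<sigma> p = c}" by auto
    ultimately have "3 * real (card {p\<in>I. \<sigma> p = c}) \<le> 4 * real (card {p\<in>I - L. \<sigma> p = c})"
      using cluster_size[OF c] L by simp
    then have "real (card {p\<in>I. \<sigma> p = c}) * ?D c \<le> 4 / 3 * real (card {p\<in>I - L. \<sigma> p = c}) * ?D c"
      by (intro mult_right_mono) auto
    then show ?thesis by simp
  qed
  then have "(\<Sum>c\<in>Cs. \<Sum>p\<in>{p\<in>I. \<sigma> p = c}. ?D (\<sigma> p)) \<le> (\<Sum>c\<in>Cs. 4 / 3 * (\<Sum>p\<in>{p\<in>I - L. \<sigma> p = c}. ?D (\<sigma> p)))"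
    by (rule sum_mono)
  also have "\<dots> = 4 / 3 * (\<Sum>p\<in>I - L. ?D (\<sigma> p))"
    unfolding sum_distrib_left[symmetric] using \<sigma> Cs I_sub
    by (subst sum.group) auto
  also have "(\<Sum>p\<in>I - L. ?D (\<sigma> p)) \<le> (\<Sum>p\<in>I - L. 2 powr z * (cost0 p + cdist p C powr z))"
  proof (rule sum_mono)
    fix p assume p: "p \<in> I - L"
    have pR: "p \<in> Rd d" "\<sigma> p \<in> Rd d" using p I_sub P \<sigma> Cs by auto
    have "cdist (\<sigma> p) C \<le> cdist p Cs + cdist p C"
      using cdist_triangle[OF pR(2,1), of C] C' pdist_commute[OF pR] \<sigma> p by auto
    then have "?D (\<sigma> p) \<le> (cdist p Cs + cdist p C) powr z"
      using z C' by (intro powr_mono2) (auto simp: cdist_nonneg)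
    also have "\<dots> \<le> 2 powr z * (cost0 p + cdist p C powr z)"
      using z C' Cs by (intro powr_add_le) (auto simp: cdist_nonneg)
    finally show "?D (\<sigma> p) \<le> 2 powr z * (cost0 p + cdist p C powr z)" .
  qed
  also have "\<dots> = 2 powr z * ((\<Sum>p\<in>I - L. cost0 p) + (\<Sum>p\<in>I - L. cdist p C powr z))"
    by (simp only: sum_distrib_left[symmetric] sum.distrib)
  also have "\<dots> \<le> 2 powr z * (opt + robust_cost z m P C)"
    unfolding opt_def L(3) using I_sub P
    by (intro mult_left_mono add_mono sum_mono2) auto
  also have "\<dots> \<le> 2 powr z * (3 * robust_cost z m P C)"
    using opt_le[OF C] by (intro mult_left_mono) auto
  finally show ?thesis
    unfolding sum_clusters by (simp add: mult_ac)
qed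

text \<open>The cluster of \<open>c\<close> alone provides \<open>4 * m\<close> terms of
  \<open>cluster_cost\<close>.\<close>

lemma cluster_cost_max:
  assumes C: "C \<in> center_sets d k" and c: "c \<in> Cs"
  shows "real m * cdist c C powr z \<le> 2 powr z * robust_cost z m P C"
proof -
  have "4 * (real m * cdist c C powr z) = real (4 * m) * cdist c C powr z" by simp
  also have "\<dots> \<le> real (card {p\<in>I. \<sigma> p = c}) * cdist c C powr z"
    using cluster_size[OF c] by (intro mult_right_mono of_nat_mono) auto
  also have "\<dots> = (\<Sum>p\<in>{p\<in>I. \<sigma> p = c}. cdist (\<sigma> p) C powr z)" by simp
  also have "\<dots> \<le> (\<Sum>p\<in>I. cdist (\<sigma> p) C powr z)"
    using I_sub by (intro sum_mono2) auto
  also note cluster_cost[OF C]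
  finally show ?thesis by simp
qed

section \<open>Candidates for the threshold\<close>

definition good :: "point set" where
  "good = {p\<in>I. opt / (2 * real (card I)) \<le> cost0 p}"

text \<open>Inliers below half of the average account for at most half of \<open>opt\<close>. The
  rest is carried by good points, each at most \<open>4 * k\<close> times the average by the spread
  assumption; so there are at least \<open>card I / (8 * k)\<close> of them, and
  \<open>card P\<close> is at most \<open>5 / 4\<close> of \<open>card I\<close>.\<close>

lemma card_good: "real (card P) \<le> 10 * real k * real (card good)"
proof (cases "opt = 0")
  case True
  then have "good = I" by (auto simp: good_def)
  moreover have "real (card P) \<le> 10 * 1 * real (card I)" using card_P_le by linarith
  moreover have "10 * 1 * real (card I) \<le> 10 * real k * real (card I)"
    using k by (intro mult_right_mono mult_left_mono) auto
  ultimately show ?thesis by simp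
next
  case False
  then have pos: "0 < opt" using opt_nonneg by simp
  have n: "0 < real (card I)" using card_I_pos by simp
  have sub: "good \<subseteq> I" by (auto simp: good_def)
  have "opt = (\<Sum>p\<in>I - good. cost0 p) + (\<Sum>p\<in>good. cost0 p)"
    unfolding opt_def by (rule sum.subset_diff[OF sub I_sub(3)])
  also have "(\<Sum>p\<in>I - good. cost0 p) \<le> real (card (I - good)) * (opt / (2 * real (card I)))"
    by (intro sum_bounded_above) (auto simp: good_def)
  also have "\<dots> \<le> real (card I) * (opt / (2 * real (card I)))"
    using I_sub opt_nonneg by (intro mult_right_mono of_nat_mono card_mono) auto
  also have "\<dots> = opt / 2" using n by simp
  also have "(\<Sum>p\<in>good. cost0 p) \<le> real (card good) * (4 * real k * opt / real (card I))"
    using cost0_le sub by (intro sum_bounded_above) auto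
  finally have "opt / 2 \<le> real (card good) * (4 * real k * opt / real (card I))" by simp
  then have "real (card I) \<le> 8 * real k * real (card good)"
    using pos n by (simp add: field_simps)
  then show ?thesis using card_P_le by linarith
qed

text \<open>Multiplying half of the average by \<open>8 * k\<close> reaches the spread bound
  \<open>4 * k\<close> times the average, so every inlier lies below.\<close>

lemma good_candidate:
  assumes p: "p \<in> good"
  shows "card {q\<in>P. 8 * real k * cost0 p < cost0 q} \<le> m"
    and "8 * real k * cost0 p \<le> 32 * (real k)\<^sup>2 * opt / real (card I)"
proof -
  have n: "0 < real (card I)" using card_I_pos by simp
  have "cost0 q \<le> 8 * real k * cost0 p" if q: "q \<in> I" for q
  proof -
    have "cost0 q \<le> 8 * real k * (opt / (2 * real (card I)))" using cost0_le[OF q] by simp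
    also have "\<dots> \<le> 8 * real k * cost0 p" using p by (intro mult_left_mono) (auto simp: good_def)
    finally show ?thesis .
  qed
  then have "{q\<in>P. 8 * real k * cost0 p < cost0 q} \<subseteq> P - I" by force
  then have "card {q\<in>P. 8 * real k * cost0 p < cost0 q} \<le> card (P - I)"
    using P by (intro card_mono) auto
  then show "card {q\<in>P. 8 * real k * cost0 p < cost0 q} \<le> m"
    using I_sub by (simp add: card_Diff_subset)
  have "8 * real k * cost0 p \<le> 8 * real k * (4 * real k * opt / real (card I))"
    using p cost0_le by (intro mult_left_mono) (auto simp: good_def)
  then show "8 * real k * cost0 p \<le> 32 * (real k)\<^sup>2 * opt / real (card I)"
    by (simp add: power2_eq_square algebra_simps)
qed

text \<open>Otherwise \<open>p\<close> and the \<open>m\<close> points outside \<open>I\<close>,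
  which cost at least as much, would be \<open>m + 1\<close> points above
  \<open>\<tau>\<close>.\<close>

lemma I_near:
  assumes "card {p\<in>P. \<tau> < cost0 p} \<le> m" "p \<in> I"
  shows "cost0 p \<le> \<tau>"
proof (rule ccontr)
  assume "\<not> cost0 p \<le> \<tau>"
  then have "insert p (P - I) \<subseteq> {p\<in>P. \<tau> < cost0 p}"
    using I_order[OF assms(2)] assms(2) I_sub by (auto simp: not_le intro: less_le_trans)
  then have "card (insert p (P - I)) \<le> m"
    using assms(1) P card_mono[of "{p\<in>P. \<tau> < cost0 p}" "insert p (P - I)"] by auto
  then show False using assms(2) I_sub P by (simp add: card_Diff_subset)
qed

end

text \<open>
  \<open>sid\<close> assigns points to strata; stratum \<open>0\<close> consists of the far points, and a near stratum \<open>i\<close>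
  lies in the ball of radius \<open>vv i powr (1 / z)\<close> around the center \<open>gc i\<close>.
\<close>

locale stratified_instance = inlier_instance +
  fixes \<tau> :: real and sid :: "point \<Rightarrow> nat" and gc :: "nat \<Rightarrow> point" and vv :: "nat \<Rightarrow> real"
    and w :: "point \<Rightarrow> real" and S :: "point set"
  assumes \<tau>: "0 \<le> \<tau>" "card {p\<in>P. \<tau> < cost0 p} \<le> m" "\<tau> \<le> 8 * real k * opt / real (card I)"
    and far: "\<And>p. p \<in> P \<Longrightarrow> sid p = 0 \<longleftrightarrow> \<tau> < cost0 p"
    and gc: "\<And>p. p \<in> P \<Longrightarrow> sid p \<noteq> 0 \<Longrightarrow> gc (sid p) \<in> Cs \<and> pdist p (gc (sid p)) = cdist p Cs"
    and vv: "\<And>p. p \<in> P \<Longrightarrow> sid p \<noteq> 0 \<Longrightarrow>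
          cost0 p \<le> vv (sid p) \<and> vv (sid p) \<le> \<tau> \<and> vv (sid p) \<le> 2 * cost0 p + \<tau> / (16 * real k)"
    and S: "S \<subseteq> P" "\<And>p. p \<in> P - S \<Longrightarrow> w p = 0" "\<And>p. p \<in> P \<Longrightarrow> 0 \<le> w p"
    and wS: "\<And>i. (\<Sum>p\<in>{p\<in>P. sid p = i}. w p) = real (card {p\<in>P. sid p = i})"
begin

text \<open>A level that no near point exceeds with respect to \<open>C\<close>. Only far points, at
  most \<open>m\<close> in number and in weight, can lie above it, which caps the dual thresholds of
  both cost functions.\<close>

definition Tmax :: "point set \<Rightarrow> real" where
  "Tmax C = ((MAX c\<in>Cs. cdist c C) + \<tau> powr (1 / z)) powr z"

text \<open>For a near stratum this bounds the costs of its points. In the far stratum costs are not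
  bounded, and the largest truncation level takes that place.\<close>

definition Rad :: "point set \<Rightarrow> nat \<Rightarrow> real" where
  "Rad C i = (if i = 0 then Tmax C else (cdist (gc i) C + vv i powr (1 / z)) powr z)"

lemma Rad_bound:
  assumes C: "C \<in> center_sets d k" and p: "p \<in> P" "sid p \<noteq> 0"
  shows "cdist p C powr z \<le> Rad C (sid p)" "Rad C (sid p) \<le> Tmax C"
    "Rad C (sid p) \<le> 2 powr z * (cdist (gc (sid p)) C powr z + vv (sid p))"
proof -
  note C' = centers[OF C]
  let ?g = "gc (sid p)" and ?v = "vv (sid p)"
  have g: "?g \<in> Cs" "pdist p ?g = cdist p Cs" using gc[OF p] by auto
  have v: "cost0 p \<le> ?v" "?v \<le> \<tau>" using vv[OF p] by auto
  have v0: "0 \<le> ?v" using v(1) order_trans[OF powr_ge_zero] by blast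
  have vz: "(?v powr (1 / z)) powr z = ?v" using v0 z by (simp add: powr_powr)
  have "cdist p C \<le> pdist p ?g + cdist ?g C"
    using p P C' g Cs by (intro cdist_triangle) auto
  moreover have "cdist p Cs \<le> ?v powr (1 / z)"
  proof -
    have "cdist p Cs = cost0 p powr (1 / z)" using z cdist_nonneg[OF Cs(2,4)] by (simp add: powr_powr)
    also have "\<dots> \<le> ?v powr (1 / z)" using v z by (intro powr_mono2) auto
    finally show ?thesis .
  qed
  ultimately have "cdist p C \<le> cdist ?g C + ?v powr (1 / z)" using g by linarith
  then show "cdist p C powr z \<le> Rad C (sid p)"
    unfolding Rad_def using p z cdist_nonneg[of C p] C' by (simp add: powr_mono2)
  have "cdist ?g C \<le> (MAX c\<in>Cs. cdist c C)" using g Cs by (intro Max_ge) auto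
  then show "Rad C (sid p) \<le> Tmax C"
    unfolding Rad_def Tmax_def using p z v v0    cdist_nonneg[of C ?g] C' by (simp add: powr_mono2 add_mono)
  show "Rad C (sid p) \<le> 2 powr z * (cdist ?g C powr z + ?v)"
    using powr_add_le[of "cdist ?g C" "?v powr (1 / z)" z] p z C'
    by (simp add: Rad_def cdist_nonneg vz)
qed

lemma Tmax_nonneg: "0 \<le> Tmax C" by (simp add: Tmax_def)

lemma Rad_nonneg: "0 \<le> Rad C i" by (simp add: Rad_def Tmax_nonneg)

text \<open>The center of \<open>Cs\<close> farthest from \<open>C\<close> determines
  \<open>Tmax C\<close>, and its cluster is large enough to pay for \<open>m\<close> copies.\<close>

lemma Tmax_le:
  assumes C: "C \<in> center_sets d k"
  shows "real m * Tmax C \<le> 2 powr z * (2 powr z * robust_cost z m P C + real m * \<tau>)"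
proof -
  note C' = centers[OF C]
  have "Max ((\<lambda>c. cdist c C) ` Cs) \<in> (\<lambda>c. cdist c C) ` Cs" using Cs by (intro Max_in) auto
  then obtain c where c: "c \<in> Cs" "(MAX c\<in>Cs. cdist c C) = cdist c C" by auto
  have "Tmax C \<le> 2 powr z * (cdist c C powr z + (\<tau> powr (1 / z)) powr z)"
    unfolding Tmax_def c(2) using z C' by (intro powr_add_le) (auto simp: cdist_nonneg)
  also have "(\<tau> powr (1 / z)) powr z = \<tau>" using \<tau> z by (simp add: powr_powr)
  finally have "real m * Tmax C \<le> real m * (2 powr z * (cdist c C powr z + \<tau>))"
    by (intro mult_left_mono) auto
  also have "\<dots> = 2 powr z * (real m * cdist c C powr z + real m * \<tau>)"
    by (simp add: algebra_simps)
  also have "\<dots> \<le> 2 powr z * (2 powr z * robust_cost z m P C + real m * \<tau>)"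
    using cluster_cost_max[OF C c(1)] by (intro mult_left_mono) auto
  finally show ?thesis .
qed

lemma m_\<tau>_le: "real m * \<tau> \<le> 2 * opt"
proof -
  have n: "0 < real (card I)" using card_I_pos by simp
  have c: "4 * real m * real k \<le> real (card I)" using card_I by (metis of_nat_le_iff of_nat_mult of_nat_numeral)
  have "real m * \<tau> \<le> real m * (8 * real k * opt / real (card I))" using \<tau> by (intro mult_left_mono) auto
  also have "\<dots> = (4 * real m * real k) * (2 * opt / real (card I))" by simp
  also have "\<dots> \<le> real (card I) * (2 * opt / real (card I))"
    using c opt_nonneg by (intro mult_right_mono) auto
  also have "\<dots> = 2 * opt" using n by simp
  finally show ?thesis .
qed

lemma far_card: "card {p\<in>P. sid p = 0} \<le> m"
proof -
  have "{p\<in>P. sid p = 0} = {p\<in>P. \<tau> < cost0 p}" using far by auto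
  then show ?thesis using \<tau> by simp
qed

lemma I_near': "p \<in> I \<Longrightarrow> sid p \<noteq> 0"
  using I_near[OF \<tau>(2)] far I_sub by (metis not_le subsetD)

text \<open>This sum is the factor by which a relative deviation in every stratum is multiplied. Far
  points and near points outside \<open>I\<close> number at most \<open>m\<close> each and are paid
  by a single cluster; the inliers are paid by \<open>cluster_cost\<close>.\<close>

lemma sum_Rad_le:
  assumes C: "C \<in> center_sets d k"
  shows "(\<Sum>p\<in>P. Rad C (sid p)) \<le> 26 * 8 powr z * robust_cost z m P C"
proof -
  note C' = centers[OF C]
  let ?R = "robust_cost z m P C"
  let ?near = "{p\<in>P. sid p \<noteq> 0}"
  let ?D = "\<lambda>c. cdist c C powr z"
  have n: "0 < real (card I)" using card_I_pos by simp
  have R0: "0 \<le> ?R" by (rule robust_cost_nonneg)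
  have Inear: "I \<subseteq> ?near" using I_near' I_sub by auto
  have cardo: "real (card (?near - I)) \<le> real m"
  proof -
    have "card (?near - I) \<le> card (P - I)" using P by (intro card_mono) auto
    then show ?thesis using I_sub by (simp add: card_Diff_subset)
  qed
  have splitI: "(\<Sum>p\<in>?near. h p) = (\<Sum>p\<in>?near - I. h p) + (\<Sum>p\<in>I. h p)" for h :: "point \<Rightarrow> real"
    using P by (intro sum.subset_diff[OF Inear]) auto
  have "(\<Sum>p\<in>P. Rad C (sid p)) = (\<Sum>p\<in>P - ?near. Rad C (sid p)) + (\<Sum>p\<in>?near. Rad C (sid p))"
    using P by (intro sum.subset_diff) auto
  also have "(\<Sum>p\<in>P - ?near. Rad C (sid p)) = (\<Sum>p\<in>{p\<in>P. sid p = 0}. Tmax C)"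
    by (intro sum.cong) (auto simp: Rad_def)
  also have "\<dots> \<le> real m * Tmax C"
    using far_card Tmax_nonneg by (simp add: mult_right_mono)
  also have "real m * Tmax C \<le> 2 powr z * (2 powr z * ?R + real m * \<tau>)" by (rule Tmax_le[OF C])
  also have "real m * \<tau> \<le> 4 * ?R" using m_\<tau>_le opt_le[OF C] by linarith
  also have "(\<Sum>p\<in>?near. Rad C (sid p)) \<le> (\<Sum>p\<in>?near. 2 powr z * (?D (gc (sid p)) + vv (sid p)))"
    using Rad_bound(3)[OF C] by (intro sum_mono) auto
  also have "\<dots> = 2 powr z * ((\<Sum>p\<in>?near. ?D (gc (sid p))) + (\<Sum>p\<in>?near. vv (sid p)))"
    by (simp only: sum_distrib_left[symmetric] sum.distrib)
  \<comment> \<open>Twice the near costs, which total at most \<open>3 * opt\<close>, plus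
    \<open>opt\<close> for the innermost scale make \<open>7 * opt\<close>, and
    \<open>opt \<le> 2 * ?R\<close>.\<close>
  also have "(\<Sum>p\<in>?near. vv (sid p)) \<le> 14 * ?R"
  proof -
    have "(\<Sum>p\<in>?near. vv (sid p)) \<le> (\<Sum>p\<in>?near. 2 * cost0 p + \<tau> / (16 * real k))"
      using vv by (intro sum_mono) auto
    also have "\<dots> = 2 * (\<Sum>p\<in>?near. cost0 p) + real (card ?near) * (\<tau> / (16 * real k))"
      by (simp add: sum.distrib sum_distrib_left)
    finally have e1: "(\<Sum>p\<in>?near. vv (sid p)) \<le> 2 * (\<Sum>p\<in>?near. cost0 p) + real (card ?near) * (\<tau> / (16 * real k))" .
    have e2: "(\<Sum>p\<in>?near. cost0 p) \<le> real (card (?near - I)) * \<tau> + opt"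
    proof -
      have "cost0 p \<le> \<tau>" if "p \<in> ?near - I" for p using far[of p] that by auto
      then show ?thesis unfolding splitI opt_def by (intro add_right_mono sum_bounded_above)
    qed
    have e3: "real (card (?near - I)) * \<tau> \<le> real m * \<tau>" using cardo \<tau> by (intro mult_right_mono)
    \<comment> \<open>The scales stop at about \<open>\<tau> / (16 * k)\<close>; over at most
      \<open>2 * card I\<close> points this adds up to no more than \<open>opt\<close>.\<close>
    have e4: "real (card ?near) * (\<tau> / (16 * real k)) \<le> opt"
    proof -
      have "real (card ?near) \<le> real (card P)" using P by (intro of_nat_mono card_mono) auto
      then have "real (card ?near) \<le> 2 * real (card I)" using card_P_le by linarith
      then have "real (card ?near) * (\<tau> / (16 * real k)) \<le> 2 * real (card I) * ((8 * real k * opt / real (card I)) / (16 * real k))"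
        using \<tau> k by (intro mult_mono divide_right_mono) auto
      also have "\<dots> = opt" using k n by simp
      finally show ?thesis .
    qed
    show ?thesis using e1 e2 e3 e4 m_\<tau>_le opt_le[OF C] by linarith
  qed
  also have "(\<Sum>p\<in>?near. ?D (gc (sid p))) \<le> 2 powr z * ?R + 6 * 4 powr z * ?R"
  proof -
    have "Max (?D ` Cs) \<in> ?D ` Cs" using Cs by (intro Max_in) auto
    then obtain c where c: "c \<in> Cs" "Max (?D ` Cs) = ?D c" by blast
    have c2: "?D c' \<le> ?D c" if "c' \<in> Cs" for c'
      unfolding c(2)[symmetric] using Cs that by (intro Max_ge) auto
    note c = c(1) c2
    have "(\<Sum>p\<in>?near - I. ?D (gc (sid p))) \<le> real (card (?near - I)) * ?D c"
      using gc c(2) by (intro sum_bounded_above) auto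
    also have "\<dots> \<le> real m * ?D c" using cardo by (intro mult_right_mono) auto
    also have "\<dots> \<le> 2 powr z * ?R" by (rule cluster_cost_max[OF C c(1)])
    finally have 1: "(\<Sum>p\<in>?near - I. ?D (gc (sid p))) \<le> 2 powr z * ?R" .
    \<comment> \<open>Both \<open>gc (sid p)\<close> and \<open>\<sigma> p\<close> are nearest to
      \<open>p\<close> but may differ in case of ties, so they are compared through
      \<open>p\<close>.\<close>
    have "(\<Sum>p\<in>I. ?D (gc (sid p))) \<le> (\<Sum>p\<in>I. 2 powr z * (2 powr z * cost0 p + ?D (\<sigma> p)))"
    proof (rule sum_mono)
      fix p assume p: "p \<in> I"
      have g: "gc (sid p) \<in> Cs" "pdist p (gc (sid p)) = cdist p Cs" using gc[of p] I_near'[OF p] p I_sub by auto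
      have R: "p \<in> Rd d" "gc (sid p) \<in> Rd d" "\<sigma> p \<in> Rd d" using p I_sub P g Cs \<sigma> by auto
      have "cdist (gc (sid p)) C \<le> pdist (gc (sid p)) p + cdist p C"
        using C' by (intro cdist_triangle[OF R(2,1)]) auto
      also have "pdist (gc (sid p)) p = cdist p Cs" using g pdist_commute[OF R(1,2)] by simp
      also have "cdist p C \<le> pdist p (\<sigma> p) + cdist (\<sigma> p) C"
        using C' by (intro cdist_triangle[OF R(1,3)]) auto
      also have "pdist p (\<sigma> p) = cdist p Cs" using \<sigma> p by auto
      finally have "cdist (gc (sid p)) C \<le> 2 * cdist p Cs + cdist (\<sigma> p) C" by simp
      then have "?D (gc (sid p)) \<le> (2 * cdist p Cs + cdist (\<sigma> p) C) powr z"
        using z C' by (intro powr_mono2) (auto simp: cdist_nonneg)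
      also have "\<dots> \<le> 2 powr z * ((2 * cdist p Cs) powr z + ?D (\<sigma> p))"
        using z C' Cs by (intro powr_add_le) (auto simp: cdist_nonneg)
      also have "(2 * cdist p Cs) powr z = 2 powr z * cost0 p"
        using Cs by (simp add: powr_mult cdist_nonneg)
      finally show "?D (gc (sid p)) \<le> 2 powr z * (2 powr z * cost0 p + ?D (\<sigma> p))" .
    qed
    also have "\<dots> = 2 powr z * (2 powr z * opt + (\<Sum>p\<in>I. ?D (\<sigma> p)))"
      by (simp only: opt_def sum_distrib_left[symmetric] sum.distrib)
    also have "\<dots> \<le> 2 powr z * (2 powr z * (2 * ?R) + 4 * 2 powr z * ?R)"
      using opt_le[OF C] cluster_cost[OF C] by (intro mult_left_mono add_mono) auto
    also have "\<dots> = 6 * (2 powr z * 2 powr z) * ?R" by (simp add: algebra_simps)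
    also have "(2::real) powr z * 2 powr z = 4 powr z" using powr_mult[of 2 2 z] by simp
    finally show ?thesis using 1 splitI[of "\<lambda>p. ?D (gc (sid p))"] by linarith
  qed
  finally have 1: "(\<Sum>p\<in>P. Rad C (sid p)) \<le> 2 powr z * (2 powr z * ?R + 4 * ?R) + 2 powr z * (2 powr z * ?R + 6 * 4 powr z * ?R + 14 * ?R)"
    by (simp add: mult_left_mono add_mono)
  have p2: "(2::real) powr z \<le> 4 powr z" "1 \<le> (4::real) powr z" using z by (auto intro: powr_mono2 ge_one_powr_ge_zero)
  have "2 powr z * ?R + 4 * ?R + (2 powr z * ?R + 6 * 4 powr z * ?R + 14 * ?R) = (2 * 2 powr z + 6 * 4 powr z + 18) * ?R"
    by (simp add: algebra_simps)
  also have "\<dots> \<le> (26 * 4 powr z) * ?R" using p2 R0 by (intro mult_right_mono) auto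
  finally have "2 powr z * (2 powr z * ?R + 4 * ?R + (2 powr z * ?R + 6 * 4 powr z * ?R + 14 * ?R)) \<le> 2 powr z * (26 * 4 powr z * ?R)"
    by (intro mult_left_mono) auto
  also have "\<dots> = 26 * (2 powr z * 4 powr z) * ?R" by simp
  also have "(2::real) powr z * 4 powr z = 8 powr z" using powr_mult[of 2 4 z] by simp
  finally show ?thesis using 1 by (simp only: distrib_left)
qed

lemma sum_strata:
  "(\<Sum>i\<in>sid ` P. \<Sum>p\<in>{p\<in>P. sid p = i}. h p) = (\<Sum>p\<in>P. h p)" for h :: "point \<Rightarrow> real"
  using P by (intro sum.group) auto

text \<open>Applied stratum by stratum, \<open>truncated_sum_le\<close> costs the relative deviation
  times the size times the radius of the stratum.\<close>

lemma truncated_total_le: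
  assumes C: "C \<in> center_sets d k" and \<theta>: "0 \<le> \<theta>" "\<theta> \<le> Tmax C" and l: "1 \<le> l" and \<eta>: "0 \<le> \<eta>"
    and h: "\<And>p. p \<in> P \<Longrightarrow> 0 \<le> h p"
    and dev: "\<And>i t. i \<in> sid ` P \<Longrightarrow> 0 \<le> t \<Longrightarrow> (\<Sum>p\<in>{p\<in>P. sid p = i}. g p * of_bool (l * t < cdist p C powr z))
       \<le> (\<Sum>p\<in>{p\<in>P. sid p = i}. h p * of_bool (t < cdist p C powr z)) + \<eta> * real (card {p\<in>P. sid p = i})"
  shows "(\<Sum>p\<in>P. g p * min (cdist p C powr z / l) \<theta>)
       \<le> (\<Sum>p\<in>P. h p * min (cdist p C powr z) \<theta>) + \<eta> * (\<Sum>p\<in>P. Rad C (sid p))"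
proof -
  let ?f = "\<lambda>p. cdist p C powr z"
  have "(\<Sum>p\<in>P. g p * min (?f p / l) \<theta>) = (\<Sum>i\<in>sid ` P. \<Sum>p\<in>{p\<in>P. sid p = i}. g p * min (?f p / l) \<theta>)"
    by (simp only: sum_strata)
  also have "\<dots> \<le> (\<Sum>i\<in>sid ` P. (\<Sum>p\<in>{p\<in>P. sid p = i}. h p * min (?f p) \<theta>) + \<eta> * real (card {p\<in>P. sid p = i}) * Rad C i)"
  proof (rule sum_mono)
    fix i assume i: "i \<in> sid ` P"
    show "(\<Sum>p\<in>{p\<in>P. sid p = i}. g p * min (?f p / l) \<theta>)
        \<le> (\<Sum>p\<in>{p\<in>P. sid p = i}. h p * min (?f p) \<theta>) + \<eta> * real (card {p\<in>P. sid p = i}) * Rad C i"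
    proof (rule truncated_sum_le)
      \<comment> \<open>Near strata satisfy the first alternative; the far stratum satisfies the
        second because \<open>\<theta> \<le> Tmax C\<close>.\<close>
      show "(\<forall>p\<in>{p\<in>P. sid p = i}. ?f p \<le> Rad C i) \<or> \<theta> \<le> Rad C i"
        using Rad_bound(1)[OF C] \<theta> by (cases "i = 0") (auto simp: Rad_def)
    qed (use P h l \<theta> \<eta> Rad_nonneg dev[OF i] in auto)
  qed
  also have "\<dots> = (\<Sum>p\<in>P. h p * min (?f p) \<theta>) + \<eta> * (\<Sum>i\<in>sid ` P. \<Sum>p\<in>{p\<in>P. sid p = i}. Rad C (sid p))"
    by (simp add: sum.distrib sum_strata sum_distrib_left mult.assoc)
  finally show ?thesis by (simp only: sum_strata)
qed

text \<open>With \<open>104 = 4 * 26\<close> and the bound of \<open>sum_Rad_le\<close>, the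
  additive error is at most \<open>\<epsilon> / 4\<close> of the robust cost. The slack
  \<open>1 + \<epsilon> / (4 * z)\<close> in the radius becomes at most
  \<open>exp (\<epsilon> / 4)\<close> in the cost.\<close>

lemma coreset_if_deviations_small:
  assumes dev: "\<And>C i t. C \<in> center_sets d k \<Longrightarrow> i \<in> sid ` P \<Longrightarrow> 0 \<le> t \<Longrightarrow>
       (\<Sum>p\<in>{p\<in>P. sid p = i}. w p * of_bool ((1 + \<epsilon> / (4 * z)) * t < cdist p C))
         \<le> (\<Sum>p\<in>{p\<in>P. sid p = i}. of_bool (t < cdist p C)) + \<epsilon> / (104 * 8 powr z) * real (card {p\<in>P. sid p = i}) \<and>
       (\<Sum>p\<in>{p\<in>P. sid p = i}. of_bool ((1 + \<epsilon> / (4 * z)) * t < cdist p C))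
         \<le> (\<Sum>p\<in>{p\<in>P. sid p = i}. w p * of_bool (t < cdist p C)) + \<epsilon> / (104 * 8 powr z) * real (card {p\<in>P. sid p = i})"
  shows "robust_coreset d k z m \<epsilon> P S w"
proof -
  define e where "e = 1 + \<epsilon> / (4 * z)"
  define \<eta> where "\<eta> = \<epsilon> / (104 * 8 powr z)"
  define l where "l = e powr z"
  have e: "1 \<le> e" using eps z by (simp add: e_def)
  have \<eta>: "0 \<le> \<eta>" using eps by (simp add: \<eta>_def)
  have l1: "1 \<le> l" unfolding l_def using e z by (simp add: ge_one_powr_ge_zero)
  have l2: "l \<le> exp (\<epsilon> / 4)"
  proof -
    have "ln e \<le> \<epsilon> / (4 * z)" using e eps z ln_add_one_self_le_self[of "\<epsilon> / (4 * z)"] by (simp add: e_def)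
    then have "z * ln e \<le> \<epsilon> / 4" using z mult_left_mono[of "ln e" "\<epsilon> / (4 * z)" z] by simp
    then show ?thesis using e by (simp add: l_def powr_def)
  qed
  have sumS: "(\<Sum>p\<in>S. w p * h p) = (\<Sum>p\<in>P. w p * h p)" for h
    using P S by (intro sum.mono_neutral_left) auto
  have finS: "finite S" using S P finite_subset by blast
  have W: "(\<Sum>p\<in>S. w p) = real (card P)"
    using sumS[of "\<lambda>_. 1"] sum_strata[of w] sum_strata[of "\<lambda>_. 1"] wS by simp
  have mW: "real m \<le> (\<Sum>p\<in>S. w p)" using W I_sub by simp
  have rel: "weighted_robust_cost z m S w C
          \<in> {(1 - \<epsilon>) * robust_cost z m P C .. (1 + \<epsilon>) * robust_cost z m P C}" if C: "C \<in> center_sets d k" for C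
  proof -
    note C' = centers[OF C]
    let ?f = "\<lambda>p. cdist p C powr z"
    let ?R = "robust_cost z m P C" and ?W = "weighted_robust_cost z m S w C"
    have R0: "0 \<le> ?R" by (rule robust_cost_nonneg)
    have lt: "l * t < ?f p \<longleftrightarrow> e * t powr (1 / z) < cdist p C" "t < ?f p \<longleftrightarrow> t powr (1 / z) < cdist p C"
      if t: "0 \<le> t" for t p
    proof -
      have c0: "0 \<le> cdist p C" using C' by (simp add: cdist_nonneg)
      have iff: "x powr z < ?f p \<longleftrightarrow> x < cdist p C" if "0 \<le> x" for x
        using that c0 z by (metis less_le_not_le linorder_not_le powr_less_mono2 powr_mono2 less_le_trans zero_less_one zero_le_one order_trans)
      have tz: "(t powr (1 / z)) powr z = t" using t z by (simp add: powr_powr)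
      have "(e * t powr (1 / z)) powr z = l * t" using e t by (simp add: powr_mult l_def tz)
      then show "l * t < ?f p \<longleftrightarrow> e * t powr (1 / z) < cdist p C" using iff[of "e * t powr (1 / z)"] e by simp
      show "t < ?f p \<longleftrightarrow> t powr (1 / z) < cdist p C" using iff[of "t powr (1 / z)"] tz by simp
    qed
    have err: "\<eta> * (\<Sum>p\<in>P. Rad C (sid p)) \<le> \<epsilon> / 4 * ?R"
    proof -
      have "\<eta> * (\<Sum>p\<in>P. Rad C (sid p)) \<le> \<eta> * (26 * 8 powr z * ?R)"
        using \<eta> sum_Rad_le[OF C] by (intro mult_left_mono)
      also have "\<dots> = \<epsilon> / 4 * ?R" by (simp add: \<eta>_def)
      finally show ?thesis .
    qed
    \<comment> \<open>The exact weight of the far stratum keeps the weight above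
      \<open>Tmax C\<close> at most \<open>m\<close>, as \<open>weighted_robust_cost_le\<close>
      demands.\<close>
    have farw: "(\<Sum>p\<in>{p\<in>P. sid p = 0}. w p) \<le> real m" using wS[of 0] far_card by simp
    have sub: "{p\<in>P. Tmax C < ?f p} \<subseteq> {p\<in>P. sid p = 0}"
    proof (intro subsetI CollectI conjI)
      fix p assume p: "p \<in> {p\<in>P. Tmax C < ?f p}"
      show "sid p = 0"
      proof (rule ccontr)
        assume "sid p \<noteq> 0"
        then show False using Rad_bound(1,2)[OF C, of p] p by force
      qed
    qed auto
    have mP: "m \<le> card P" using I_sub by simp
    have "card {p\<in>P. Tmax C < ?f p} \<le> m"
      using card_mono[OF _ sub] P far_card by simp
    from robust_cost_eq[OF P(1) mP Tmax_nonneg this] obtain \<theta>P where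
      \<theta>P: "0 \<le> \<theta>P" "\<theta>P \<le> Tmax C" "?R = (\<Sum>p\<in>P. min (?f p) \<theta>P) - real m * \<theta>P" by blast
    have "(\<Sum>p\<in>{p\<in>S. Tmax C < ?f p}. w p) \<le> (\<Sum>p\<in>{p\<in>P. sid p = 0}. w p)"
      using P S sub by (intro sum_mono2) auto
    then have "(\<Sum>p\<in>{p\<in>S. Tmax C < ?f p}. w p) \<le> real m" using farw by linarith
    from weighted_robust_cost_le[OF finS _ mW Tmax_nonneg this] S obtain \<theta>S where
      \<theta>S: "0 \<le> \<theta>S" "\<theta>S \<le> Tmax C" "?W \<le> (\<Sum>p\<in>S. w p * min (?f p) \<theta>S) - real m * \<theta>S" by blast
    have div: "\<theta> / l \<le> Tmax C" "0 \<le> \<theta> / l" if "0 \<le> \<theta>" "\<theta> \<le> Tmax C" for \<theta>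
    proof -
      have "\<theta> / l \<le> \<theta>" using that l1 by (simp add: divide_le_eq mult_le_cancel_left1)
      then show "\<theta> / l \<le> Tmax C" using that by simp
      show "0 \<le> \<theta> / l" using that l1 by simp
    qed
    have mindiv: "min (x / l) (\<theta> / l) = min x \<theta> / l" for x \<theta>
      using l1 by (simp add: min_def divide_le_cancel)
    \<comment> \<open>The multiplier found for the weighted set, divided by \<open>l\<close>, is
      used as a mere test value for \<open>P\<close>, where weak duality suffices. The lower bound
      exchanges the roles.\<close>
    have up: "?W / l \<le> ?R + \<epsilon> / 4 * ?R"
    proof -
      have "(\<Sum>p\<in>P. w p * min (?f p / l) (\<theta>S / l)) \<le> (\<Sum>p\<in>P. 1 * min (?f p) (\<theta>S / l)) + \<eta> * (\<Sum>p\<in>P. Rad C (sid p))"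
      proof (rule truncated_total_le[OF C div(2,1)[OF \<theta>S(1,2)] l1 \<eta>])
        fix i t assume i: "i \<in> sid ` P" and t: "0 \<le> (t::real)"
        show "(\<Sum>p\<in>{p\<in>P. sid p = i}. w p * of_bool (l * t < ?f p))
          \<le> (\<Sum>p\<in>{p\<in>P. sid p = i}. 1 * of_bool (t < ?f p)) + \<eta> * real (card {p\<in>P. sid p = i})"
          using dev[OF C i, of "t powr (1 / z)"] by (simp add: lt[OF t] e_def \<eta>_def)
      qed auto
      moreover have "(\<Sum>p\<in>P. w p * min (?f p / l) (\<theta>S / l)) = (\<Sum>p\<in>S. w p * min (?f p) \<theta>S) / l"
        unfolding sumS mindiv by (simp add: sum_divide_distrib)
      moreover have "(\<Sum>p\<in>P. min (?f p) (\<theta>S / l)) - real m * (\<theta>S / l) \<le> ?R"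
        by (rule robust_cost_ge[OF P(1) mP div(2)[OF \<theta>S(1,2)]])
      moreover have "?W / l \<le> (\<Sum>p\<in>S. w p * min (?f p) \<theta>S) / l - real m * (\<theta>S / l)"
        using divide_right_mono[OF \<theta>S(3), of l] l1 by (simp add: diff_divide_distrib)
      ultimately show ?thesis using err by simp
    qed
    have lo: "?R / l \<le> ?W + \<epsilon> / 4 * ?R"
    proof -
      have "(\<Sum>p\<in>P. 1 * min (?f p / l) (\<theta>P / l)) \<le> (\<Sum>p\<in>P. w p * min (?f p) (\<theta>P / l)) + \<eta> * (\<Sum>p\<in>P. Rad C (sid p))"
      proof (rule truncated_total_le[OF C div(2,1)[OF \<theta>P(1,2)] l1 \<eta>])
        fix i t assume i: "i \<in> sid ` P" and t: "0 \<le> (t::real)"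
        show "(\<Sum>p\<in>{p\<in>P. sid p = i}. 1 * of_bool (l * t < ?f p))
          \<le> (\<Sum>p\<in>{p\<in>P. sid p = i}. w p * of_bool (t < ?f p)) + \<eta> * real (card {p\<in>P. sid p = i})"
          using dev[OF C i, of "t powr (1 / z)"] by (simp add: lt[OF t] e_def \<eta>_def)
      qed (use S in auto)
      moreover have "(\<Sum>p\<in>P. 1 * min (?f p / l) (\<theta>P / l)) = (\<Sum>p\<in>P. min (?f p) \<theta>P) / l"
        unfolding mindiv by (simp add: sum_divide_distrib)
      moreover have "(\<Sum>p\<in>S. w p * min (?f p) (\<theta>P / l)) - real m * (\<theta>P / l) \<le> ?W"
        using S by (intro weighted_robust_cost_ge[OF finS _ mW div(2)[OF \<theta>P(1,2)]]) auto
      moreover have "?R / l = (\<Sum>p\<in>P. min (?f p) \<theta>P) / l - real m * (\<theta>P / l)"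
        unfolding \<theta>P(3) by (simp add: diff_divide_distrib)
      ultimately show ?thesis using err by (simp add: sumS)
    qed
    have "?W \<le> l * ((1 + \<epsilon> / 4) * ?R)" using up l1 by (simp add: field_simps)
    also have "\<dots> \<le> (1 + 5 / 16 * \<epsilon>) * ((1 + \<epsilon> / 4) * ?R)"
    proof (intro mult_right_mono)
      have "l \<le> 1 + \<epsilon> / 4 + (\<epsilon> / 4)\<^sup>2" using l2 exp_bound[of "\<epsilon> / 4"] eps by linarith
      also have "(\<epsilon> / 4)\<^sup>2 \<le> 1 / 16 * \<epsilon>" using eps by (simp add: power2_eq_square mult_left_le)
      finally show "l \<le> 1 + 5 / 16 * \<epsilon>" by simp
    qed (use R0 eps in auto)
    also have "\<dots> = (1 + (9 / 16) * \<epsilon> + (5 / 64) * (\<epsilon> * \<epsilon>)) * ?R" by (simp add: algebra_simps)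
    also have "\<dots> \<le> (1 + \<epsilon>) * ?R"
    proof (intro mult_right_mono R0)
      have "\<epsilon> * \<epsilon> \<le> \<epsilon> * 1" using eps by (intro mult_left_mono) auto
      then show "1 + (9 / 16) * \<epsilon> + (5 / 64) * (\<epsilon> * \<epsilon>) \<le> 1 + \<epsilon>" using eps by linarith
    qed
    finally have U: "?W \<le> (1 + \<epsilon>) * ?R" .
    have "1 - \<epsilon> / 4 \<le> exp (- (\<epsilon> / 4))" using exp_ge_add_one_self[of "- (\<epsilon> / 4)"] by simp
    also have "\<dots> \<le> 1 / l" using l2 l1 by (simp add: exp_minus field_simps)
    finally have "(1 - \<epsilon> / 4) * ?R \<le> 1 / l * ?R" using R0 by (rule mult_right_mono)
    then have "(1 - \<epsilon> / 4) * ?R - \<epsilon> / 4 * ?R \<le> ?W" using lo by simp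
    moreover have "(1 - \<epsilon>) * ?R \<le> (1 - \<epsilon> / 4) * ?R - \<epsilon> / 4 * ?R"
      using R0 eps mult_nonneg_nonneg[of \<epsilon> ?R] by (simp add: algebra_simps)
    ultimately show ?thesis using U by simp
  qed
  show ?thesis
    unfolding robust_coreset_def using S W rel by blast
qed

end

section \<open>Events determined by finitely many cells\<close>

text \<open>For \<open>0 \<le> x\<close> and \<open>1 \<le> b\<close> this is the floor of
  \<open>x * b\<close>, capped at \<open>b - 1\<close>. It is phrased by comparisons, which is how
  programs without rounding can find it.\<close>

definition cell :: "nat \<Rightarrow> real \<Rightarrow> nat" where
  "cell b x = Max {i. i < b \<and> real i \<le> x * real b}"

lemma cell_props:
  assumes b: "1 \<le> b" and x: "0 \<le> x"
  shows "cell b x < b" "real (cell b x) \<le> x * real b"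
    "\<And>i. i < b \<Longrightarrow> real i \<le> x * real b \<longleftrightarrow> i \<le> cell b x"
proof -
  let ?S = "{i. i < b \<and> real i \<le> x * real b}"
  have fin: "finite ?S" by simp
  have "0 \<in> ?S" using b x by simp
  then have "?S \<noteq> {}" by blast
  from Max_in[OF fin this] show 1: "cell b x < b" "real (cell b x) \<le> x * real b"
    unfolding cell_def by auto
  fix i assume i: "i < b"
  show "real i \<le> x * real b \<longleftrightarrow> i \<le> cell b x"
  proof
    assume "real i \<le> x * real b"
    then show "i \<le> cell b x" unfolding cell_def using fin i by (intro Max_ge) auto
  next
    assume "i \<le> cell b x"
    then have "real i \<le> real (cell b x)" by simp
    with 1(2) show "real i \<le> x * real b" by linarith
  qed
qed

lemma cell_eqI:
  assumes b: "1 \<le> b" and i: "i < b" and x: "real i / real b \<le> x" "x < (real i + 1) / real b"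
  shows "cell b x = i"
proof -
  have x0: "0 \<le> x" using x(1) by (meson divide_nonneg_nonneg of_nat_0_le_iff order_trans)
  note c = cell_props[OF b x0]
  have "real i \<le> x * real b" using x(1) b by (simp add: field_simps)
  then have "i \<le> cell b x" using c(3) i by blast
  moreover have "x * real b < real i + 1" using x(2) b by (simp add: field_simps)
  then have "real (cell b x) < real i + 1" using c(2) by linarith
  then have "cell b x \<le> i" by linarith
  ultimately show ?thesis by simp
qed

lemma space_coins: "space coins = UNIV"
  by (simp add: coins_def space_PiM)

text \<open>Half-open cells make the boxes of different choices disjoint; a coin equal to 1 lies in
  no cell.\<close>

definition box :: "nat set \<Rightarrow> (nat \<Rightarrow> nat) \<Rightarrow> (nat \<Rightarrow> nat) \<Rightarrow> (nat \<Rightarrow> real) set" where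
  "box J \<beta> x = {\<omega>. \<forall>j\<in>J. real (x j) / real (\<beta> j) \<le> \<omega> j \<and> \<omega> j < (real (x j) + 1) / real (\<beta> j)}"

lemma measurable_box:
  assumes "finite J"
  shows "box J \<beta> x \<in> sets coins"
proof -
  have "{\<omega> \<in> space coins. \<forall>j\<in>J. \<omega> j \<in> {real (x j) / real (\<beta> j)..<(real (x j) + 1) / real (\<beta> j)}} \<in> sets coins"
    unfolding coins_def using assms by (intro sets.sets_Collect_finite_All sets_Collect_single') auto
  then show ?thesis by (simp add: box_def space_coins)
qed

lemma measure_box:
  assumes J: "finite J" and x: "x \<in> choices J \<beta>"
  shows "measure coins (box J \<beta> x) = 1 / real (card (choices J \<beta>))"
proof -
  interpret coins: product_prob_space "\<lambda>_::nat. uniform_measure lborel {0..1::real}" UNIV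
    by (intro product_prob_spaceI prob_space_uniform_measure) auto
  let ?X = "\<lambda>j. {real (x j) / real (\<beta> j)..<(real (x j) + 1) / real (\<beta> j)}"
  have eq: "box J \<beta> x = prod_emb UNIV (\<lambda>_. uniform_measure lborel {0..1::real}) J (PiE J ?X)"
    by (auto simp: box_def prod_emb_def space_PiM PiE_iff extensional_def)
  have m: "measure (uniform_measure lborel {0..1::real}) (?X j) = 1 / real (\<beta> j)" if j: "j \<in> J" for j
  proof -
    have xj: "x j < \<beta> j" using x j by auto
    then have b: "0 < real (\<beta> j)" "(real (x j) + 1) / real (\<beta> j) \<le> 1" "0 \<le> real (x j) / real (\<beta> j)" by auto
    have "{0..1} \<inter> ?X j = ?X j"
    proof (intro Int_absorb1 subsetI)
      fix y assume "y \<in> ?X j"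
      then have "real (x j) / real (\<beta> j) \<le> y" "y < (real (x j) + 1) / real (\<beta> j)" by simp_all
      with b(2,3) show "y \<in> {0..1}" unfolding atLeastAtMost_iff by linarith
    qed
    then show ?thesis using b by (simp add: diff_divide_distrib[symmetric] divide_le_cancel)
  qed
  have "measure coins (box J \<beta> x) = (\<Prod>j\<in>J. measure (uniform_measure lborel {0..1::real}) (?X j))"
    unfolding eq coins_def using J by (intro coins.measure_PiM_emb) auto
  also have "\<dots> = (\<Prod>j\<in>J. 1 / real (\<beta> j))" by (intro prod.cong m refl)
  also have "\<dots> = 1 / real (card (choices J \<beta>))"
    using J by (simp add: card_PiE prod_dividef)
  finally show ?thesis .
qed

text \<open>
  Up to a null set \<open>boxes J \<beta> X\<close> is the event that the cells of the coins in \<open>J\<close> form an element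
  of \<open>X\<close>.
\<close>

definition boxes :: "nat set \<Rightarrow> (nat \<Rightarrow> nat) \<Rightarrow> (nat \<Rightarrow> nat) set \<Rightarrow> (nat \<Rightarrow> real) set" where
  "boxes J \<beta> X = (\<Union>x\<in>X. box J \<beta> x)"

lemma box_cell:
  assumes "x \<in> choices J \<beta>" "\<omega> \<in> box J \<beta> x"
  shows "(\<lambda>j\<in>J. cell (\<beta> j) (\<omega> j)) = x"
proof
  fix j
  show "(\<lambda>j\<in>J. cell (\<beta> j) (\<omega> j)) j = x j"
  proof (cases "j \<in> J")
    case True
    then have "x j < \<beta> j" using assms(1) by auto
    then have "cell (\<beta> j) (\<omega> j) = x j"
      using assms(2) True by (intro cell_eqI) (auto simp: box_def)
    then show ?thesis using True by simp
  next
    case False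
    then show ?thesis using assms(1) by (auto simp: PiE_def extensional_def)
  qed
qed

lemma boxes_cell:
  assumes "X \<subseteq> choices J \<beta>" "\<omega> \<in> boxes J \<beta> X"
  shows "(\<lambda>j\<in>J. cell (\<beta> j) (\<omega> j)) \<in> X"
  using assms box_cell[of _ J \<beta> \<omega>] unfolding boxes_def by (metis UN_E subsetD)

lemma finite_choices: "finite J \<Longrightarrow> finite (choices J \<beta>)"
  by (simp add: finite_PiE)

lemma measurable_boxes:
  assumes "finite J" "X \<subseteq> choices J \<beta>"
  shows "boxes J \<beta> X \<in> sets coins"
  unfolding boxes_def using assms finite_subset[OF _ finite_choices]
  by (intro sets.finite_UN measurable_box) auto

lemma measure_boxes:
  assumes J: "finite J" and X: "X \<subseteq> choices J \<beta>"
  shows "measure coins (boxes J \<beta> X) = real (card X) / real (card (choices J \<beta>))"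
proof -
  interpret c: prob_space coins by (rule prob_space_coins)
  have fin: "finite X" using X finite_choices[OF J] finite_subset by blast
  have "measure coins (boxes J \<beta> X) = (\<Sum>x\<in>X. measure coins (box J \<beta> x))"
    unfolding boxes_def
  proof (intro c.finite_measure_finite_Union fin)
    show "disjoint_family_on (box J \<beta>) X"
    proof (unfold disjoint_family_on_def, intro ballI impI)
      fix x y assume xy: "x \<in> X" "y \<in> X" "x \<noteq> y"
      then have "x \<in> choices J \<beta>" "y \<in> choices J \<beta>" using X by auto
      then show "box J \<beta> x \<inter> box J \<beta> y = {}"
        using xy(3) box_cell[of x J \<beta>] box_cell[of y J \<beta>] by fastforce
    qed
  qed (use J measurable_box in auto)
  also have "\<dots> = (\<Sum>x\<in>X. 1 / real (card (choices J \<beta>)))"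
    using X by (intro sum.cong refl measure_box[OF J]) auto
  finally show ?thesis by simp
qed

text \<open>A box on \<open>J\<close> and a box on \<open>K\<close> intersect in a box on
  \<open>J \<union> K\<close> for the merged choice, so independence reduces to counting
  choices.\<close>

lemma boxes_Int_prob:
  assumes J: "finite J" "finite K" "J \<inter> K = {}" and X: "X \<subseteq> choices J \<beta>" and Y: "Y \<subseteq> choices K \<gamma>"
  shows "measure coins (boxes J \<beta> X \<inter> boxes K \<gamma> Y) = measure coins (boxes J \<beta> X) * measure coins (boxes K \<gamma> Y)"
proof -
  define \<delta> where "\<delta> = (\<lambda>j. if j \<in> J then \<beta> j else \<gamma> j)"
  define mg where "mg = (\<lambda>(x, y). \<lambda>j\<in>J \<union> K. if j \<in> J then x j else (y j :: nat))"
  have mg: "mg (x, y) \<in> choices (J \<union> K) \<delta>" "box (J \<union> K) \<delta> (mg (x, y)) = box J \<beta> x \<inter> box K \<gamma> y"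
    "restrict (mg (x, y)) J = x" "restrict (mg (x, y)) K = y"
    if "x \<in> choices J \<beta>" "y \<in> choices K \<gamma>" for x y
  proof -
    have d: "j \<notin> J" if "j \<in> K" for j using J(3) that by auto
    show "mg (x, y) \<in> choices (J \<union> K) \<delta>"
      using that by (auto simp: mg_def \<delta>_def PiE_iff extensional_def)
    show "box (J \<union> K) \<delta> (mg (x, y)) = box J \<beta> x \<inter> box K \<gamma> y"
      using d by (auto simp: box_def mg_def \<delta>_def)
    show "restrict (mg (x, y)) J = x" "restrict (mg (x, y)) K = y"
      using that d by (auto simp: mg_def PiE_iff extensional_def restrict_def fun_eq_iff)
  qed
  have "boxes J \<beta> X \<inter> boxes K \<gamma> Y = boxes (J \<union> K) \<delta> (mg ` (X \<times> Y))"
    using mg(2) X Y unfolding boxes_def by (auto 0 3 simp: subset_iff)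
  moreover have "card (mg ` (X \<times> Y)) = card X * card Y"
  proof -
    have "inj_on mg (X \<times> Y)"
    proof (rule inj_onI)
      fix a b assume "a \<in> X \<times> Y" "b \<in> X \<times> Y" "mg a = mg b"
      moreover from this(1,2) obtain x y x' y' where "a = (x, y)" "b = (x', y')"
        "x \<in> choices J \<beta>" "y \<in> choices K \<gamma>" "x' \<in> choices J \<beta>" "y' \<in> choices K \<gamma>"
        using X Y by blast
      ultimately show "a = b" using mg(3,4)[of x y] mg(3,4)[of x' y'] by simp
    qed
    then show ?thesis by (simp add: card_image card_cartesian_product)
  qed
  moreover have "card (choices (J \<union> K) \<delta>) = card (choices J \<beta>) * card (choices K \<gamma>)"
  proof -
    have "(\<Prod>j\<in>K. \<delta> j) = (\<Prod>j\<in>K. \<gamma> j)" using J(3) by (intro prod.cong) (auto simp: \<delta>_def)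
    then show ?thesis using J by (simp add: card_PiE prod.union_disjoint \<delta>_def)
  qed
  moreover have "mg ` (X \<times> Y) \<subseteq> choices (J \<union> K) \<delta>"
  proof (rule image_subsetI)
    fix r assume "r \<in> X \<times> Y"
    then obtain x y where "r = (x, y)" "x \<in> choices J \<beta>" "y \<in> choices K \<gamma>" using X Y by blast
    then show "mg r \<in> choices (J \<union> K) \<delta>" using mg(1) by metis
  qed
  ultimately show ?thesis
    using J X Y by (simp add: measure_boxes)
qed

text \<open>
  A two-stage experiment: the coins in \<open>J\<close> determine, through their cells, the value \<open>h\<close> of a
  parameter, and for each value of the parameter the coins outside of \<open>J\<close> fail with probability at
  most \<open>p\<close>.
\<close>

lemma two_stage_bound:
  assumes J: "finite J" and h: "h ` choices J \<beta> = T" and p: "0 \<le> p"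
    and Bad: "\<And>t. t \<in> T \<Longrightarrow> \<exists>R. finite R \<and> Bad t = (\<Union>(K, \<gamma>, Y)\<in>R. boxes K \<gamma> Y)
        \<and> (\<forall>(K, \<gamma>, Y)\<in>R. finite K \<and> J \<inter> K = {} \<and> Y \<subseteq> choices K \<gamma>)
        \<and> (\<Sum>(K, \<gamma>, Y)\<in>R. measure coins (boxes K \<gamma> Y)) \<le> p"
  shows "(\<Union>t\<in>T. boxes J \<beta> {x \<in> choices J \<beta>. h x = t} \<inter> Bad t) \<in> sets coins
    \<and> measure coins (\<Union>t\<in>T. boxes J \<beta> {x \<in> choices J \<beta>. h x = t} \<inter> Bad t) \<le> p"
proof -
  interpret c: prob_space coins by (rule prob_space_coins)
  define A where "A = (\<lambda>t. boxes J \<beta> {x \<in> choices J \<beta>. h x = t})"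
  have finT: "finite T" using h finite_choices[OF J] by blast
  have A: "A t \<in> sets coins" for t unfolding A_def by (intro measurable_boxes J) auto
  \<comment> \<open>The cells determine \<open>h\<close>, so these events exclude each other and
    their probabilities add up to at most 1.\<close>
  have Adisj: "disjoint_family_on A T"
  proof (unfold disjoint_family_on_def, intro ballI impI)
    fix s t assume "s \<in> T" "t \<in> T" and st: "s \<noteq> t"
    have "s = t" if "\<omega> \<in> A s" "\<omega> \<in> A t" for \<omega>
      using boxes_cell[of "{x \<in> choices J \<beta>. h x = s}" J \<beta> \<omega>] boxes_cell[of "{x \<in> choices J \<beta>. h x = t}" J \<beta> \<omega>] that
      by (auto simp: A_def)
    then show "A s \<inter> A t = {}" using st by blast
  qed
  have B: "Bad t \<in> sets coins \<and> measure coins (A t \<inter> Bad t) \<le> measure coins (A t) * p" if t: "t \<in> T" for t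
  proof -
    from Bad[OF t] obtain R where R0: "finite R \<and> Bad t = (\<Union>(K, \<gamma>, Y)\<in>R. boxes K \<gamma> Y)
        \<and> (\<forall>(K, \<gamma>, Y)\<in>R. finite K \<and> J \<inter> K = {} \<and> Y \<subseteq> choices K \<gamma>)
        \<and> (\<Sum>(K, \<gamma>, Y)\<in>R. measure coins (boxes K \<gamma> Y)) \<le> p" by (rule exE)
    then have R: "finite R" "Bad t = (\<Union>(K, \<gamma>, Y)\<in>R. boxes K \<gamma> Y)"
      "\<And>K \<gamma> Y. (K, \<gamma>, Y) \<in> R \<Longrightarrow> finite K \<and> J \<inter> K = {} \<and> Y \<subseteq> choices K \<gamma>"
      "(\<Sum>(K, \<gamma>, Y)\<in>R. measure coins (boxes K \<gamma> Y)) \<le> p" by blast+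
    have Rm: "boxes K \<gamma> Y \<in> sets coins" if "(K, \<gamma>, Y) \<in> R" for K \<gamma> Y
      using R(3)[OF that] by (intro measurable_boxes) auto
    have Bs: "Bad t \<in> sets coins"
      unfolding R(2)
    proof (rule sets.finite_UN[OF R(1)])
      fix r assume "r \<in> R"
      then show "(case r of (K, \<gamma>, Y) \<Rightarrow> boxes K \<gamma> Y) \<in> sets coins" using Rm by (cases r) simp
    qed
    have "measure coins (A t \<inter> Bad t) = measure coins (\<Union>r\<in>R. A t \<inter> (case r of (K, \<gamma>, Y) \<Rightarrow> boxes K \<gamma> Y))"
      unfolding R(2) by (simp only: Int_UN_distrib)
    also have "\<dots> \<le> (\<Sum>r\<in>R. measure coins (A t \<inter> (case r of (K, \<gamma>, Y) \<Rightarrow> boxes K \<gamma> Y)))"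
    proof (rule measure_UNION_le[OF R(1)])
      fix r assume "r \<in> R"
      then show "A t \<inter> (case r of (K, \<gamma>, Y) \<Rightarrow> boxes K \<gamma> Y) \<in> sets coins"
        using Rm A[of t] by (cases r) (simp add: sets.Int)
    qed
    also have "\<dots> = (\<Sum>r\<in>R. measure coins (A t) * (case r of (K, \<gamma>, Y) \<Rightarrow> measure coins (boxes K \<gamma> Y)))"
    proof (rule sum.cong[OF refl])
      fix r assume r: "r \<in> R"
      obtain K \<gamma> Y where [simp]: "r = (K, \<gamma>, Y)" by (cases r) auto
      show "measure coins (A t \<inter> (case r of (K, \<gamma>, Y) \<Rightarrow> boxes K \<gamma> Y))
        = measure coins (A t) * (case r of (K, \<gamma>, Y) \<Rightarrow> measure coins (boxes K \<gamma> Y))"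
        unfolding A_def using R(3)[of K \<gamma> Y] r J by (simp add: boxes_Int_prob)
    qed
    also have "\<dots> = measure coins (A t) * (\<Sum>(K, \<gamma>, Y)\<in>R. measure coins (boxes K \<gamma> Y))"
      by (simp add: sum_distrib_left case_prod_unfold)
    also have "\<dots> \<le> measure coins (A t) * p" using R(4) by (intro mult_left_mono) auto
    finally show ?thesis using Bs by blast
  qed
  have AB: "A t \<inter> Bad t \<in> sets coins" if "t \<in> T" for t using A[of t] B[OF that] by (simp add: sets.Int)
  have "measure coins (\<Union>t\<in>T. A t \<inter> Bad t) \<le> (\<Sum>t\<in>T. measure coins (A t \<inter> Bad t))"
    by (rule measure_UNION_le[OF finT AB])
  also have "\<dots> \<le> (\<Sum>t\<in>T. measure coins (A t) * p)" by (rule sum_mono) (rule conjunct2[OF B])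
  also have "\<dots> = measure coins (\<Union>t\<in>T. A t) * p"
    using A by (simp add: sum_distrib_right[symmetric] c.finite_measure_finite_Union[OF finT _ Adisj] image_subset_iff)
  finally have 1: "measure coins (\<Union>t\<in>T. A t \<inter> Bad t) \<le> measure coins (\<Union>t\<in>T. A t) * p" .
  have "measure coins (\<Union>t\<in>T. A t) * p \<le> 1 * p"
    using p by (intro mult_right_mono c.prob_le_1)
  then have "measure coins (\<Union>t\<in>T. A t \<inter> Bad t) \<le> p" using 1 by simp
  moreover have "(\<Union>t\<in>T. A t \<inter> Bad t) \<in> sets coins"
    by (rule sets.finite_UN[OF finT AB])
  ultimately show ?thesis
    unfolding A_def by blast
qed

section \<open>Running time of programs\<close>

text \<open>By \<open>exec_deterministic\<close> the execution is unique, so the existential form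
  expresses total correctness with a time bound.\<close>

definition runs :: "(nat \<Rightarrow> real) \<Rightarrow> com \<Rightarrow> store \<Rightarrow> nat \<Rightarrow> (store \<Rightarrow> bool) \<Rightarrow> bool" where
  "runs \<omega> c s T Q \<longleftrightarrow> (\<exists>\<tau> t. exec \<omega> c s \<tau> t \<and> \<tau> \<le> T \<and> Q t)"

fun loop_free :: "com \<Rightarrow> bool" where
  "loop_free (Seq c c') \<longleftrightarrow> loop_free c \<and> loop_free c'"
| "loop_free (Cond b c c') \<longleftrightarrow> loop_free c \<and> loop_free c'"
| "loop_free (While b c) \<longleftrightarrow> False"
| "loop_free _ \<longleftrightarrow> True"

fun csize :: "com \<Rightarrow> nat" where
  "csize (Seq c c') = csize c + csize c'"
| "csize (Cond b c c') = Suc (csize c + csize c')"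
| "csize _ = 1"

text \<open>Allows loop-free code to be evaluated by simplification. The last clause is meant for
  \<open>Skip\<close>; for \<open>While\<close>, which \<open>loop_free\<close> excludes, it is a
  dummy value.\<close>

fun sem :: "(nat \<Rightarrow> real) \<Rightarrow> com \<Rightarrow> store \<Rightarrow> store" where
  "sem \<omega> (NSet x e) s = s\<lparr>nreg := (nreg s)(x := nval e s)\<rparr>"
| "sem \<omega> (RSet x e) s = s\<lparr>rreg := (rreg s)(x := rval e s)\<rparr>"
| "sem \<omega> (NPut a i e) s = s\<lparr>narr := (narr s)(a := (narr s a)(nval i s := nval e s))\<rparr>"
| "sem \<omega> (RPut a i e) s = s\<lparr>rarr := (rarr s)(a := (rarr s a)(nval i s := rval e s))\<rparr>"
| "sem \<omega> (Sample x) s = s\<lparr>rreg := (rreg s)(x := \<omega> (used s)), used := Suc (used s)\<rparr>"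
| "sem \<omega> (Seq c c') s = sem \<omega> c' (sem \<omega> c s)"
| "sem \<omega> (Cond b c c') s = (if bval b s then sem \<omega> c s else sem \<omega> c' s)"
| "sem \<omega> _ s = s"

lemma exec_sem: "loop_free c \<Longrightarrow> \<exists>\<tau>\<le>csize c. exec \<omega> c s \<tau> (sem \<omega> c s)"
proof (induction c arbitrary: s)
  case (Seq c c')
  then obtain i j where "i \<le> csize c" "exec \<omega> c s i (sem \<omega> c s)"
    "j \<le> csize c'" "exec \<omega> c' (sem \<omega> c s) j (sem \<omega> c' (sem \<omega> c s))" by force
  then show ?case by (intro exI[of _ "i + j"]) (auto intro: exec.Seq)
next
  case (Cond b c c')
  then obtain i j where "i \<le> csize c" "exec \<omega> c s i (sem \<omega> c s)"
    "j \<le> csize c'" "exec \<omega> c' s j (sem \<omega> c' s)" by force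
  then show ?case
  proof (cases "bval b s")
    case True
    with \<open>exec \<omega> c s i _\<close> \<open>i \<le> _\<close> show ?thesis by (auto intro!: exI[of _ "Suc i"] exec.CondTrue)
  next
    case False
    with \<open>exec \<omega> c' s j _\<close> \<open>j \<le> _\<close> show ?thesis by (auto intro!: exI[of _ "Suc j"] exec.CondFalse)
  qed
qed (auto intro!: exI[of _ "Suc 0"]
    exec.intros(1-6)[unfolded One_nat_def])

lemma runs_loop_free:
  assumes "loop_free c" "csize c \<le> T" "Q (sem \<omega> c s)"
  shows "runs \<omega> c s T Q"
  using exec_sem[OF assms(1), of \<omega> s] assms(2,3) unfolding runs_def by (meson order_trans)

lemma runs_Seq:
  assumes "runs \<omega> c s Ta R" "\<And>t. R t \<Longrightarrow> runs \<omega> c' t Tb Q" "Ta + Tb \<le> T"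
  shows "runs \<omega> (Seq c c') s T Q"
proof -
  obtain i t where 1: "exec \<omega> c s i t" "i \<le> Ta" "R t" using assms(1) by (auto simp: runs_def)
  obtain j u where 2: "exec \<omega> c' t j u" "j \<le> Tb" "Q u" using assms(2)[OF 1(3)] by (auto simp: runs_def)
  show ?thesis unfolding runs_def
    using exec.Seq[OF 1(1) 2(1)] 1(2) 2(2,3) assms(3) by (intro exI[of _ "i + j"]) auto
qed

lemma runs_Cond:
  assumes "bval b s \<Longrightarrow> runs \<omega> c s T Q" "\<not> bval b s \<Longrightarrow> runs \<omega> c' s T Q"
  shows "runs \<omega> (Cond b c c') s (Suc T) Q"
  using assms exec.CondTrue[of b s \<omega> c] exec.CondFalse[of b s \<omega> c'] unfolding runs_def
  by (cases "bval b s") (meson Suc_le_mono)+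

lemma runs_mono: "runs \<omega> c s T Q \<Longrightarrow> T \<le> T' \<Longrightarrow> (\<And>t. Q t \<Longrightarrow> Q' t) \<Longrightarrow> runs \<omega> c s T' Q'"
  unfolding runs_def by (meson order_trans)

text \<open>\<open>R\<close> is the exact number of rounds. Every round pays one test in addition to
  its body, and the failing test pays the final 1.\<close>

lemma runs_While:
  assumes step: "\<And>r t. r < R \<Longrightarrow> Inv r t \<Longrightarrow> bval b t \<and> runs \<omega> c t B (Inv (Suc r))"
    and stop: "\<And>t. Inv R t \<Longrightarrow> \<not> bval b t \<and> Q t"
    and init: "Inv 0 s" and T: "R * (B + 1) + 1 \<le> T"
  shows "runs \<omega> (While b c) s T Q"
proof -
  have "runs \<omega> (While b c) t ((R - r) * (B + 1) + 1) Q" if "r \<le> R" "Inv r t" for r t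
    using that
  proof (induction "R - r" arbitrary: r t)
    case 0
    then have "r = R" by simp
    then have "\<not> bval b t" "Q t" using stop 0 by auto
    then show ?case unfolding runs_def
      by (intro exI[of _ 1] exI[of _ t] conjI exec.WhileFalse) auto
  next
    case (Suc x)
    then have r: "r < R" by simp
    obtain i u where b: "bval b t" and 1: "exec \<omega> c t i u" "i \<le> B" "Inv (Suc r) u"
      using step[OF r Suc.prems(2)] by (auto simp: runs_def)
    have "runs \<omega> (While b c) u ((R - Suc r) * (B + 1) + 1) Q"
      using Suc.hyps(1)[of "Suc r" u] Suc.hyps(2) r 1(3) by auto
    then obtain j v where 2: "exec \<omega> (While b c) u j v" "j \<le> (R - Suc r) * (B + 1) + 1" "Q v"
      by (auto simp: runs_def)
    have "R - r = Suc (R - Suc r)" using r by simp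
    then have "Suc (i + j) \<le> (R - r) * (B + 1) + 1" using 1(2) 2(2) by simp
    then show ?case unfolding runs_def
      using exec.WhileTrue[OF b 1(1) 2(1)] 2(3) by blast
  qed
  from this[of 0 s] init T show ?thesis by (auto elim: runs_mono)
qed

definition For :: "nat \<Rightarrow> nexp \<Rightarrow> com \<Rightarrow> com" where
  "For x N c = Seq (NSet x (NLit 0))
     (While (NLess (NReg x) N) (Seq c (NSet x (NAdd (NReg x) (NLit 1)))))"

text \<open>A round pays for the body, the increment and the test, hence \<open>B + 2\<close>; the
  other 2 are the initialisation and the failing test. The body has to establish the invariant for
  the store after the increment.\<close>

lemma runs_For:
  assumes step: "\<And>i t. i < n \<Longrightarrow> Inv i t \<Longrightarrow>
        runs \<omega> c t B (\<lambda>u. nreg u x = i \<and> Inv (Suc i) (u\<lparr>nreg := (nreg u)(x := Suc i)\<rparr>))"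
    and reg: "\<And>i t. Inv i t \<Longrightarrow> nreg t x = i \<and> nval N t = n"
    and init: "Inv 0 (s\<lparr>nreg := (nreg s)(x := 0)\<rparr>)"
    and fin: "\<And>t. Inv n t \<Longrightarrow> Q t" and T: "n * (B + 2) + 2 \<le> T"
  shows "runs \<omega> (For x N c) s T Q"
  unfolding For_def
proof (rule runs_Seq)
  show "runs \<omega> (NSet x (NLit 0)) s 1 (Inv 0)"
    using init by (intro runs_loop_free) auto
  fix t assume "Inv 0 t"
  then show "runs \<omega> (While (NLess (NReg x) N) (Seq c (NSet x (NAdd (NReg x) (NLit 1))))) t (n * (B + 2) + 1) Q"
  proof (rule runs_While[rotated 2])
    fix i t assume i: "i < n" and Inv: "Inv i t"
    show "bval (NLess (NReg x) N) t \<and> runs \<omega> (Seq c (NSet x (NAdd (NReg x) (NLit 1)))) t (B + 1) (Inv (Suc i))"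
    proof
      show "bval (NLess (NReg x) N) t" using reg[OF Inv] i by simp
      show "runs \<omega> (Seq c (NSet x (NAdd (NReg x) (NLit 1)))) t (B + 1) (Inv (Suc i))"
        by (rule runs_Seq[OF step[OF i Inv], of _ 1]) (auto intro!: runs_loop_free)
    qed
  next
    fix t assume "Inv n t"
    then show "\<not> bval (NLess (NReg x) N) t \<and> Q t" using reg fin by auto
  qed auto
qed (use T in auto)

section \<open>Distances to the given centers\<close>

definition sqd :: "nat \<Rightarrow> (nat \<Rightarrow> real) \<Rightarrow> (nat \<Rightarrow> real) \<Rightarrow> nat \<Rightarrow> nat \<Rightarrow> nat \<Rightarrow> real" where
  "sqd d PA CA i j q = (\<Sum>l<q. (PA (i * d + l) - CA (j * d + l)) * (PA (i * d + l) - CA (j * d + l)))"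

text \<open>The first minimiser among the indices below the argument, in the recursion of the scan
  that computes it.\<close>

fun best :: "(nat \<Rightarrow> real) \<Rightarrow> nat \<Rightarrow> nat" where
  "best h 0 = 0"
| "best h (Suc j) = (if 0 < j \<and> \<not> h j < h (best h j) then best h j else j)"

lemma best_min: "0 < j \<Longrightarrow> best h j < j \<and> (\<forall>i<j. h (best h j) \<le> h i)"
proof (induction j)
  case (Suc j)
  then show ?case by (cases "j = 0") (auto simp: less_Suc_eq intro: order_trans less_imp_le)
qed simp

text \<open>The zeros of register 5 and of arrays 2 to 7 are recorded because later phases use them
  as initial values of counters.\<close>

definition env :: "nat \<Rightarrow> nat \<Rightarrow> nat \<Rightarrow> nat \<Rightarrow> real \<Rightarrow> real \<Rightarrow> store \<Rightarrow> bool" where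
  "env n k d m z \<epsilon> s \<longleftrightarrow> nreg s 0 = n \<and> nreg s 1 = k \<and> nreg s 2 = d \<and> nreg s 3 = m \<and> nreg s 5 = 0 \<and>
     rreg s 0 = z \<and> rreg s 1 = \<epsilon> \<and> (\<forall>a\<in>{2..7}. narr s a = (\<lambda>_. 0))"

text \<open>The cost is obtained from the squared distance by the power \<open>z / 2\<close>,
  without a square root.\<close>

definition dist_prog :: com where
  "dist_prog = For 6 (NReg 0) (For 7 (NReg 1)
     (Seq (RSet 2 (RNat (NLit 0)))
     (Seq (For 8 (NReg 2)
        (RSet 2 (RAdd (RReg 2)
          (RMul (RSub (RAt 0 (NAdd (NMul (NReg 6) (NReg 2)) (NReg 8))) (RAt 1 (NAdd (NMul (NReg 7) (NReg 2)) (NReg 8))))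
                (RSub (RAt 0 (NAdd (NMul (NReg 6) (NReg 2)) (NReg 8))) (RAt 1 (NAdd (NMul (NReg 7) (NReg 2)) (NReg 8))))))))
     (Seq (RSet 3 (RPow (RReg 2) (RDiv (RReg 0) (RNat (NLit 2)))))
        (Cond (BAnd (NLess (NLit 0) (NReg 7)) (BNot (RLess (RReg 3) (RAt 2 (NReg 6)))))
           Skip (Seq (RPut 2 (NReg 6) (RReg 3)) (NPut 1 (NReg 6) (NReg 7))))))))"

lemma runs_dist_prog:
  fixes PA CA :: "nat \<Rightarrow> real" and d k :: nat and z :: real
  defines "h \<equiv> \<lambda>i j. sqd d PA CA i j d powr (z / 2)"
  assumes env: "env n k d m z \<epsilon> s" and arr: "rarr s 0 = PA" "rarr s 1 = CA" "used s = 0" and k: "1 \<le> k"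
    and T: "n * (k * (3 * d + 11) + 4) + 2 \<le> T"
  shows "runs \<omega> dist_prog s T (\<lambda>t. env n k d m z \<epsilon> t \<and> used t = 0 \<and>
     (\<forall>i<n. rarr t 2 i = h i (best (h i) k) \<and> narr t 1 i = best (h i) k))"
proof -
  define Base where "Base = (\<lambda>i t. env n k d m z \<epsilon> t \<and> used t = 0 \<and> rarr t 0 = PA \<and> rarr t 1 = CA \<and> nreg t 6 = i \<and>
     (\<forall>i'<i. rarr t 2 i' = h i' (best (h i') k) \<and> narr t 1 i' = best (h i') k))"
  define Mid where "Mid = (\<lambda>i j t. Base i t \<and> nreg t 7 = j \<and>
     (0 < j \<longrightarrow> rarr t 2 i = h i (best (h i) j) \<and> narr t 1 i = best (h i) j))"
  show ?thesis
    unfolding dist_prog_def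
  proof (rule runs_For[where Inv = Base and n = n and B = "k * (3 * d + 11) + 2"])
    fix i t assume i: "i < n" and Base: "Base i t"
    show "runs \<omega> (For 7 (NReg 1)
     (Seq (RSet 2 (RNat (NLit 0)))
     (Seq (For 8 (NReg 2)
        (RSet 2 (RAdd (RReg 2)
          (RMul (RSub (RAt 0 (NAdd (NMul (NReg 6) (NReg 2)) (NReg 8))) (RAt 1 (NAdd (NMul (NReg 7) (NReg 2)) (NReg 8))))
                (RSub (RAt 0 (NAdd (NMul (NReg 6) (NReg 2)) (NReg 8))) (RAt 1 (NAdd (NMul (NReg 7) (NReg 2)) (NReg 8))))))))
     (Seq (RSet 3 (RPow (RReg 2) (RDiv (RReg 0) (RNat (NLit 2)))))
        (Cond (BAnd (NLess (NLit 0) (NReg 7)) (BNot (RLess (RReg 3) (RAt 2 (NReg 6)))))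
           Skip (Seq (RPut 2 (NReg 6) (RReg 3)) (NPut 1 (NReg 6) (NReg 7)))))))) t (k * (3 * d + 11) + 2)
      (\<lambda>u. nreg u 6 = i \<and> Base (Suc i) (u\<lparr>nreg := (nreg u)(6 := Suc i)\<rparr>))"
    proof (rule runs_For[where Inv = "Mid i" and n = k and B = "3 * d + 9"])
      fix j t assume j: "j < k" and Mid: "Mid i j t"
      define In where "In = (\<lambda>q t. Mid i j t \<and> nreg t 8 = q \<and> rreg t 2 = sqd d PA CA i j q)"
      show "runs \<omega> (Seq (RSet 2 (RNat (NLit 0)))
       (Seq (For 8 (NReg 2)
        (RSet 2 (RAdd (RReg 2)
          (RMul (RSub (RAt 0 (NAdd (NMul (NReg 6) (NReg 2)) (NReg 8))) (RAt 1 (NAdd (NMul (NReg 7) (NReg 2)) (NReg 8))))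
                (RSub (RAt 0 (NAdd (NMul (NReg 6) (NReg 2)) (NReg 8))) (RAt 1 (NAdd (NMul (NReg 7) (NReg 2)) (NReg 8))))))))
       (Seq (RSet 3 (RPow (RReg 2) (RDiv (RReg 0) (RNat (NLit 2)))))
        (Cond (BAnd (NLess (NLit 0) (NReg 7)) (BNot (RLess (RReg 3) (RAt 2 (NReg 6)))))
           Skip (Seq (RPut 2 (NReg 6) (RReg 3)) (NPut 1 (NReg 6) (NReg 7))))))) t (3 * d + 9)
        (\<lambda>u. nreg u 7 = j \<and> Mid i (Suc j) (u\<lparr>nreg := (nreg u)(7 := Suc j)\<rparr>))"
      proof (rule runs_Seq[where Ta = 1 and Tb = "3 * d + 8" and R = "\<lambda>t. Mid i j t \<and> rreg t 2 = 0"])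
        show "runs \<omega> (RSet 2 (RNat (NLit 0))) t 1 (\<lambda>t. Mid i j t \<and> rreg t 2 = 0)"
          using Mid by (intro runs_loop_free) (simp_all add: Mid_def Base_def env_def)
        fix t assume M: "Mid i j t \<and> rreg t 2 = 0"
        show "runs \<omega> (Seq (For 8 (NReg 2)
          (RSet 2 (RAdd (RReg 2)
          (RMul (RSub (RAt 0 (NAdd (NMul (NReg 6) (NReg 2)) (NReg 8))) (RAt 1 (NAdd (NMul (NReg 7) (NReg 2)) (NReg 8))))
                (RSub (RAt 0 (NAdd (NMul (NReg 6) (NReg 2)) (NReg 8))) (RAt 1 (NAdd (NMul (NReg 7) (NReg 2)) (NReg 8))))))))
         (Seq (RSet 3 (RPow (RReg 2) (RDiv (RReg 0) (RNat (NLit 2)))))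
          (Cond (BAnd (NLess (NLit 0) (NReg 7)) (BNot (RLess (RReg 3) (RAt 2 (NReg 6)))))
           Skip (Seq (RPut 2 (NReg 6) (RReg 3)) (NPut 1 (NReg 6) (NReg 7)))))) t (3 * d + 8)
          (\<lambda>u. nreg u 7 = j \<and> Mid i (Suc j) (u\<lparr>nreg := (nreg u)(7 := Suc j)\<rparr>))"
        proof (rule runs_Seq[where Ta = "3 * d + 2" and Tb = 6 and R = "In d"])
          show "runs \<omega> (For 8 (NReg 2)
            (RSet 2 (RAdd (RReg 2)
            (RMul (RSub (RAt 0 (NAdd (NMul (NReg 6) (NReg 2)) (NReg 8))) (RAt 1 (NAdd (NMul (NReg 7) (NReg 2)) (NReg 8))))
                (RSub (RAt 0 (NAdd (NMul (NReg 6) (NReg 2)) (NReg 8))) (RAt 1 (NAdd (NMul (NReg 7) (NReg 2)) (NReg 8)))))))) t (3 * d + 2) (In d)"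
            by (rule runs_For[where Inv = In and n = d and B = 1])
              (use M in \<open>simp_all add: In_def Mid_def Base_def env_def sqd_def runs_loop_free\<close>)
          fix t assume "In d t"
          then show "runs \<omega> (Seq (RSet 3 (RPow (RReg 2) (RDiv (RReg 0) (RNat (NLit 2)))))
            (Cond (BAnd (NLess (NLit 0) (NReg 7)) (BNot (RLess (RReg 3) (RAt 2 (NReg 6)))))
             Skip (Seq (RPut 2 (NReg 6) (RReg 3)) (NPut 1 (NReg 6) (NReg 7))))) t 6
             (\<lambda>u. nreg u 7 = j \<and> Mid i (Suc j) (u\<lparr>nreg := (nreg u)(7 := Suc j)\<rparr>))"
            by (cases "j = 0") (intro runs_loop_free; simp add: In_def Mid_def Base_def env_def h_def)+
        qed simp
      qed simp
    next
      show "Mid i 0 (t\<lparr>nreg := (nreg t)(7 := 0)\<rparr>)" using Base by (auto simp: Mid_def Base_def env_def)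
      fix u assume "Mid i k u"
      then show "nreg u 6 = i \<and> Base (Suc i) (u\<lparr>nreg := (nreg u)(6 := Suc i)\<rparr>)"
        using k by (auto simp: Mid_def Base_def env_def less_Suc_eq)
    qed (auto simp: Mid_def Base_def env_def)
  next
    show "n * (k * (3 * d + 11) + 2 + 2) + 2 \<le> T" using T by (simp add: algebra_simps)
  qed (use env arr in \<open>auto simp: Base_def env_def\<close>)
qed

text \<open>Serves for counting and also as the rank of an index among those that satisfy
  \<open>P\<close>.\<close>

definition cnt :: "(nat \<Rightarrow> bool) \<Rightarrow> nat \<Rightarrow> nat" where
  "cnt P n = card {i. i < n \<and> P i}"

lemma cnt_0 [simp]: "cnt P 0 = 0"
  by (simp add: cnt_def)

lemma cnt_Suc [simp]: "cnt P (Suc n) = (if P n then Suc (cnt P n) else cnt P n)"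
proof -
  have "{i. i < Suc n \<and> P i} = (if P n then insert n {i. i < n \<and> P i} else {i. i < n \<and> P i})"
    by (auto simp: less_Suc_eq)
  then show ?thesis by (simp add: cnt_def)
qed

lemma cnt_mono: "m \<le> n \<Longrightarrow> cnt P m \<le> cnt P n"
  unfolding cnt_def by (intro card_mono) auto

lemma cnt_strict: "i < n \<Longrightarrow> P i \<Longrightarrow> cnt P i < cnt P n"
  using cnt_mono[of "Suc i" n P] by simp

section \<open>Selection of the threshold\<close>

definition test :: "(nat \<Rightarrow> real) \<Rightarrow> nat \<Rightarrow> nat \<Rightarrow> real \<Rightarrow> real \<Rightarrow> real" where
  "test F n m v t = (if cnt (\<lambda>i. v < F i) n \<le> m \<and> v < t then v else t)"

fun running_max :: "(nat \<Rightarrow> real) \<Rightarrow> nat \<Rightarrow> real" where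
  "running_max F 0 = 0"
| "running_max F (Suc i) = (if running_max F i < F i then F i else running_max F i)"

fun try_candidates :: "(nat \<Rightarrow> real) \<Rightarrow> nat \<Rightarrow> nat \<Rightarrow> nat \<Rightarrow> (nat \<Rightarrow> nat) \<Rightarrow> nat \<Rightarrow> real" where
  "try_candidates F n k m x 0 = running_max F n"
| "try_candidates F n k m x (Suc j) = test F n m (8 * real k * F (x j)) (try_candidates F n k m x j)"

fun try_halving :: "(nat \<Rightarrow> real) \<Rightarrow> nat \<Rightarrow> nat \<Rightarrow> real \<Rightarrow> nat \<Rightarrow> real" where
  "try_halving F n m t 0 = t"
| "try_halving F n m t (Suc j) = test F n m (try_halving F n m t j / 2) (try_halving F n m t j)"

text \<open>The maximum is a valid start. With probability at least
  \<open>1 - exp (- K / 10)\<close> some candidate brings the value to at most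
  \<open>32 * k^2\<close> times the average inlier cost; since
  \<open>2 ^ (k + 3) \<ge> 4 * k\<close>, the halvings reduce this to \<open>8 * k\<close> times the
  average. All tests together take \<open>O(nk)\<close> steps for fixed \<open>K\<close>.\<close>

definition threshold :: "(nat \<Rightarrow> real) \<Rightarrow> nat \<Rightarrow> nat \<Rightarrow> nat \<Rightarrow> nat \<Rightarrow> (nat \<Rightarrow> nat) \<Rightarrow> real" where
  "threshold F n k m K x = try_halving F n m (try_candidates F n k m x (K * k)) (k + 3)"

definition test_prog :: com where
  "test_prog = Seq (NSet 9 (NLit 0)) (Seq
     (For 6 (NReg 0) (Cond (RLess (RReg 5) (RAt 2 (NReg 6))) (NSet 9 (NAdd (NReg 9) (NLit 1))) Skip))
     (Cond (BAnd (BNot (NLess (NReg 3) (NReg 9))) (RLess (RReg 5) (RReg 4))) (RSet 4 (RReg 5)) Skip))"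

text \<open>The scan overwrites register 5 as long as the index is at most the coin times
  \<open>n\<close>; what remains belongs to the index \<open>cell n\<close> of the coin.\<close>

definition pick_prog :: com where
  "pick_prog = For 6 (NReg 0) (Cond (BNot (RLess (RMul (RReg 6) (RNat (NReg 0))) (RNat (NReg 6))))
     (RSet 5 (RMul (RMul (RNat (NLit 8)) (RNat (NReg 1))) (RAt 2 (NReg 6)))) Skip)"

definition threshold_prog :: "nat \<Rightarrow> com" where
  "threshold_prog K = Seq (RSet 4 (RNat (NLit 0))) (Seq
     (For 6 (NReg 0) (Cond (RLess (RReg 4) (RAt 2 (NReg 6))) (RSet 4 (RAt 2 (NReg 6))) Skip)) (Seq
     (NSet 11 (NMul (NLit K) (NReg 1))) (Seq
     (For 7 (NReg 11) (Seq (Sample 6) (Seq pick_prog test_prog)))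
     (For 7 (NAdd (NReg 1) (NLit 3)) (Seq (RSet 5 (RDiv (RReg 4) (RNat (NLit 2)))) test_prog)))))"

locale threshold_state =
  fixes n k d m :: nat and z \<epsilon> :: real and F :: "nat \<Rightarrow> real" and G :: "nat \<Rightarrow> nat" and \<omega> :: "nat \<Rightarrow> real"
  assumes n: "1 \<le> n" and \<omega>: "\<And>i. 0 \<le> \<omega> i"
begin

definition st :: "store \<Rightarrow> bool" where
  "st s \<longleftrightarrow> env n k d m z \<epsilon> s \<and> (\<forall>i<n. rarr s 2 i = F i \<and> narr s 1 i = G i)"

lemma runs_test_prog:
  assumes "st s" "nreg s 7 = j" "nreg s 11 = x" "used s = u" "rreg s 5 = v" "rreg s 4 = t"
  shows "runs \<omega> test_prog s (5 * n + 6)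
     (\<lambda>s. st s \<and> nreg s 7 = j \<and> nreg s 11 = x \<and> used s = u \<and> rreg s 4 = test F n m v t)"
proof -
  define P where "P = (\<lambda>s. st s \<and> nreg s 7 = j \<and> nreg s 11 = x \<and> used s = u \<and> rreg s 5 = v \<and> rreg s 4 = t)"
  define Inv where "Inv = (\<lambda>i s. P s \<and> nreg s 6 = i \<and> nreg s 9 = cnt (\<lambda>i. v < F i) i)"
  show ?thesis unfolding test_prog_def
  proof (rule runs_Seq[where Ta = 1 and Tb = "5 * n + 5" and R = "\<lambda>s. P s \<and> nreg s 9 = 0"])
    show "runs \<omega> (NSet 9 (NLit 0)) s 1 (\<lambda>s. P s \<and> nreg s 9 = 0)"
      using assms by (intro runs_loop_free) (simp_all add: P_def st_def env_def)
    fix s assume s: "P s \<and> nreg s 9 = 0"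
    show "runs \<omega> (Seq
     (For 6 (NReg 0) (Cond (RLess (RReg 5) (RAt 2 (NReg 6))) (NSet 9 (NAdd (NReg 9) (NLit 1))) Skip))
     (Cond (BAnd (BNot (NLess (NReg 3) (NReg 9))) (RLess (RReg 5) (RReg 4))) (RSet 4 (RReg 5)) Skip)) s (5 * n + 5)
     (\<lambda>s. st s \<and> nreg s 7 = j \<and> nreg s 11 = x \<and> used s = u \<and> rreg s 4 = test F n m v t)"
    proof (rule runs_Seq[where Ta = "n * 5 + 2" and Tb = 3 and R = "Inv n"])
      show "runs \<omega> (For 6 (NReg 0) (Cond (RLess (RReg 5) (RAt 2 (NReg 6))) (NSet 9 (NAdd (NReg 9) (NLit 1))) Skip)) s (n * 5 + 2) (Inv n)"
        by (rule runs_For[where Inv = Inv and n = n and B = 3])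
          (use s in \<open>simp_all add: Inv_def P_def st_def env_def runs_loop_free\<close>)
      fix s assume "Inv n s"
      then show "runs \<omega> (Cond (BAnd (BNot (NLess (NReg 3) (NReg 9))) (RLess (RReg 5) (RReg 4))) (RSet 4 (RReg 5)) Skip) s 3
        (\<lambda>s. st s \<and> nreg s 7 = j \<and> nreg s 11 = x \<and> used s = u \<and> rreg s 4 = test F n m v t)"
        by (intro runs_loop_free) (simp_all add: Inv_def P_def st_def env_def test_def not_less)
    qed simp
  qed simp
qed

lemma runs_pick_prog:
  assumes "st s" "nreg s 7 = j" "nreg s 11 = x" "used s = u" "rreg s 6 = \<omega> j" "rreg s 4 = t"
  shows "runs \<omega> pick_prog s (5 * n + 2)
     (\<lambda>s. st s \<and> nreg s 7 = j \<and> nreg s 11 = x \<and> used s = u \<and> rreg s 4 = t \<and>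
          rreg s 5 = 8 * real k * F (cell n (\<omega> j)))"
proof -
  note c = cell_props[OF n \<omega>[of j]]
  \<comment> \<open>Register 5 belongs to the last index scanned, or to the cell once that has been
    passed.\<close>
  define Inv where "Inv = (\<lambda>i s. st s \<and> nreg s 6 = i \<and> nreg s 7 = j \<and> nreg s 11 = x \<and> used s = u \<and>
     rreg s 6 = \<omega> j \<and> rreg s 4 = t \<and> (0 < i \<longrightarrow> rreg s 5 = 8 * real k * F (min (i - 1) (cell n (\<omega> j)))))"
  show ?thesis unfolding pick_prog_def
  proof (rule runs_For[where Inv = Inv and n = n and B = 3])
    fix i s assume i: "i < n" and Inv: "Inv i s"
    have iff: "\<omega> j * real n < real i \<longleftrightarrow> cell n (\<omega> j) < i" using c(3)[OF i] by linarith
    have "min (i - Suc 0) (cell n (\<omega> j)) = min i (cell n (\<omega> j))" if "cell n (\<omega> j) < i" using that by simp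
    then show "runs \<omega> (Cond (BNot (RLess (RMul (RReg 6) (RNat (NReg 0))) (RNat (NReg 6))))
       (RSet 5 (RMul (RMul (RNat (NLit 8)) (RNat (NReg 1))) (RAt 2 (NReg 6)))) Skip) s 3
      (\<lambda>u. nreg u 6 = i \<and> Inv (Suc i) (u\<lparr>nreg := (nreg u)(6 := Suc i)\<rparr>))"
      using Inv i iff by (intro runs_loop_free) (simp_all add: Inv_def st_def env_def min_def)
  next
    fix s assume "Inv n s"
    moreover have "min (n - 1) (cell n (\<omega> j)) = cell n (\<omega> j)" using c(1) by simp
    ultimately show "st s \<and> nreg s 7 = j \<and> nreg s 11 = x \<and> used s = u \<and> rreg s 4 = t \<and>
          rreg s 5 = 8 * real k * F (cell n (\<omega> j))"
      using n by (simp add: Inv_def)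
  qed (use assms in \<open>simp_all add: Inv_def st_def env_def\<close>)
qed

lemma runs_threshold_prog:
  assumes s: "st s" "used s = 0" and T: "K * k * (10 * n + 11) + (k + 3) * (5 * n + 9) + 5 * n + 8 \<le> T"
  shows "runs \<omega> (threshold_prog K) s T
     (\<lambda>s. st s \<and> used s = K * k \<and> rreg s 4 = threshold F n k m K (\<lambda>j. cell n (\<omega> j)))"
proof -
  let ?x = "\<lambda>j. cell n (\<omega> j)"
  let ?init = "For 6 (NReg 0) (Cond (RLess (RReg 4) (RAt 2 (NReg 6))) (RSet 4 (RAt 2 (NReg 6))) Skip)"
  let ?cand = "For 7 (NReg 11) (Seq (Sample 6) (Seq pick_prog test_prog))"
  let ?half = "For 7 (NAdd (NReg 1) (NLit 3)) (Seq (RSet 5 (RDiv (RReg 4) (RNat (NLit 2)))) test_prog)"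
  let ?post = "\<lambda>s. st s \<and> used s = K * k \<and> rreg s 4 = threshold F n k m K ?x"
  define I1 where "I1 = (\<lambda>i s. st s \<and> used s = 0 \<and> nreg s 6 = i \<and> rreg s 4 = running_max F i)"
  define I2 where "I2 = (\<lambda>j s. st s \<and> used s = j \<and> nreg s 7 = j \<and> nreg s 11 = K * k \<and> rreg s 4 = try_candidates F n k m ?x j)"
  define I3 where "I3 = (\<lambda>j s. st s \<and> used s = K * k \<and> nreg s 7 = j \<and> rreg s 4 = try_halving F n m (try_candidates F n k m ?x (K * k)) j)"
  have 1: "runs \<omega> (RSet 4 (RNat (NLit 0))) s 1 (\<lambda>s. st s \<and> used s = 0 \<and> rreg s 4 = 0)"
    using s by (intro runs_loop_free) (simp_all add: st_def env_def)
  have 2: "runs \<omega> ?init s (n * 5 + 2) (\<lambda>s. st s \<and> used s = 0 \<and> rreg s 4 = running_max F n)"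
    if "st s \<and> used s = 0 \<and> rreg s 4 = 0" for s
    by (rule runs_For[where Inv = I1 and n = n and B = 3])
      (use that in \<open>simp_all add: I1_def st_def env_def runs_loop_free\<close>)
  have 3: "runs \<omega> (NSet 11 (NMul (NLit K) (NReg 1))) s 1
      (\<lambda>s. st s \<and> used s = 0 \<and> nreg s 11 = K * k \<and> rreg s 4 = running_max F n)"
    if "st s \<and> used s = 0 \<and> rreg s 4 = running_max F n" for s
    using that by (intro runs_loop_free) (simp_all add: st_def env_def)
  have 4: "runs \<omega> ?cand s (K * k * (10 * n + 11) + 2) (\<lambda>s. st s \<and> used s = K * k \<and> rreg s 4 = try_candidates F n k m ?x (K * k))"
    if s4: "st s \<and> used s = 0 \<and> nreg s 11 = K * k \<and> rreg s 4 = running_max F n" for s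
  proof (rule runs_For[where Inv = I2 and n = "K * k" and B = "10 * n + 9"])
    fix j s assume I2: "I2 j s"
    show "runs \<omega> (Seq (Sample 6) (Seq pick_prog test_prog)) s (10 * n + 9)
       (\<lambda>u. nreg u 7 = j \<and> I2 (Suc j) (u\<lparr>nreg := (nreg u)(7 := Suc j)\<rparr>))"
    proof (rule runs_Seq[where Ta = 1 and Tb = "10 * n + 8" and
        R = "\<lambda>s. st s \<and> nreg s 7 = j \<and> nreg s 11 = K * k \<and> used s = Suc j \<and> rreg s 6 = \<omega> j \<and> rreg s 4 = try_candidates F n k m ?x j"])
      show "runs \<omega> (Sample 6) s 1 (\<lambda>s. st s \<and> nreg s 7 = j \<and> nreg s 11 = K * k \<and> used s = Suc j \<and> rreg s 6 = \<omega> j \<and> rreg s 4 = try_candidates F n k m ?x j)"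
        using I2 by (intro runs_loop_free) (simp_all add: I2_def st_def env_def)
      fix t assume t: "st t \<and> nreg t 7 = j \<and> nreg t 11 = K * k \<and> used t = Suc j \<and> rreg t 6 = \<omega> j \<and> rreg t 4 = try_candidates F n k m ?x j"
      show "runs \<omega> (Seq pick_prog test_prog) t (10 * n + 8) (\<lambda>u. nreg u 7 = j \<and> I2 (Suc j) (u\<lparr>nreg := (nreg u)(7 := Suc j)\<rparr>))"
      proof (rule runs_Seq)
        show "runs \<omega> pick_prog t (5 * n + 2) (\<lambda>s. st s \<and> nreg s 7 = j \<and> nreg s 11 = K * k \<and> used s = Suc j \<and> rreg s 4 = try_candidates F n k m ?x j \<and>
          rreg s 5 = 8 * real k * F (cell n (\<omega> j)))"
          using t by (intro runs_pick_prog) auto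
        fix u assume u: "st u \<and> nreg u 7 = j \<and> nreg u 11 = K * k \<and> used u = Suc j \<and> rreg u 4 = try_candidates F n k m ?x j \<and>
          rreg u 5 = 8 * real k * F (cell n (\<omega> j))"
        show "runs \<omega> test_prog u (5 * n + 6) (\<lambda>u. nreg u 7 = j \<and> I2 (Suc j) (u\<lparr>nreg := (nreg u)(7 := Suc j)\<rparr>))"
          by (rule runs_mono[OF runs_test_prog[of u j "K * k" "Suc j" "8 * real k * F (cell n (\<omega> j))" "try_candidates F n k m ?x j"]])
            (use u in \<open>simp_all add: I2_def st_def env_def\<close>)
      qed simp
    qed simp
  qed (use s4 in \<open>simp_all add: I2_def st_def env_def\<close>)
  have 5: "runs \<omega> ?half s ((k + 3) * (5 * n + 9) + 2) ?post"
    if s5: "st s \<and> used s = K * k \<and> rreg s 4 = try_candidates F n k m ?x (K * k)" for s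
  proof (rule runs_For[where Inv = I3 and n = "k + 3" and B = "5 * n + 7"])
    fix j s assume s: "I3 j s"
    show "runs \<omega> (Seq (RSet 5 (RDiv (RReg 4) (RNat (NLit 2)))) test_prog) s (5 * n + 7)
       (\<lambda>u. nreg u 7 = j \<and> I3 (Suc j) (u\<lparr>nreg := (nreg u)(7 := Suc j)\<rparr>))"
    proof (rule runs_Seq)
      show "runs \<omega> (RSet 5 (RDiv (RReg 4) (RNat (NLit 2)))) s 1 (\<lambda>s. I3 j s \<and> rreg s 5 = rreg s 4 / 2)"
        using s by (intro runs_loop_free) (simp_all add: I3_def st_def env_def)
      fix u assume u: "I3 j u \<and> rreg u 5 = rreg u 4 / 2"
      show "runs \<omega> test_prog u (5 * n + 6) (\<lambda>u. nreg u 7 = j \<and> I3 (Suc j) (u\<lparr>nreg := (nreg u)(7 := Suc j)\<rparr>))"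
        by (rule runs_mono[OF runs_test_prog[of u j "nreg u 11" "K * k" "rreg u 4 / 2" "rreg u 4"]])
          (use u in \<open>simp_all add: I3_def st_def env_def\<close>)
    qed simp
  qed (use s5 in \<open>simp_all add: I3_def st_def env_def threshold_def\<close>)
  have c45: "runs \<omega> (Seq ?cand ?half) s ((K * k * (10 * n + 11) + 2) + ((k + 3) * (5 * n + 9) + 2)) ?post"
    if "st s \<and> used s = 0 \<and> nreg s 11 = K * k \<and> rreg s 4 = running_max F n" for s
    by (rule runs_Seq[OF 4[OF that] 5]) auto
  have c345: "runs \<omega> (Seq (NSet 11 (NMul (NLit K) (NReg 1))) (Seq ?cand ?half)) s
       (1 + ((K * k * (10 * n + 11) + 2) + ((k + 3) * (5 * n + 9) + 2))) ?post"
    if "st s \<and> used s = 0 \<and> rreg s 4 = running_max F n" for s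
    by (rule runs_Seq[OF 3[OF that] c45]) auto
  have c2345: "runs \<omega> (Seq ?init (Seq (NSet 11 (NMul (NLit K) (NReg 1))) (Seq ?cand ?half))) s
       ((n * 5 + 2) + (1 + ((K * k * (10 * n + 11) + 2) + ((k + 3) * (5 * n + 9) + 2)))) ?post"
    if "st s \<and> used s = 0 \<and> rreg s 4 = 0" for s
    by (rule runs_Seq[OF 2[OF that] c345]) auto
  show ?thesis unfolding threshold_prog_def
    by (rule runs_Seq[OF 1 c2345]) (use T in auto)
qed

end

section \<open>Strata\<close>

text \<open>The first failure of a loop guard: halving stops when the scale
  \<open>\<tau> / 2 ^ r\<close> is less than twice \<open>f\<close>, or has dropped to
  \<open>\<tau> / (16 * k)\<close> or below.\<close>

definition ring :: "real \<Rightarrow> nat \<Rightarrow> real \<Rightarrow> nat" where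
  "ring \<tau> k f = (LEAST r. \<not> (f \<le> \<tau> / 2 ^ r / 2 \<and> \<tau> < 16 * real k * (\<tau> / 2 ^ r)))"

lemma ring_bound:
  assumes "0 \<le> \<tau>" "\<tau> < 16 * real k * (\<tau> / 2 ^ r)"
  shows "2 ^ r < 16 * k" "r < k + 4"
proof -
  have "\<tau> \<noteq> 0" using assms(2) by auto
  then have "0 < \<tau>" using assms(1) by simp
  then have "2 ^ r < 16 * real k" using assms(2) by (simp add: field_simps)
  then have "real (2 ^ r) < real (16 * k)" by simp
  then show 1: "2 ^ r < 16 * k" by (simp only: of_nat_less_iff)
  have "k < 2 ^ k" by (rule less_exp)
  then have "16 * k \<le> 2 ^ (k + 4)" by (simp add: power_add)
  with 1 have "(2::nat) ^ r < 2 ^ (k + 4)" by linarith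
  then show "r < k + 4" by (rule power_less_imp_less_exp[rotated]) simp
qed

lemma ring_props:
  assumes \<tau>: "0 \<le> \<tau>"
  shows "\<not> (f \<le> \<tau> / 2 ^ ring \<tau> k f / 2 \<and> \<tau> < 16 * real k * (\<tau> / 2 ^ ring \<tau> k f))"
    and "r < ring \<tau> k f \<Longrightarrow> f \<le> \<tau> / 2 ^ r / 2 \<and> \<tau> < 16 * real k * (\<tau> / 2 ^ r)"
    and "ring \<tau> k f \<le> k + 4"
proof -
  have ex: "\<not> (f \<le> \<tau> / 2 ^ (k + 4) / 2 \<and> \<tau> < 16 * real k * (\<tau> / 2 ^ (k + 4)))"
    using ring_bound(2)[OF \<tau>, of k "k + 4"] by blast
  show "\<not> (f \<le> \<tau> / 2 ^ ring \<tau> k f / 2 \<and> \<tau> < 16 * real k * (\<tau> / 2 ^ ring \<tau> k f))"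
    unfolding ring_def by (rule LeastI[where P = "\<lambda>r. \<not> (f \<le> \<tau> / 2 ^ r / 2 \<and> \<tau> < 16 * real k * (\<tau> / 2 ^ r))", OF ex])
  show "ring \<tau> k f \<le> k + 4"
    unfolding ring_def by (rule Least_le[where P = "\<lambda>r. \<not> (f \<le> \<tau> / 2 ^ r / 2 \<and> \<tau> < 16 * real k * (\<tau> / 2 ^ r))", OF ex])
  show "f \<le> \<tau> / 2 ^ r / 2 \<and> \<tau> < 16 * real k * (\<tau> / 2 ^ r)" if "r < ring \<tau> k f"
    using not_less_Least[where P = "\<lambda>r. \<not> (f \<le> \<tau> / 2 ^ r / 2 \<and> \<tau> < 16 * real k * (\<tau> / 2 ^ r))", of r] that
    unfolding ring_def by blast
qed

text \<open>Center and ring are packed into one number that can address arrays. For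
  \<open>G i < k\<close> they are recovered by \<open>mod k\<close> and \<open>div k\<close> after
  subtracting the 1 that keeps id 0 for far points.\<close>

definition stratum :: "(nat \<Rightarrow> real) \<Rightarrow> (nat \<Rightarrow> nat) \<Rightarrow> nat \<Rightarrow> real \<Rightarrow> nat \<Rightarrow> nat" where
  "stratum F G k \<tau> i = (if \<tau> < F i then 0 else 1 + G i + k * ring \<tau> k (F i))"

text \<open>\<open>pred_block X N\<close> is the block size for a stratum with \<open>N\<close> points minus one.\<close>

fun pred_block :: "real \<Rightarrow> nat \<Rightarrow> nat" where
  "pred_block X 0 = 0"
| "pred_block X (Suc N) = (if X * real (Suc N) < real (pred_block X N + 2) then pred_block X N else pred_block X N + 1)"

text \<open>Together these say that \<open>pred_block X N + 1\<close> is the larger of 1 and the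
  floor of \<open>X * N\<close>. As \<open>X \<le> 1\<close>, each new point raises the floor by at
  most one, so the block size can be maintained by increments.\<close>

lemma pred_block_props:
  assumes "0 < X" "X \<le> 1"
  shows "pred_block X N = 0 \<or> real (pred_block X N + 1) \<le> X * real N" "X * real N < real (pred_block X N + 2)"
proof -
  have "(pred_block X N = 0 \<or> real (pred_block X N + 1) \<le> X * real N) \<and> X * real N < real (pred_block X N + 2)"
  proof (induction N)
    case (Suc N)
    have "X * real (Suc N) = X * real N + X" by (simp add: algebra_simps)
    then show ?case using Suc assms by (auto simp del: of_nat_Suc) 
  qed simp
  then show "pred_block X N = 0 \<or> real (pred_block X N + 1) \<le> X * real N" "X * real N < real (pred_block X N + 2)"
    by blast+
qed

text \<open>Up to logarithms and powers of \<open>z\<close> this is the cover exponent per center: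
  the grid serves dimensions below \<open>1 / \<epsilon>^2\<close>, the perceptron the
  others.\<close>

definition eff_dim :: "nat \<Rightarrow> real \<Rightarrow> real" where
  "eff_dim d \<epsilon> = (if real d < 1 / (\<epsilon> * \<epsilon>) then real d else 1 / (\<epsilon> * \<epsilon>))"

definition complexity :: "nat \<Rightarrow> nat \<Rightarrow> real \<Rightarrow> real" where
  "complexity k d \<epsilon> = real k * eff_dim d \<epsilon> / (\<epsilon> * \<epsilon>)"

text \<open>A block holds about this fraction of its stratum. The logarithm compensates for the
  logarithm of the sample size in the cover exponent, and \<open>D powr z\<close> for constants
  exponential in \<open>z\<close>.\<close>

definition rate :: "nat \<Rightarrow> nat \<Rightarrow> real \<Rightarrow> nat \<Rightarrow> nat \<Rightarrow> real \<Rightarrow> real" where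
  "rate H D z k d \<epsilon> =
     1 / (real H * real D powr z * complexity k d \<epsilon> * (1 + ln (complexity k d \<epsilon>)))"

text \<open>One pass over the points fills array 2 with stratum ids and maintains, per stratum, the
  size in array 3 and the block size minus one in array 4.\<close>

definition strata_prog :: "nat \<Rightarrow> nat \<Rightarrow> com" where
  "strata_prog H D = Seq
    (Seq (RSet 2 (RDiv (RNat (NLit 1)) (RMul (RReg 1) (RReg 1))))
    (Seq (Cond (RLess (RNat (NReg 2)) (RReg 2)) (RSet 2 (RNat (NReg 2))) Skip)
    (Seq (RSet 3 (RDiv (RMul (RNat (NReg 1)) (RReg 2)) (RMul (RReg 1) (RReg 1))))
      (RSet 7 (RDiv (RNat (NLit 1)) (RMul (RMul (RMul (RNat (NLit H)) (RPow (RNat (NLit D)) (RReg 0))) (RReg 3))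
         (RAdd (RNat (NLit 1)) (RLn (RReg 3)))))))))
    (For 6 (NReg 0) (Seq
      (Cond (RLess (RReg 4) (RAt 2 (NReg 6))) (NPut 2 (NReg 6) (NLit 0))
        (Seq (Seq (RSet 8 (RReg 4)) (NSet 7 (NLit 0)))
        (Seq (While (BAnd (BNot (RLess (RDiv (RReg 8) (RNat (NLit 2))) (RAt 2 (NReg 6))))
                     (RLess (RReg 4) (RMul (RMul (RNat (NLit 16)) (RNat (NReg 1))) (RReg 8))))
                (Seq (RSet 8 (RDiv (RReg 8) (RNat (NLit 2)))) (NSet 7 (NAdd (NReg 7) (NLit 1)))))
          (NPut 2 (NReg 6) (NAdd (NAdd (NLit 1) (NAt 1 (NReg 6))) (NMul (NReg 1) (NReg 7)))))))
      (Seq (NSet 10 (NAt 2 (NReg 6)))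
      (Seq (NPut 3 (NReg 10) (NAdd (NAt 3 (NReg 10)) (NLit 1)))
        (Cond (RLess (RMul (RReg 7) (RNat (NAt 3 (NReg 10)))) (RNat (NAdd (NAt 4 (NReg 10)) (NLit 2))))
           Skip (NPut 4 (NReg 10) (NAdd (NAt 4 (NReg 10)) (NLit 1))))))))"

definition stratified :: "nat \<Rightarrow> nat \<Rightarrow> (nat \<Rightarrow> nat) \<Rightarrow> real \<Rightarrow> nat \<Rightarrow> store \<Rightarrow> bool" where
  "stratified n i ID X a s \<longleftrightarrow> nreg s 0 = n \<and> nreg s 5 = 0 \<and> used s = a \<and> narr s 5 = (\<lambda>_. 0) \<and>
     (\<forall>i'<i. narr s 2 i' = ID i') \<and>
     (\<forall>id. narr s 3 id = cnt (\<lambda>i. ID i = id) i \<and> narr s 4 id = pred_block X (cnt (\<lambda>i. ID i = id) i))"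

lemma (in threshold_state) runs_strata_prog:
  fixes H D :: nat and \<tau> :: real
  defines "X \<equiv> rate H D z k d \<epsilon>" and "ID \<equiv> stratum F G k \<tau>"
  assumes s: "st s" "used s = a" "rreg s 4 = \<tau>" and \<tau>: "0 \<le> \<tau>" and T: "n * (3 * k + 27) + 8 \<le> T"
  shows "runs \<omega> (strata_prog H D) s T (stratified n n ID X a)"
proof -
  let ?pre = "(Seq (RSet 2 (RDiv (RNat (NLit 1)) (RMul (RReg 1) (RReg 1))))
    (Seq (Cond (RLess (RNat (NReg 2)) (RReg 2)) (RSet 2 (RNat (NReg 2))) Skip)
    (Seq (RSet 3 (RDiv (RMul (RNat (NReg 1)) (RReg 2)) (RMul (RReg 1) (RReg 1))))
      (RSet 7 (RDiv (RNat (NLit 1)) (RMul (RMul (RMul (RNat (NLit H)) (RPow (RNat (NLit D)) (RReg 0))) (RReg 3))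
         (RAdd (RNat (NLit 1)) (RLn (RReg 3)))))))))"
  let ?while = "While (BAnd (BNot (RLess (RDiv (RReg 8) (RNat (NLit 2))) (RAt 2 (NReg 6))))
                     (RLess (RReg 4) (RMul (RMul (RNat (NLit 16)) (RNat (NReg 1))) (RReg 8))))
                (Seq (RSet 8 (RDiv (RReg 8) (RNat (NLit 2)))) (NSet 7 (NAdd (NReg 7) (NLit 1))))"
  let ?put = "NPut 2 (NReg 6) (NAdd (NAdd (NLit 1) (NAt 1 (NReg 6))) (NMul (NReg 1) (NReg 7)))"
  let ?ring = "(Seq (Seq (RSet 8 (RReg 4)) (NSet 7 (NLit 0))) (Seq ?while ?put))"
  let ?if = "Cond (RLess (RReg 4) (RAt 2 (NReg 6))) (NPut 2 (NReg 6) (NLit 0)) ?ring"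
  let ?cnt = "(Seq (NSet 10 (NAt 2 (NReg 6)))
      (Seq (NPut 3 (NReg 10) (NAdd (NAt 3 (NReg 10)) (NLit 1)))
        (Cond (RLess (RMul (RReg 7) (RNat (NAt 3 (NReg 10)))) (RNat (NAdd (NAt 4 (NReg 10)) (NLit 2))))
           Skip (NPut 4 (NReg 10) (NAdd (NAt 4 (NReg 10)) (NLit 1))))))"
  define Base where "Base = (\<lambda>i s. stratified n i ID X a s \<and> nreg s 6 = i \<and> nreg s 1 = k \<and> rreg s 4 = \<tau> \<and> rreg s 7 = X \<and>
    (\<forall>i<n. rarr s 2 i = F i \<and> narr s 1 i = G i))"
  have 1: "runs \<omega> ?pre s 6 (\<lambda>s. st s \<and> used s = a \<and> rreg s 4 = \<tau> \<and> rreg s 7 = X)"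
    using s by (intro runs_loop_free) (simp_all add: st_def env_def X_def rate_def complexity_def eff_dim_def)
  have 2: "runs \<omega> (For 6 (NReg 0) (Seq ?if ?cnt)) s (n * (3 * k + 27) + 2) (stratified n n ID X a)"
    if s2: "st s \<and> used s = a \<and> rreg s 4 = \<tau> \<and> rreg s 7 = X" for s
  proof (rule runs_For[where Inv = Base and n = n and B = "3 * k + 25"])
    fix i s assume i: "i < n" and B: "Base i s"
    show "runs \<omega> (Seq ?if ?cnt) s (3 * k + 25) (\<lambda>u. nreg u 6 = i \<and> Base (Suc i) (u\<lparr>nreg := (nreg u)(6 := Suc i)\<rparr>))"
    proof (rule runs_Seq[where R = "\<lambda>s. Base i s \<and> narr s 2 i = ID i"])
      show "runs \<omega> ?if s (Suc (3 * k + 16)) (\<lambda>s. Base i s \<and> narr s 2 i = ID i)"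
      proof (rule runs_Cond)
        assume "bval (RLess (RReg 4) (RAt 2 (NReg 6))) s"
        then show "runs \<omega> (NPut 2 (NReg 6) (NLit 0)) s (3 * k + 16) (\<lambda>s. Base i s \<and> narr s 2 i = ID i)"
          using B i by (intro runs_loop_free) (simp_all add: Base_def stratified_def ID_def stratum_def)
      next
        assume "\<not> bval (RLess (RReg 4) (RAt 2 (NReg 6))) s"
        then have nf: "\<not> \<tau> < F i" using B i by (auto simp: Base_def)
        define J where "J = (\<lambda>r s. Base i s \<and> rreg s 8 = \<tau> / 2 ^ r \<and> nreg s 7 = r)"
        let ?R = "ring \<tau> k (F i)"
        have a: "runs \<omega> (Seq (RSet 8 (RReg 4)) (NSet 7 (NLit 0))) s 2 (J 0)"
          using B by (intro runs_loop_free) (simp_all add: J_def Base_def stratified_def)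
        have b: "runs \<omega> ?while s ((k + 4) * 3 + 1) (J ?R)" if "J 0 s" for s
        proof (rule runs_While[where R = ?R and Inv = J and B = 2])
          fix r s assume r: "r < ?R" and J: "J r s"
          have h: "\<tau> / 2 ^ r / 2 = \<tau> / 2 ^ Suc r" by simp
          show "bval (BAnd (BNot (RLess (RDiv (RReg 8) (RNat (NLit 2))) (RAt 2 (NReg 6))))
                     (RLess (RReg 4) (RMul (RMul (RNat (NLit 16)) (RNat (NReg 1))) (RReg 8)))) s \<and>
             runs \<omega> (Seq (RSet 8 (RDiv (RReg 8) (RNat (NLit 2)))) (NSet 7 (NAdd (NReg 7) (NLit 1)))) s 2 (J (Suc r))"
            using ring_props(2)[OF \<tau> r] J i
            by (intro conjI runs_loop_free) (auto simp: J_def Base_def stratified_def not_less)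
        next
          fix s assume J: "J ?R s"
          show "\<not> bval (BAnd (BNot (RLess (RDiv (RReg 8) (RNat (NLit 2))) (RAt 2 (NReg 6))))
                     (RLess (RReg 4) (RMul (RMul (RNat (NLit 16)) (RNat (NReg 1))) (RReg 8)))) s \<and> J ?R s"
            using ring_props(1)[OF \<tau>, of "F i" k] J i by (auto simp: J_def Base_def stratified_def not_less)
        next
          show "?R * (2 + 1) + 1 \<le> (k + 4) * 3 + 1" using ring_props(3)[OF \<tau>, of k "F i"] by simp
        qed (use that in auto)
        have c: "runs \<omega> ?put s 1 (\<lambda>s. Base i s \<and> narr s 2 i = ID i)" if "J ?R s" for s
          using that i nf by (intro runs_loop_free) (simp_all add: J_def Base_def stratified_def ID_def stratum_def)
        show "runs \<omega> ?ring s (3 * k + 16) (\<lambda>s. Base i s \<and> narr s 2 i = ID i)"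
          by (rule runs_Seq[OF a runs_Seq[OF b c]]) (auto simp: algebra_simps)
      qed
      fix s assume "Base i s \<and> narr s 2 i = ID i"
      then show "runs \<omega> ?cnt s 5 (\<lambda>u. nreg u 6 = i \<and> Base (Suc i) (u\<lparr>nreg := (nreg u)(6 := Suc i)\<rparr>))"
        by (intro runs_loop_free) (simp_all add: Base_def stratified_def less_Suc_eq)
    qed simp
  qed (use s2 in \<open>simp_all add: Base_def stratified_def st_def env_def\<close>)
  show ?thesis unfolding strata_prog_def
    by (rule runs_Seq[OF 1 2]) (use T in auto)
qed

section \<open>Block sampling\<close>

lemma cnt_surj: "r < cnt P n \<Longrightarrow> \<exists>i<n. P i \<and> cnt P i = r"
proof (induction n)
  case (Suc n)
  show ?case
  proof (cases "r < cnt P n")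
    case True
    then show ?thesis using Suc.IH less_Suc_eq by blast
  next
    case False
    then have "P n \<and> cnt P n = r" using Suc.prems by (simp split: if_splits)
    then show ?thesis by blast
  qed
qed simp

lemma cnt_inj: "P i \<Longrightarrow> P j \<Longrightarrow> cnt P i = cnt P j \<Longrightarrow> i = j"
  using cnt_strict[of i j P] cnt_strict[of j i P] by (metis linorder_neqE_nat less_irrefl)

lemma multiples_gap: "x < y \<Longrightarrow> x mod b = 0 \<Longrightarrow> y mod b = 0 \<Longrightarrow> x + b \<le> (y::nat)"
proof -
  assume a: "x < y" "x mod b = 0" "y mod b = 0"
  then have "b dvd y - x" by (simp add: dvd_diff_nat mod_0_imp_dvd)
  then have "b \<le> y - x" using a by (intro dvd_imp_le) auto
  then show ?thesis using a by simp
qed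

text \<open>
  \<open>pnt g r\<close> is the point of rank \<open>r\<close> in stratum \<open>g\<close>.  A point \<open>p\<close> opens a block if its rank is a
  multiple of the block size; \<open>bs p\<close> is the size of that block, and the point selected from it is
  determined by coin \<open>a + p\<close>.
\<close>

locale block_sampling =
  fixes n :: nat and ID :: "nat \<Rightarrow> nat" and B :: "nat \<Rightarrow> nat" and a :: nat and \<omega> :: "nat \<Rightarrow> real"
  assumes B: "\<And>g. 1 \<le> B g" and \<omega>: "\<And>i. 0 \<le> \<omega> i"
begin

definition N :: "nat \<Rightarrow> nat" where "N g = cnt (\<lambda>i. ID i = g) n"
definition q :: "nat \<Rightarrow> nat \<Rightarrow> nat" where "q g i = cnt (\<lambda>i. ID i = g) i"
definition rk :: "nat \<Rightarrow> nat" where "rk i = q (ID i) i"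
definition pnt :: "nat \<Rightarrow> nat \<Rightarrow> nat" where "pnt g r = (THE i. i < n \<and> ID i = g \<and> rk i = r)"
definition opens :: "nat \<Rightarrow> bool" where "opens p \<longleftrightarrow> rk p mod B (ID p) = 0"
definition bs :: "nat \<Rightarrow> nat" where "bs p = min (B (ID p)) (N (ID p) - rk p)"
definition sel :: "nat \<Rightarrow> nat" where "sel p = pnt (ID p) (rk p + cell (bs p) (\<omega> (a + p)))"

lemma pnt_eqI: "i < n \<Longrightarrow> ID i = g \<Longrightarrow> rk i = r \<Longrightarrow> pnt g r = i"
  unfolding pnt_def by (rule the_equality) (auto simp: rk_def q_def intro: cnt_inj[of "\<lambda>j. ID j = ID i"])

lemma pnt_props:
  assumes "r < N g"
  shows "pnt g r < n" "ID (pnt g r) = g" "rk (pnt g r) = r"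
proof -
  obtain i where i: "i < n" "ID i = g" "rk i = r"
    using cnt_surj[of r "\<lambda>i. ID i = g" n] assms by (auto simp: N_def rk_def q_def)
  then have "pnt g r = i" by (rule pnt_eqI)
  with i show "pnt g r < n" "ID (pnt g r) = g" "rk (pnt g r) = r" by auto
qed

lemma rk_less: "i < n \<Longrightarrow> rk i < N (ID i)"
  unfolding rk_def q_def N_def by (rule cnt_strict) auto

lemma q_Suc: "q g (Suc i) = (if ID i = g then Suc (q g i) else q g i)"
  by (simp add: q_def)

lemma bs_pos: "p < n \<Longrightarrow> 1 \<le> bs p"
  using rk_less[of p] B[of "ID p"] by (simp add: bs_def)

lemma cell_bs: "p < n \<Longrightarrow> cell (bs p) (\<omega> (a + p)) < bs p"
  using cell_props(1)[OF bs_pos \<omega>] .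

text \<open>The state kept for stratum \<open>g\<close> after \<open>x\<close> of its points:
  position \<open>ps\<close> in the current block (0 between blocks), points \<open>rm\<close>
  remaining beyond that block, its output slot, its size \<open>s\<close> and its coin
  \<open>u\<close>.\<close>

definition ok_at :: "nat \<Rightarrow> nat \<Rightarrow> nat \<Rightarrow> nat \<Rightarrow> nat \<Rightarrow> nat \<Rightarrow> real \<Rightarrow> bool" where
  "ok_at g x rm ps slot s u \<longleftrightarrow> ps = x mod B g \<and> (ps = 0 \<longrightarrow> rm = N g - x) \<and>
     (ps \<noteq> 0 \<longrightarrow> s = bs (pnt g (x - ps)) \<and> rm = N g - (x - ps) - s \<and>
        u = \<omega> (a + pnt g (x - ps)) \<and> slot = cnt opens (pnt g (x - ps)))"

text \<open>A slot holds the last point seen whose offset in the block is at most the cell, hence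
  the \<open>min\<close>. \<open>ok_at\<close> is demanded only while points of the stratum are
  still to come, because a short final block resets its position before a multiple of the block size
  is reached.\<close>

definition binv :: "nat \<Rightarrow> (nat \<Rightarrow> nat) \<Rightarrow> (nat \<Rightarrow> nat) \<Rightarrow> (nat \<Rightarrow> nat) \<Rightarrow> (nat \<Rightarrow> nat) \<Rightarrow> (nat \<Rightarrow> real) \<Rightarrow>
    nat \<Rightarrow> (nat \<Rightarrow> nat) \<Rightarrow> (nat \<Rightarrow> real) \<Rightarrow> bool" where
  "binv i rem pos sl sz U l out wt \<longleftrightarrow> l = cnt opens i \<and>
     (\<forall>g. q g i < N g \<longrightarrow> ok_at g (q g i) (rem g) (pos g) (sl g) (sz g) (U g)) \<and>
     (\<forall>p<i. opens p \<longrightarrow> wt (cnt opens p) = real (bs p) \<and>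
        out (cnt opens p) = pnt (ID p) (rk p + min (cell (bs p) (\<omega> (a + p))) (q (ID p) i - rk p - 1)))"

text \<open>By truncated subtraction \<open>s\<close> is the minimum of \<open>rem g\<close> and
  \<open>B g\<close>. Earlier slots of the same stratum are complete, since ranks that open blocks
  differ by at least \<open>B g\<close>.\<close>

lemma binv_open:
  assumes i: "i < n" and binv: "binv i rem pos sl sz U l out wt" and g: "g = ID i" and p0: "pos g = 0"
    and s: "s = rem g - (rem g - B g)"
  shows "binv (Suc i) (rem(g := rem g - s)) (if 1 < s then pos(g := 1) else pos(g := 0)) (sl(g := l)) (sz(g := s))
     (U(g := \<omega> (a + i))) (Suc l) (out(l := i)) (wt(l := real s))"
proof -
  have qN: "q g i < N g" using rk_less[OF i] by (simp add: rk_def g)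
  have l: "l = cnt opens i" and m0: "q g i mod B g = 0" and rem: "rem g = N g - q g i"
    using binv qN p0 unfolding binv_def ok_at_def by metis+
  have op: "opens i" using m0 by (simp add: opens_def rk_def g)
  have bsi: "bs i = min (B g) (N g - q g i)" by (simp add: bs_def rk_def g)
  have s': "s = bs i" "1 \<le> s" unfolding bsi s rem using qN B[of g] by auto
  have pi: "pnt g (q g i) = i" using i by (intro pnt_eqI) (auto simp: g rk_def)
  let ?pos = "if 1 < s then pos(g := 1) else pos(g := 0)"
  have 2: "ok_at g' (q g' (Suc i)) ((rem(g := rem g - s)) g') (?pos g') ((sl(g := l)) g') ((sz(g := s)) g') ((U(g := \<omega> (a + i))) g')"
    if q': "q g' (Suc i) < N g'" for g'
  proof (cases "g' = g")
    case False
    then have "q g' (Suc i) = q g' i" by (simp add: q_Suc g)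
    then show ?thesis using binv q' False by (simp add: binv_def)
  next
    case True
    have qs: "q g (Suc i) = Suc (q g i)" by (simp add: q_Suc g)
    have q2: "Suc (q g i) < N g" using q' True qs by simp
    show ?thesis
    proof (cases "B g = 1")
      case B1: True
      then have "s = 1" using s' qN by (simp add: bs_def rk_def g[symmetric])
      then show ?thesis using True qs B1 rem by (simp add: ok_at_def)
    next
      case False
      then have B2: "2 \<le> B g" using B[of g] by linarith
      then have "2 \<le> s" using s'(1) q2 by (simp add: bs_def rk_def g[symmetric])
      moreover have "Suc (q g i) mod B g = 1" using m0 B2 by (simp add: mod_Suc)
      ultimately show ?thesis using True qs pi s'(1) rem l by (simp add: ok_at_def)
    qed
  qed
  have 3: "(wt(l := real s)) (cnt opens p) = real (bs p) \<and>
        (out(l := i)) (cnt opens p) = pnt (ID p) (rk p + min (cell (bs p) (\<omega> (a + p))) (q (ID p) (Suc i) - rk p - 1))"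
    if p: "p < Suc i" "opens p" for p
  proof (cases "p = i")
    case True
    have "q (ID i) (Suc i) - rk i - 1 = 0" by (simp add: q_Suc rk_def)
    then show ?thesis using True l s' pi by (simp add: rk_def g[symmetric])
  next
    case False
    then have pi': "p < i" using p by simp
    have "cnt opens p < l" unfolding l using pi' p by (intro cnt_strict) auto
    moreover have "min (cell (bs p) (\<omega> (a + p))) (q (ID p) (Suc i) - rk p - 1) = min (cell (bs p) (\<omega> (a + p))) (q (ID p) i - rk p - 1)"
    proof (cases "ID p = g")
      case True
      have "rk p < q g i" unfolding rk_def q_def True using pi' True by (intro cnt_strict) auto
      then have "rk p + B g \<le> q g i" using m0 p True by (intro multiples_gap) (auto simp: opens_def)
      moreover have "cell (bs p) (\<omega> (a + p)) < B g" using cell_bs[of p] pi' i True by (simp add: bs_def)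
      ultimately show ?thesis using True by (simp add: q_Suc)
    qed (simp add: q_Suc g)
    ultimately show ?thesis using binv pi' p unfolding binv_def by simp
  qed
  show ?thesis unfolding binv_def using 2 3 l op by simp
qed

text \<open>The comparison of coin and position succeeds up to the cell of the coin, so exactly
  until then the slot is overwritten by the current point.\<close>

lemma binv_continue:
  assumes i: "i < n" and binv: "binv i rem pos sl sz U l out wt" and g: "g = ID i" and p0: "pos g \<noteq> 0"
  shows "binv (Suc i) rem (if pos g + 1 < sz g then pos(g := pos g + 1) else pos(g := 0)) sl sz U l
     (if U g * real (sz g) < real (pos g) then out else out(sl g := i)) wt"
proof -
  have qN: "q g i < N g" using rk_less[OF i] by (simp add: rk_def g)
  define st where "st = q g i - pos g"
  define b where "b = pnt g st"
  have l: "l = cnt opens i" and pos: "pos g = q g i mod B g" and rem: "rem g = N g - st - sz g"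
    and sz: "sz g = bs b" and U: "U g = \<omega> (a + b)" and sl: "sl g = cnt opens b"
    using binv qN p0 unfolding binv_def ok_at_def st_def b_def by metis+
  have Bp: "0 < B g" using B[of g] by linarith
  have "pos g \<le> q g i" unfolding pos by (rule mod_less_eq_dividend)
  then have stq: "st < q g i" "q g i = st + pos g" using p0 by (auto simp: st_def)
  have st0: "st mod B g = 0" unfolding st_def pos by (simp add: minus_mod_eq_mult_div)
  note stq = stq st0
  have b: "b < n" "ID b = g" "rk b = st" unfolding b_def using pnt_props[of st g] stq qN by auto
  have opb: "opens b" using b stq by (simp add: opens_def)
  have bi: "b < i"
  proof (rule ccontr)
    assume "\<not> b < i"
    then have "q g i \<le> q g b" unfolding q_def by (intro cnt_mono) auto
    then show False using b stq by (simp add: rk_def)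
  qed
  have bsb: "bs b = min (B g) (N g - st)" using b by (simp add: bs_def)
  have "pos g < B g" unfolding pos by (rule mod_less_divisor[OF Bp])
  then have posb: "pos g < bs b" using qN stq(2) unfolding bsb by simp
  have iff: "U g * real (sz g) < real (pos g) \<longleftrightarrow> cell (bs b) (\<omega> (a + b)) < pos g"
    unfolding U sz using cell_props(3)[OF bs_pos[OF b(1)] \<omega> posb, of "a + b"] by linarith
  have pi: "pnt g (st + pos g) = i" using i stq by (intro pnt_eqI) (auto simp: g rk_def)
  let ?pos = "if pos g + 1 < sz g then pos(g := pos g + 1) else pos(g := 0)"
  let ?out = "if U g * real (sz g) < real (pos g) then out else out(sl g := i)"
  have 2: "ok_at g' (q g' (Suc i)) (rem g') (?pos g') (sl g') (sz g') (U g')"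
    if q': "q g' (Suc i) < N g'" for g'
  proof (cases "g' = g")
    case False
    then have "q g' (Suc i) = q g' i" by (simp add: q_Suc g)
    then show ?thesis using binv q' False by (simp add: binv_def)
  next
    case True
    have qs: "q g (Suc i) = Suc (q g i)" by (simp add: q_Suc g)
    have q2: "Suc (q g i) < N g" using q' True qs by simp
    show ?thesis
    proof (cases "Suc (pos g) = B g")
      case TB: True
      then have "Suc (q g i) mod B g = 0" using pos by (simp add: mod_Suc)
      moreover have "sz g = B g" unfolding sz bsb using q2 stq TB by simp
      moreover have "rem g = N g - Suc (q g i)" using rem stq TB \<open>sz g = B g\<close> by simp
      ultimately show ?thesis using True qs TB by (simp add: ok_at_def)
    next
      case False
      then have m: "Suc (q g i) mod B g = Suc (pos g)" using pos by (simp add: mod_Suc)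
      have "pos g + 1 < B g" using False pos Bp mod_less_divisor[OF Bp, of "q g i"] by linarith
      then have "pos g + 1 < sz g" unfolding sz bsb using q2 stq by simp
      moreover have "Suc (q g i) - Suc (pos g) = st" by (simp add: st_def)
      ultimately show ?thesis using True qs m sz rem U sl by (simp add: ok_at_def b_def[symmetric])
    qed
  qed
  have 3: "wt (cnt opens p) = real (bs p) \<and>
        ?out (cnt opens p) = pnt (ID p) (rk p + min (cell (bs p) (\<omega> (a + p))) (q (ID p) (Suc i) - rk p - 1))"
    if p: "p < Suc i" "opens p" for p
  proof -
    have "\<not> opens i" using p0 pos by (simp add: opens_def rk_def g)
    then have pi': "p < i" using p by (cases "p = i") auto
    have old: "wt (cnt opens p) = real (bs p)"
      "out (cnt opens p) = pnt (ID p) (rk p + min (cell (bs p) (\<omega> (a + p))) (q (ID p) i - rk p - 1))"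
      using binv pi' p unfolding binv_def by auto
    show ?thesis
    proof (cases "p = b")
      case True
      have e: "q g (Suc i) - st - 1 = pos g" "q g i - st - 1 = pos g - 1" using stq by (auto simp: q_Suc g)
      show ?thesis
      proof (cases "cell (bs b) (\<omega> (a + b)) < pos g")
        case lt: True
        then have "min (cell (bs b) (\<omega> (a + b))) (pos g) = min (cell (bs b) (\<omega> (a + b))) (pos g - 1)" by simp
        then show ?thesis using old lt iff True b e by simp
      next
        case False
        then show ?thesis using old(1) iff True b e sl pi by simp
      qed
    next
      case False
      have "cnt opens p \<noteq> sl g" unfolding sl using False p opb cnt_inj[of opens p b] by auto
      moreover have "min (cell (bs p) (\<omega> (a + p))) (q (ID p) (Suc i) - rk p - 1) = min (cell (bs p) (\<omega> (a + p))) (q (ID p) i - rk p - 1)"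
      proof (cases "ID p = g")
        case True
        have rq: "rk p < q g i" unfolding rk_def q_def True using pi' True by (intro cnt_strict) auto
        have "rk p \<noteq> st" using False b True pnt_eqI[of p g st] pi' i by (auto simp: b_def)
        moreover have "rk p \<le> st"
        proof (rule ccontr)
          assume "\<not> rk p \<le> st"
          then have "st + B g \<le> rk p" using stq p True by (intro multiples_gap) (auto simp: opens_def)
          then show False using rq stq pos mod_less_divisor[OF Bp, of "q g i"] by linarith
        qed
        ultimately have "rk p + B g \<le> st" using stq p True by (intro multiples_gap) (auto simp: opens_def)
        moreover have "cell (bs p) (\<omega> (a + p)) < B g" using cell_bs[of p] pi' i True by (simp add: bs_def)
        ultimately show ?thesis using True stq by (simp add: q_Suc)
      qed (simp add: q_Suc g)
      ultimately show ?thesis using old by simp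
    qed
  qed
  have "\<not> opens i" using p0 pos by (simp add: opens_def rk_def g)
  then show ?thesis unfolding binv_def using 2 3 l by simp
qed

text \<open>A coin is drawn at every point, which ties coin \<open>a + p\<close> to index
  \<open>p\<close>, but it is stored only when a block opens. The opening point then passes the
  comparison at position 0 and enters its slot like any later point.\<close>

definition block_body :: com where
  "block_body = Seq (Seq (NSet 10 (NAt 2 (NReg 6))) (Sample 6))
    (Seq (Cond (NLess (NAt 5 (NReg 10)) (NLit 1))
        (Seq (RPut 3 (NReg 10) (RReg 6))
        (Seq (NPut 7 (NReg 10) (NSub (NAt 3 (NReg 10)) (NSub (NAt 3 (NReg 10)) (NAdd (NAt 4 (NReg 10)) (NLit 1)))))
        (Seq (NPut 3 (NReg 10) (NSub (NAt 3 (NReg 10)) (NAt 7 (NReg 10))))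
        (Seq (NPut 6 (NReg 10) (NReg 5))
        (Seq (RPut 0 (NReg 5) (RNat (NAt 7 (NReg 10))))
          (NSet 5 (NAdd (NReg 5) (NLit 1))))))))
        Skip)
    (Seq (Cond (RLess (RMul (RAt 3 (NReg 10)) (RNat (NAt 7 (NReg 10)))) (RNat (NAt 5 (NReg 10))))
        Skip (NPut 0 (NAt 6 (NReg 10)) (NReg 6)))
      (Cond (NLess (NAdd (NAt 5 (NReg 10)) (NLit 1)) (NAt 7 (NReg 10)))
        (NPut 5 (NReg 10) (NAdd (NAt 5 (NReg 10)) (NLit 1))) (NPut 5 (NReg 10) (NLit 0)))))"

end

definition block_prog :: com where
  "block_prog = Seq (For 6 (NReg 0) block_sampling.block_body) (NSet 0 (NReg 5))"

context block_sampling
begin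

lemma runs_block_prog:
  assumes s: "nreg s 0 = n" "nreg s 5 = 0" "used s = a" "narr s 5 = (\<lambda>_. 0)"
    "\<And>i. i < n \<Longrightarrow> narr s 2 i = ID i" "\<And>g. narr s 3 g = N g" "\<And>g. Suc (narr s 4 g) = B g"
    and T: "n * 19 + 3 \<le> T"
  shows "runs \<omega> block_prog s T (\<lambda>t. nreg t 0 = cnt opens n \<and>
      (\<forall>p<n. opens p \<longrightarrow> rarr t 0 (cnt opens p) = real (bs p) \<and> narr t 0 (cnt opens p) = sel p))"
proof -
  define Inv where "Inv = (\<lambda>i (t::store). nreg t 0 = n \<and> nreg t 6 = i \<and> used t = a + i \<and> (\<forall>i<n. narr t 2 i = ID i) \<and>
     (\<forall>g. Suc (narr t 4 g) = B g) \<and>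
     binv i (narr t 3) (narr t 5) (narr t 6) (narr t 7) (rarr t 3) (nreg t 5) (narr t 0) (rarr t 0))"
  have 1: "runs \<omega> (For 6 (NReg 0) block_body) s (n * 19 + 2) (Inv n)"
  proof (rule runs_For[where Inv = Inv and n = n and B = 17])
    fix i t assume i: "i < n" and Inv: "Inv i t"
    have I: "nreg t 0 = n" "nreg t 6 = i" "used t = a + i" "\<forall>i<n. narr t 2 i = ID i" "\<forall>g. Suc (narr t 4 g) = B g"
     "binv i (narr t 3) (narr t 5) (narr t 6) (narr t 7) (rarr t 3) (nreg t 5) (narr t 0) (rarr t 0)"
      using Inv by (auto simp: Inv_def)
    show "runs \<omega> block_body t 17 (\<lambda>u. nreg u 6 = i \<and> Inv (Suc i) (u\<lparr>nreg := (nreg u)(6 := Suc i)\<rparr>))"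
    proof (intro runs_loop_free)
      show "loop_free block_body" "csize block_body \<le> 17" by (simp_all add: block_body_def)
      define u where "u = sem \<omega> block_body t"
      define g where "g = ID i"
      have I2: "narr t 2 i = g" using I(4) i by (simp add: g_def)
      have I4: "narr t 4 g + 1 = B g" using I(5) by simp
      have "nreg u 6 = i \<and> Inv (Suc i) (u\<lparr>nreg := (nreg u)(6 := Suc i)\<rparr>)"
      proof (cases "narr t 5 g = 0")
        case True
        define s where "s = narr t 3 g - (narr t 3 g - B g)"
        have nn: "\<not> \<omega> (a + i) * real s < 0" using \<omega>[of "a + i"] by (simp add: not_less)
        note [simp] = I(2,3) I2 I4[simplified] True s_def[symmetric] nn
        have u: "nreg u 0 = nreg t 0" "nreg u 6 = i" "nreg u 5 = Suc (nreg t 5)" "used u = Suc (a + i)"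
          "narr u 2 = narr t 2" "narr u 4 = narr t 4" "narr u 3 = (narr t 3)(g := narr t 3 g - s)"
          "narr u 5 = (if 1 < s then (narr t 5)(g := 1) else (narr t 5)(g := 0))"
          "narr u 6 = (narr t 6)(g := nreg t 5)" "narr u 7 = (narr t 7)(g := s)"
          "rarr u 3 = (rarr t 3)(g := \<omega> (a + i))" "narr u 0 = (narr t 0)(nreg t 5 := i)"
          "rarr u 0 = (rarr t 0)(nreg t 5 := real s)"
          by (simp_all add: u_def block_body_def)
        have "binv (Suc i) (narr u 3) (narr u 5) (narr u 6) (narr u 7) (rarr u 3) (nreg u 5) (narr u 0) (rarr u 0)"
          unfolding u by (rule binv_open[OF i I(6) g_def True s_def])
        then show ?thesis using I u(1-6) by (simp add: Inv_def)
      next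
        case False
        note [simp] = I(2,3) I2 False
        have u: "nreg u 0 = nreg t 0" "nreg u 6 = i" "nreg u 5 = nreg t 5" "used u = Suc (a + i)"
          "narr u 2 = narr t 2" "narr u 4 = narr t 4" "narr u 3 = narr t 3"
          "narr u 5 = (if narr t 5 g + 1 < narr t 7 g then (narr t 5)(g := narr t 5 g + 1) else (narr t 5)(g := 0))"
          "narr u 6 = narr t 6" "narr u 7 = narr t 7" "rarr u 3 = rarr t 3"
          "narr u 0 = (if rarr t 3 g * real (narr t 7 g) < real (narr t 5 g) then narr t 0 else (narr t 0)(narr t 6 g := i))"
          "rarr u 0 = rarr t 0"
          by (simp_all add: u_def block_body_def)
        have "binv (Suc i) (narr u 3) (narr u 5) (narr u 6) (narr u 7) (rarr u 3) (nreg u 5) (narr u 0) (rarr u 0)"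
          unfolding u by (rule binv_continue[OF i I(6) g_def False])
        then show ?thesis using I u(1-6) by (simp add: Inv_def)
      qed
      then show "nreg (sem \<omega> block_body t) 6 = i \<and> Inv (Suc i) ((sem \<omega> block_body t)\<lparr>nreg := (nreg (sem \<omega> block_body t))(6 := Suc i)\<rparr>)"
        by (simp only: u_def)
    qed
  next
    show "Inv 0 (s\<lparr>nreg := (nreg s)(6 := 0)\<rparr>)"
      using s by (simp add: Inv_def binv_def ok_at_def q_def)
  qed (auto simp: Inv_def)
  have 2: "runs \<omega> (NSet 0 (NReg 5)) t 1 (\<lambda>t. nreg t 0 = cnt opens n \<and>
      (\<forall>p<n. opens p \<longrightarrow> rarr t 0 (cnt opens p) = real (bs p) \<and> narr t 0 (cnt opens p) = sel p))" if t: "Inv n t" for t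
  proof -
    \<comment> \<open>After the pass every block has been seen completely, so the last offset is at
      least \<open>bs p - 1\<close> and the slot holds the intended point.\<close>
    have "min (cell (bs p) (\<omega> (a + p))) (q (ID p) n - rk p - 1) = cell (bs p) (\<omega> (a + p))" if "p < n" for p
    proof -
      have "bs p \<le> q (ID p) n - rk p" by (simp add: bs_def N_def q_def)
      then show ?thesis using cell_bs[OF that] by (intro min_absorb1) linarith
    qed
    then show ?thesis
      using t by (intro runs_loop_free) (auto simp: Inv_def binv_def sel_def)
  qed
  show ?thesis unfolding block_prog_def by (rule runs_Seq[OF 1 2]) (use T in auto)
qed

end

section \<open>Strata as block samples\<close>

definition covers :: "nat \<Rightarrow> nat \<Rightarrow> real \<Rightarrow> real \<Rightarrow> point set \<Rightarrow> point set set \<Rightarrow> bool" where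
  "covers d k e \<Phi> Z F \<longleftrightarrow> finite F \<and> real (card F) \<le> \<Phi> \<and>
     (\<forall>C\<in>center_sets d k. \<forall>t\<ge>0. \<exists>B\<in>F. {p\<in>Z. cdist p C \<le> t} \<subseteq> B \<and> B \<subseteq> {p\<in>Z. cdist p C \<le> e * t})"

context block_sampling
begin

definition openings :: "nat \<Rightarrow> nat set" where
  "openings g = {p. p < n \<and> ID p = g \<and> opens p}"

lemma finite_openings [simp]: "finite (openings g)"
  by (simp add: openings_def)

lemma sum_stratum: "(\<Sum>r<N g. h (pnt g r)) = (\<Sum>p | p < n \<and> ID p = g. h p)" for h :: "nat \<Rightarrow> 'c::comm_monoid_add"
  by (rule sum.reindex_bij_witness[of _ rk "pnt g"]) (use rk_less in \<open>auto simp: pnt_props intro: pnt_eqI\<close>)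

lemma opening_of_rank:
  assumes r: "r < N g"
  shows "pnt g (r - r mod B g) \<in> openings g" "rk (pnt g (r - r mod B g)) = r - r mod B g"
    "r mod B g < bs (pnt g (r - r mod B g))"
proof -
  have r': "r - r mod B g < N g" using r by simp
  note p = pnt_props[OF r']
  have Bp: "0 < B g" using B[of g] by linarith
  show "pnt g (r - r mod B g) \<in> openings g"
    using p by (simp add: openings_def opens_def minus_mod_eq_mult_div)
  show "rk (pnt g (r - r mod B g)) = r - r mod B g" using p by simp
  have "r mod B g < B g" by (rule mod_less_divisor[OF Bp])
  moreover have "r mod B g < N g - (r - r mod B g)" using r mod_less_eq_dividend[of r "B g"] by linarith
  ultimately show "r mod B g < bs (pnt g (r - r mod B g))" using p by (simp add: bs_def)
qed

lemma block_in_stratum: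
  assumes "p \<in> openings g" "x < bs p"
  shows "rk p + x < N g" "(rk p + x) mod B g = x"
proof -
  have x: "x < B g" "x < N g - rk p" using assms by (auto simp: openings_def bs_def)
  then show "rk p + x < N g" by linarith
  have "rk p mod B g = 0" using assms by (auto simp: openings_def opens_def)
  then have "(rk p + x) mod B g = (0 + x) mod B g" by (metis mod_add_left_eq)
  then show "(rk p + x) mod B g = x" using x by simp
qed

text \<open>Division with remainder: a rank \<open>r\<close> splits into the start of its block and
  the offset \<open>r mod B g\<close>.\<close>

lemma sum_blocks:
  "(\<Sum>p\<in>openings g. \<Sum>x<bs p. h (pnt g (rk p + x))) = (\<Sum>p | p < n \<and> ID p = g. h p)"
  for h :: "nat \<Rightarrow> 'c::comm_monoid_add"
proof -
  have "(\<Sum>p\<in>openings g. \<Sum>x<bs p. h (pnt g (rk p + x)))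
      = (\<Sum>(p, x)\<in>(SIGMA p:openings g. {..<bs p}). h (pnt g (rk p + x)))"
    by (rule sum.Sigma) auto
  also have "\<dots> = (\<Sum>r<N g. h (pnt g r))"
  proof (rule sum.reindex_bij_witness[of _ "\<lambda>r. (pnt g (r - r mod B g), r mod B g)" "\<lambda>(p, x). rk p + x"])
    fix a assume a: "a \<in> (SIGMA p:openings g. {..<bs p})"
    then obtain p x where px: "a = (p, x)" "p \<in> openings g" "x < bs p" by blast
    note b = block_in_stratum[OF px(2,3)]
    have "pnt g (rk p) = p" using px(2) by (intro pnt_eqI) (auto simp: openings_def)
    then show "(pnt g ((case a of (p, x) \<Rightarrow> rk p + x) - (case a of (p, x) \<Rightarrow> rk p + x) mod B g), (case a of (p, x) \<Rightarrow> rk p + x) mod B g) = a"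
      using b px(1) by simp
    show "(case a of (p, x) \<Rightarrow> rk p + x) \<in> {..<N g}" using b px(1) by simp
    show "h (pnt g (case a of (p, x) \<Rightarrow> rk p + x)) = (case a of (p, x) \<Rightarrow> h (pnt g (rk p + x)))"
      using px(1) by simp
  next
    fix r assume "r \<in> {..<N g}"
    then have r: "r < N g" by simp
    show "(case (pnt g (r - r mod B g), r mod B g) of (p, x) \<Rightarrow> rk p + x) = r"
      using opening_of_rank(2)[OF r] mod_less_eq_dividend[of r "B g"] by simp
    show "(pnt g (r - r mod B g), r mod B g) \<in> (SIGMA p:openings g. {..<bs p})"
      using opening_of_rank[OF r] by simp
  qed
  also have "\<dots> = (\<Sum>p | p < n \<and> ID p = g. h p)" by (rule sum_stratum)
  finally show ?thesis .
qed

lemma sum_bs: "(\<Sum>p\<in>openings g. real (bs p)) = real (N g)"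
proof -
  have "(\<Sum>p\<in>openings g. \<Sum>x<bs p. (1::real)) = (\<Sum>p | p < n \<and> ID p = g. 1)" by (rule sum_blocks)
  then show ?thesis by (simp add: N_def cnt_def)
qed

text \<open>The quotient \<open>rk p div B g\<close> numbers the blocks of the stratum.\<close>

lemma card_openings: "real (card (openings g)) \<le> real (N g) / real (B g) + 1"
proof -
  have Bp: "0 < B g" using B[of g] by linarith
  have "inj_on (\<lambda>p. rk p div B g) (openings g)"
  proof (rule inj_onI)
    fix p p' assume a: "p \<in> openings g" "p' \<in> openings g" "rk p div B g = rk p' div B g"
    then have "rk p = rk p'"
      by (metis (mono_tags, lifting) openings_def opens_def mem_Collect_eq div_mult_mod_eq)
    then show "p = p'" using a cnt_inj[of "\<lambda>i. ID i = g" p p'] by (simp add: openings_def rk_def q_def)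
  qed
  moreover have "(\<lambda>p. rk p div B g) ` openings g \<subseteq> {..N g div B g}"
  proof (rule image_subsetI)
    fix p assume "p \<in> openings g"
    then have "rk p \<le> N g" using rk_less[of p] by (auto simp: openings_def)
    then show "rk p div B g \<in> {..N g div B g}" by (simp add: div_le_mono)
  qed
  ultimately have "card (openings g) \<le> card {..N g div B g}"
    by (metis card_image card_mono finite_atMost)
  then have "real (card (openings g)) \<le> real (N g div B g) + 1" by simp
  also have "real (N g div B g) \<le> real (N g) / real (B g)" by (rule of_nat_div_le_of_nat)
  finally show ?thesis by simp
qed

lemma sel_props:
  assumes "p < n"
  shows "sel p < n" "ID (sel p) = ID p"
proof -
  have "rk p + cell (bs p) (\<omega> (a + p)) < N (ID p)"
  proof -
    have "bs p \<le> N (ID p) - rk p" by (simp add: bs_def)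
    then show ?thesis using cell_bs[OF assms] rk_less[OF assms] by linarith
  qed
  from pnt_props[OF this] show "sel p < n" "ID (sel p) = ID p" by (auto simp: sel_def)
qed

text \<open>Translation to \<open>block_weight\<close>: the block opened by \<open>p\<close> is
  named after the coin \<open>a + p\<close> that decides it.\<close>

definition cJ :: "nat \<Rightarrow> nat set" where "cJ g = (\<lambda>p. a + p) ` openings g"
definition c\<beta> :: "nat \<Rightarrow> nat" where "c\<beta> j = bs (j - a)"
definition cpt :: "point list \<Rightarrow> nat \<Rightarrow> nat \<Rightarrow> nat \<Rightarrow> point" where
  "cpt ps g j x = ps ! pnt g (rk (j - a) + x)"

lemma cJ_sum: "(\<Sum>j\<in>cJ g. h j) = (\<Sum>p\<in>openings g. h (a + p))"
  unfolding cJ_def by (subst sum.reindex) (auto simp: inj_on_def)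

lemma block_count_eq: "block_count (cJ g) c\<beta> (cpt ps g) A = real (card {p. p < n \<and> ID p = g \<and> ps ! p \<in> A})"
proof -
  have "block_count (cJ g) c\<beta> (cpt ps g) A = (\<Sum>p\<in>openings g. \<Sum>x<bs p. of_bool (ps ! pnt g (rk p + x) \<in> A))"
    unfolding block_count_def cJ_sum c\<beta>_def cpt_def by simp
  also have "\<dots> = (\<Sum>p | p < n \<and> ID p = g. of_bool (ps ! p \<in> A))" by (rule sum_blocks)
  also have "\<dots> = real (card {p. p < n \<and> ID p = g \<and> ps ! p \<in> A})"
  proof -
    have "{p. p < n \<and> ID p = g \<and> ps ! p \<in> A} = {p. p < n \<and> ID p = g} \<inter> {p. ps ! p \<in> A}" by blast
    then show ?thesis by simp
  qed
  finally show ?thesis .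
qed

lemma block_weight_eq:
  "block_weight (cJ g) c\<beta> (cpt ps g) (\<lambda>j\<in>cJ g. cell (c\<beta> j) (\<omega> j)) A
     = (\<Sum>p\<in>openings g. real (bs p) * of_bool (ps ! sel p \<in> A))"
proof -
  have "block_weight (cJ g) c\<beta> (cpt ps g) (\<lambda>j\<in>cJ g. cell (c\<beta> j) (\<omega> j)) A
      = (\<Sum>p\<in>openings g. real (bs p) * of_bool (ps ! pnt g (rk p + cell (bs p) (\<omega> (a + p))) \<in> A))"
    unfolding block_weight_def cJ_sum c\<beta>_def cpt_def by (intro sum.cong refl) (auto simp: cJ_def)
  also have "\<dots> = (\<Sum>p\<in>openings g. real (bs p) * of_bool (ps ! sel p \<in> A))"
    by (intro sum.cong refl) (auto simp: sel_def openings_def)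
  finally show ?thesis .
qed

definition good_sample :: "nat \<Rightarrow> nat \<Rightarrow> real \<Rightarrow> real \<Rightarrow> point list \<Rightarrow> nat \<Rightarrow> (nat \<Rightarrow> nat) \<Rightarrow> bool" where
  "good_sample d k e \<eta> ps g x \<longleftrightarrow> (\<forall>C\<in>center_sets d k. \<forall>t\<ge>0.
     block_count (cJ g) c\<beta> (cpt ps g) {p\<in>Rd d. cdist p C \<le> t}
       \<le> block_weight (cJ g) c\<beta> (cpt ps g) x {p\<in>Rd d. cdist p C \<le> e * t} + \<eta> * real (N g) \<and>
     block_weight (cJ g) c\<beta> (cpt ps g) x {p\<in>Rd d. cdist p C \<le> t}
       \<le> block_count (cJ g) c\<beta> (cpt ps g) {p\<in>Rd d. cdist p C \<le> e * t} + \<eta> * real (N g))"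

text \<open>A stratum with block size 1 is reproduced exactly. Otherwise
  \<open>B g \<le> X * N g\<close>, so the exponent from \<open>symmetrization\<close> is at least
  \<open>\<eta>^2 / (2 * X)\<close> in size; the two directions give the factor 2. A sample has at
  most \<open>3 / X\<close> points, so covers are required for the \<open>6 / X\<close> points of
  two samples.\<close>

lemma bad_samples:
  assumes X: "0 < X" "X \<le> 1" and Bg: "B g = pred_block X (N g) + 1"
    and cov: "\<And>Z. finite Z \<Longrightarrow> Z \<subseteq> Rd d \<Longrightarrow> real (card Z) \<le> 6 / X \<Longrightarrow> \<exists>F. covers d k e \<Phi> Z F"
    and e: "1 \<le> e" and \<eta>: "0 \<le> \<eta>" and p: "2 * (\<Phi> * exp (- (\<eta>\<^sup>2 / (2 * X)))) \<le> p"
  shows "measure coins (boxes (cJ g) c\<beta> {x\<in>choices (cJ g) c\<beta>. \<not> good_sample d k e \<eta> ps g x}) \<le> p"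
    and "real (card (openings g)) \<le> 3 / X"
proof -
  let ?N = "N g"
  let ?J = "cJ g"
  let ?\<Omega> = "choices ?J c\<beta>"
  have finJ: "finite ?J" by (simp add: cJ_def)
  have cardJ: "card ?J = card (openings g)" unfolding cJ_def by (intro card_image) (auto simp: inj_on_def)
  note pb = pred_block_props[OF X, of ?N]
  have sJ: "real (card (openings g)) \<le> 3 / X"
  proof (cases "B g = 1")
    case True
    then have "X * real ?N < 2" using pb(2) Bg by simp
    then have "real ?N < 2 / X" using X by (simp add: field_simps)
    moreover have "1 \<le> 1 / X" using X by simp
    ultimately show ?thesis using card_openings[of g] True by simp
  next
    case False
    then have "2 \<le> B g" using B[of g] by linarith
    then have "real (B g) \<le> X * real ?N" using pb(1) Bg by auto
    then have "2 \<le> X * real ?N" using \<open>2 \<le> B g\<close> by linarith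
    moreover have "X * real ?N < real (B g) + 1" using pb(2) Bg by simp
    ultimately have "X * real ?N \<le> 2 * real (B g)" using \<open>2 \<le> B g\<close> by linarith
    then have "real ?N / real (B g) \<le> 2 / X" using X \<open>2 \<le> B g\<close> by (simp add: field_simps)
    moreover have "1 \<le> 1 / X" using X by simp
    ultimately show ?thesis using card_openings[of g] by simp
  qed
  then show "real (card (openings g)) \<le> 3 / X" .
  have \<beta>: "1 \<le> c\<beta> j" "c\<beta> j \<le> B g" if "j \<in> ?J" for j
    using that bs_pos by (auto simp: cJ_def c\<beta>_def openings_def bs_def)
  have N: "real ?N = (\<Sum>j\<in>?J. real (c\<beta> j))" unfolding cJ_sum c\<beta>_def by (simp add: sum_bs)
  define \<A> where "\<A> = {({p\<in>Rd d. cdist p C \<le> t}, {p\<in>Rd d. cdist p C \<le> e * t}) | C t. C \<in> center_sets d k \<and> 0 \<le> t}"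
  have sub: "A \<subseteq> A'" if AA: "(A, A') \<in> \<A>" for A A'
  proof -
    obtain C t where "A = {p\<in>Rd d. cdist p C \<le> t}" "A' = {p\<in>Rd d. cdist p C \<le> e * t}" "0 \<le> t"
      using AA unfolding \<A>_def by blast
    moreover have "t \<le> e * t" using e mult_right_mono[of 1 e t] \<open>0 \<le> t\<close> by simp
    ultimately show ?thesis by auto
  qed
  let ?w = "block_weight ?J c\<beta> (cpt ps g)" and ?c = "block_count ?J c\<beta> (cpt ps g)"
  let ?D1 = "\<lambda>x A A'. ?c A - ?w x A'" and ?D2 = "\<lambda>x A A'. ?w x A - ?c A'"
  let ?B1 = "{x\<in>?\<Omega>. \<exists>(A, A')\<in>\<A>. ?D1 x A A' > \<eta> * real ?N}" and ?B2 = "{x\<in>?\<Omega>. \<exists>(A, A')\<in>\<A>. ?D2 x A A' > \<eta> * real ?N}"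
  have bad: "{x\<in>?\<Omega>. \<not> good_sample d k e \<eta> ps g x} \<subseteq> ?B1 \<union> ?B2"
  proof
    fix x assume "x \<in> {x\<in>?\<Omega>. \<not> good_sample d k e \<eta> ps g x}"
    then obtain C t where x: "x \<in> ?\<Omega>" and Ct: "C \<in> center_sets d k" "0 \<le> t" and
      "\<not> (?c {p\<in>Rd d. cdist p C \<le> t} \<le> ?w x {p\<in>Rd d. cdist p C \<le> e * t} + \<eta> * real ?N \<and>
          ?w x {p\<in>Rd d. cdist p C \<le> t} \<le> ?c {p\<in>Rd d. cdist p C \<le> e * t} + \<eta> * real ?N)"
      unfolding good_sample_def by blast
    then have "?D1 x {p\<in>Rd d. cdist p C \<le> t} {p\<in>Rd d. cdist p C \<le> e * t} > \<eta> * real ?N \<or>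
      ?D2 x {p\<in>Rd d. cdist p C \<le> t} {p\<in>Rd d. cdist p C \<le> e * t} > \<eta> * real ?N" by linarith
    moreover have "({p\<in>Rd d. cdist p C \<le> t}, {p\<in>Rd d. cdist p C \<le> e * t}) \<in> \<A>" using Ct unfolding \<A>_def by blast
    ultimately show "x \<in> ?B1 \<union> ?B2" using x by blast
  qed
  have fin\<Omega>: "finite ?\<Omega>" by (rule finite_choices[OF finJ])
  have p0: "0 \<le> p"
  proof -
    obtain F where "covers d k e \<Phi> {} F" using cov[of "{}"] X by auto
    then have "0 \<le> \<Phi>" by (auto simp: covers_def intro: order_trans[OF of_nat_0_le_iff])
    then have "0 \<le> 2 * (\<Phi> * exp (- (\<eta>\<^sup>2 / (2 * X))))" by simp
    then show ?thesis using p by linarith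
  qed
  have "real (card (?B1 \<union> ?B2)) \<le> real (card ?\<Omega>) * p"
  proof (cases "B g = 1")
    case True
    have eq: "?w x A = ?c A" if x: "x \<in> ?\<Omega>" for x A
      unfolding block_weight_def block_count_def
    proof (rule sum.cong[OF refl])
      fix j assume j: "j \<in> ?J"
      then have b: "c\<beta> j = 1" using \<beta>[OF j] True by simp
      have "x j < c\<beta> j" using x j by auto
      then have "x j = 0" using b by simp
      then show "real (c\<beta> j) * of_bool (cpt ps g j (x j) \<in> A) = (\<Sum>i<c\<beta> j. of_bool (cpt ps g j i \<in> A))"
        by (simp add: b)
    qed
    have le: "?w x A \<le> ?w x A'" if "(A, A') \<in> \<A>" for x A A'
      using sub[OF that] by (intro block_weight_mono) auto
    have "0 \<le> \<eta> * real ?N" using \<eta> by simp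
    have b1: "?B1 = {}"
    proof (rule ccontr)
      assume "?B1 \<noteq> {}"
      then obtain x A A' where "x \<in> ?\<Omega>" "(A, A') \<in> \<A>" "?D1 x A A' > \<eta> * real ?N" by blast
      then show False using eq[of x A] le[of A A' x] \<open>0 \<le> \<eta> * real ?N\<close> by linarith
    qed
    have b2: "?B2 = {}"
    proof (rule ccontr)
      assume "?B2 \<noteq> {}"
      then obtain x A A' where "x \<in> ?\<Omega>" "(A, A') \<in> \<A>" "?D2 x A A' > \<eta> * real ?N" by blast
      then show False using eq[of x A'] le[of A A' x] \<open>0 \<le> \<eta> * real ?N\<close> by linarith
    qed
    have "card (?B1 \<union> ?B2) = 0" unfolding b1 b2 by simp
    then show ?thesis using p0 by simp
  next
    case False
    then have B2: "2 \<le> B g" using B[of g] by linarith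
    then have BXN: "real (B g) \<le> X * real ?N" using pb(1) Bg by auto
    \<comment> \<open>\<open>symmetrization\<close> wants a finite family for every \<open>Z\<close>
      and a sandwich for every finite one. Beyond the size of two samples the power set provides
      it.\<close>
    define F where "F = (\<lambda>Z. if finite Z \<and> card Z \<le> 2 * card ?J
        then (SOME F. covers d k e \<Phi> (Z \<inter> Rd d) F) else if finite Z then Pow Z else {})"
    have F: "covers d k e \<Phi> (Z \<inter> Rd d) (F Z)" if Z: "finite Z" "card Z \<le> 2 * card ?J" for Z
    proof -
      have "card (Z \<inter> Rd d) \<le> card Z" using Z by (intro card_mono) auto
      then have "real (card (Z \<inter> Rd d)) \<le> real (2 * card (openings g))" using Z cardJ by linarith
      also have "\<dots> \<le> 6 / X" using sJ by simp
      finally have "\<exists>F. covers d k e \<Phi> (Z \<inter> Rd d) F" using Z by (intro cov) auto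
      then have "covers d k e \<Phi> (Z \<inter> Rd d) (SOME F. covers d k e \<Phi> (Z \<inter> Rd d) F)" by (rule someI_ex)
      then show ?thesis using Z by (simp add: F_def)
    qed
    have finF: "finite (F Z)" for Z
      using F[of Z] by (cases "finite Z \<and> card Z \<le> 2 * card ?J") (auto simp: F_def covers_def)
    have cardF: "real (card (F Z)) \<le> \<Phi>" if "finite Z" "card Z \<le> 2 * card ?J" for Z
      using F[OF that] by (simp add: covers_def)
    have coverF: "\<exists>B\<in>F Z. A \<inter> Z \<subseteq> B \<and> B \<inter> Z \<subseteq> A'" if A: "(A, A') \<in> \<A>" and Z: "finite Z" for A A' Z
    proof (cases "card Z \<le> 2 * card ?J")
      case True
      obtain C t where Ct: "A = {p\<in>Rd d. cdist p C \<le> t}" "A' = {p\<in>Rd d. cdist p C \<le> e * t}" "C \<in> center_sets d k" "0 \<le> t"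
        using A unfolding \<A>_def by blast
      obtain B' where "B' \<in> F Z" "{p\<in>Z \<inter> Rd d. cdist p C \<le> t} \<subseteq> B'" "B' \<subseteq> {p\<in>Z \<inter> Rd d. cdist p C \<le> e * t}"
        using F[OF Z True] Ct(3,4) unfolding covers_def by blast
      then show ?thesis unfolding Ct(1,2) by (intro bexI[of _ B']) auto
    next
      case False
      then show ?thesis using sub[OF A] Z by (intro bexI[of _ "A \<inter> Z"]) (auto simp: F_def)
    qed
    have bound: "\<Phi> * exp (- (\<eta>\<^sup>2 * real ?N / (2 * real (B g)))) \<le> p / 2"
    proof -
      have "0 \<le> \<Phi>" using cardF[of "{}"] by (auto intro: order_trans[OF of_nat_0_le_iff])
      have "1 / X \<le> real ?N / real (B g)" using BXN X B2 by (simp add: field_simps)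
      then have "\<eta>\<^sup>2 / 2 * (1 / X) \<le> \<eta>\<^sup>2 / 2 * (real ?N / real (B g))" by (intro mult_left_mono) auto
      then have "exp (- (\<eta>\<^sup>2 * real ?N / (2 * real (B g)))) \<le> exp (- (\<eta>\<^sup>2 / (2 * X)))" by simp
      then have "\<Phi> * exp (- (\<eta>\<^sup>2 * real ?N / (2 * real (B g)))) \<le> \<Phi> * exp (- (\<eta>\<^sup>2 / (2 * X)))"
        using \<open>0 \<le> \<Phi>\<close> by (rule mult_left_mono)
      then show ?thesis using p by linarith
    qed
    have B0: "0 < B g" using B2 by linarith
    have s1: "real (card ?B1) \<le> real (card ?\<Omega>) * (\<Phi> * exp (- (\<eta>\<^sup>2 * real ?N / (2 * real (B g)))))"
      by (rule symmetrization[where F = F and \<A> = \<A> and D = ?D1, OF finJ \<beta> B0 finF cardF coverF \<eta> N]) auto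
    have s2: "real (card ?B2) \<le> real (card ?\<Omega>) * (\<Phi> * exp (- (\<eta>\<^sup>2 * real ?N / (2 * real (B g)))))"
      by (rule symmetrization[where F = F and \<A> = \<A> and D = ?D2, OF finJ \<beta> B0 finF cardF coverF \<eta> N]) auto
    have "real (card (?B1 \<union> ?B2)) \<le> real (card ?B1) + real (card ?B2)"
      using card_Un_le[of ?B1 ?B2] by linarith
    also have "\<dots> \<le> real (card ?\<Omega>) * (p / 2) + real (card ?\<Omega>) * (p / 2)"
      using s1 s2 bound by (intro add_mono) (meson mult_left_mono of_nat_0_le_iff order_trans)+
    also have "\<dots> = real (card ?\<Omega>) * p" by simp
    finally show ?thesis .
  qed
  moreover have "card {x\<in>?\<Omega>. \<not> good_sample d k e \<eta> ps g x} \<le> card (?B1 \<union> ?B2)"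
    using fin\<Omega> by (intro card_mono bad) auto
  ultimately have "real (card {x\<in>?\<Omega>. \<not> good_sample d k e \<eta> ps g x}) \<le> real (card ?\<Omega>) * p" by linarith
  moreover have "0 < real (card ?\<Omega>)"
    using finJ \<beta>(1) by (auto simp: card_PiE intro!: prod_pos) (fastforce simp: Suc_le_eq)
  ultimately show "measure coins (boxes ?J c\<beta> {x\<in>?\<Omega>. \<not> good_sample d k e \<eta> ps g x}) \<le> p"
    using finJ by (simp add: measure_boxes divide_le_eq mult.commute)
qed

end

section \<open>Choice of the sampling rate\<close>

lemma eff_dim_bounds:
  assumes "0 < \<epsilon>" "\<epsilon> < 1" "1 \<le> d"
  shows "1 \<le> eff_dim d \<epsilon>" "eff_dim d \<epsilon> \<le> real d" "eff_dim d \<epsilon> \<le> 1 / \<epsilon>\<^sup>2"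
proof -
  have "\<epsilon> * \<epsilon> \<le> 1 * 1" using assms by (intro mult_mono) auto
  then have "1 \<le> 1 / (\<epsilon> * \<epsilon>)" using assms by simp
  then show "1 \<le> eff_dim d \<epsilon>" "eff_dim d \<epsilon> \<le> real d" "eff_dim d \<epsilon> \<le> 1 / \<epsilon>\<^sup>2"
    using assms by (auto simp: eff_dim_def power2_eq_square)
qed

lemma complexity_bounds:
  assumes "0 < \<epsilon>" "\<epsilon> < 1" "1 \<le> d" "1 \<le> k"
  shows "real k \<le> complexity k d \<epsilon>" "1 / \<epsilon>\<^sup>2 \<le> complexity k d \<epsilon>" "1 \<le> complexity k d \<epsilon>"
proof -
  note e = eff_dim_bounds[OF assms(1-3)]
  have "\<epsilon>\<^sup>2 \<le> 1\<^sup>2" using assms by (intro power_mono) auto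
  then have e2: "1 \<le> 1 / \<epsilon>\<^sup>2" using assms by simp
  have Y: "complexity k d \<epsilon> = real k * eff_dim d \<epsilon> * (1 / \<epsilon>\<^sup>2)" by (simp add: complexity_def power2_eq_square)
  have k1: "1 \<le> real k" using assms by simp
  have "real k * 1 * 1 \<le> complexity k d \<epsilon>" unfolding Y using e e2 k1 by (intro mult_mono) auto
  then show "real k \<le> complexity k d \<epsilon>" by simp
  then show "1 \<le> complexity k d \<epsilon>" using k1 by linarith
  have "1 * 1 * (1 / \<epsilon>\<^sup>2) \<le> complexity k d \<epsilon>" unfolding Y using e e2 k1 by (intro mult_mono) auto
  then show "1 / \<epsilon>\<^sup>2 \<le> complexity k d \<epsilon>" by simp
qed

text \<open>Centers times rings: the scales between \<open>\<tau>\<close> and about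
  \<open>\<tau> / (16 * k)\<close> number \<open>O(1 + ln k)\<close>.\<close>

definition strata_bound :: "nat \<Rightarrow> real" where
  "strata_bound k = 7 * real k * (1 + ln (real k))"

text \<open>The constant \<open>512 = 8\<^sup>3\<close> absorbs \<open>64 powr z\<close> and the polynomial factors in \<open>z\<close>.\<close>

definition suitable :: "real \<Rightarrow> nat \<Rightarrow> bool" where
  "suitable p H \<longleftrightarrow> 1 \<le> H \<and>
     21632 * (260 * (ln (21 * real H) + 2 + ln 512) + \<bar>ln (14 / p)\<bar> + 2) \<le> real H"

text \<open>The left side of the inequality grows only logarithmically with
  \<open>H\<close>.\<close>

lemma suitable_exists: "\<exists>H. suitable p H"
proof -
  have "eventually (\<lambda>H::nat. 21632 * (260 * (ln (21 * real H) + 2 + ln 512) + c + 2) \<le> real H) at_top" for c :: real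
    by real_asymp
  then have "eventually (\<lambda>H::nat. suitable p H) at_top"
    using eventually_ge_at_top[of 1] unfolding suitable_def by eventually_elim auto
  then show ?thesis by (auto dest: eventually_happens)
qed

lemma le_powr_2:
  fixes z :: real
  assumes z: "1 \<le> z"
  shows "z \<le> 2 powr z"
proof -
  have l2: "1/2 \<le> ln (2::real)" using exp_bound[of "1/2::real"] by (subst ln_ge_iff) (auto simp: power2_eq_square)
  define w where "w = (z - 1) * ln 2"
  define y where "y = exp w"
  have "2 powr z = 2 * y"
    by (simp add: powr_def y_def w_def left_diff_distrib exp_diff)
  moreover have "1 + w \<le> y" unfolding y_def by (rule exp_ge_add_one_self)
  moreover have "z - 1 \<le> 2 * w" using mult_left_mono[OF l2, of "z - 1"] z by (simp add: w_def)
  ultimately show ?thesis by simp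
qed

text \<open>\<open>H\<close> is independent of \<open>z\<close>, so the powers \<open>z^2\<close>
  and \<open>z^3\<close> are bounded by \<open>8 powr z\<close>. From \<open>512 = 8 * 64\<close>
  there remains \<open>64 powr z\<close> for the squared deviation, and
  \<open>21632 = 2 * 104^2\<close> has the same origin.\<close>

lemma main_param_inequality:
  fixes z :: real
  assumes H: "suitable p H" and z: "1 \<le> z"
  shows "260 * z\<^sup>2 * (ln (21 * (real H * 512 powr z)) + 2) + \<bar>ln (14 / p)\<bar> + 2 \<le> real H * 512 powr z / (21632 * 64 powr z)"
proof -
  have H1: "1 \<le> real H" using H by (simp add: suitable_def)
  define c where "c = \<bar>ln (14 / p)\<bar> + 2"
  define b where "b = ln (21 * real H) + 2"
  have c: "0 \<le> c" and b: "0 \<le> b" using H1 by (auto simp: c_def b_def intro!: add_nonneg_nonneg ln_ge_zero)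
  have p2: "z \<le> 2 powr z" by (rule le_powr_2[OF z])
  have p4: "z\<^sup>2 \<le> 4 powr z"
  proof -
    have "z\<^sup>2 \<le> 2 powr z * 2 powr z" unfolding power2_eq_square using p2 z by (intro mult_mono) auto
    also have "\<dots> = 4 powr z" using powr_mult[of 2 2 z] by simp
    finally show ?thesis .
  qed
  have p8: "z\<^sup>2 * z \<le> 8 powr z"
  proof -
    have "z\<^sup>2 * z \<le> 4 powr z * 2 powr z" using p2 p4 z by (intro mult_mono) auto
    also have "\<dots> = 8 powr z" using powr_mult[of 4 2 z] by simp
    finally show ?thesis .
  qed
  have p48: "4 powr z \<le> 8 powr z" using z by (intro powr_mono2) auto
  have p18: "1 \<le> (8::real) powr z" using z by (intro ge_one_powr_ge_zero) auto
  have "ln (21 * (real H * 512 powr z)) = ln (21 * real H) + z * ln 512"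
    using H1 by (simp add: ln_mult ln_powr mult.assoc[symmetric])
  then have "260 * z\<^sup>2 * (ln (21 * (real H * 512 powr z)) + 2) + c = 260 * (z\<^sup>2 * b + (z\<^sup>2 * z) * ln 512) + c"
    by (simp add: b_def algebra_simps)
  also have "\<dots> \<le> 260 * (8 powr z * b + 8 powr z * ln 512) + 8 powr z * c"
    using p4 p8 p48 b c mult_right_mono[OF p18 c]
    by (intro add_mono mult_left_mono mult_right_mono) auto
  also have "\<dots> = 8 powr z * (260 * (b + ln 512) + c)" by (simp add: algebra_simps)
  also have "\<dots> \<le> 8 powr z * (real H / 21632)"
    using H unfolding suitable_def b_def c_def by (intro mult_left_mono) auto
  also have "(8::real) powr z = 512 powr z / 64 powr z"
    using powr_divide[of 512 64 z] by simp
  finally show ?thesis by (simp add: c_def mult_ac)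
qed

lemma nat_ceiling_le: "0 \<le> x \<Longrightarrow> real (nat \<lceil>x\<rceil>) \<le> x + 1" "x \<le> real (nat \<lceil>x\<rceil>)"
  by linarith+

text \<open>Grid or perceptron, according to which term attains \<open>eff_dim\<close>. The base
  \<open>21 / X\<close> dominates \<open>3 * card Z + 3 \<le> 18 / X + 3\<close>;
  \<open>260 = 256 + 4\<close> stems from the length
  \<open>16 / e'^2 = 256 * z^2 / \<epsilon>^2\<close>, with 1 for rounding and 3 from the perceptron
  cover.\<close>

lemma cover_exists:
  assumes \<epsilon>: "0 < \<epsilon>" "\<epsilon> < 1" and d: "1 \<le> d" and k: "1 \<le> k" and z: "1 \<le> z"
    and B: "1 \<le> Bc" "z \<le> Bc" and X: "X = 1 / (Bc * complexity k d \<epsilon> * (1 + ln (complexity k d \<epsilon>)))"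
    and Z: "finite Z" "Z \<subseteq> Rd d" "real (card Z) \<le> 6 / X"
  shows "\<exists>F. covers d k (1 + \<epsilon> / (4 * z)) (exp (real k * (260 * z\<^sup>2 * eff_dim d \<epsilon> * ln (21 / X)))) Z F"
proof -
  let ?Y = "complexity k d \<epsilon>" and ?E = "eff_dim d \<epsilon>"
  note Y = complexity_bounds[OF \<epsilon> d k] and E = eff_dim_bounds[OF \<epsilon> d]
  have L: "0 \<le> ln ?Y" using Y by simp
  have X1: "1 / X = Bc * ?Y * (1 + ln ?Y)" by (simp add: X)
  have X2: "1 \<le> 1 / X" "z / \<epsilon>\<^sup>2 \<le> 1 / X"
  proof -
    have "1 * 1 * 1 \<le> Bc * ?Y * (1 + ln ?Y)" using B Y L by (intro mult_mono) auto
    then show "1 \<le> 1 / X" unfolding X1 by simp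
    have "z * (1 / \<epsilon>\<^sup>2) * 1 \<le> Bc * ?Y * (1 + ln ?Y)" using B Y L z by (intro mult_mono) auto
    then show "z / \<epsilon>\<^sup>2 \<le> 1 / X" unfolding X1 by simp
  qed
  have X0: "0 < X" using X2(1) by (metis less_le_trans zero_less_one zero_less_divide_1_iff)
  define W where "W = 21 / X"
  have W: "21 \<le> W" "3 * real (card Z) + 3 \<le> W" "21 * z / \<epsilon>\<^sup>2 \<le> W"
    using X2 Z(3) by (auto simp: W_def)
  have lnW: "0 \<le> ln W" using W by simp
  have z2: "1 \<le> z\<^sup>2" using z by simp
  define e' where "e' = \<epsilon> / (4 * z)"
  have e': "0 < e'" using \<epsilon> z by (simp add: e'_def)
  have "\<exists>F. finite F \<and> real (card F) \<le> exp (260 * z\<^sup>2 * ?E * ln W) \<and>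
    (\<forall>c\<in>Rd d. \<forall>t\<ge>0. \<exists>B\<in>F. {p\<in>Z. pdist p c \<le> t} \<subseteq> B \<and> B \<subseteq> {p\<in>Z. pdist p c \<le> (1 + e') * t})"
  proof (cases "real d < 1 / (\<epsilon> * \<epsilon>)")
    case True
    then have Ed: "?E = real d" by (simp add: eff_dim_def)
    define g where "g = nat \<lceil>2 * sqrt (real d) / e'\<rceil> + 1"
    have g1: "2 * sqrt (real d) / e' + 1 \<le> real g"
      using nat_ceiling_le(2)[of "2 * sqrt (real d) / e'"] unfolding g_def of_nat_add by linarith
    have g2: "real g \<le> 2 * sqrt (real d) / e' + 2"
    proof -
      have "0 \<le> 2 * sqrt (real d) / e'" using e' by simp
      from nat_ceiling_le(1)[OF this] show ?thesis unfolding g_def of_nat_add by linarith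
    qed
    obtain F where F: "finite F" "card F \<le> (card Z + 1) ^ 2 * (2 * g + 1) ^ d"
      "\<forall>c\<in>Rd d. \<forall>t\<ge>0. \<exists>B\<in>F. {p\<in>Z. pdist p c \<le> t} \<subseteq> B \<and> B \<subseteq> {p\<in>Z. pdist p c \<le> (1 + e') * t}"
      using ball_cover_grid[OF Z(1,2) e' d g1] by blast
    \<comment> \<open>A small dimension also keeps the grid small: the number of values per
      coordinate is \<open>O(z / \<epsilon>^2)\<close> and thus at most \<open>W\<close>.\<close>
    have "sqrt (real d) \<le> 1 / \<epsilon>"
      using True \<epsilon> by (intro real_le_lsqrt) (auto simp: power2_eq_square)
    then have "2 * sqrt (real d) / e' \<le> 2 * (1 / \<epsilon>) / e'" using e' by (intro divide_right_mono mult_left_mono) auto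
    also have "\<dots> = 8 * z / \<epsilon>\<^sup>2" by (simp add: e'_def power2_eq_square)
    finally have "real (2 * g + 1) \<le> 16 * z / \<epsilon>\<^sup>2 + 5" using g2 by simp
    also have "5 \<le> 5 * (z / \<epsilon>\<^sup>2)"
    proof -
      have "\<epsilon>\<^sup>2 \<le> 1\<^sup>2" using \<epsilon> by (intro power_mono) auto
      then have "\<epsilon>\<^sup>2 \<le> z" using z by simp
      then show ?thesis using \<epsilon> by (simp add: le_divide_eq)
    qed
    finally have g3: "real (2 * g + 1) \<le> W" using W(3) by simp
    have "real (card F) \<le> real ((card Z + 1) ^ 2 * (2 * g + 1) ^ d)" using F(2) by (simp only: of_nat_le_iff)
    also have "\<dots> = (real (card Z) + 1) ^ 2 * real (2 * g + 1) ^ d" by simp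
    also have "\<dots> \<le> W ^ 2 * W ^ d" using W g3 by (intro mult_mono power_mono) auto
    also have "\<dots> = W ^ (2 + d)" by (simp only: power_add)
    also have "\<dots> = exp (real (2 + d) * ln W)" using W by (subst exp_of_nat_mult) simp
    also have "\<dots> \<le> exp (260 * z\<^sup>2 * ?E * ln W)"
    proof -
      have "real (2 + d) \<le> 260 * 1 * real d" using d by simp
      also have "\<dots> \<le> 260 * z\<^sup>2 * real d" using z2 by (intro mult_right_mono mult_left_mono) auto
      finally show ?thesis unfolding Ed using lnW by (simp add: mult_right_mono)
    qed
    finally show ?thesis using F by blast
  next
    case False
    then have Ee: "?E = 1 / \<epsilon>\<^sup>2" by (simp add: eff_dim_def power2_eq_square)
    define len where "len = nat \<lceil>16 / e'\<^sup>2\<rceil>"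
    have l1: "16 / e'\<^sup>2 \<le> real len" using nat_ceiling_le(2) by (simp add: len_def)
    have l2: "real len \<le> 256 * z\<^sup>2 / \<epsilon>\<^sup>2 + 1"
      using nat_ceiling_le(1)[of "16 / e'\<^sup>2"] by (simp add: len_def e'_def power_divide power_mult_distrib)
    obtain F where F: "finite F" "card F \<le> (3 * card Z + 3) ^ (len + 3)"
      "\<forall>c\<in>Rd d. \<forall>t\<ge>0. \<exists>B\<in>F. {p\<in>Z. pdist p c \<le> t} \<subseteq> B \<and> B \<subseteq> {p\<in>Z. pdist p c \<le> (1 + e') * t}"
      using ball_cover_perceptron[OF Z(1,2) e' l1] by blast
    have "real (card F) \<le> real ((3 * card Z + 3) ^ (len + 3))" using F(2) by (simp only: of_nat_le_iff)
    also have "\<dots> = (3 * real (card Z) + 3) ^ (len + 3)" by simp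
    also have "\<dots> \<le> W ^ (len + 3)" using W by (intro power_mono) auto
    also have "\<dots> = exp (real (len + 3) * ln W)" using W by (subst exp_of_nat_mult) simp
    also have "\<dots> \<le> exp (260 * z\<^sup>2 * ?E * ln W)"
    proof -
      have "1 * 1 \<le> z\<^sup>2 * (1 / \<epsilon>\<^sup>2)" using z2 E by (intro mult_mono) auto
      then have "real (len + 3) \<le> 260 * z\<^sup>2 * (1 / \<epsilon>\<^sup>2)" using l2 by simp
      then show ?thesis unfolding Ee using lnW by (intro iffD2[OF exp_le_cancel_iff] mult_right_mono) auto
    qed
    finally show ?thesis using F by blast
  qed
  then obtain F where F: "finite F" "real (card F) \<le> exp (260 * z\<^sup>2 * ?E * ln W)"
    "\<forall>c\<in>Rd d. \<forall>t\<ge>0. \<exists>B\<in>F. {p\<in>Z. pdist p c \<le> t} \<subseteq> B \<and> B \<subseteq> {p\<in>Z. pdist p c \<le> (1 + e') * t}" by blast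
  obtain F' where F': "finite F'" "card F' \<le> card F ^ k"
    "\<forall>C\<in>center_sets d k. \<forall>t\<ge>0. \<exists>B\<in>F'. {p\<in>Z. cdist p C \<le> t} \<subseteq> B \<and> B \<subseteq> {p\<in>Z. cdist p C \<le> (1 + e') * t}"
    using center_cover[OF F(1,3) k] by blast
  have "real (card F') \<le> real (card F ^ k)" using F'(2) by (simp only: of_nat_le_iff)
  also have "\<dots> = real (card F) ^ k" by simp
  also have "\<dots> \<le> exp (260 * z\<^sup>2 * ?E * ln W) ^ k" using F by (intro power_mono) auto
  also have "\<dots> = exp (real k * (260 * z\<^sup>2 * ?E * ln W))" by (simp add: exp_of_nat_mult)
  finally show ?thesis
    unfolding covers_def using F' by (auto simp: e'_def W_def)
qed

text \<open>Cover exponent, deviation exponent and the logarithm of the number of strata are all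
  compared as multiples of \<open>k * eff_dim d \<epsilon> * (1 + ln (complexity k d
  \<epsilon>))\<close>; what remains is \<open>main_param_inequality\<close>.\<close>

lemma failure_probability:
  fixes z :: real
  assumes \<epsilon>: "0 < \<epsilon>" "\<epsilon> < 1" and d: "1 \<le> d" and k: "1 \<le> k" and z: "1 \<le> z"
    and H: "suitable p H" and p: "0 < p"
  defines "X \<equiv> rate H 512 z k d \<epsilon>"
  shows "2 * (exp (real k * (260 * z\<^sup>2 * eff_dim d \<epsilon> * ln (21 / X))) * exp (- ((\<epsilon> / (104 * 8 powr z))\<^sup>2 / (2 * X))))
      \<le> p / strata_bound k"
proof -
  let ?Y = "complexity k d \<epsilon>" and ?E = "eff_dim d \<epsilon>"
  note Y = complexity_bounds[OF \<epsilon> d k] and E = eff_dim_bounds[OF \<epsilon> d]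
  define B where "B = real H * 512 powr z"
  define L where "L = 1 + ln ?Y"
  have L1: "1 \<le> L" using Y by (simp add: L_def)
  have k1: "1 \<le> real k" using k by simp
  have H1: "1 \<le> real H" using H by (simp add: suitable_def)
  have B1: "1 \<le> B"
  proof -
    have "1 * 1 \<le> real H * 512 powr z" using H1 z by (intro mult_mono ge_one_powr_ge_zero) auto
    then show ?thesis by (simp add: B_def)
  qed
  have X: "X = 1 / (B * ?Y * L)" by (simp add: X_def rate_def B_def L_def)
  have kE: "1 \<le> real k * ?E" using mult_mono[OF k1 E(1)] by simp
  have lnW: "ln (21 / X) \<le> (ln (21 * B) + 2) * L"
  proof -
    have "21 / X = (21 * B) * (?Y * L)" by (simp add: X)
    then have "ln (21 / X) = ln (21 * B) + (ln ?Y + ln L)"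
      using B1 Y L1 by (simp add: ln_mult)
    \<comment> \<open>The cover exponent contains the logarithm of \<open>1 / X\<close>, which
      itself has the factor \<open>L\<close>. As \<open>L = 1 + ln ?Y\<close>, the iterated
      logarithm costs no more than another \<open>ln ?Y\<close>.\<close>
    also have "ln L \<le> ln ?Y" using ln_le_minus_one[of L] L1 by (simp add: L_def)
    also have "ln (21 * B) + (ln ?Y + ln ?Y) \<le> ln (21 * B) * L + 2 * L"
    proof -
      have "ln (21 * B) * 1 \<le> ln (21 * B) * L" using B1 L1 by (intro mult_left_mono) auto
      moreover have "ln ?Y = L - 1" by (simp add: L_def)
      ultimately show ?thesis by linarith
    qed
    finally show ?thesis by (simp add: algebra_simps)
  qed
  have t1: "real k * (260 * z\<^sup>2 * ?E * ln (21 / X)) \<le> (real k * ?E * L) * (260 * z\<^sup>2 * (ln (21 * B) + 2))"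
  proof -
    have "real k * ?E * (260 * z\<^sup>2) * ln (21 / X) \<le> real k * ?E * (260 * z\<^sup>2) * ((ln (21 * B) + 2) * L)"
      using lnW kE by (intro mult_left_mono) auto
    then show ?thesis by (simp add: mult_ac)
  qed
  \<comment> \<open>The square of \<open>\<epsilon>\<close> in the deviation cancels against the
    \<open>1 / \<epsilon>^2\<close> in the complexity.\<close>
  have t2: "(\<epsilon> / (104 * 8 powr z))\<^sup>2 / (2 * X) = (real k * ?E * L) * (B / (21632 * 64 powr z))"
  proof -
    have "((8::real) powr z)\<^sup>2 = 64 powr z" using powr_mult[of 8 8 z] by (simp add: power2_eq_square)
    then show ?thesis using \<epsilon> by (simp add: X complexity_def power_divide power_mult_distrib power2_eq_square)
  qed
  have t3: "ln (2 * strata_bound k / p) \<le> (real k * ?E * L) * (\<bar>ln (14 / p)\<bar> + 2)"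
  proof -
    have lk: "0 \<le> ln (real k)" using k1 by simp
    have eq: "2 * strata_bound k / p = (14 / p) * (real k * (1 + ln (real k)))" by (simp add: strata_bound_def)
    have "ln (2 * strata_bound k / p) = ln (14 / p) + (ln (real k) + ln (1 + ln (real k)))"
    proof -
      have pos: "0 < 14 / p" "0 < real k" "0 < 1 + ln (real k)" using p k1 by (simp, simp, use lk in linarith)
      show ?thesis unfolding eq ln_mult_pos[OF pos(1) mult_pos_pos[OF pos(2,3)]] ln_mult_pos[OF pos(2,3)] ..
    qed
    also have "ln (1 + ln (real k)) \<le> ln (real k)" using lk by (rule ln_add_one_self_le_self)
    also have "ln (real k) \<le> ln ?Y" using Y k1 by simp
    finally have "ln (2 * strata_bound k / p) \<le> \<bar>ln (14 / p)\<bar> + 2 * ln ?Y" by linarith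
    also have "\<dots> \<le> \<bar>ln (14 / p)\<bar> * L + 2 * L"
    proof -
      have "\<bar>ln (14 / p)\<bar> * 1 \<le> \<bar>ln (14 / p)\<bar> * L" using L1 by (intro mult_left_mono) auto
      moreover have "ln ?Y = L - 1" by (simp add: L_def)
      ultimately show ?thesis by linarith
    qed
    also have "\<dots> = 1 * (L * (\<bar>ln (14 / p)\<bar> + 2))" by (simp add: algebra_simps)
    also have "\<dots> \<le> (real k * ?E) * (L * (\<bar>ln (14 / p)\<bar> + 2))"
      using kE L1 by (intro mult_right_mono) auto
    finally show ?thesis by (simp add: mult_ac)
  qed
  have "(real k * ?E * L) * (260 * z\<^sup>2 * (ln (21 * B) + 2)) + (real k * ?E * L) * (\<bar>ln (14 / p)\<bar> + 2)
      = (real k * ?E * L) * (260 * z\<^sup>2 * (ln (21 * B) + 2) + \<bar>ln (14 / p)\<bar> + 2)"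
    by (simp add: algebra_simps)
  also have "\<dots> \<le> (real k * ?E * L) * (B / (21632 * 64 powr z))"
    using main_param_inequality[OF H z] kE L1 unfolding B_def by (intro mult_left_mono) auto
  finally have "real k * (260 * z\<^sup>2 * ?E * ln (21 / X)) - (\<epsilon> / (104 * 8 powr z))\<^sup>2 / (2 * X) \<le> - ln (2 * strata_bound k / p)"
    using t1 t2 t3 by linarith
  then have "exp (real k * (260 * z\<^sup>2 * ?E * ln (21 / X)) - (\<epsilon> / (104 * 8 powr z))\<^sup>2 / (2 * X)) \<le> exp (- ln (2 * strata_bound k / p))"
    by simp
  also have "\<dots> = p / (2 * strata_bound k)"
  proof -
    have "0 < strata_bound k" using k1 by (simp add: strata_bound_def add_pos_nonneg)
    then show ?thesis using p by (simp add: exp_minus)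
  qed
  finally have "exp (real k * (260 * z\<^sup>2 * ?E * ln (21 / X))) * exp (- ((\<epsilon> / (104 * 8 powr z))\<^sup>2 / (2 * X))) \<le> p / (2 * strata_bound k)"
    unfolding mult_exp_exp diff_conv_add_uminus .
  from mult_left_mono[OF this, of 2] show ?thesis by simp
qed

lemma rate_bounds:
  assumes \<epsilon>: "0 < \<epsilon>" "\<epsilon> < 1" and d: "1 \<le> d" and k: "1 \<le> k" and z: "1 \<le> z" and H: "1 \<le> H"
  shows "0 < rate H 512 z k d \<epsilon>" "rate H 512 z k d \<epsilon> \<le> 1"
    "1 \<le> real H * 512 powr z" "z \<le> real H * 512 powr z"
proof -
  note Y = complexity_bounds[OF \<epsilon> d k]
  have "1 * 1 \<le> real H * 512 powr z" using H z by (intro mult_mono ge_one_powr_ge_zero) auto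
  then show B: "1 \<le> real H * 512 powr z" by simp
  have "z \<le> 2 powr z" by (rule le_powr_2[OF z])
  also have "\<dots> \<le> 512 powr z" using z by (intro powr_mono2) auto
  also have "1 * 512 powr z \<le> real H * 512 powr z" using H by (intro mult_right_mono) auto
  finally show "z \<le> real H * 512 powr z" by simp
  have "1 * 1 * 1 \<le> real H * 512 powr z * complexity k d \<epsilon> * (1 + ln (complexity k d \<epsilon>))"
    using B Y by (intro mult_mono) auto
  then show "0 < rate H 512 z k d \<epsilon>" "rate H 512 z k d \<epsilon> \<le> 1" by (auto simp: rate_def)
qed

text \<open>\<open>k\<close> times the complexity is
  \<open>k^2 * \<epsilon>^(-2) * eff_dim d \<epsilon>\<close>, which is at most the size term as
  \<open>z \<ge> 1\<close>. One logarithm comes from the strata and one from the rate, and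
  \<open>21 = 7 * 3\<close>.\<close>

lemma size_bound:
  assumes \<epsilon>: "0 < \<epsilon>" "\<epsilon> < 1" and d: "1 \<le> d" and k: "1 \<le> k" and z: "1 \<le> z" and H: "1 \<le> H"
  shows "strata_bound k * (3 / rate H 512 z k d \<epsilon>)
     \<le> 21 * (real H * 512 powr z) * coreset_size_term d k z \<epsilon> * (1 + ln (coreset_size_term d k z \<epsilon>)) ^ 2"
proof -
  let ?Y = "complexity k d \<epsilon>" and ?S = "coreset_size_term d k z \<epsilon>"
  note Y = complexity_bounds[OF \<epsilon> d k] and E = eff_dim_bounds[OF \<epsilon> d]
  have k1: "1 \<le> real k" using k by simp
  have "\<epsilon> powr 2 \<ge> \<epsilon> powr (2 * z)" using \<epsilon> z by (intro powr_mono') auto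
  then have e: "1 / \<epsilon>\<^sup>2 \<le> \<epsilon> powr (- 2 * z)"
    using \<epsilon> by (simp add: powr_minus_divide powr_numeral divide_left_mono)
  have m: "min (\<epsilon> powr (- 2)) (real d) = eff_dim d \<epsilon>"
    using \<epsilon> by (auto simp: eff_dim_def powr_minus_divide powr_numeral power2_eq_square min_def)
  have "real k * ?Y = (real k)\<^sup>2 * (1 / \<epsilon>\<^sup>2) * eff_dim d \<epsilon>"
    by (simp add: complexity_def power2_eq_square)
  also have "\<dots> \<le> (real k)\<^sup>2 * \<epsilon> powr (- 2 * z) * eff_dim d \<epsilon>"
    using e E by (intro mult_right_mono mult_left_mono) auto
  finally have S: "real k * ?Y \<le> ?S" by (simp add: coreset_size_term_def m)
  have YS: "?Y \<le> ?S" using S mult_right_mono[OF k1, of ?Y] Y by linarith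
  have kS: "real k \<le> ?S" using YS Y by linarith
  have lS: "0 \<le> ln ?S" "ln ?Y \<le> ln ?S" "ln (real k) \<le> ln ?S" "0 \<le> ln (real k)" "0 \<le> ln ?Y" using YS kS Y k1 by auto
  have "strata_bound k * (3 / rate H 512 z k d \<epsilon>)
      = 21 * (real H * 512 powr z) * (real k * ?Y) * ((1 + ln (real k)) * (1 + ln ?Y))"
    by (simp add: strata_bound_def rate_def)
  also have "\<dots> \<le> 21 * (real H * 512 powr z) * ?S * ((1 + ln ?S) * (1 + ln ?S))"
  proof (rule mult_mono)
    show "21 * (real H * 512 powr z) * (real k * ?Y) \<le> 21 * (real H * 512 powr z) * ?S"
      using S by (intro mult_left_mono) auto
    show "(1 + ln (real k)) * (1 + ln ?Y) \<le> (1 + ln ?S) * (1 + ln ?S)"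
      by (rule mult_mono) (use lS in linarith)+
    have "0 \<le> ?S" using kS k1 by linarith
    then show "0 \<le> 21 * (real H * 512 powr z) * ?S" by simp
    show "0 \<le> (1 + ln (real k)) * (1 + ln ?Y)"
      by (rule mult_nonneg_nonneg) (use lS in linarith)+
  qed
  finally show ?thesis by (simp add: power2_eq_square)
qed

section \<open>Guarantees for the threshold and the strata\<close>

lemma running_max_props: "0 \<le> running_max F n \<and> (\<forall>i<n. F i \<le> running_max F n)"
  by (induction n) (auto simp: less_Suc_eq intro: order_trans less_imp_le)

lemma threshold_props:
  assumes F: "\<And>i. 0 \<le> F i"
  shows "0 \<le> threshold F n k m K x" "cnt (\<lambda>i. threshold F n k m K x < F i) n \<le> m"
proof -
  define ok where "ok = (\<lambda>t. 0 \<le> t \<and> cnt (\<lambda>i. t < F i) n \<le> m)"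
  have t: "ok (test F n m v t)" if "0 \<le> v" "ok t" for v t using that by (auto simp: ok_def test_def)
  have "cnt (\<lambda>i. running_max F n < F i) n = 0"
    using running_max_props[of F n] by (auto simp: cnt_def not_less[symmetric])
  then have 0: "ok (running_max F n)" using running_max_props[of F n] by (simp add: ok_def)
  have 1: "ok (try_candidates F n k m x j)" for j
    by (induction j) (use 0 F in \<open>auto intro!: t\<close>)
  have "ok (try_halving F n m (try_candidates F n k m x (K * k)) j)" for j
  proof (induction j)
    case (Suc j)
    then have "0 \<le> try_halving F n m (try_candidates F n k m x (K * k)) j / 2" by (simp add: ok_def)
    from t[OF this Suc] show ?case by simp
  qed (use 1 in simp)
  then show "0 \<le> threshold F n k m K x" "cnt (\<lambda>i. threshold F n k m K x < F i) n \<le> m"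
    by (auto simp: ok_def threshold_def)
qed

text \<open>Tests never increase the value, so it is at most \<open>V\<close> once candidate
  \<open>j\<close> has been tried. A halving is refused only if half of the value is below
  \<open>M\<close>, or if the value is not positive; in both cases the value is already at most
  \<open>2 * M\<close>.\<close>

lemma threshold_le:
  assumes F: "\<And>i. 0 \<le> F i" and M: "0 \<le> M" "\<And>v. M \<le> v \<Longrightarrow> cnt (\<lambda>i. v < F i) n \<le> m"
    and j: "j < K * k" "cnt (\<lambda>i. 8 * real k * F (x j) < F i) n \<le> m" "8 * real k * F (x j) \<le> V"
  shows "threshold F n k m K x \<le> max (2 * M) (V / 2 ^ (k + 3))"
proof -
  have tl: "test F n m v t \<le> t" for v t by (auto simp: test_def)
  have "try_candidates F n k m x i \<le> V" if "j < i" for i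
    using that
  proof (induction i)
    case (Suc i)
    show ?case
    proof (cases "i = j")
      case True
      then show ?thesis using j by (auto simp: test_def)
    next
      case False
      then show ?thesis using Suc tl[of "8 * real k * F (x i)"] by (auto intro: order_trans)
    qed
  qed simp
  then have c: "try_candidates F n k m x (K * k) \<le> V" using j by simp
  let ?h = "try_halving F n m (try_candidates F n k m x (K * k))"
  have "?h i \<le> max (2 * M) (V / 2 ^ i)" for i
  proof (induction i)
    case (Suc i)
    show ?case
    proof (cases "cnt (\<lambda>l. ?h i / 2 < F l) n \<le> m \<and> ?h i / 2 < ?h i")
      case True
      then have "?h (Suc i) = ?h i / 2" by (simp add: test_def)
      also have "\<dots> \<le> max (2 * M) (V / 2 ^ i) / 2" using Suc by simp
      also have "\<dots> \<le> max (2 * M) (V / 2 ^ Suc i)" using M by (auto simp: max_def)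
      finally show ?thesis .
    next
      case False
      then have e: "?h (Suc i) = ?h i" by (auto simp: test_def)
      have "?h i \<le> 2 * M"
      proof (cases "cnt (\<lambda>l. ?h i / 2 < F l) n \<le> m")
        case True
        then have "?h i \<le> 0" using False by auto
        then show ?thesis using M by simp
      next
        case nc: False
        then have "\<not> M \<le> ?h i / 2" using M(2) by blast
        then show ?thesis by simp
      qed
      then show ?thesis unfolding e by simp
    qed
  qed (use c in auto)
  then show ?thesis by (simp add: threshold_def)
qed

text \<open>The guard held one step before the loop stopped, so rings are at most
  \<open>log 2 (32 * k)\<close>; the ids are then bounded by \<open>k\<close> plus \<open>k\<close>
  times this.\<close>

lemma card_strata:
  assumes k: "1 \<le> k" and G: "\<And>i. i < n \<Longrightarrow> G i < k" and \<tau>: "0 \<le> \<tau>"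
  shows "real (card (stratum F G k \<tau> ` {..<n})) \<le> strata_bound k"
proof -
  define R where "R = log 2 (32 * real k)"
  have kpos: "0 < real k" using k by simp
  have r: "real (ring \<tau> k f) \<le> R" for f
  proof (cases "ring \<tau> k f")
    case 0
    have "1 \<le> 32 * real k" using k by linarith
    then show ?thesis using 0 by (simp add: R_def)
  next
    case (Suc r)
    then have "2 ^ r < 16 * k"
      using ring_props(2)[OF \<tau>, of r k f] ring_bound(1)[OF \<tau>, of k r] by simp
    then have "2 ^ Suc r \<le> 32 * k" by simp
    then have "real (2 ^ Suc r) \<le> real (32 * k)" by (simp only: of_nat_le_iff)
    then have "2 powr real (Suc r) \<le> 32 * real k" by (subst powr_realpow) auto
    then show ?thesis unfolding Suc R_def using kpos by (subst le_log_iff) auto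
  qed
  have "stratum F G k \<tau> i \<le> nat \<lfloor>real k + real k * R\<rfloor>" if "i < n" for i
  proof -
    have "stratum F G k \<tau> i \<le> k + k * ring \<tau> k (F i)" using G[OF that] by (simp add: stratum_def)
    then have "real (stratum F G k \<tau> i) \<le> real (k + k * ring \<tau> k (F i))" by (simp only: of_nat_le_iff)
    also have "\<dots> = real k + real k * real (ring \<tau> k (F i))" by simp
    also have "\<dots> \<le> real k + real k * R" using r by (intro add_left_mono mult_left_mono) auto
    finally show ?thesis by linarith
  qed
  then have "stratum F G k \<tau> ` {..<n} \<subseteq> {..nat \<lfloor>real k + real k * R\<rfloor>}" by auto
  then have "card (stratum F G k \<tau> ` {..<n}) \<le> nat \<lfloor>real k + real k * R\<rfloor> + 1"
    using card_mono[OF finite_atMost] by (metis card_atMost Suc_eq_plus1)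
  moreover have "0 \<le> R" using k unfolding R_def by (intro zero_le_log_cancel_iff[THEN iffD2]) auto
  then have "0 \<le> real k + real k * R" by simp
  ultimately have 1: "real (card (stratum F G k \<tau> ` {..<n})) \<le> real k + real k * R + 1" by linarith
  have "R = 5 + log 2 (real k)"
  proof -
    have "log 2 (32 * real k) = log 2 32 + log 2 (real k)" using kpos by (simp add: log_mult)
    moreover have "log 2 (32::real) = 5" using log_pow_cancel[of 2 5] by simp
    ultimately show ?thesis by (simp add: R_def)
  qed
  moreover have "log 2 (real k) \<le> 2 * ln (real k)"
  proof -
    have "(1/2::real) \<le> ln 2" using exp_bound[of "1/2::real"] by (subst ln_ge_iff) (auto simp: power2_eq_square)
    then have "ln (real k) \<le> 2 * ln (real k) * ln 2" using k mult_left_mono[of "1/2" "ln 2" "2 * ln (real k)"] by simp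
    then show ?thesis by (simp add: log_def divide_le_eq)
  qed
  ultimately have R2: "real k * R \<le> real k * (5 + 2 * ln (real k))" by (intro mult_left_mono) auto
  define y where "y = real k * ln (real k)"
  have "0 \<le> y" "real k * (5 + 2 * ln (real k)) = 5 * real k + 2 * y" "strata_bound k = 7 * real k + 7 * y"
    using k by (auto simp: y_def strata_bound_def algebra_simps)
  moreover have "1 \<le> real k" using k by simp
  ultimately show ?thesis using 1 R2 by linarith
qed

text \<open>Each of the \<open>K * k\<close> independent draws misses with probability at most
  \<open>1 - 1 / (10 * k)\<close>, and \<open>1 - x \<le> exp (- x)\<close>.\<close>

lemma candidates_failure:
  assumes n: "1 \<le> n" and k: "1 \<le> k" and g: "real n \<le> 10 * real k * real (card {i. i < n \<and> Gd i})"
  shows "measure coins (boxes {..<K * k} (\<lambda>_. n) {x \<in> choices {..<K * k} (\<lambda>_. n). \<forall>j<K * k. \<not> Gd (x j)}) \<le> exp (- real K / 10)"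
proof -
  let ?J = "{..<K * k}" and ?good = "{i. i < n \<and> Gd i}"
  have c: "card {i. i < n \<and> \<not> Gd i} = n - card ?good"
  proof -
    have "{i. i < n \<and> \<not> Gd i} = {..<n} - ?good" by auto
    then show ?thesis by (simp add: card_Diff_subset subset_iff)
  qed
  have gn: "card ?good \<le> n" using card_mono[of "{..<n}" ?good] by auto
  have eq: "{x \<in> choices ?J (\<lambda>_. n). \<forall>j<K * k. \<not> Gd (x j)} = PiE ?J (\<lambda>_. {i. i < n \<and> \<not> Gd i})"
    unfolding set_eq_iff mem_Collect_eq PiE_iff lessThan_iff Ball_def by blast
  have m: "measure coins (boxes ?J (\<lambda>_. n) {x \<in> choices ?J (\<lambda>_. n). \<forall>j<K * k. \<not> Gd (x j)})
      = ((real n - real (card ?good)) / real n) ^ (K * k)"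
  proof -
    have sub: "PiE ?J (\<lambda>_. {i. i < n \<and> \<not> Gd i}) \<subseteq> choices ?J (\<lambda>_. n)"
      by (rule PiE_mono) auto
    have "measure coins (boxes ?J (\<lambda>_. n) (PiE ?J (\<lambda>_. {i. i < n \<and> \<not> Gd i})))
        = real (card (PiE ?J (\<lambda>_. {i. i < n \<and> \<not> Gd i}))) / real (card (choices ?J (\<lambda>_. n)))"
      by (rule measure_boxes[OF finite_lessThan sub])
    also have "\<dots> = (real n - real (card ?good)) ^ (K * k) / real n ^ (K * k)"
      by (simp only: card_PiE[OF finite_lessThan] prod_constant card_lessThan c of_nat_power of_nat_diff[OF gn])
    finally show ?thesis unfolding eq by (simp only: power_divide)
  qed
  note m
  also have "((real n - real (card ?good)) / real n) ^ (K * k) \<le> (1 - 1 / (10 * real k)) ^ (K * k)"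
  proof (rule power_mono)
    show "(real n - real (card ?good)) / real n \<le> 1 - 1 / (10 * real k)"
      using g n k by (simp add: field_simps)
    show "0 \<le> (real n - real (card ?good)) / real n" using gn by simp
  qed
  also have "\<dots> \<le> (exp (- (1 / (10 * real k)))) ^ (K * k)"
    using exp_ge_add_one_self[of "- (1 / (10 * real k))"] k by (intro power_mono) auto
  also have "\<dots> = exp (real (K * k) * (- (1 / (10 * real k))))" by (simp only: exp_of_nat_mult)
  also have "real (K * k) * (- (1 / (10 * real k))) = - real K / 10" using k by simp
  finally show ?thesis .
qed

text \<open>Complements \<open>box_cell\<close>: coins below 1 always lie in the box of their own
  cells. A coin equal to 1 would be assigned the last cell without lying in it.\<close>

lemma box_cells:
  assumes \<omega>: "\<And>j. j \<in> J \<Longrightarrow> 0 \<le> \<omega> j \<and> \<omega> j < 1" and \<beta>: "\<And>j. j \<in> J \<Longrightarrow> 1 \<le> \<beta> j"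
  shows "\<omega> \<in> box J \<beta> (\<lambda>j\<in>J. cell (\<beta> j) (\<omega> j))" "(\<lambda>j\<in>J. cell (\<beta> j) (\<omega> j)) \<in> choices J \<beta>"
proof -
  have c: "cell (\<beta> j) (\<omega> j) < \<beta> j" "real (cell (\<beta> j) (\<omega> j)) \<le> \<omega> j * real (\<beta> j)"
    "\<omega> j * real (\<beta> j) < real (cell (\<beta> j) (\<omega> j)) + 1" if j: "j \<in> J" for j
  proof -
    note cp = cell_props[OF \<beta>[OF j] conjunct1[OF \<omega>[OF j]]]
    show "cell (\<beta> j) (\<omega> j) < \<beta> j" "real (cell (\<beta> j) (\<omega> j)) \<le> \<omega> j * real (\<beta> j)" using cp by auto
    show "\<omega> j * real (\<beta> j) < real (cell (\<beta> j) (\<omega> j)) + 1"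
    proof (cases "cell (\<beta> j) (\<omega> j) + 1 < \<beta> j")
      case True
      then show ?thesis using cp(3)[OF True] by (simp add: not_le)
    next
      case False
      then have "cell (\<beta> j) (\<omega> j) + 1 = \<beta> j" using cp(1) by simp
      then have "real (cell (\<beta> j) (\<omega> j)) + 1 = real (\<beta> j)" by (metis of_nat_1 of_nat_add)
      moreover have "\<omega> j * real (\<beta> j) < 1 * real (\<beta> j)" using \<omega>[OF j] \<beta>[OF j] by (intro mult_strict_right_mono) auto
      ultimately show ?thesis by simp
    qed
  qed
  then show "(\<lambda>j\<in>J. cell (\<beta> j) (\<omega> j)) \<in> choices J \<beta>" by auto
  show "\<omega> \<in> box J \<beta> (\<lambda>j\<in>J. cell (\<beta> j) (\<omega> j))"
    unfolding box_def
  proof (intro CollectI ballI conjI)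
    fix j assume j: "j \<in> J"
    have "0 < real (\<beta> j)" using \<beta>[OF j] by simp
    then show "real ((\<lambda>j\<in>J. cell (\<beta> j) (\<omega> j)) j) / real (\<beta> j) \<le> \<omega> j"
      "\<omega> j < (real ((\<lambda>j\<in>J. cell (\<beta> j) (\<omega> j)) j) + 1) / real (\<beta> j)"
      using c(2,3)[OF j] j by (simp_all add: divide_le_eq less_divide_eq)
  qed
qed

lemma not_boxes_cells:
  assumes "\<omega> \<notin> boxes J \<beta> {x\<in>choices J \<beta>. Q x}"
    and "\<And>j. j \<in> J \<Longrightarrow> 0 \<le> \<omega> j \<and> \<omega> j < 1" "\<And>j. j \<in> J \<Longrightarrow> 1 \<le> \<beta> j"
  shows "\<not> Q (\<lambda>j\<in>J. cell (\<beta> j) (\<omega> j))"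
  using box_cells[of J \<omega> \<beta>, OF assms(2,3)] assms(1) unfolding boxes_def by blast

section \<open>The coreset program\<close>

definition coreset_prog :: "nat \<Rightarrow> nat \<Rightarrow> com" where
  "coreset_prog K H = Seq dist_prog (Seq (threshold_prog K) (Seq (strata_prog H 512) block_prog))"

text \<open>The threshold is a function of the cells of the first \<open>K * k\<close> coins, as the
  two-stage argument requires of its parameter.\<close>

lemma threshold_cong:
  assumes "\<And>j. j < K * k \<Longrightarrow> x j = y j"
  shows "threshold F n k m K x = threshold F n k m K y"
proof -
  have "try_candidates F n k m x j = try_candidates F n k m y j" if "j \<le> K * k" for j
    using that by (induction j) (use assms in \<open>auto simp: Suc_le_eq\<close>)
  then show ?thesis by (simp add: threshold_def)
qed

text \<open>Transfers the strata from indices to points, where distinctness of the list makes the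
  index of a point unique, and reads the locale assumptions off the encoding of the ids.\<close>

lemma (in inlier_instance) sample_is_coreset:
  fixes ps cs :: "point list" and F :: "nat \<Rightarrow> real" and G B :: "nat \<Rightarrow> nat" and \<tau> :: real and \<omega> :: "nat \<Rightarrow> real" and a :: nat
  defines "n \<equiv> length ps" and "ID \<equiv> stratum F G k \<tau>"
  assumes ps: "set ps = P" "distinct ps" and cs: "set cs = Cs" "length cs = k"
    and F: "\<And>i. i < n \<Longrightarrow> F i = cost0 (ps ! i)"
    and G: "\<And>i. i < n \<Longrightarrow> G i < k \<and> pdist (ps ! i) (cs ! G i) = cdist (ps ! i) Cs"
    and \<tau>: "0 \<le> \<tau>" "cnt (\<lambda>i. \<tau> < F i) n \<le> m" "\<tau> \<le> 8 * real k * opt / real (card I)"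
    and bs: "block_sampling B \<omega>"
    and good: "\<And>g. g \<in> ID ` {..<n} \<Longrightarrow>
      block_sampling.good_sample n ID B a d k (1 + \<epsilon> / (4 * z)) (\<epsilon> / (104 * 8 powr z)) ps g
        (\<lambda>j\<in>block_sampling.cJ n ID B a g. cell (block_sampling.c\<beta> n ID B a j) (\<omega> j))"
  shows "robust_coreset d k z m \<epsilon> P
     ((\<lambda>p. ps ! block_sampling.sel n ID B a \<omega> p) ` {p. p < n \<and> block_sampling.opens ID B p})
     (\<lambda>x. \<Sum>p | p < n \<and> block_sampling.opens ID B p \<and> ps ! block_sampling.sel n ID B a \<omega> p = x. real (block_sampling.bs n ID B p))"
proof -
  interpret b: block_sampling n ID B a \<omega> by (rule bs)
  let ?e = "1 + \<epsilon> / (4 * z)" and ?\<eta> = "\<epsilon> / (104 * 8 powr z)"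
  define ix where "ix = (\<lambda>x. THE i. i < n \<and> ps ! i = x)"
  have ix: "ix (ps ! i) = i" if "i < n" for i
    unfolding ix_def using that ps(2) by (intro the_equality) (auto simp: n_def nth_eq_iff_index_eq)
  have P_ex: "\<exists>i<n. x = ps ! i" if "x \<in> P" for x using that ps(1) by (auto simp: n_def in_set_conv_nth)
  have nP: "ps ! i \<in> P" if "i < n" for i using that ps(1) by (auto simp: n_def)
  have inj: "inj_on ((!) ps) {i. i < n \<and> Q i}" for Q using ps(2) by (auto simp: n_def inj_on_def nth_eq_iff_index_eq)
  define sid where "sid = (\<lambda>x. ID (ix x))"
  \<comment> \<open>Center and ring are decoded from the id; \<open>vv\<close> is the scale at which
    the halving stopped.\<close>
  define gc where "gc = (\<lambda>g. cs ! ((g - 1) mod k))"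
  define vv where "vv = (\<lambda>g. \<tau> / 2 ^ ((g - 1) div k))"
  let ?S = "(\<lambda>p. ps ! b.sel p) ` {p. p < n \<and> b.opens p}"
  let ?w = "\<lambda>x. \<Sum>p | p < n \<and> b.opens p \<and> ps ! b.sel p = x. real (b.bs p)"
  have k0: "0 < k" using k by simp
  have strat: "{x\<in>P. sid x = g} = (!) ps ` {i. i < n \<and> ID i = g}" for g
  proof (intro equalityI subsetI)
    fix x assume "x \<in> {x\<in>P. sid x = g}"
    then obtain i where "i < n" "x = ps ! i" "sid x = g" using P_ex[of x] by blast
    then show "x \<in> (!) ps ` {i. i < n \<and> ID i = g}" using ix by (auto simp: sid_def)
  qed (use nP ix in \<open>auto simp: sid_def\<close>)
  have sumP: "(\<Sum>x\<in>{x\<in>P. sid x = g}. h x) = (\<Sum>i | i < n \<and> ID i = g. h (ps ! i))" for g and h :: "point \<Rightarrow> real"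
    unfolding strat by (subst sum.reindex[OF inj]) simp
  have cardP: "real (card {x\<in>P. sid x = g}) = real (b.N g)" for g
    unfolding strat b.N_def cnt_def by (simp add: card_image[OF inj])
  have near: "ID i \<noteq> 0 \<longleftrightarrow> \<not> \<tau> < F i" "ID i \<noteq> 0 \<Longrightarrow> ID i - 1 = G i + k * ring \<tau> k (F i)" for i
    by (auto simp: ID_def stratum_def)
  have dm: "(ID i - 1) mod k = G i" "(ID i - 1) div k = ring \<tau> k (F i)" if "i < n" "ID i \<noteq> 0" for i
    using near(2)[OF that(2)] G[OF that(1)] k0 by auto
  have sumw: "(\<Sum>x\<in>{x\<in>P. sid x = g}. ?w x * h x) = (\<Sum>p\<in>b.openings g. real (b.bs p) * h (ps ! b.sel p))"
    for g and h :: "point \<Rightarrow> real"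
  proof -
    let ?Q = "{x\<in>P. sid x = g}"
    have sg: "ps ! b.sel p \<in> ?Q \<longleftrightarrow> ID p = g" if "p < n" for p
      using b.sel_props[OF that] nP ix by (auto simp: sid_def)
    have "(\<Sum>x\<in>?Q. ?w x * h x) = (\<Sum>x\<in>?Q. \<Sum>p\<in>{p\<in>b.openings g. ps ! b.sel p = x}. real (b.bs p) * h (ps ! b.sel p))"
    proof (rule sum.cong[OF refl])
      fix x assume x: "x \<in> ?Q"
      have "{p. p < n \<and> b.opens p \<and> ps ! b.sel p = x} = {p\<in>b.openings g. ps ! b.sel p = x}"
        using sg x by (auto simp: b.openings_def)
      then show "?w x * h x = (\<Sum>p\<in>{p\<in>b.openings g. ps ! b.sel p = x}. real (b.bs p) * h (ps ! b.sel p))"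
        by (simp add: sum_distrib_right)
    qed
    also have "\<dots> = (\<Sum>p\<in>b.openings g. real (b.bs p) * h (ps ! b.sel p))"
      using P sg by (intro sum.group) (auto simp: b.openings_def)
    finally show ?thesis .
  qed
  have w0: "0 \<le> ?w x" for x by (intro sum_nonneg) auto
  interpret stratified_instance d k m z \<epsilon> P Cs I \<sigma> \<tau> sid gc vv ?w ?S
  proof unfold_locales
    show "0 \<le> \<tau>" "\<tau> \<le> 8 * real k * opt / real (card I)" by fact+
    have "{p\<in>P. \<tau> < cost0 p} = (!) ps ` {i. i < n \<and> \<tau> < F i}"
    proof (intro equalityI subsetI)
      fix x assume "x \<in> {p\<in>P. \<tau> < cost0 p}"
      then obtain i where "i < n" "x = ps ! i" "\<tau> < cost0 x" using P_ex[of x] by blast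
      then show "x \<in> (!) ps ` {i. i < n \<and> \<tau> < F i}" using F by auto
    qed (use nP F in auto)
    then show "card {p\<in>P. \<tau> < cost0 p} \<le> m" using \<tau>(2) by (simp add: cnt_def card_image[OF inj])
    show "(sid p = 0) = (\<tau> < cost0 p)" if p: "p \<in> P" for p
    proof -
      obtain i where i: "i < n" "p = ps ! i" using P_ex[OF p] by blast
      then have "sid p = ID i" "cost0 p = F i" using ix F by (simp_all add: sid_def)
      then show ?thesis using near(1)[of i] by metis
    qed
    show "gc (sid p) \<in> Cs \<and> pdist p (gc (sid p)) = cdist p Cs" if p: "p \<in> P" "sid p \<noteq> 0" for p
    proof -
      obtain i where i: "i < n" "p = ps ! i" using P_ex[OF p(1)] by blast
      then have "ID i \<noteq> 0" using p(2) ix by (simp add: sid_def)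
      then have "gc (sid p) = cs ! G i" using dm(1)[OF i(1)] i ix by (simp add: gc_def sid_def)
      moreover have "cs ! G i \<in> Cs" using G[OF i(1)] cs nth_mem by metis
      ultimately show ?thesis using G[OF i(1)] i(2) by simp
    qed
    show "cost0 p \<le> vv (sid p) \<and> vv (sid p) \<le> \<tau> \<and> vv (sid p) \<le> 2 * cost0 p + \<tau> / (16 * real k)"
      if p: "p \<in> P" "sid p \<noteq> 0" for p
    proof -
      obtain i where i: "i < n" "p = ps ! i" using P_ex[OF p(1)] by blast
      then have I0: "ID i \<noteq> 0" using p(2) ix by (simp add: sid_def)
      let ?r = "ring \<tau> k (F i)"
      have v: "vv (sid p) = \<tau> / 2 ^ ?r" using dm(2)[OF i(1) I0] i ix by (simp add: vv_def sid_def)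
      have Fi: "cost0 p = F i" using F i by simp
      have F0: "0 \<le> F i" using Fi by (metis powr_ge_zero)
      define y where "y = \<tau> / 2 ^ ?r"
      \<comment> \<open>Without any halving this is nearness; otherwise the last successful guard
        bounded \<open>F i\<close> by the halved scale.\<close>
      have "F i \<le> y"
      proof (cases ?r)
        case 0
        then show ?thesis using near(1)[of i] I0 by (simp add: y_def)
      next
        case (Suc r)
        then have "F i \<le> \<tau> / 2 ^ r / 2" using ring_props(2)[OF \<tau>(1), of r k "F i"] by simp
        then show ?thesis using Suc by (simp add: y_def mult.commute)
      qed
      moreover have "y \<le> \<tau> / 1" unfolding y_def using \<tau>(1) by (intro divide_left_mono) auto
      moreover have "y \<le> 2 * F i + \<tau> / (16 * real k)"
      proof (cases "F i \<le> y / 2")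
        case False
        moreover have "0 \<le> \<tau> / (16 * real k)" using \<tau>(1) by simp
        ultimately show ?thesis by linarith
      next
        case True
        then have "16 * real k * y \<le> \<tau>" using ring_props(1)[OF \<tau>(1), of "F i" k] unfolding y_def by linarith
        then have "y \<le> \<tau> / (16 * real k)" using k0 by (simp add: field_simps)
        then show ?thesis using F0 by linarith
      qed
      ultimately show ?thesis unfolding v Fi y_def by simp
    qed
    show "?S \<subseteq> P" using b.sel_props(1) nP by auto
    show "?w p = 0" if "p \<in> P - ?S" for p using that by (intro sum.neutral) auto
    show "0 \<le> ?w p" for p by (rule w0)
    show "(\<Sum>p\<in>{p\<in>P. sid p = i}. ?w p) = real (card {p\<in>P. sid p = i})" for i
      using sumw[where g = i and h = "\<lambda>_. 1"] b.sum_bs[of i] cardP[of i] by simp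
  qed
  show ?thesis
  proof (rule coreset_if_deviations_small)
    fix C g and t :: real
    assume C: "C \<in> center_sets d k" and g: "g \<in> sid ` P" and t: "0 \<le> t"
    let ?Q = "{p\<in>P. sid p = g}"
    have gI: "g \<in> ID ` {..<n}"
    proof -
      obtain x where x: "x \<in> P" "g = sid x" using g by blast
      obtain i where i: "i < n" "x = ps ! i" using P_ex[OF x(1)] by blast
      then have "g = ID i" using ix x(2) by (simp add: sid_def)
      then show ?thesis using i(1) by blast
    qed
    define A where "A = (\<lambda>r. {p\<in>Rd d. cdist p C \<le> r})"
    let ?x = "\<lambda>j\<in>b.cJ g. cell (b.c\<beta> j) (\<omega> j)"
    let ?W = "\<lambda>r. \<Sum>p\<in>?Q. ?w p * of_bool (r < cdist p C)" and ?N = "\<lambda>r. \<Sum>p\<in>?Q. of_bool (r < cdist p C) :: real"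
    have PR: "x \<in> Rd d" if "x \<in> P" for x using that P by auto
    \<comment> \<open>Count and weight have the same stratum total, so estimates for neighbourhoods
      turn into estimates for their complements, with the two directions exchanged.\<close>
    have cA: "block_count (b.cJ g) b.c\<beta> (b.cpt ps g) (A r) = real (b.N g) - ?N r" for r
    proof -
      have "block_count (b.cJ g) b.c\<beta> (b.cpt ps g) (A r) = (\<Sum>i | i < n \<and> ID i = g. of_bool (ps ! i \<in> A r))"
        unfolding b.block_count_eq
      proof -
        have "{p. p < n \<and> ID p = g \<and> ps ! p \<in> A r} = {i. i < n \<and> ID i = g} \<inter> {i. ps ! i \<in> A r}" by blast
        then show "real (card {p. p < n \<and> ID p = g \<and> ps ! p \<in> A r}) = (\<Sum>i | i < n \<and> ID i = g. of_bool (ps ! i \<in> A r))" by simp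
      qed
      also have "\<dots> = (\<Sum>p\<in>?Q. of_bool (p \<in> A r))" by (rule sumP[symmetric])
      also have "\<dots> = (\<Sum>p\<in>?Q. 1 - of_bool (r < cdist p C))"
        using PR by (intro sum.cong refl) (auto simp: A_def)
      also have "\<dots> = real (b.N g) - ?N r" using cardP[of g] by (simp add: sum_subtractf)
      finally show ?thesis .
    qed
    have wA: "block_weight (b.cJ g) b.c\<beta> (b.cpt ps g) ?x (A r) = real (b.N g) - ?W r" for r
    proof -
      have "block_weight (b.cJ g) b.c\<beta> (b.cpt ps g) ?x (A r) = (\<Sum>p\<in>?Q. ?w p * of_bool (p \<in> A r))"
        unfolding b.block_weight_eq sumw ..
      also have "\<dots> = (\<Sum>p\<in>?Q. ?w p * (1 - of_bool (r < cdist p C)))"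
        using PR by (intro sum.cong refl) (auto simp: A_def)
      also have "\<dots> = (\<Sum>p\<in>?Q. ?w p) - ?W r" by (simp only: right_diff_distrib sum_subtractf mult_1_right)
      also have "(\<Sum>p\<in>?Q. ?w p) = real (b.N g)" using sumw[where g = g and h = "\<lambda>_. 1"] b.sum_bs[of g] by simp
      finally show ?thesis .
    qed
    have gs: "block_count (b.cJ g) b.c\<beta> (b.cpt ps g) (A t)
         \<le> block_weight (b.cJ g) b.c\<beta> (b.cpt ps g) ?x (A (?e * t)) + ?\<eta> * real (b.N g)"
      "block_weight (b.cJ g) b.c\<beta> (b.cpt ps g) ?x (A t)
         \<le> block_count (b.cJ g) b.c\<beta> (b.cpt ps g) (A (?e * t)) + ?\<eta> * real (b.N g)"
      using good[OF gI] C t unfolding b.good_sample_def A_def by blast+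
    show "?W (?e * t) \<le> ?N t + ?\<eta> * real (card ?Q) \<and> ?N (?e * t) \<le> ?W t + ?\<eta> * real (card ?Q)"
      using gs unfolding cA wA cardP by linarith
  qed
qed

lemma sqd_matrix:
  assumes "set ps \<subseteq> Rd d" "set cs \<subseteq> Rd d" "i < length ps" "j < length cs"
  shows "sqd d (matrix_arr d ps) (matrix_arr d cs) i j d powr (z / 2) = pdist (ps ! i) (cs ! j) powr z"
proof -
  have arr: "matrix_arr d xs (i * d + l) = xs ! i ! l" if il: "i < length xs" "l < d" for xs i l
  proof -
    have "i * d + l < (i + 1) * d" using il by simp
    also have "\<dots> \<le> length xs * d" using il by (intro mult_le_mono1) simp
    finally show ?thesis using il by (simp add: matrix_arr_def)
  qed
  have "ps ! i \<in> Rd d" using assms(1,3) nth_mem by blast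
  then have "length (ps ! i) = d" by (simp add: Rd_def)
  moreover have "sqd d (matrix_arr d ps) (matrix_arr d cs) i j d = (\<Sum>l<d. (ps ! i ! l - cs ! j ! l)\<^sup>2)"
    unfolding sqd_def power2_eq_square using arr assms by (intro sum.cong) auto
  moreover define Q where "Q = (\<Sum>l<d. (ps ! i ! l - cs ! j ! l)\<^sup>2)"
  moreover have "0 \<le> Q" by (auto simp: Q_def intro: sum_nonneg)
  then have "sqrt Q powr z = Q powr (z / 2)" by (simp add: powr_half_sqrt[symmetric] powr_powr)
  ultimately show ?thesis by (simp add: pdist_def L2_set_def)
qed

text \<open>The distances take \<open>O(nkd)\<close> steps, each of the \<open>K * k\<close>
  candidates and \<open>k + 3\<close> halvings \<open>O(n)\<close>, the ring of a point
  \<open>O(k)\<close>, and the block sampling \<open>O(1)\<close> per point.\<close>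

lemma runs_coreset_prog:
  fixes ps cs :: "point list" and z \<epsilon> :: real and d m K H :: nat and \<omega> :: "nat \<Rightarrow> real"
  defines "n \<equiv> length ps" and "k \<equiv> length cs"
  defines "h \<equiv> \<lambda>i j. sqd d (matrix_arr d ps) (matrix_arr d cs) i j d powr (z / 2)"
  defines "G \<equiv> \<lambda>i. best (h i) k"
  defines "F \<equiv> \<lambda>i. h i (G i)"
  defines "ID \<equiv> stratum F G k (threshold F n k m K (\<lambda>j. cell n (\<omega> j)))"
  defines "B \<equiv> \<lambda>g. pred_block (rate H 512 z k d \<epsilon>) (cnt (\<lambda>i. ID i = g) n) + 1"
  assumes nkd: "1 \<le> n" "1 \<le> k" "1 \<le> d" and \<omega>: "\<And>i. 0 \<le> \<omega> i"
  shows "runs \<omega> (coreset_prog K H) (input_store d k z m \<epsilon> ps cs) ((21 * K + 200) * (n * k * d))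
     (\<lambda>t. nreg t 0 = cnt (block_sampling.opens ID B) n \<and>
        (\<forall>p<n. block_sampling.opens ID B p \<longrightarrow>
           rarr t 0 (cnt (block_sampling.opens ID B) p) = real (block_sampling.bs n ID B p) \<and>
           narr t 0 (cnt (block_sampling.opens ID B) p) = block_sampling.sel n ID B (K * k) \<omega> p))"
proof -
  interpret s: threshold_state n k d m z \<epsilon> F G \<omega> using nkd \<omega> by unfold_locales
  interpret b: block_sampling n ID B "K * k" \<omega> using \<omega> by unfold_locales (auto simp: B_def)
  have F0: "0 \<le> F i" for i by (simp add: F_def h_def)
  define w where "w = n * k * d"
  have le: "n * k \<le> w" "n \<le> w" "k \<le> w" "1 \<le> w" "n * k * d = w"
    using nkd by (auto simp: w_def Suc_le_eq)
  define T1 where "T1 = n * (k * (3 * d + 11) + 4) + 2"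
  define T2 where "T2 = K * k * (10 * n + 11) + (k + 3) * (5 * n + 9) + 5 * n + 8"
  define T3 where "T3 = n * (3 * k + 27) + 8"
  define T4 where "T4 = n * 19 + 3"
  have "T1 = 3 * (n * k * d) + 11 * (n * k) + 4 * n + 2" by (simp add: T1_def algebra_simps)
  then have 1: "T1 \<le> 20 * w" using le by linarith
  have "T3 = 3 * (n * k) + 27 * n + 8" by (simp add: T3_def algebra_simps)
  then have 3: "T3 \<le> 38 * w" using le by linarith
  have 4: "T4 \<le> 22 * w" using le by (simp add: T4_def)
  have "T2 = K * (10 * (n * k) + 11 * k) + (5 * (n * k) + 9 * k + 15 * n + 27) + 5 * n + 8"
    by (simp add: T2_def algebra_simps)
  moreover have "K * (10 * (n * k) + 11 * k) \<le> K * (21 * w)" using le by (intro mult_le_mono2) linarith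
  ultimately have 2: "T2 \<le> K * (21 * w) + 69 * w" using le by linarith
  have "(21 * K + 200) * (n * k * d) = K * (21 * w) + 200 * w" by (simp add: w_def algebra_simps)
  then have T: "T1 + (T2 + (T3 + T4)) \<le> (21 * K + 200) * (n * k * d)" using 1 2 3 4 by linarith
  let ?s = "input_store d k z m \<epsilon> ps cs"
  let ?post = "\<lambda>t. nreg t 0 = cnt b.opens n \<and>
      (\<forall>p<n. b.opens p \<longrightarrow> rarr t 0 (cnt b.opens p) = real (b.bs p) \<and> narr t 0 (cnt b.opens p) = b.sel p)"
  show ?thesis
    unfolding coreset_prog_def
  proof (rule runs_Seq)
    show "runs \<omega> dist_prog ?s T1 (\<lambda>t. env n k d m z \<epsilon> t \<and> used t = 0 \<and>
       (\<forall>i<n. rarr t 2 i = h i (best (h i) k) \<and> narr t 1 i = best (h i) k))"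
      unfolding h_def using nkd
      by (intro runs_dist_prog) (auto simp: env_def input_store_def n_def T1_def)
    fix t assume t: "env n k d m z \<epsilon> t \<and> used t = 0 \<and>
       (\<forall>i<n. rarr t 2 i = h i (best (h i) k) \<and> narr t 1 i = best (h i) k)"
    then have st: "s.st t" unfolding s.st_def by (simp add: F_def G_def)
    show "runs \<omega> (Seq (threshold_prog K) (Seq (strata_prog H 512) block_prog)) t (T2 + (T3 + T4)) ?post"
    proof (rule runs_Seq)
      show "runs \<omega> (threshold_prog K) t T2
         (\<lambda>s. s.st s \<and> used s = K * k \<and> rreg s 4 = threshold F n k m K (\<lambda>j. cell n (\<omega> j)))"
        by (rule s.runs_threshold_prog[OF st]) (use t in \<open>simp_all add: T2_def\<close>)
      fix u assume u: "s.st u \<and> used u = K * k \<and> rreg u 4 = threshold F n k m K (\<lambda>j. cell n (\<omega> j))"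
      show "runs \<omega> (Seq (strata_prog H 512) block_prog) u (T3 + T4) ?post"
      proof (rule runs_Seq)
        show "runs \<omega> (strata_prog H 512) u T3 (stratified n n ID (rate H 512 z k d \<epsilon>) (K * k))"
          unfolding ID_def
          by (rule s.runs_strata_prog) (use u threshold_props(1)[OF F0] in \<open>simp_all add: T3_def\<close>)
        fix v assume "stratified n n ID (rate H 512 z k d \<epsilon>) (K * k) v"
        then show "runs \<omega> block_prog v T4 ?post"
          by (intro b.runs_block_prog) (simp_all add: stratified_def T4_def B_def b.N_def)
      qed simp
    qed simp
  qed (rule T)
qed

text \<open>\<open>cnt opens\<close> numbers the opening points consecutively, which is a bijection
  with the output slots. Different blocks may select equal points only as list entries, and
  \<open>out_weight\<close> adds their weights either way.\<close>

lemma (in block_sampling) out_sample: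
  assumes n: "length ps = n" and t: "nreg t 0 = cnt opens n"
    "\<forall>p<n. opens p \<longrightarrow> rarr t 0 (cnt opens p) = real (bs p) \<and> narr t 0 (cnt opens p) = sel p"
  shows "out_valid ps t" "out_set ps t = (\<lambda>p. ps ! sel p) ` {p. p < n \<and> opens p}"
    "out_weight ps t = (\<lambda>x. \<Sum>p | p < n \<and> opens p \<and> ps ! sel p = x. real (bs p))"
proof -
  have lt: "{..<nreg t 0} = cnt opens ` {p. p < n \<and> opens p}"
  proof (intro equalityI subsetI)
    fix j assume "j \<in> {..<nreg t 0}"
    then show "j \<in> cnt opens ` {p. p < n \<and> opens p}" using cnt_surj[of j opens n] t(1) by auto
  qed (use cnt_strict t(1) in auto)
  have nr: "narr t 0 (cnt opens p) = sel p" "rarr t 0 (cnt opens p) = real (bs p)" if "p < n" "opens p" for p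
    using t(2) that by auto
  have "narr t 0 j < length ps" if j: "j < nreg t 0" for j
  proof -
    have "j \<in> cnt opens ` {p. p < n \<and> opens p}" using j lt by (metis lessThan_iff)
    then show ?thesis using nr sel_props(1) n by auto
  qed
  then show "out_valid ps t" by (simp add: out_valid_def)
  show "out_set ps t = (\<lambda>p. ps ! sel p) ` {p. p < n \<and> opens p}"
    unfolding out_set_def lt image_image using nr by (intro image_cong) auto
  show "out_weight ps t = (\<lambda>x. \<Sum>p | p < n \<and> opens p \<and> ps ! sel p = x. real (bs p))"
  proof
    fix x
    have "out_weight ps t x = (\<Sum>j | j < nreg t 0 \<and> ps ! narr t 0 j = x. rarr t 0 j)" by (simp add: out_weight_def)
    also have "{j. j < nreg t 0 \<and> ps ! narr t 0 j = x} = {j\<in>{..<nreg t 0}. ps ! narr t 0 j = x}" by simp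
    also have "\<dots> = cnt opens ` {p. p < n \<and> opens p \<and> ps ! sel p = x}" unfolding lt using nr by auto
    also have "(\<Sum>j\<in>\<dots>. rarr t 0 j) = (\<Sum>p | p < n \<and> opens p \<and> ps ! sel p = x. rarr t 0 (cnt opens p))"
      by (subst sum.reindex) (auto simp: inj_on_def dest: cnt_inj[of opens])
    also have "\<dots> = (\<Sum>p | p < n \<and> opens p \<and> ps ! sel p = x. real (bs p))"
      using nr by (intro sum.cong) auto
    finally show "out_weight ps t x = (\<Sum>p | p < n \<and> opens p \<and> ps ! sel p = x. real (bs p))" .
  qed
qed

text \<open>Two failures of probability at most \<open>p\<close> are removed: no good candidate
  (\<open>U1\<close>), and a bad sample in some stratum for the threshold actually found
  (\<open>U2\<close>). The latter is controlled because sampling uses coins from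
  \<open>K * k\<close> on, independent of those that determine the threshold.\<close>

lemma (in inlier_instance) success_event:
  fixes ps cs :: "point list" and F :: "nat \<Rightarrow> real" and G :: "nat \<Rightarrow> nat" and K H :: nat and p :: real
  defines "n \<equiv> length ps"
  defines "thr \<equiv> threshold F n k m K"
  defines "ID \<equiv> \<lambda>\<omega>. stratum F G k (thr (\<lambda>j. cell n (\<omega> j)))"
  defines "B \<equiv> \<lambda>\<omega> g. pred_block (rate H 512 z k d \<epsilon>) (cnt (\<lambda>i. ID \<omega> i = g) n) + 1"
  defines "S \<equiv> \<lambda>\<omega>. (\<lambda>p. ps ! block_sampling.sel n (ID \<omega>) (B \<omega>) (K * k) \<omega> p)
       ` {p. p < n \<and> block_sampling.opens (ID \<omega>) (B \<omega>) p}"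
  assumes d: "1 \<le> d" and ps: "set ps = P" "distinct ps" and cs: "set cs = Cs" "length cs = k"
    and F0: "\<And>i. 0 \<le> F i" and F: "\<And>i. i < n \<Longrightarrow> F i = cost0 (ps ! i)"
    and G: "\<And>i. i < n \<Longrightarrow> G i < k \<and> pdist (ps ! i) (cs ! G i) = cdist (ps ! i) Cs"
    and H: "suitable p H" and p: "0 < p" and K: "exp (- real K / 10) \<le> p"
  shows "\<exists>E\<in>sets coins. 1 - 2 * p \<le> measure coins E \<and> (\<forall>\<omega>\<in>E. (\<forall>i. 0 \<le> \<omega> i) \<longrightarrow>
     robust_coreset d k z m \<epsilon> P (S \<omega>)
       (\<lambda>x. \<Sum>p | p < n \<and> block_sampling.opens (ID \<omega>) (B \<omega>) p \<and> ps ! block_sampling.sel n (ID \<omega>) (B \<omega>) (K * k) \<omega> p = x.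
          real (block_sampling.bs n (ID \<omega>) (B \<omega>) p)) \<and>
     real (card (S \<omega>)) \<le> 21 * (real H * 512 powr z) * coreset_size_term d k z \<epsilon> * (1 + ln (coreset_size_term d k z \<epsilon>)) ^ 2)"
proof -
  interpret c: prob_space coins by (rule prob_space_coins)
  let ?X = "rate H 512 z k d \<epsilon>" and ?e = "1 + \<epsilon> / (4 * z)" and ?\<eta> = "\<epsilon> / (104 * 8 powr z)"
  let ?J = "{..<K * k}" and ?\<beta> = "\<lambda>_::nat. n"
  have H1: "1 \<le> H" using H by (simp add: suitable_def)
  note rb = rate_bounds[OF eps d k z H1]
  have n1: "1 \<le> n" using P(3) ps(1) by (cases ps) (auto simp: n_def)
  have sb: "0 < strata_bound k"
  proof -
    have "0 \<le> ln (real k)" "0 < real k" using k by auto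
    then show ?thesis by (simp add: strata_bound_def add_pos_nonneg)
  qed
  define Gd where "Gd = (\<lambda>i. ps ! i \<in> good)"
  define I1 where "I1 = (\<lambda>t. stratum F G k t)"
  define B1 where "B1 = (\<lambda>t g. pred_block ?X (cnt (\<lambda>i. I1 t i = g) n) + 1)"
  define J1 where "J1 = (\<lambda>t. block_sampling.cJ n (I1 t) (B1 t) (K * k))"
  define \<beta>1 where "\<beta>1 = (\<lambda>t. block_sampling.c\<beta> n (I1 t) (B1 t) (K * k))"
  define gs where "gs = (\<lambda>t. block_sampling.good_sample n (I1 t) (B1 t) (K * k) d k ?e ?\<eta> ps)"
  define bad where "bad = (\<lambda>t g. {x\<in>choices (J1 t g) (\<beta>1 t). \<not> gs t g x})"
  define Bad where "Bad = (\<lambda>t. \<Union>g\<in>I1 t ` {..<n}. boxes (J1 t g) (\<beta>1 t) (bad t g))"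
  define U1 where "U1 = boxes ?J ?\<beta> {x\<in>choices ?J ?\<beta>. \<forall>j<K * k. \<not> Gd (x j)}"
  \<comment> \<open>Strata and blocks depend on the threshold, which takes only finitely many
    values, so the bad samples are collected value by value.\<close>
  define U2 where "U2 = (\<Union>t\<in>thr ` choices ?J ?\<beta>. boxes ?J ?\<beta> {x\<in>choices ?J ?\<beta>. thr x = t} \<inter> Bad t)"
  define L where "L = {..<K * k + n}"
  \<comment> \<open>With one cell per coin this says that all relevant coins are in
    \<open>[0, 1)\<close>, which has probability 1.\<close>
  define U0 where "U0 = box L (\<lambda>_. 1) (\<lambda>_\<in>L. 0)"
  have bsl: "block_sampling (B1 t) w" if "\<And>i. 0 \<le> w i" for t and w :: "nat \<Rightarrow> real"
    using that by unfold_locales (auto simp: B1_def)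
  have thr0: "0 \<le> thr x" for x unfolding thr_def by (rule threshold_props(1)[OF F0])
  have small: "measure coins (boxes (J1 t g) (\<beta>1 t) (bad t g)) \<le> p / strata_bound k"
    "real (card (block_sampling.openings n (I1 t) (B1 t) g)) \<le> 3 / ?X"
    "finite (J1 t g)" "?J \<inter> J1 t g = {}" "j \<in> J1 t g \<Longrightarrow> j < K * k + n \<and> 1 \<le> \<beta>1 t j" for t g j
  proof -
    interpret b: block_sampling n "I1 t" "B1 t" "K * k" "\<lambda>_. 0" by (rule bsl) simp
    have Bg: "B1 t g = pred_block ?X (b.N g) + 1" by (simp add: B1_def b.N_def)
    have cov: "\<exists>F. covers d k ?e (exp (real k * (260 * z\<^sup>2 * eff_dim d \<epsilon> * ln (21 / ?X)))) Z F"
      if Z: "finite Z" "Z \<subseteq> Rd d" "real (card Z) \<le> 6 / ?X" for Z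
      by (rule cover_exists[OF eps d k z rb(3,4) _ Z]) (simp add: rate_def)
    have e: "1 \<le> ?e" "0 \<le> ?\<eta>" using eps z by auto
    note bp = b.bad_samples[OF rb(1,2) Bg cov e failure_probability[OF eps d k z H p]]
    show "measure coins (boxes (J1 t g) (\<beta>1 t) (bad t g)) \<le> p / strata_bound k"
      unfolding J1_def \<beta>1_def bad_def gs_def by (rule bp(1))
    show "real (card (b.openings g)) \<le> 3 / ?X" by (rule bp(2))
    show "finite (J1 t g)" "?J \<inter> J1 t g = {}" by (auto simp: J1_def b.cJ_def)
    show "j \<in> J1 t g \<Longrightarrow> j < K * k + n \<and> 1 \<le> \<beta>1 t j"
      using b.bs_pos by (auto simp: J1_def b.cJ_def \<beta>1_def b.c\<beta>_def b.openings_def)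
  qed
  have strata: "real (card (I1 t ` {..<n})) \<le> strata_bound k" if "0 \<le> t" for t
    unfolding I1_def using G by (intro card_strata k that) blast
  have U1: "U1 \<in> sets coins" "measure coins U1 \<le> p"
  proof -
    show "U1 \<in> sets coins" unfolding U1_def by (intro measurable_boxes) auto
    have "good \<subseteq> P" using I_sub(1) by (auto simp: good_def)
    then have "good = (!) ps ` {i. i < n \<and> Gd i}" unfolding Gd_def n_def ps(1)[symmetric] set_conv_nth by auto
    then have "card good \<le> card {i. i < n \<and> Gd i}" by (simp add: card_image_le)
    then have "10 * real k * real (card good) \<le> 10 * real k * real (card {i. i < n \<and> Gd i})"
      by (intro mult_left_mono) auto
    moreover have "card P = n" using distinct_card[OF ps(2)] ps(1) by (simp add: n_def)
    ultimately have "real n \<le> 10 * real k * real (card {i. i < n \<and> Gd i})" using card_good by linarith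
    from candidates_failure[OF n1 k this, of K] show "measure coins U1 \<le> p" unfolding U1_def using K by linarith
  qed
  have U2: "U2 \<in> sets coins \<and> measure coins U2 \<le> p"
    unfolding U2_def
  proof (rule two_stage_bound)
    fix t assume "t \<in> thr ` choices ?J ?\<beta>"
    then have t: "0 \<le> t" using thr0 by auto
    let ?f = "\<lambda>g. (J1 t g, \<beta>1 t, bad t g)" and ?M = "\<lambda>(K, \<gamma>, Y). measure coins (boxes K \<gamma> Y)"
    let ?R = "?f ` I1 t ` {..<n}"
    have "(\<Sum>r\<in>?R. ?M r) \<le> (\<Sum>g\<in>I1 t ` {..<n}. (?M \<circ> ?f) g)" by (intro sum_image_le) auto
    also have "\<dots> \<le> real (card (I1 t ` {..<n})) * (p / strata_bound k)"
      using small(1) by (intro sum_bounded_above) simp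
    also have "\<dots> \<le> strata_bound k * (p / strata_bound k)" using strata[OF t] p sb by (intro mult_right_mono) auto
    also have "\<dots> = p" using sb by simp
    finally have "(\<Sum>r\<in>?R. ?M r) \<le> p" .
    moreover have "Bad t = (\<Union>(K, \<gamma>, Y)\<in>?R. boxes K \<gamma> Y)" by (simp add: Bad_def)
    moreover have "\<forall>(K', \<gamma>, Y)\<in>?R. finite K' \<and> ?J \<inter> K' = {} \<and> Y \<subseteq> choices K' \<gamma>"
    proof (intro ballI)
      fix r assume "r \<in> ?R"
      then obtain g where r: "r = ?f g" by blast
      have "bad t g \<subseteq> choices (J1 t g) (\<beta>1 t)" unfolding bad_def by blast
      then show "case r of (K', \<gamma>, Y) \<Rightarrow> finite K' \<and> ?J \<inter> K' = {} \<and> Y \<subseteq> choices K' \<gamma>"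
        using small(3,4)[of t g] by (simp add: r)
    qed
    ultimately show "\<exists>R. finite R \<and> Bad t = (\<Union>(K, \<gamma>, Y)\<in>R. boxes K \<gamma> Y)
        \<and> (\<forall>(K', \<gamma>, Y)\<in>R. finite K' \<and> ?J \<inter> K' = {} \<and> Y \<subseteq> choices K' \<gamma>)
        \<and> (\<Sum>(K, \<gamma>, Y)\<in>R. measure coins (boxes K \<gamma> Y)) \<le> p"
      by (intro exI[of _ ?R] conjI finite_imageI finite_lessThan)
  qed (use p in auto)
  have U0: "U0 \<in> sets coins" "measure coins U0 = 1"
  proof -
    show "U0 \<in> sets coins" unfolding U0_def L_def by (rule measurable_box) simp
    have "measure coins U0 = 1 / real (card (choices L (\<lambda>_. 1)))"
      unfolding U0_def by (rule measure_box) (auto simp: L_def)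
    then show "measure coins U0 = 1" by (simp add: card_PiE L_def)
  qed
  let ?E = "U0 - (U1 \<union> U2)"
  have E: "?E \<in> sets coins" using U0(1) U1(1) U2 by auto
  have "1 \<le> measure coins (?E \<union> (U1 \<union> U2))"
    unfolding U0(2)[symmetric] using U0(1) U1(1) U2 by (intro c.finite_measure_mono) auto
  also have "\<dots> \<le> measure coins ?E + measure coins (U1 \<union> U2)"
    using E U1(1) U2 by (intro measure_Un_le) auto
  also have "measure coins (U1 \<union> U2) \<le> measure coins U1 + measure coins U2"
    using U1(1) U2 by (intro measure_Un_le) auto
  finally have mE: "1 - 2 * p \<le> measure coins ?E" using U1(2) U2 by linarith
  show ?thesis
  proof (intro bexI[of _ ?E] conjI ballI impI mE E)
    fix \<omega> assume \<omega>E: "\<omega> \<in> ?E" and "\<forall>i. 0 \<le> \<omega> i"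
    then have w0: "0 \<le> \<omega> i" for i by simp
    define t where "t = thr (\<lambda>j. cell n (\<omega> j))"
    have ID: "ID \<omega> = I1 t" by (simp add: ID_def I1_def t_def)
    have B: "B \<omega> = B1 t" by (simp add: B_def B1_def ID)
    interpret b: block_sampling n "I1 t" "B1 t" "K * k" \<omega> by (rule bsl[OF w0])
    have w1: "0 \<le> \<omega> j \<and> \<omega> j < 1" if "j < K * k + n" for j
      using \<omega>E that by (auto simp: U0_def box_def L_def)
    define x where "x = (\<lambda>j\<in>?J. cell n (\<omega> j))"
    have tx: "t = thr x" unfolding t_def thr_def by (rule threshold_cong) (simp add: x_def)
    have w2: "0 \<le> \<omega> j \<and> \<omega> j < 1" if "j \<in> ?J" for j using that by (intro w1) simp
    have xc: "\<omega> \<in> box ?J ?\<beta> x" "x \<in> choices ?J ?\<beta>"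
      using box_cells[of ?J \<omega> ?\<beta>, OF w2 n1] unfolding x_def by blast+
    have "\<omega> \<notin> boxes ?J ?\<beta> {x\<in>choices ?J ?\<beta>. \<forall>j<K * k. \<not> Gd (x j)}" using \<omega>E by (simp add: U1_def)
    from not_boxes_cells[OF this w2 n1] obtain j where j: "j < K * k" "ps ! x j \<in> good"
      unfolding x_def Gd_def by blast
    have xj: "x j < n" using xc(2) j(1) by auto
    have cntP: "cnt (\<lambda>i. v < F i) n = card {q\<in>P. v < cost0 q}" for v
    proof -
      have "{q\<in>P. v < cost0 q} = (!) ps ` {i. i < n \<and> v < F i}"
        unfolding ps(1)[symmetric] set_conv_nth using F by (auto simp: n_def)
      moreover have "inj_on ((!) ps) {i. i < n \<and> v < F i}"
        using ps(2) by (auto simp: n_def inj_on_def nth_eq_iff_index_eq)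
      ultimately show ?thesis by (simp add: cnt_def card_image)
    qed
    let ?M = "4 * real k * opt / real (card I)" and ?V = "32 * (real k)\<^sup>2 * opt / real (card I)"
    have M0: "0 \<le> ?M" using opt_nonneg by simp
    have t0: "0 \<le> t" unfolding t_def by (rule thr0)
    have t1: "cnt (\<lambda>i. t < F i) n \<le> m" unfolding t_def thr_def by (rule threshold_props(2)[OF F0])
    have "t \<le> max (2 * ?M) (?V / 2 ^ (k + 3))"
      unfolding tx thr_def
    proof (rule threshold_le[OF F0 M0 _ j(1)])
      fix v assume v: "?M \<le> v"
      have "{q\<in>P. v < cost0 q} \<subseteq> P - I" using cost0_le v by force
      then have "card {q\<in>P. v < cost0 q} \<le> card (P - I)" using P by (intro card_mono) auto
      then show "cnt (\<lambda>i. v < F i) n \<le> m" unfolding cntP using I_sub by (simp add: card_Diff_subset)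
    next
      show "cnt (\<lambda>i. 8 * real k * F (x j) < F i) n \<le> m" "8 * real k * F (x j) \<le> ?V"
        unfolding cntP F[OF xj] by (rule good_candidate[OF j(2)])+
    qed
    \<comment> \<open>\<open>?V\<close> is \<open>8 * k * ?M\<close> and
      \<open>2 ^ (k + 3) \<ge> 4 * k\<close>, so both terms of the maximum are at most
      \<open>2 * ?M\<close>.\<close>
    also have "\<dots> \<le> 8 * real k * opt / real (card I)"
    proof -
      have "real k \<le> 2 * 2 ^ k" using less_exp[of k] by (metis mult_2 of_nat_less_numeral_power_cancel_iff less_imp_le add_increasing zero_le_power zero_le_numeral)
      then have "?M * (8 * real k) \<le> ?M * (8 * (2 * 2 ^ k))" using M0 by (intro mult_left_mono) auto
      then have 1: "?M * (8 * real k) / 2 ^ (k + 3) \<le> ?M * (8 * (2 * 2 ^ k)) / 2 ^ (k + 3)" by (intro divide_right_mono) auto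
      have 2: "?M * (8 * (2 * 2 ^ k)) / 2 ^ (k + 3) = 2 * ?M" by (simp add: power_add)
      have 3: "?M * (8 * real k) = ?V" by (simp add: power2_eq_square)
      have "?V / 2 ^ (k + 3) \<le> 2 * ?M" using 1 unfolding 2 3 .
      then show ?thesis by simp
    qed
    finally have t2: "t \<le> 8 * real k * opt / real (card I)" .
    have nB: "\<omega> \<notin> Bad t"
    proof
      assume "\<omega> \<in> Bad t"
      moreover have "t \<in> thr ` choices ?J ?\<beta>" using tx xc(2) by blast
      moreover have "\<omega> \<in> boxes ?J ?\<beta> {x\<in>choices ?J ?\<beta>. thr x = t}"
        using xc tx unfolding boxes_def by blast
      ultimately have "\<omega> \<in> U2" unfolding U2_def by blast
      then show False using \<omega>E by simp
    qed
    have good: "gs t g (\<lambda>j\<in>J1 t g. cell (\<beta>1 t j) (\<omega> j))" if g: "g \<in> I1 t ` {..<n}" for g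
    proof -
      have "\<omega> \<notin> boxes (J1 t g) (\<beta>1 t) {x\<in>choices (J1 t g) (\<beta>1 t). \<not> gs t g x}"
        using nB g unfolding Bad_def bad_def by blast
      from not_boxes_cells[OF this] small(5) w1 show ?thesis by blast
    qed
    show "robust_coreset d k z m \<epsilon> P (S \<omega>)
       (\<lambda>x. \<Sum>p | p < n \<and> block_sampling.opens (ID \<omega>) (B \<omega>) p \<and> ps ! block_sampling.sel n (ID \<omega>) (B \<omega>) (K * k) \<omega> p = x.
          real (block_sampling.bs n (ID \<omega>) (B \<omega>) p))"
      unfolding S_def ID B unfolding I1_def n_def
      by (rule sample_is_coreset[OF ps cs, where \<tau> = t])
        (use F G t0 t1 t2 good bsl[OF w0] in \<open>auto simp: n_def I1_def gs_def J1_def \<beta>1_def\<close>)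
    have "{p. p < n \<and> b.opens p} \<subseteq> (\<Union>g\<in>I1 t ` {..<n}. b.openings g)" by (auto simp: b.openings_def)
    then have "card {p. p < n \<and> b.opens p} \<le> card (\<Union>g\<in>I1 t ` {..<n}. b.openings g)"
      by (intro card_mono) auto
    also have "\<dots> \<le> (\<Sum>g\<in>I1 t ` {..<n}. card (b.openings g))" by (rule card_UN_le) simp
    finally have "card (S \<omega>) \<le> (\<Sum>g\<in>I1 t ` {..<n}. card (b.openings g))"
      unfolding S_def ID B using card_image_le[of "{p. p < n \<and> b.opens p}" "\<lambda>p. ps ! b.sel p"] by simp
    then have "real (card (S \<omega>)) \<le> (\<Sum>g\<in>I1 t ` {..<n}. real (card (b.openings g)))"
      by (metis of_nat_le_iff of_nat_sum)
    also have "\<dots> \<le> real (card (I1 t ` {..<n})) * (3 / ?X)" using small(2) by (intro sum_bounded_above) simp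
    also have "\<dots> \<le> strata_bound k * (3 / ?X)" using strata[OF t0] rb(1) by (intro mult_right_mono) auto
    also note size_bound[OF eps d k z H1]
    finally show "real (card (S \<omega>)) \<le> 21 * (real H * 512 powr z) * coreset_size_term d k z \<epsilon> * (1 + ln (coreset_size_term d k z \<epsilon>)) ^ 2" .
  qed
qed

text \<open>The program minimises powers of distances, and by monotonicity its choice is a nearest
  center. Termination and time are shown for all coins in the unit interval, the quality of the
  output only on \<open>E\<close>.\<close>

lemma coreset_prog_correct:
  fixes ps cs :: "point list" and z \<epsilon> p :: real and m d K H :: nat
  defines "n \<equiv> length ps" and "k \<equiv> length cs"
  assumes n: "1 \<le> n" and k: "1 \<le> k" and d: "1 \<le> d" and z: "1 \<le> z" and eps: "0 < \<epsilon>" "\<epsilon> < 1"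
    and ps: "distinct ps" "set ps \<subseteq> Rd d" and cs: "distinct cs"
    and ap: "approx_center_set d k z m \<epsilon> (set ps) (set cs)" and inl: "inlier_assumption k z m (set ps) (set cs)"
    and H: "suitable p H" and p: "0 < p" and K: "exp (- real K / 10) \<le> p"
  shows "\<exists>E\<in>sets coins. 1 - 2 * p \<le> measure coins E \<and> (\<forall>\<omega>. (\<forall>i. \<omega> i \<in> {0..1}) \<longrightarrow>
     (\<exists>\<tau> t. exec \<omega> (coreset_prog K H) (input_store d k z m \<epsilon> ps cs) \<tau> t \<and>
        real \<tau> \<le> real (21 * K + 200) * real n * real k * real d \<and>
        (\<omega> \<in> E \<longrightarrow> out_valid ps t \<and> robust_coreset d k z m \<epsilon> (set ps) (out_set ps t) (out_weight ps t) \<and>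
           real (card (out_set ps t)) \<le> 21 * (real H * 512 powr z) * coreset_size_term d k z \<epsilon> *
             (1 + ln (coreset_size_term d k z \<epsilon>)) ^ 2)))"
proof -
  from inl obtain I \<sigma> where I: "is_arg_min (\<lambda>Q. \<Sum>p\<in>Q. cdist p (set cs)) (\<lambda>Q. Q \<subseteq> set ps \<and> card Q + m = card (set ps)) I"
    "\<forall>p\<in>I. \<sigma> p \<in> set cs \<and> pdist p (\<sigma> p) = cdist p (set cs)"
    "4 * m \<le> (MIN c\<in>set cs. card {p\<in>I. \<sigma> p = c})"
    "(MAX p\<in>I. cdist p (set cs) powr z) \<le> 4 * real k * (\<Sum>p\<in>I. cdist p (set cs) powr z) / real (card I)"
    unfolding inlier_assumption_def by blast
  have ne: "set ps \<noteq> {}" using n by (auto simp: n_def)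
  interpret inlier_instance d k m z \<epsilon> "set ps" "set cs" I \<sigma>
    using k z eps ps(2) ap I ne by unfold_locales auto
  define h where "h = (\<lambda>i j. sqd d (matrix_arr d ps) (matrix_arr d cs) i j d powr (z / 2))"
  define G where "G = (\<lambda>i. best (h i) k)"
  define F where "F = (\<lambda>i. h i (G i))"
  have hd: "h i j = pdist (ps ! i) (cs ! j) powr z" if "i < n" "j < k" for i j
    unfolding h_def using that ps(2) Cs(5) by (intro sqd_matrix) (auto simp: n_def k_def)
  have GF: "G i < k \<and> pdist (ps ! i) (cs ! G i) = cdist (ps ! i) (set cs)" if i: "i < n" for i
  proof -
    have "0 < k" using k by simp
    note bm = best_min[OF this, of "h i"]
    then have Gk: "G i < k" by (simp add: G_def)
    obtain j where j: "j < k" "pdist (ps ! i) (cs ! j) = cdist (ps ! i) (set cs)"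
      using cdist_attained[of "set cs" "ps ! i"] Cs(4) by (auto simp: in_set_conv_nth k_def)
    have "h i (G i) \<le> h i j" using bm j(1) by (simp add: G_def)
    then have "pdist (ps ! i) (cs ! G i) powr z \<le> pdist (ps ! i) (cs ! j) powr z"
      using hd[OF i] Gk j(1) by simp
    moreover have "0 \<le> pdist (ps ! i) (cs ! G i)" "0 \<le> pdist (ps ! i) (cs ! j)"
      by (simp_all add: pdist_def)
    ultimately have "pdist (ps ! i) (cs ! G i) \<le> pdist (ps ! i) (cs ! j)"
      using z powr_less_mono2[of z "pdist (ps ! i) (cs ! j)" "pdist (ps ! i) (cs ! G i)"] by linarith
    moreover have "cdist (ps ! i) (set cs) \<le> pdist (ps ! i) (cs ! G i)"
      using Gk by (intro cdist_le) (auto simp: k_def)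
    ultimately show ?thesis using Gk j(2) by simp
  qed
  have F: "F i = cdist (ps ! i) (set cs) powr z" if "i < n" for i
    using GF[OF that] hd[OF that] by (simp add: F_def)
  have F0: "0 \<le> F i" for i by (simp add: F_def h_def)
  define ID where "ID = (\<lambda>\<omega>. stratum F G k (threshold F n k m K (\<lambda>j. cell n (\<omega> j))))"
  define B where "B = (\<lambda>\<omega> g. pred_block (rate H 512 z k d \<epsilon>) (cnt (\<lambda>i. ID \<omega> i = g) n) + 1)"
  have ex: "\<exists>E\<in>sets coins. 1 - 2 * p \<le> measure coins E \<and> (\<forall>\<omega>\<in>E. (\<forall>i. 0 \<le> \<omega> i) \<longrightarrow>
     robust_coreset d k z m \<epsilon> (set ps) ((\<lambda>p. ps ! block_sampling.sel n (ID \<omega>) (B \<omega>) (K * k) \<omega> p)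
       ` {p. p < n \<and> block_sampling.opens (ID \<omega>) (B \<omega>) p})
       (\<lambda>x. \<Sum>p | p < n \<and> block_sampling.opens (ID \<omega>) (B \<omega>) p \<and> ps ! block_sampling.sel n (ID \<omega>) (B \<omega>) (K * k) \<omega> p = x.
          real (block_sampling.bs n (ID \<omega>) (B \<omega>) p)) \<and>
     real (card ((\<lambda>p. ps ! block_sampling.sel n (ID \<omega>) (B \<omega>) (K * k) \<omega> p)
       ` {p. p < n \<and> block_sampling.opens (ID \<omega>) (B \<omega>) p})) \<le> 21 * (real H * 512 powr z) * coreset_size_term d k z \<epsilon> * (1 + ln (coreset_size_term d k z \<epsilon>)) ^ 2)"
    unfolding ID_def B_def n_def
    by (rule success_event[OF d refl ps(1) refl _ F0 _ _ H p K]) (use F GF in \<open>auto simp: n_def k_def\<close>)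
  then obtain E where E: "E \<in> sets coins" "1 - 2 * p \<le> measure coins E"
    and good: "\<And>\<omega>. \<omega> \<in> E \<Longrightarrow> (\<forall>i. 0 \<le> \<omega> i) \<Longrightarrow>
     robust_coreset d k z m \<epsilon> (set ps) ((\<lambda>p. ps ! block_sampling.sel n (ID \<omega>) (B \<omega>) (K * k) \<omega> p)
       ` {p. p < n \<and> block_sampling.opens (ID \<omega>) (B \<omega>) p})
       (\<lambda>x. \<Sum>p | p < n \<and> block_sampling.opens (ID \<omega>) (B \<omega>) p \<and> ps ! block_sampling.sel n (ID \<omega>) (B \<omega>) (K * k) \<omega> p = x.
          real (block_sampling.bs n (ID \<omega>) (B \<omega>) p)) \<and>
     real (card ((\<lambda>p. ps ! block_sampling.sel n (ID \<omega>) (B \<omega>) (K * k) \<omega> p)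
       ` {p. p < n \<and> block_sampling.opens (ID \<omega>) (B \<omega>) p})) \<le> 21 * (real H * 512 powr z) * coreset_size_term d k z \<epsilon> * (1 + ln (coreset_size_term d k z \<epsilon>)) ^ 2"
    by blast
  show ?thesis
  proof (intro bexI[OF _ E(1)] conjI E(2) allI impI)
    fix \<omega> :: "nat \<Rightarrow> real"
    assume "\<forall>i. \<omega> i \<in> {0..1}"
    then have w: "\<forall>i. 0 \<le> \<omega> i" by simp
    interpret b: block_sampling n "ID \<omega>" "B \<omega>" "K * k" \<omega> using w by unfold_locales (auto simp: B_def)
    have "runs \<omega> (coreset_prog K H) (input_store d k z m \<epsilon> ps cs) ((21 * K + 200) * (n * k * d))
     (\<lambda>t. nreg t 0 = cnt b.opens n \<and>
        (\<forall>p<n. b.opens p \<longrightarrow> rarr t 0 (cnt b.opens p) = real (b.bs p) \<and> narr t 0 (cnt b.opens p) = b.sel p))"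
      unfolding ID_def B_def F_def G_def h_def n_def k_def
      by (rule runs_coreset_prog) (use n k d w in \<open>auto simp: n_def k_def\<close>)
    then obtain \<tau> t where r: "exec \<omega> (coreset_prog K H) (input_store d k z m \<epsilon> ps cs) \<tau> t"
      "\<tau> \<le> (21 * K + 200) * (n * k * d)" and t: "nreg t 0 = cnt b.opens n"
        "\<forall>p<n. b.opens p \<longrightarrow> rarr t 0 (cnt b.opens p) = real (b.bs p) \<and> narr t 0 (cnt b.opens p) = b.sel p"
      unfolding runs_def by blast
    have ln: "length ps = n" by (simp add: n_def)
    note out = b.out_sample[OF ln t]
    have "real \<tau> \<le> real ((21 * K + 200) * (n * k * d))" using r(2) by (simp only: of_nat_le_iff)
    also have "\<dots> = real (21 * K + 200) * real n * real k * real d" by (simp only: of_nat_mult mult.assoc)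
    finally have time: "real \<tau> \<le> real (21 * K + 200) * real n * real k * real d" .
    show "\<exists>\<tau> t. exec \<omega> (coreset_prog K H) (input_store d k z m \<epsilon> ps cs) \<tau> t \<and>
        real \<tau> \<le> real (21 * K + 200) * real n * real k * real d \<and>
        (\<omega> \<in> E \<longrightarrow> out_valid ps t \<and> robust_coreset d k z m \<epsilon> (set ps) (out_set ps t) (out_weight ps t) \<and>
           real (card (out_set ps t)) \<le> 21 * (real H * 512 powr z) * coreset_size_term d k z \<epsilon> *
             (1 + ln (coreset_size_term d k z \<epsilon>)) ^ 2)"
    proof (intro exI[of _ \<tau>] exI[of _ t] conjI impI r(1) time out(1))
      assume wE: "\<omega> \<in> E"
      show "robust_coreset d k z m \<epsilon> (set ps) (out_set ps t) (out_weight ps t)"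
        "real (card (out_set ps t)) \<le> 21 * (real H * 512 powr z) * coreset_size_term d k z \<epsilon> *
             (1 + ln (coreset_size_term d k z \<epsilon>)) ^ 2"
        unfolding out(2,3) using good[OF wE w] by blast+
    qed
  qed
qed

theorem theorem1p5:
  fixes \<delta> :: real
  assumes "0 < \<delta>" "\<delta> < 1"
  shows "\<exists>(prog :: com) (T :: real). \<forall>z::real. z \<ge> 1 \<longrightarrow> (\<exists>(A :: real) (q :: nat).
    \<forall>(n :: nat) (k :: nat) (d :: nat) (m :: nat) (\<epsilon> :: real) (ps :: point list) (cs :: point list).
      n \<ge> 1 \<and> k \<ge> 1 \<and> d \<ge> 1 \<and> 0 < \<epsilon> \<and> \<epsilon> < 1 \<and>
      distinct ps \<and> length ps = n \<and> set ps \<subseteq> Rd d \<and>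
      distinct cs \<and> length cs = k \<and>
      approx_center_set d k z m \<epsilon> (set ps) (set cs) \<and>
      inlier_assumption k z m (set ps) (set cs) \<longrightarrow>
      (\<exists>E \<in> sets coins. measure coins E \<ge> 1 - \<delta> \<and>
        (\<forall>\<omega>. (\<forall>i. \<omega> i \<in> {0..1}) \<longrightarrow>
          (\<exists>\<tau> t. exec \<omega> prog (input_store d k z m \<epsilon> ps cs) \<tau> t \<and>
             real \<tau> \<le> T * real n * real k * real d \<and>
             (\<omega> \<in> E \<longrightarrow>
                out_valid ps t \<and>
                robust_coreset d k z m \<epsilon> (set ps) (out_set ps t) (out_weight ps t) \<and>
                real (card (out_set ps t))
                  \<le> A * coreset_size_term d k z \<epsilon> *
                      (1 + ln (coreset_size_term d k z \<epsilon>)) ^ q)))))"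
proof -
  \<comment> \<open>\<open>H\<close> and \<open>K\<close> depend on \<open>\<delta>\<close> alone,
    since the program is fixed before \<open>z\<close>; each of the two failures is allotted
    \<open>\<delta> / 2\<close>.\<close>
  obtain H where H: "suitable (\<delta> / 2) H" using suitable_exists by blast
  have p: "0 < \<delta> / 2" using assms by simp
  obtain K :: nat where "- (10 * ln (\<delta> / 2)) \<le> real K" using real_arch_simple by blast
  then have "- real K / 10 \<le> ln (\<delta> / 2)" by simp
  then have K: "exp (- real K / 10) \<le> \<delta> / 2" using p by (metis exp_le_cancel_iff exp_ln)
  show ?thesis
  proof (rule exI[of _ "coreset_prog K H"], rule exI[of _ "real (21 * K + 200)"], intro allI impI)
    fix z :: real assume z: "1 \<le> z"
    show "\<exists>(A :: real) (q :: nat).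
    \<forall>(n :: nat) (k :: nat) (d :: nat) (m :: nat) (\<epsilon> :: real) (ps :: point list) (cs :: point list).
      n \<ge> 1 \<and> k \<ge> 1 \<and> d \<ge> 1 \<and> 0 < \<epsilon> \<and> \<epsilon> < 1 \<and>
      distinct ps \<and> length ps = n \<and> set ps \<subseteq> Rd d \<and>
      distinct cs \<and> length cs = k \<and>
      approx_center_set d k z m \<epsilon> (set ps) (set cs) \<and>
      inlier_assumption k z m (set ps) (set cs) \<longrightarrow>
      (\<exists>E \<in> sets coins. measure coins E \<ge> 1 - \<delta> \<and>
        (\<forall>\<omega>. (\<forall>i. \<omega> i \<in> {0..1}) \<longrightarrow>
          (\<exists>\<tau> t. exec \<omega> (coreset_prog K H) (input_store d k z m \<epsilon> ps cs) \<tau> t \<and>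
             real \<tau> \<le> real (21 * K + 200) * real n * real k * real d \<and>
             (\<omega> \<in> E \<longrightarrow>
                out_valid ps t \<and>
                robust_coreset d k z m \<epsilon> (set ps) (out_set ps t) (out_weight ps t) \<and>
                real (card (out_set ps t))
                  \<le> A * coreset_size_term d k z \<epsilon> *
                      (1 + ln (coreset_size_term d k z \<epsilon>)) ^ q))))"
    \<comment> \<open>Only the size constant depends on \<open>z\<close>; the exponent 2 counts the
      logarithms from the number of strata and from the sampling rate.\<close>
    proof (intro exI[of _ "21 * (real H * 512 powr z)"] exI[of _ "2::nat"] allI impI, elim conjE)
      fix n k d m :: nat and \<epsilon> :: real and ps cs :: "point list"
      assume a: "1 \<le> n" "1 \<le> k" "1 \<le> d" "0 < \<epsilon>" "\<epsilon> < 1" "distinct ps" "length ps = n" "set ps \<subseteq> Rd d"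
        "distinct cs" "length cs = k" "approx_center_set d k z m \<epsilon> (set ps) (set cs)"
        "inlier_assumption k z m (set ps) (set cs)"
      have e: "1 - 2 * (\<delta> / 2) = 1 - \<delta>" by simp
      show "\<exists>E \<in> sets coins. measure coins E \<ge> 1 - \<delta> \<and>
        (\<forall>\<omega>. (\<forall>i. \<omega> i \<in> {0..1}) \<longrightarrow>
          (\<exists>\<tau> t. exec \<omega> (coreset_prog K H) (input_store d k z m \<epsilon> ps cs) \<tau> t \<and>
             real \<tau> \<le> real (21 * K + 200) * real n * real k * real d \<and>
             (\<omega> \<in> E \<longrightarrow>
                out_valid ps t \<and>
                robust_coreset d k z m \<epsilon> (set ps) (out_set ps t) (out_weight ps t) \<and>
                real (card (out_set ps t))
                  \<le> 21 * (real H * 512 powr z) * coreset_size_term d k z \<epsilon> *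
                      (1 + ln (coreset_size_term d k z \<epsilon>)) ^ 2)))"
        using coreset_prog_correct[of ps cs d z \<epsilon> m "\<delta> / 2" H K] a z H p K unfolding a(7,10) e by blast
    qed
  qed
qed

end
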